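(* Let $\alpha\in(1,2)$ and $\nu_h>0$. Classical solutions to the fractional primitive equations are unique: for every $T>0$ and every $u_0$ with $u_0\in\mathcal{D}(\Lambda_h^\alpha)\cap\mathrm{H}$, $\omega_0=\partial_z u_0\in\mathcal{D}(\Lambda_h^{\alpha/2})\cap L^\infty$, $\partial_z\omega_0\in L^2$, any two classical solutions on $[0,T]$ with initial condition $u_0$ coincide.
   Context: $\Omega=\{(x,z):x\in\mathbb{T},\ z\in[0,1]\}$, $\mathbb{T}$ the torus of length $1$; $L^p=L^p(\Omega)$. $\Lambda_h^s=(-\partial_x^2)^{s/2}$ (Fourier multiplier in $x$), $\mathcal{D}(\Lambda_h^s)=\{f\in L^2:\|\Lambda_h^s f\|_{L^2}<\infty\}$, $\mathrm{H}=\{f\in L^2(\Omega):\int_0^1 f(x,z)\,\mathrm{d}z=0\ \forall x\in\mathbb{T}\}$. Fractional primitive equations: $\partial_t u+u\partial_x u+w\partial_z u+\partial_x p+\nu_h\Lambda_h^\alpha u=0$, $\partial_z p=0$, $\partial_x u+\partial_z w=0$ on $\Omega$, with $w|_{z=0,1}=0$ (so $w=-\int_0^z\partial_x u\,\mathrm{d}\tilde z$). Write $\omega=\partial_z u$. Classical solution on $[0,T]$: a solution $u$ with $u(0)=u_0$ such that $u\in C([0,T];\mathcal{D}(\Lambda_h^\alpha)\cap\mathrm{H})\cap L^2(0,T;\mathcal{D}(\Lambda_h^{3\alpha/2}))$, $\omega\in L^\infty(0,T;L^\infty)\cap C([0,T];\mathcal{D}(\Lambda_h^{\alpha/2}))\cap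 L^2(0,T;\mathcal{D}(\Lambda_h^{\alpha}))$, $\partial_z\omega\in C([0,T];L^2)\cap L^2(0,T;\mathcal{D}(\Lambda_h^{\alpha/2}))$. *)

theory Defs
  imports "HOL-Analysis.Analysis"
begin

text \<open>
  The torus of length 1 is represented by the interval \<open>[0,1]\<close> with Lebesgue measure. Elements of
  \<open>L\<^sup>2(\<Omega>)\<close> are represented by functions of \<open>(x, z)\<close>, and equality in \<open>L\<^sup>2(\<Omega>)\<close> is equality almost
  everywhere; periodicity in \<open>x\<close> enters through the test functions and the Fourier coefficients.
\<close>

definition unit_ivl :: "real measure" where
  "unit_ivl = restrict_space lborel {0..1}"

definition Omega :: "(real \<times> real) measure" where
  "Omega = unit_ivl \<Otimes>\<^sub>M unit_ivl"

definition L2 :: "(real \<times> real \<Rightarrow> real) set" where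
  "L2 = {f \<in> borel_measurable Omega. integrable Omega (\<lambda>q. (f q)\<^sup>2)}"

definition L2_norm :: "(real \<times> real \<Rightarrow> real) \<Rightarrow> real" where
  "L2_norm f = sqrt (LINT q|Omega. (f q)\<^sup>2)"

definition Linf_bound :: "real \<Rightarrow> (real \<times> real \<Rightarrow> real) \<Rightarrow> bool" where
  "Linf_bound C f \<longleftrightarrow> f \<in> borel_measurable Omega \<and> (AE q in Omega. \<bar>f q\<bar> \<le> C)"

definition Linf :: "(real \<times> real \<Rightarrow> real) set" where
  "Linf = {f. \<exists>C. Linf_bound C f}"

definition mean_zero :: "(real \<times> real \<Rightarrow> real) set" where
  "mean_zero = {f \<in> L2. AE x in unit_ivl. (LINT z|unit_ivl. f (x, z)) = 0}"


subsection \<open>Horizontal fractional derivatives\<close>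

definition fourier_h :: "(real \<times> real \<Rightarrow> real) \<Rightarrow> int \<Rightarrow> real \<Rightarrow> complex" where
  "fourier_h f k z = (LINT x|unit_ivl. complex_of_real (f (x, z)) * cis (- (2 * pi * of_int k * x)))"

text \<open>\<open>is_Lambda_h s f g\<close>: the function \<open>g \<in> L\<^sup>2\<close> is \<open>\<Lambda>\<^sub>h\<^sup>s f\<close>, that is, its horizontal Fourier
  coefficients are those of \<open>f\<close> multiplied by \<open>|2\<pi>k|\<^sup>s\<close>. Such a \<open>g\<close> is unique up to null sets. Only
  \<open>s > 0\<close> is used, so that \<open>0 powr s = 0\<close> is the right multiplier at \<open>k = 0\<close>.\<close>

definition is_Lambda_h :: "real \<Rightarrow> (real \<times> real \<Rightarrow> real) \<Rightarrow> (real \<times> real \<Rightarrow> real) \<Rightarrow> bool" where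
  "is_Lambda_h s f g \<longleftrightarrow> f \<in> L2 \<and> g \<in> L2 \<and>
     (\<forall>k. AE z in unit_ivl.
        fourier_h g k z = complex_of_real (\<bar>2 * pi * of_int k\<bar> powr s) * fourier_h f k z)"

definition dom_Lambda_h :: "real \<Rightarrow> (real \<times> real \<Rightarrow> real) set" where
  "dom_Lambda_h s = {f \<in> L2. \<exists>g. is_Lambda_h s f g}"

definition Lambda_h :: "real \<Rightarrow> (real \<times> real \<Rightarrow> real) \<Rightarrow> real \<times> real \<Rightarrow> real" where
  "Lambda_h s f = (SOME g. is_Lambda_h s f g)"

definition dom_Lambda_h_norm :: "real \<Rightarrow> (real \<times> real \<Rightarrow> real) \<Rightarrow> real" where
  "dom_Lambda_h_norm s f = sqrt ((L2_norm f)\<^sup>2 + (L2_norm (Lambda_h s f))\<^sup>2)"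


subsection \<open>Test functions and weak derivatives\<close>

definition pderiv_dir :: "'a::euclidean_space \<Rightarrow> ('a \<Rightarrow> real) \<Rightarrow> 'a \<Rightarrow> real" where
  "pderiv_dir b f q = frechet_derivative f (at q) b"

primrec Ck :: "nat \<Rightarrow> ('a::euclidean_space \<Rightarrow> real) \<Rightarrow> bool" where
  "Ck 0 f \<longleftrightarrow> continuous_on UNIV f"
| "Ck (Suc n) f \<longleftrightarrow> f differentiable_on UNIV \<and> (\<forall>b\<in>Basis. Ck n (pderiv_dir b f))"

definition smooth :: "('a::euclidean_space \<Rightarrow> real) \<Rightarrow> bool" where
  "smooth f \<longleftrightarrow> (\<forall>n. Ck n f)"

text \<open>Smooth functions with compact support in \<open>\<T> \<times> (0,1)\<close> and in \<open>(0,T) \<times> \<T> \<times> (0,1)\<close>.\<close>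

definition test_fun :: "(real \<times> real \<Rightarrow> real) \<Rightarrow> bool" where
  "test_fun \<phi> \<longleftrightarrow> smooth \<phi> \<and> (\<forall>x z. \<phi> (x + 1, z) = \<phi> (x, z)) \<and>
     (\<exists>\<delta>>0. \<forall>x z. z \<notin> {\<delta>..1 - \<delta>} \<longrightarrow> \<phi> (x, z) = 0)"

definition test_fun_time :: "real \<Rightarrow> (real \<times> real \<times> real \<Rightarrow> real) \<Rightarrow> bool" where
  "test_fun_time T \<phi> \<longleftrightarrow> smooth \<phi> \<and> (\<forall>t x z. \<phi> (t, x + 1, z) = \<phi> (t, x, z)) \<and>
     (\<exists>\<delta>>0. \<forall>t x z. t \<notin> {\<delta>..T - \<delta>} \<or> z \<notin> {\<delta>..1 - \<delta>} \<longrightarrow> \<phi> (t, x, z) = 0)"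

definition weak_dx :: "(real \<times> real \<Rightarrow> real) \<Rightarrow> (real \<times> real \<Rightarrow> real) \<Rightarrow> bool" where
  "weak_dx f g \<longleftrightarrow> f \<in> L2 \<and> g \<in> L2 \<and>
     (\<forall>\<phi>. test_fun \<phi> \<longrightarrow>
        (LINT q|Omega. g q * \<phi> q) = - (LINT q|Omega. f q * pderiv_dir (1, 0) \<phi> q))"

definition weak_dz :: "(real \<times> real \<Rightarrow> real) \<Rightarrow> (real \<times> real \<Rightarrow> real) \<Rightarrow> bool" where
  "weak_dz f g \<longleftrightarrow> f \<in> L2 \<and> g \<in> L2 \<and>
     (\<forall>\<phi>. test_fun \<phi> \<longrightarrow>
        (LINT q|Omega. g q * \<phi> q) = - (LINT q|Omega. f q * pderiv_dir (0, 1) \<phi> q))"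


subsection \<open>Time-dependent functions with values in a space \<open>X\<close> normed by \<open>N\<close>\<close>

definition C_time :: "real \<Rightarrow> (real \<times> real \<Rightarrow> real) set \<Rightarrow> ((real \<times> real \<Rightarrow> real) \<Rightarrow> real)
    \<Rightarrow> (real \<Rightarrow> real \<times> real \<Rightarrow> real) \<Rightarrow> bool" where
  "C_time T X N u \<longleftrightarrow> (\<forall>t\<in>{0..T}. u t \<in> X) \<and>
     (\<forall>t\<in>{0..T}. ((\<lambda>s. N (\<lambda>q. u s q - u t q)) \<longlongrightarrow> 0) (at t within {0..T}))"

text \<open>Bochner measurability: almost everywhere limit, in the norm \<open>N\<close>, of measurable \<open>X\<close>-valued
  functions with finitely many values.\<close>

definition strongly_measurable_time :: "real \<Rightarrow> (real \<times> real \<Rightarrow> real) set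
    \<Rightarrow> ((real \<times> real \<Rightarrow> real) \<Rightarrow> real) \<Rightarrow> (real \<Rightarrow> real \<times> real \<Rightarrow> real) \<Rightarrow> bool" where
  "strongly_measurable_time T X N u \<longleftrightarrow>
     (\<exists>S :: nat \<Rightarrow> real \<Rightarrow> real \<times> real \<Rightarrow> real.
        (\<forall>n. finite (S n ` {0..T}) \<and> S n ` {0..T} \<subseteq> X \<and>
             (\<forall>f. {t \<in> {0..T}. S n t = f} \<in> sets lebesgue)) \<and>
        (AE t in lebesgue_on {0..T}. (\<lambda>n. N (\<lambda>q. u t q - S n t q)) \<longlonglongrightarrow> 0))"

definition L2_time :: "real \<Rightarrow> (real \<times> real \<Rightarrow> real) set \<Rightarrow> ((real \<times> real \<Rightarrow> real) \<Rightarrow> real)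
    \<Rightarrow> (real \<Rightarrow> real \<times> real \<Rightarrow> real) \<Rightarrow> bool" where
  "L2_time T X N u \<longleftrightarrow> (AE t in lebesgue_on {0..T}. u t \<in> X) \<and>
     strongly_measurable_time T X N u \<and>
     integrable (lebesgue_on {0..T}) (\<lambda>t. (N (u t))\<^sup>2)"

text \<open>Bound for membership in \<open>L\<^sup>\<infinity>(0,T;L\<^sup>\<infinity>)\<close>. It is only imposed on functions in \<open>C([0,T];L\<^sup>2)\<close>, which
  makes a separate measurability condition in time superfluous.\<close>

definition Linf_time :: "real \<Rightarrow> (real \<Rightarrow> real \<times> real \<Rightarrow> real) \<Rightarrow> bool" where
  "Linf_time T u \<longleftrightarrow> (\<exists>C. AE t in lebesgue_on {0..T}. Linf_bound C (u t))"


subsection \<open>The fractional primitive equations\<close>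

text \<open>\<open>\<partial>\<^sub>x u + \<partial>\<^sub>z w = 0\<close> with \<open>w = 0\<close> at \<open>z = 0, 1\<close>, where \<open>v = \<partial>\<^sub>x u\<close>: for almost every \<open>x\<close>, the
  function \<open>w (x, \<cdot>)\<close> is a primitive of \<open>- v (x, \<cdot>)\<close> that vanishes at both end points.\<close>

definition incompressible :: "(real \<times> real \<Rightarrow> real) \<Rightarrow> (real \<times> real \<Rightarrow> real) \<Rightarrow> bool" where
  "incompressible v w \<longleftrightarrow> w \<in> L2 \<and>
     (AE x in unit_ivl. w (x, 0) = 0 \<and> w (x, 1) = 0 \<and>
        (\<forall>z\<in>{0..1}. w (x, z) = w (x, 0) - (LINT y:{0..z}|lborel. v (x, y))))"

definition Omega_time :: "real \<Rightarrow> (real \<times> real \<times> real) measure" where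
  "Omega_time T = restrict_space lborel {0<..<T} \<Otimes>\<^sub>M Omega"

definition locally_integrable_time :: "real \<Rightarrow> (real \<times> real \<times> real \<Rightarrow> real) \<Rightarrow> bool" where
  "locally_integrable_time T p \<longleftrightarrow>
     (\<forall>\<delta>>0. set_integrable (Omega_time T) ({\<delta>..T - \<delta>} \<times> {0..1} \<times> {\<delta>..1 - \<delta>}) p)"

text \<open>The equations hold in the sense of distributions on \<open>(0,T) \<times> \<T> \<times> (0,1)\<close>. For the terms that
  only involve the \<open>L\<^sup>2\<close>-valued function \<open>u\<close>, the pairing is an iterated integral, since the
  representatives \<open>u t\<close> need not be jointly measurable in \<open>(t, x, z)\<close>.\<close>

definition fpe_solution :: "real \<Rightarrow> real \<Rightarrow> real \<Rightarrow> (real \<Rightarrow> real \<times> real \<Rightarrow> real) \<Rightarrow> bool" where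
  "fpe_solution \<alpha> \<nu> T u \<longleftrightarrow>
     (\<exists>v \<omega> w p.
        (\<forall>t\<in>{0..T}. u t \<in> dom_Lambda_h \<alpha> \<and> weak_dx (u t) (v t) \<and> weak_dz (u t) (\<omega> t) \<and>
           incompressible (v t) (w t)) \<and>
        locally_integrable_time T p \<and>
        (\<forall>\<phi>. test_fun_time T \<phi> \<longrightarrow>
           - (LINT t:{0<..<T}|lborel. LINT q|Omega. u t q * pderiv_dir (1, 0, 0) \<phi> (t, q))
           + (LINT t:{0<..<T}|lborel. LINT q|Omega.
                (u t q * v t q + w t q * \<omega> t q + \<nu> * Lambda_h \<alpha> (u t) q) * \<phi> (t, q))
           - (LINT r|Omega_time T. p r * pderiv_dir (0, 1, 0) \<phi> r) = 0) \<and>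
        (\<forall>\<phi>. test_fun_time T \<phi> \<longrightarrow> (LINT r|Omega_time T. p r * pderiv_dir (0, 0, 1) \<phi> r) = 0))"

definition classical_solution ::
    "real \<Rightarrow> real \<Rightarrow> real \<Rightarrow> (real \<times> real \<Rightarrow> real) \<Rightarrow> (real \<Rightarrow> real \<times> real \<Rightarrow> real) \<Rightarrow> bool" where
  "classical_solution \<alpha> \<nu> T u0 u \<longleftrightarrow>
     fpe_solution \<alpha> \<nu> T u \<and>
     (AE q in Omega. u 0 q = u0 q) \<and>
     C_time T (dom_Lambda_h \<alpha> \<inter> mean_zero) (dom_Lambda_h_norm \<alpha>) u \<and>
     L2_time T (dom_Lambda_h (3 * \<alpha> / 2)) (dom_Lambda_h_norm (3 * \<alpha> / 2)) u \<and>
     (\<exists>\<omega> \<zeta>.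
        (\<forall>t\<in>{0..T}. weak_dz (u t) (\<omega> t) \<and> weak_dz (\<omega> t) (\<zeta> t)) \<and>
        Linf_time T \<omega> \<and>
        C_time T (dom_Lambda_h (\<alpha> / 2)) (dom_Lambda_h_norm (\<alpha> / 2)) \<omega> \<and>
        L2_time T (dom_Lambda_h \<alpha>) (dom_Lambda_h_norm \<alpha>) \<omega> \<and>
        C_time T L2 L2_norm \<zeta> \<and>
        L2_time T (dom_Lambda_h (\<alpha> / 2)) (dom_Lambda_h_norm (\<alpha> / 2)) \<zeta>)"

end

theory Submission
  imports Defs
begin

text \<open>
  Expand everything in Fourier series in \<open>x\<close> and write \<open>\<parallel>\<cdot>\<parallel>\<close> for the norm of \<open>L\<^sup>2(dz)\<close>. Let \<open>d\<close> be the
  difference of two solutions, \<open>\<theta> = \<partial>\<^sub>z d\<close>, \<open>W\<close> the difference of the vertical velocities, and put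
  \<open>e\<^sub>k = \<parallel>d\<^sub>k\<parallel>\<close> and \<open>b\<^sub>k = \<parallel>\<omega>\<^sub>1\<^sub>k\<parallel> + \<parallel>\<omega>\<^sub>2\<^sub>k\<parallel>\<close>. Since the velocities have vanishing vertical mean, \<open>|u\<^sub>i\<^sub>k(z)| \<le> b\<^sub>k\<close>, and
  \<open>|W\<^sub>k(z)| \<le> 2\<pi>|k| e\<^sub>k\<close>. In the energy balance for \<open>d\<close> the nonlinearity is
  \<open>d \<partial>\<^sub>x u\<^sub>1 + u\<^sub>2 \<partial>\<^sub>x d + \<omega>\<^sub>1 W + w\<^sub>2 \<theta>\<close>; in the last term the \<open>z\<close>-derivative is removed by symmetrizing and
  integrating by parts in \<open>z\<close>. All four terms are then bounded by multiples of \<open>\<Sum> |i| e\<^sub>i e\<^sub>j b\<^sub>i\<^sub>+\<^sub>j\<close>.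
  Splitting \<open>|i|\<close> into the powers \<open>\<alpha>/2\<close> and \<open>1 - \<alpha>/2\<close> and distributing the second one on \<open>j\<close> and \<open>i + j\<close>,
  Young's inequality bounds this sum by an arbitrarily small multiple of the dissipation plus a
  multiple of the energy, because \<open>\<alpha> > 1\<close> makes \<open>b\<close> summable, uniformly in time. Gronwall's lemma concludes.
  The energy balance itself is obtained for finitely many modes at a time: the equation holds weakly
  with data that are continuous in time, so that every mode is continuously differentiable
  when tested against a function of \<open>z\<close> with vanishing mean.
\<close>

subsection \<open>Smooth test functions\<close>

text \<open>The weak formulation shapes the argument. The representatives \<open>u t\<close> need
  not be jointly measurable and no time derivative is given as a function, so the difference of two
  solutions cannot simply be inserted as a test function. The squared norm of a mode amounts to a
  test function that itself moves in time; an exact algebraic splitting with a quadratic remainder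
  takes the place of the chain rule. The pressure is invisible to z-derivatives of test functions,
  hence to every function of mean zero, and the velocity modes are of this kind. Products are
  handled asymmetrically: each of the four terms has a factor with summable modes (the difference,
  the second velocity, the first vorticity, the vorticity difference). Its convolution formula then
  holds with an \<open>L1\<close> truncation error that is uniform in time, whatever the other
  factor does. Cutting the energy to modes in \<open>{- n..n}\<close> leaves the errors
  \<open>\<delta> n\<close> and \<open>tail (Suc n)\<close> in the differential inequality; both
  tend to 0 by the weighted mode bounds. The dissipation appears with the factor 2 \<nu>, and the
  choice \<epsilon> = \<nu> / (80 pi) lets the nonlinearity consume half of it.\<close>

lemma pderiv_dir_real:
  assumes "(f has_real_derivative D) (at x)"
  shows "pderiv_dir 1 f x = D"
  using frechet_derivative_at[OF assms[unfolded has_field_derivative_def]]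
  by (simp add: pderiv_dir_def fun_eq_iff) (metis mult.right_neutral)

text \<open>\<open>Basis\<close> of the reals is \<open>{1}\<close>, so the Frechet definition
  reduces to an ordinary derivative. Smoothness in one variable can then be proved by exhibiting
  derivatives instead of computing with \<open>frechet_derivative\<close>.\<close>

lemma Ck_Suc_real:
  fixes f :: "real \<Rightarrow> real"
  shows "Ck (Suc n) f \<longleftrightarrow> (\<exists>f'. (\<forall>x. (f has_real_derivative f' x) (at x)) \<and> Ck n f')"
proof
  assume *: "Ck (Suc n) f"
  then have "(f has_real_derivative pderiv_dir 1 f x) (at x)" for x
    using pderiv_dir_real[of f _ x]
    by (simp add: differentiable_on_def) (metis UNIV_I real_differentiable_def)
  with * show "\<exists>f'. (\<forall>x. (f has_real_derivative f' x) (at x)) \<and> Ck n f'"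
    by (intro exI[of _ "pderiv_dir 1 f"]) simp
next
  assume "\<exists>f'. (\<forall>x. (f has_real_derivative f' x) (at x)) \<and> Ck n f'"
  then obtain f' where f': "\<And>x. (f has_real_derivative f' x) (at x)" "Ck n f'" by blast
  have "pderiv_dir 1 f = f'" using pderiv_dir_real[OF f'(1)] by auto
  with f' show "Ck (Suc n) f"
    by (auto simp: differentiable_on_def) (metis real_differentiable_def)
qed

lemma Ck_Suc_imp_Ck:
  fixes f :: "real \<Rightarrow> real"
  shows "Ck (Suc n) f \<Longrightarrow> Ck n f"
proof (induction n arbitrary: f)
  case 0
  then show ?case by (auto simp: differentiable_imp_continuous_on)
next
  case (Suc n)
  then show ?case by (subst Ck_Suc_real) (use Ck_Suc_real in blast)
qed

lemma Ck_const: "Ck n (\<lambda>x::real. c)"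
proof (induction n arbitrary: c)
  case (Suc n)
  show ?case unfolding Ck_Suc_real using Suc[of 0]
    by (intro exI[of _ "\<lambda>_. 0"]) auto
qed simp

lemma Ck_add:
  fixes f g :: "real \<Rightarrow> real"
  shows "Ck n f \<Longrightarrow> Ck n g \<Longrightarrow> Ck n (\<lambda>x. f x + g x)"
proof (induction n arbitrary: f g)
  case (Suc n)
  then obtain f' g' where "\<And>x. (f has_real_derivative f' x) (at x)" "Ck n f'"
    "\<And>x. (g has_real_derivative g' x) (at x)" "Ck n g'" unfolding Ck_Suc_real by blast
  then show ?case unfolding Ck_Suc_real using Suc.IH
    by (intro exI[of _ "\<lambda>x. f' x + g' x"]) (auto intro: derivative_eq_intros)
qed (auto intro: continuous_intros)

lemma Ck_mult:
  fixes f g :: "real \<Rightarrow> real"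
  shows "Ck n f \<Longrightarrow> Ck n g \<Longrightarrow> Ck n (\<lambda>x. f x * g x)"
proof (induction n arbitrary: f g)
  case (Suc n)
  then obtain f' g' where *: "\<And>x. (f has_real_derivative f' x) (at x)" "Ck n f'"
    "\<And>x. (g has_real_derivative g' x) (at x)" "Ck n g'" unfolding Ck_Suc_real by blast
  have "Ck n f" "Ck n g" using Suc.prems Ck_Suc_imp_Ck by blast+
  then show ?case unfolding Ck_Suc_real using Suc.IH *
    by (intro exI[of _ "\<lambda>x. f' x * g x + f x * g' x"])
       (auto intro!: derivative_eq_intros Ck_add)
qed (auto intro: continuous_intros)

lemma Ck_affine:
  fixes f :: "real \<Rightarrow> real"
  shows "Ck n f \<Longrightarrow> Ck n (\<lambda>x. f (a * x + b))"
proof (induction n arbitrary: f)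
  case 0
  moreover have "continuous_on UNIV (\<lambda>x. a * x + b)" by (intro continuous_intros)
  ultimately show ?case using continuous_on_compose2[of UNIV f UNIV "\<lambda>x. a * x + b"] by simp
next
  case (Suc n)
  then obtain f' where *: "\<And>x. (f has_real_derivative f' x) (at x)" "Ck n f'"
    unfolding Ck_Suc_real by blast
  have "((\<lambda>x. f (a * x + b)) has_real_derivative a * f' (a * x + b)) (at x)" for x
  proof -
    have "((\<lambda>x. a * x + b) has_real_derivative a) (at x)" by (auto intro!: derivative_eq_intros)
    from DERIV_chain2[OF *(1) this] show ?thesis by (simp only: mult.commute)
  qed
  then show ?case unfolding Ck_Suc_real using Ck_mult[OF Ck_const Suc.IH[OF *(2)]]
    by (intro exI[of _ "\<lambda>x. a * f' (a * x + b)"]) auto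
qed

lemma smooth_const: "smooth (\<lambda>x::real. c)"
  and smooth_add: "smooth f \<Longrightarrow> smooth g \<Longrightarrow> smooth (\<lambda>x::real. f x + g x)"
  and smooth_mult: "smooth f \<Longrightarrow> smooth g \<Longrightarrow> smooth (\<lambda>x::real. f x * g x)"
  and smooth_affine: "smooth f \<Longrightarrow> smooth (\<lambda>x::real. f (a * x + b))"
  by (auto simp: smooth_def Ck_const Ck_add Ck_mult Ck_affine)

lemma smooth_imp_continuous: "smooth f \<Longrightarrow> continuous_on UNIV f"
  unfolding smooth_def using Ck.simps(1) by blast

text \<open>Each order n supplies its own derivative; uniqueness of derivatives identifies them, so
  a single \<open>f'\<close> is \<open>Ck n\<close> for all n.\<close>

lemma smooth_derivE:
  assumes "smooth (f :: real \<Rightarrow> real)"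
  obtains f' where "\<And>x. (f has_real_derivative f' x) (at x)" "smooth f'"
proof -
  from assms have *: "\<exists>f'. (\<forall>x. (f has_real_derivative f' x) (at x)) \<and> Ck n f'" for n
    unfolding smooth_def using Ck_Suc_real by blast
  then obtain f' where f': "\<And>x. (f has_real_derivative f' x) (at x)" by blast
  have "Ck n f'" for n
  proof -
    obtain g where "\<forall>x. (f has_real_derivative g x) (at x)" "Ck n g" using * by blast
    moreover from this f' have "g = f'" by (auto intro: DERIV_unique)
    ultimately show ?thesis by simp
  qed
  with f' that show thesis by (auto simp: smooth_def)
qed

text \<open>Smoothness as a greatest fixed point: a class of functions closed under differentiation
  consists of smooth functions. This spares formulas for the n-th derivative when the class is a
  parametrized family.\<close>

lemma smooth_coinduct:
  assumes "P f" "\<And>f :: real \<Rightarrow> real. P f \<Longrightarrow> \<exists>f'. (\<forall>x. (f has_real_derivative f' x) (at x)) \<and> P f'"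
  shows "smooth f"
proof -
  have "P f \<Longrightarrow> Ck n f" for n f
  proof (induction n arbitrary: f)
    case 0
    then obtain f' where "\<forall>x. (f has_real_derivative f' x) (at x)" using assms(2) by blast
    then show ?case by (auto intro!: continuous_at_imp_continuous_on DERIV_isCont)
  next
    case (Suc n)
    then show ?case unfolding Ck_Suc_real using assms(2) by blast
  qed
  with assms(1) show ?thesis by (simp add: smooth_def)
qed

lemma smooth_antideriv:
  assumes "smooth f" "\<And>x. (F has_real_derivative f x) (at x)"
  shows "smooth F"
proof (rule smooth_coinduct[where P = "\<lambda>g. g = F \<or> smooth g"])
  fix g assume "g = F \<or> smooth g"
  then show "\<exists>f'. (\<forall>x. (g has_real_derivative f' x) (at x)) \<and> (f' = F \<or> smooth f')"
    using assms smooth_derivE by metis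
qed simp

lemma smooth_ident: "smooth (\<lambda>x::real. x)"
  by (rule smooth_antideriv[OF smooth_const[of 1]]) (auto intro: derivative_eq_intros)

lemma smooth_sin_cos: "smooth (\<lambda>x::real. A * sin (c * x) + B * cos (c * x))"
proof (rule smooth_coinduct[where P = "\<lambda>f. \<exists>A B. f = (\<lambda>x::real. A * sin (c * x) + B * cos (c * x))"])
  fix f assume "\<exists>A B. f = (\<lambda>x::real. A * sin (c * x) + B * cos (c * x))"
  then obtain A B where f: "f = (\<lambda>x::real. A * sin (c * x) + B * cos (c * x))" by blast
  show "\<exists>f'. (\<forall>x. (f has_real_derivative f' x) (at x)) \<and>
      (\<exists>A B. f' = (\<lambda>x::real. A * sin (c * x) + B * cos (c * x)))"
  proof (intro exI[of _ "\<lambda>x. (- B * c) * sin (c * x) + (A * c) * cos (c * x)"] conjI allI)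
    show "\<exists>A' B'. (\<lambda>x. (- B * c) * sin (c * x) + (A * c) * cos (c * x)) =
        (\<lambda>x. A' * sin (c * x) + B' * cos (c * x))" by blast
  qed (auto simp: f intro!: derivative_eq_intros)
qed blast

lemma smooth_real_polynomial_function:
  "real_polynomial_function (p :: real \<Rightarrow> real) \<Longrightarrow> smooth p"
proof (induction rule: real_polynomial_function.induct)
  case (linear f)
  have "f x = f 1 * x" for x
    using linear_scale[OF bounded_linear.linear[OF linear], of x 1] by simp
  then have "f = (\<lambda>x. f 1 * x)" by blast
  then show ?case using smooth_mult[OF smooth_const[of "f 1"] smooth_ident] by metis
qed (auto intro: smooth_const smooth_add smooth_mult)

section \<open>Smooth cutoffs and functions of compact support in an interval\<close>

definition flat_fun :: "real poly \<Rightarrow> real \<Rightarrow> real" where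
  "flat_fun p x = (if x > 0 then poly p (1 / x) * exp (- (1 / x)) else 0)"

lemma poly_times_exp_minus_tendsto_0: "((\<lambda>y. poly p y * exp (- y)) \<longlongrightarrow> (0::real)) at_top"
proof -
  have "((\<lambda>y. \<Sum>i\<le>degree p. coeff p i * (y ^ i / exp y)) \<longlongrightarrow> (\<Sum>i\<le>degree p. coeff p i * 0)) at_top"
    by (intro tendsto_intros tendsto_power_div_exp_0)
  then show ?thesis
    by (simp add: poly_altdef exp_minus divide_inverse sum_distrib_right mult.assoc)
qed

text \<open>With y = 1/x the derivative of p(y) exp(-y) is y^2 (p - p')(y) exp(-y), and
  \<open>[:0, 0, 1:]\<close> is the polynomial y^2. The polynomial parameter of
  \<open>flat_fun\<close> exists to make the family closed under differentiation; p = 1 is the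
  classical flat function exp(-1/x).\<close>

lemma flat_fun_deriv:
  "(flat_fun p has_real_derivative flat_fun ([:0, 0, 1:] * (p - pderiv p)) x) (at x)"
proof -
  consider "x > 0" | "x < 0" | "x = 0" by linarith
  then show ?thesis
  proof cases
    case 1
    have "((\<lambda>x. poly p (1 / x) * exp (- (1 / x))) has_real_derivative
        poly ([:0, 0, 1:] * (p - pderiv p)) (1 / x) * exp (- (1 / x))) (at x)"
    proof -
      have "((\<lambda>x. 1 / x) has_real_derivative - ((1 / x) * (1 / x))) (at x)"
        using 1 by (auto intro!: derivative_eq_intros simp: power2_eq_square)
      then have "((\<lambda>x. poly p (1 / x) * exp (- (1 / x))) has_real_derivative
          poly (pderiv p) (1 / x) * - ((1 / x) * (1 / x)) * exp (- (1 / x)) +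
          exp (- (1 / x)) * - (- ((1 / x) * (1 / x))) * poly p (1 / x)) (at x)"
        by (intro DERIV_mult DERIV_chain2[OF poly_DERIV] DERIV_chain2[OF DERIV_exp] DERIV_minus)
      moreover have "d * - (y * y) * e + e * - (- (y * y)) * q = poly [:0, 0, 1:] y * (q - d) * e"
        for d y e q :: real by (simp add: algebra_simps)
      ultimately show ?thesis unfolding poly_mult poly_diff by metis
    qed
    then show ?thesis
      unfolding flat_fun_def[of _ x] if_P[OF 1]
      by (rule has_field_derivative_transform_within_open[where S="{0<..}"]) (use 1 in \<open>auto simp: flat_fun_def\<close>)
  next
    case 2
    have "((\<lambda>x. 0) has_real_derivative flat_fun ([:0, 0, 1:] * (p - pderiv p)) x) (at x)"
      using 2 by (simp add: flat_fun_def)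
    then show ?thesis
      by (rule has_field_derivative_transform_within_open[where S="{..<0}"]) (use 2 in \<open>auto simp: flat_fun_def\<close>)
  next
    case 3
    \<comment> \<open>The difference quotient at 0 from the right is again of the flat form:
      dividing by h multiplies the polynomial by y = 1/h.\<close>
    have "((\<lambda>h. poly ([:0, 1:] * p) (inverse h) * exp (- inverse h)) \<longlongrightarrow> 0) (at_right 0)"
      using filterlim_compose[OF poly_times_exp_minus_tendsto_0 filterlim_inverse_at_top_right] .
    then have "((\<lambda>h. flat_fun p h / h) \<longlongrightarrow> 0) (at_right 0)"
      by (rule Lim_transform_eventually)
         (auto simp: flat_fun_def eventually_at_filter divide_inverse mult_ac)
    moreover have "((\<lambda>h. flat_fun p h / h) \<longlongrightarrow> 0) (at_left 0)"
      by (rule Lim_transform_eventually[OF tendsto_const]) (auto simp: flat_fun_def eventually_at_filter)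
    ultimately show ?thesis
      unfolding has_field_derivative_iff 3 by (auto simp: flat_fun_def filterlim_split_at)
  qed
qed

lemma smooth_flat_fun: "smooth (flat_fun p)"
  by (rule smooth_coinduct[where P = "\<lambda>f. \<exists>p. f = flat_fun p"]) (use flat_fun_deriv in blast)+

text \<open>Test functions on the open interval (a, b), with support kept away from the end points
  by a margin \<delta> exactly as in \<open>test_fun\<close>. For b \<le> a only the zero function
  qualifies.\<close>

definition bump :: "real \<Rightarrow> real \<Rightarrow> (real \<Rightarrow> real) \<Rightarrow> bool" where
  "bump a b \<rho> \<longleftrightarrow> smooth \<rho> \<and> (\<exists>\<delta>>0. \<forall>x. x \<notin> {a + \<delta>..b - \<delta>} \<longrightarrow> \<rho> x = 0)"

text \<open>A smooth approximation of the indicator of (c, d) with values in [0, 1]. The shift by 1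
  in both arguments makes it vanish within distance 1/n of the end points, so that its support is
  compact in (c, d).\<close>

definition plateau :: "real \<Rightarrow> real \<Rightarrow> nat \<Rightarrow> real \<Rightarrow> real" where
  "plateau c d n x = flat_fun 1 (real n * x + (- real n * c - 1)) * flat_fun 1 (- real n * x + (real n * d - 1))"

lemma smooth_plateau: "smooth (plateau c d n)"
  unfolding plateau_def[abs_def] by (intro smooth_mult smooth_affine smooth_flat_fun)

lemma flat_fun_1_bounds: "0 \<le> flat_fun 1 x" "flat_fun 1 x \<le> 1"
  by (auto simp: flat_fun_def)

lemma plateau_bounds: "0 \<le> plateau c d n x" "plateau c d n x \<le> 1"
  using flat_fun_1_bounds by (auto simp: plateau_def intro: mult_le_one)

lemma flat_fun_1_tendsto: "(flat_fun 1 \<longlongrightarrow> 1) at_top"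
proof -
  have "((\<lambda>x::real. exp (- inverse x)) \<longlongrightarrow> exp (- 0)) at_top"
    by (intro tendsto_intros tendsto_inverse_0_at_top filterlim_ident)
  then have "((\<lambda>x::real. exp (- inverse x)) \<longlongrightarrow> 1) at_top" by simp
  then show ?thesis
    by (rule Lim_transform_eventually)
       (use eventually_gt_at_top[of 0] in eventually_elim, simp add: flat_fun_def inverse_eq_divide)
qed

lemma plateau_tendsto:
  assumes "x \<in> {c<..<d}" shows "(\<lambda>n. plateau c d n x) \<longlonglongrightarrow> 1"
proof -
  have *: "filterlim (\<lambda>n. -1 + y * real n) at_top sequentially" if "0 < y" for y
    by (intro filterlim_tendsto_add_at_top[OF tendsto_const]
        filterlim_tendsto_pos_mult_at_top[OF tendsto_const that] filterlim_real_sequentially)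
  have "(\<lambda>n. flat_fun 1 (-1 + (x - c) * real n) * flat_fun 1 (-1 + (d - x) * real n)) \<longlonglongrightarrow> 1 * 1"
    using assms by (intro tendsto_mult filterlim_compose[OF flat_fun_1_tendsto] *) auto
  then show ?thesis by (simp add: plateau_def algebra_simps)
qed

lemma bump_plateau:
  assumes "a \<le> c" "d \<le> b" shows "bump a b (plateau c d n)"
  unfolding bump_def
\<comment> \<open>The margin 1/(n + 1) stays positive for n = 0, where the plateau is identically 0;
  for larger n it is below the distance 1/n within which one of the two factors vanishes.\<close>
proof (intro conjI exI[of _ "1 / real (n + 1)"] allI impI)
  fix x assume x: "x \<notin> {a + 1 / real (n + 1)..b - 1 / real (n + 1)}"
  show "plateau c d n x = 0"
  proof (cases "n = 0")
    case False
    define e where "e = 1 / real (n + 1)"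
    have e: "0 < e" "real n * e < 1" unfolding e_def by (auto simp: field_simps)
    have "x < c + e \<or> x > d - e" using x assms unfolding e_def by auto
    then have "real n * (x - c) \<le> real n * e \<or> real n * (d - x) \<le> real n * e"
      by (auto intro: mult_left_mono)
    with e(2) have "real n * x + (- real n * c - 1) \<le> 0 \<or> - real n * x + (real n * d - 1) \<le> 0"
      by (auto simp: algebra_simps)
    then show ?thesis by (auto simp: plateau_def flat_fun_def)
  qed (simp add: plateau_def flat_fun_def)
qed (use smooth_plateau in auto)

lemma bump_add: "bump a b f \<Longrightarrow> bump a b g \<Longrightarrow> bump a b (\<lambda>x. f x + g x)"
  unfolding bump_def
proof (elim conjE exE, intro conjI)
  fix \<delta> \<epsilon> :: real
  assume "0 < \<delta>" "\<forall>x. x \<notin> {a + \<delta>..b - \<delta>} \<longrightarrow> f x = 0" "0 < \<epsilon>" "\<forall>x. x \<notin> {a + \<epsilon>..b - \<epsilon>} \<longrightarrow> g x = 0"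
  then show "\<exists>\<delta>>0. \<forall>x. x \<notin> {a + \<delta>..b - \<delta>} \<longrightarrow> f x + g x = 0"
    by (intro exI[of _ "min \<delta> \<epsilon>"]) (auto simp: min_def split: if_splits)
qed (rule smooth_add)

lemma bump_smult: "smooth f \<Longrightarrow> bump a b g \<Longrightarrow> bump a b (\<lambda>x. f x * g x)"
  by (auto simp: bump_def intro: smooth_mult)

lemma bump_derivE:
  assumes "bump a b \<rho>"
  obtains \<rho>' where "bump a b \<rho>'" "\<And>x. (\<rho> has_real_derivative \<rho>' x) (at x)"
proof -
  from assms obtain \<delta> where \<delta>: "0 < \<delta>" "\<And>x. x \<notin> {a + \<delta>..b - \<delta>} \<Longrightarrow> \<rho> x = 0"
    by (auto simp: bump_def)
  from assms obtain \<rho>' where \<rho>': "\<And>x. (\<rho> has_real_derivative \<rho>' x) (at x)" "smooth \<rho>'"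
    by (auto simp: bump_def elim: smooth_derivE)
  have "\<rho>' x = 0" if "x \<notin> {a + \<delta>..b - \<delta>}" for x
  proof -
    have "((\<lambda>x. 0) has_real_derivative 0) (at x)" by simp
    then have "(\<rho> has_real_derivative 0) (at x)"
      by (rule has_field_derivative_transform_within_open[where S = "- {a + \<delta>..b - \<delta>}"])
         (use that \<delta> in auto)
    then show ?thesis using \<rho>'(1) DERIV_unique by blast
  qed
  with \<rho>' \<delta>(1) that show thesis by (auto simp: bump_def)
qed

lemma bump_continuous: "bump a b f \<Longrightarrow> continuous_on S f"
  using smooth_imp_continuous continuous_on_subset by (fastforce simp: bump_def)

lemma bump_eq_0: "bump a b f \<Longrightarrow> x \<notin> {a<..<b} \<Longrightarrow> f x = 0"
  unfolding bump_def by (metis atLeastAtMost_iff greaterThanLessThan_iff add_le_same_cancel1 diff_ge_0_iff_ge le_add_same_cancel1 less_add_same_cancel1 less_diff_eq not_less order.strict_trans2 order_less_le_trans add_less_cancel_left diff_less_eq linorder_not_le)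

lemma continuous_antiderivative_ex:
  fixes f :: "real \<Rightarrow> real"
  assumes "continuous_on UNIV f"
  shows "\<exists>F. \<forall>x. (F has_real_derivative f x) (at x)"
proof -
  have "\<exists>F. \<forall>x::real. - \<infinity> < ereal x \<longrightarrow> ereal x < \<infinity> \<longrightarrow> (F has_vector_derivative f x) (at x)"
    by (rule einterval_antiderivative)
       (use assms in \<open>auto simp: continuous_on_eq_continuous_at\<close>)
  then show ?thesis by (auto simp: has_real_derivative_iff_has_vector_derivative)
qed

text \<open>The primitive normalized at a is constant to the left and to the right of the support of
  f. The left constant is 0 by normalization, the right one because the integral of f
  vanishes.\<close>

lemma bump_antiderivE:
  assumes "bump a b f" "a < b" and int: "(f has_integral 0) {a..b}"
  obtains F where "bump a b F" "\<And>x. (F has_real_derivative f x) (at x)"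
proof -
  from assms obtain \<delta> where \<delta>: "0 < \<delta>" "\<And>x. x \<notin> {a + \<delta>..b - \<delta>} \<Longrightarrow> f x = 0"
    by (auto simp: bump_def)
  obtain F where F: "\<And>x. (F has_real_derivative f x) (at x)"
    using continuous_antiderivative_ex[OF bump_continuous[OF assms(1)]] by blast
  define G where "G x = F x - F a" for x
  have G: "(G has_real_derivative f x) (at x)" for x
    unfolding G_def by (auto intro!: derivative_eq_intros F)
  have "(f has_integral (G b - G a)) {a..b}"
  proof (rule fundamental_theorem_of_calculus)
    show "(G has_vector_derivative f x) (at x within {a..b})" for x
      using has_field_derivative_at_within[OF G]
      unfolding has_real_derivative_iff_has_vector_derivative .
  qed (use assms(2) in simp)
  from has_integral_unique[OF this int] have "G b = G a" by simp
  have left: "G x = G a" if "x < a + \<delta>" for x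
  proof -
    have "(G has_real_derivative 0) (at y within {..<a + \<delta>})" if "y \<in> {..<a + \<delta>}" for y
      using has_field_derivative_at_within[OF G, of y] \<delta>(2)[of y] that by simp
    then have "\<exists>c. \<forall>x\<in>{..<a + \<delta>}. G x = c" by (intro has_field_derivative_zero_constant) auto
    then show ?thesis using that \<delta>(1) by force
  qed
  have right: "G x = G b" if "b - \<delta> < x" for x
  proof -
    have "(G has_real_derivative 0) (at y within {b - \<delta><..})" if "y \<in> {b - \<delta><..}" for y
      using has_field_derivative_at_within[OF G, of y] \<delta>(2)[of y] that by simp
    then have "\<exists>c. \<forall>x\<in>{b - \<delta><..}. G x = c" by (intro has_field_derivative_zero_constant) auto
    then show ?thesis using that \<delta>(1) by force
  qed
  have "G x = 0" if "x \<notin> {a + \<delta>..b - \<delta>}" for x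
    using left[of x] right[of x] that \<open>G b = G a\<close> by (auto simp: G_def not_le)
  with \<delta>(1) G have "bump a b G"
    unfolding bump_def using smooth_antideriv[OF _ G] assms(1) by (auto simp: bump_def)
  with G show thesis using that by blast
qed

section \<open>Test functions in product form\<close>

lemma has_derivative_tensor2:
  assumes "(a has_real_derivative a') (at x)" "(b has_real_derivative b') (at z)"
  shows "((\<lambda>(x, z). a x * b z) has_derivative (\<lambda>(h, k). a' * h * b z + a x * (b' * k))) (at (x, z))"
proof -
  have "((\<lambda>q. a (fst q)) has_derivative (\<lambda>h. a' * fst h)) (at (x, z))"
    using has_derivative_compose[OF has_derivative_fst[OF has_derivative_ident], of a "\<lambda>h. a' * h" "(x, z)" UNIV]
      assms(1) by (simp add: has_field_derivative_def)
  moreover have "((\<lambda>q. b (snd q)) has_derivative (\<lambda>h. b' * snd h)) (at (x, z))"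
    using has_derivative_compose[OF has_derivative_snd[OF has_derivative_ident], of b "\<lambda>h. b' * h" "(x, z)" UNIV]
      assms(2) by (simp add: has_field_derivative_def)
  ultimately have "((\<lambda>q. a (fst q) * b (snd q)) has_derivative
      (\<lambda>h. a (fst (x, z)) * (b' * snd h) + a' * fst h * b (snd (x, z)))) (at (x, z))"
    by (rule has_derivative_mult)
  then show ?thesis by (simp add: case_prod_unfold add.commute)
qed

lemma has_derivative_tensor3:
  assumes "(a has_real_derivative a') (at t)" "(b has_real_derivative b') (at x)"
    "(c has_real_derivative c') (at z)"
  shows "((\<lambda>(t, x, z). a t * (b x * c z)) has_derivative
    (\<lambda>(s, h, k). a' * s * (b x * c z) + a t * (b' * h * c z + b x * (c' * k)))) (at (t, x, z))"
proof -
  have "((\<lambda>q. a (fst q)) has_derivative (\<lambda>h. a' * fst h)) (at (t, x, z))"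
    using has_derivative_compose[OF has_derivative_fst[OF has_derivative_ident], of a "\<lambda>h. a' * h" "(t, x, z)" UNIV]
      assms(1) by (simp add: has_field_derivative_def)
  moreover have "((\<lambda>q. (\<lambda>(x, z). b x * c z) (snd q)) has_derivative
      (\<lambda>h. (\<lambda>(h, k). b' * h * c z + b x * (c' * k)) (snd h))) (at (t, x, z))"
    using has_derivative_compose[OF has_derivative_snd[OF has_derivative_ident],
        of "\<lambda>(x, z). b x * c z" "\<lambda>(h, k). b' * h * c z + b x * (c' * k)" "(t, x, z)" UNIV]
      has_derivative_tensor2[OF assms(2,3)] by simp
  ultimately have "((\<lambda>q. a (fst q) * (\<lambda>(x, z). b x * c z) (snd q)) has_derivative
      (\<lambda>h. a (fst (t, x, z)) * (\<lambda>(h, k). b' * h * c z + b x * (c' * k)) (snd h)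
        + a' * fst h * (\<lambda>(x, z). b x * c z) (snd (t, x, z)))) (at (t, x, z))"
    by (rule has_derivative_mult)
  then show ?thesis by (simp add: case_prod_unfold add.commute)
qed

lemma pderiv_dir_tensor2:
  assumes "\<And>x. (a has_real_derivative a' x) (at x)" "\<And>x. (b has_real_derivative b' x) (at x)"
  shows "pderiv_dir (1, 0) (\<lambda>(x, z). a x * b z) = (\<lambda>(x, z). a' x * b z)"
    and "pderiv_dir (0, 1) (\<lambda>(x, z). a x * b z) = (\<lambda>(x, z). a x * b' z)"
  using frechet_derivative_at[OF has_derivative_tensor2[OF assms]]
  by (auto simp: pderiv_dir_def fun_eq_iff split: prod.splits) (metis mult.right_neutral mult_zero_right add_0 add_0_right mult_zero_left)+

lemma pderiv_dir_tensor3: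
  assumes "\<And>x. (a has_real_derivative a' x) (at x)" "\<And>x. (b has_real_derivative b' x) (at x)"
    "\<And>x. (c has_real_derivative c' x) (at x)"
  shows "pderiv_dir (1, 0, 0) (\<lambda>(t, x, z). a t * (b x * c z)) = (\<lambda>(t, x, z). a' t * (b x * c z))"
    and "pderiv_dir (0, 1, 0) (\<lambda>(t, x, z). a t * (b x * c z)) = (\<lambda>(t, x, z). a t * (b' x * c z))"
    and "pderiv_dir (0, 0, 1) (\<lambda>(t, x, z). a t * (b x * c z)) = (\<lambda>(t, x, z). a t * (b x * c' z))"
proof -
  have "frechet_derivative (\<lambda>(t, x, z). a t * (b x * c z)) (at (t, x, z)) =
      (\<lambda>(s, h, k). a' t * s * (b x * c z) + a t * (b' x * h * c z + b x * (c' z * k)))" for t x z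
    using frechet_derivative_at[OF has_derivative_tensor3[OF assms]] by simp
  then show "pderiv_dir (1, 0, 0) (\<lambda>(t, x, z). a t * (b x * c z)) = (\<lambda>(t, x, z). a' t * (b x * c z))"
    "pderiv_dir (0, 1, 0) (\<lambda>(t, x, z). a t * (b x * c z)) = (\<lambda>(t, x, z). a t * (b' x * c z))"
    "pderiv_dir (0, 0, 1) (\<lambda>(t, x, z). a t * (b x * c z)) = (\<lambda>(t, x, z). a t * (b x * c' z))"
    by (auto simp: pderiv_dir_def fun_eq_iff)
qed

text \<open>The partial derivatives of a product of one-variable functions are products of the same
  kind with one factor differentiated. Hence the induction on the order has to generalize over both
  factors.\<close>

lemma smooth_tensor2:
  fixes a b :: "real \<Rightarrow> real"
  assumes "smooth a" "smooth b"
  shows "smooth (\<lambda>(x, z). a x * b z :: real)"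
proof -
  have "smooth a \<Longrightarrow> smooth b \<Longrightarrow> Ck n (\<lambda>(x, z). a x * b z)" for n and a b :: "real \<Rightarrow> real"
  proof (induction n arbitrary: a b)
    case 0
    then have "continuous_on UNIV a" "continuous_on UNIV b" by (auto intro: smooth_imp_continuous)
    then show ?case
      by (auto simp: case_prod_unfold intro!: continuous_intros continuous_on_compose2[of UNIV a] continuous_on_compose2[of UNIV b])
  next
    case (Suc n)
    obtain a' where a': "\<And>x. (a has_real_derivative a' x) (at x)" "smooth a'"
      using Suc.prems smooth_derivE by blast
    obtain b' where b': "\<And>x. (b has_real_derivative b' x) (at x)" "smooth b'"
      using Suc.prems smooth_derivE by blast
    have "(\<lambda>(x, z). a x * b z) differentiable (at q)" for q
      using has_derivative_tensor2[OF a'(1) b'(1)] by (cases q) (auto simp: differentiable_def)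
    moreover have "Ck n (pderiv_dir e (\<lambda>(x, z). a x * b z))" if "e \<in> Basis" for e
      using that Suc.IH[OF a'(2) Suc.prems(2)] Suc.IH[OF Suc.prems(1) b'(2)]
      by (auto simp: Basis_prod_def pderiv_dir_tensor2[OF a'(1) b'(1)])
    ultimately show ?case by (auto simp: differentiable_on_def)
  qed
  with assms show ?thesis by (simp add: smooth_def)
qed

lemma smooth_tensor3:
  fixes a b c :: "real \<Rightarrow> real"
  assumes "smooth a" "smooth b" "smooth c"
  shows "smooth (\<lambda>(t, x, z). a t * (b x * c z) :: real)"
proof -
  have "smooth a \<Longrightarrow> smooth b \<Longrightarrow> smooth c \<Longrightarrow> Ck n (\<lambda>(t, x, z). a t * (b x * c z))" for n and a b c :: "real \<Rightarrow> real"
  proof (induction n arbitrary: a b c)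
    case 0
    then have "continuous_on UNIV a" "continuous_on UNIV b" "continuous_on UNIV c"
      by (auto intro: smooth_imp_continuous)
    then show ?case
      by (auto simp: case_prod_unfold intro!: continuous_intros continuous_on_compose2[of UNIV a]
          continuous_on_compose2[of UNIV b] continuous_on_compose2[of UNIV c])
  next
    case (Suc n)
    obtain a' where a': "\<And>x. (a has_real_derivative a' x) (at x)" "smooth a'"
      using Suc.prems smooth_derivE by blast
    obtain b' where b': "\<And>x. (b has_real_derivative b' x) (at x)" "smooth b'"
      using Suc.prems smooth_derivE by blast
    obtain c' where c': "\<And>x. (c has_real_derivative c' x) (at x)" "smooth c'"
      using Suc.prems smooth_derivE by blast
    have "(\<lambda>(t, x, z). a t * (b x * c z)) differentiable (at q)" for q
      using has_derivative_tensor3[OF a'(1) b'(1) c'(1)]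
      by (cases q) (auto simp: differentiable_def)
    moreover have "Ck n (pderiv_dir e (\<lambda>(t, x, z). a t * (b x * c z)))" if "e \<in> Basis" for e
      using that Suc.IH[OF a'(2) Suc.prems(2,3)] Suc.IH[OF Suc.prems(1) b'(2) Suc.prems(3)]
        Suc.IH[OF Suc.prems(1,2) c'(2)]
      by (auto simp: Basis_prod_def zero_prod_def pderiv_dir_tensor3[OF a'(1) b'(1) c'(1)])
    ultimately show ?case by (auto simp: differentiable_on_def)
  qed
  with assms show ?thesis by (simp add: smooth_def)
qed

lemma test_fun_tensor:
  assumes "smooth a" "\<And>x. a (x + 1) = a x" "bump 0 1 b"
  shows "test_fun (\<lambda>(x, z). a x * b z)"
  unfolding test_fun_def using assms smooth_tensor2 by (fastforce simp: bump_def)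

lemma test_fun_time_tensor:
  assumes "bump 0 T \<eta>" "smooth a" "\<And>x. a (x + 1) = a x" "bump 0 1 b"
  shows "test_fun_time T (\<lambda>(t, x, z). \<eta> t * (a x * b z))"
proof -
  from assms obtain \<delta> where \<delta>: "0 < \<delta>" "\<And>x. x \<notin> {\<delta>..T - \<delta>} \<Longrightarrow> \<eta> x = 0" by (auto simp: bump_def)
  from assms obtain \<epsilon> where \<epsilon>: "0 < \<epsilon>" "\<And>x. x \<notin> {\<epsilon>..1 - \<epsilon>} \<Longrightarrow> b x = 0" by (auto simp: bump_def)
  have "\<eta> t * (a x * b z) = 0"
    if "t \<notin> {min \<delta> \<epsilon>..T - min \<delta> \<epsilon>} \<or> z \<notin> {min \<delta> \<epsilon>..1 - min \<delta> \<epsilon>}" for t x z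
  proof -
    have "t \<notin> {\<delta>..T - \<delta>} \<or> z \<notin> {\<epsilon>..1 - \<epsilon>}" using that by auto
    with \<delta> \<epsilon> show ?thesis by fastforce
  qed
  moreover have "smooth (\<lambda>(t, x, z). \<eta> t * (a x * b z))"
    using assms by (intro smooth_tensor3) (auto simp: bump_def)
  ultimately show ?thesis
    unfolding test_fun_time_def using assms(3) \<delta>(1) \<epsilon>(1) by (auto intro!: exI[of _ "min \<delta> \<epsilon>"])
qed

subsection \<open>The lemma of du Bois-Reymond\<close>

abbreviation ivl :: "real \<Rightarrow> real \<Rightarrow> real measure" where
  "ivl a b \<equiv> restrict_space lborel {a..b}"

lemma integral_ivl: "integral\<^sup>L (ivl a b) f = (LINT x:{a..b}|lborel. f x)"
  for f :: "real \<Rightarrow> 'a::{banach,second_countable_topology}"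
  by (subst integral_restrict_space) (auto simp: set_lebesgue_integral_def)

lemma integrable_ivl: "integrable (ivl a b) f \<longleftrightarrow> set_integrable lborel {a..b} f"
  for f :: "real \<Rightarrow> 'a::{banach,second_countable_topology}"
  by (subst integrable_restrict_space) (auto simp: set_integrable_def)

lemma finite_measure_ivl: "finite_measure (ivl a b)"
  by (rule finite_measureI) (simp add: emeasure_restrict_space space_restrict_space emeasure_lborel_Icc_eq)

lemma measurable_ivl_continuous:
  fixes f :: "real \<Rightarrow> 'a::topological_space"
  assumes "continuous_on {a..b} f" shows "f \<in> borel_measurable (ivl a b)"
  using borel_measurable_continuous_on_restrict[OF assms]
  by (simp add: measurable_def space_restrict_space sets_restrict_space)

lemma measurable_ivl_indicator:
  "A \<in> sets borel \<Longrightarrow> (indicator A :: real \<Rightarrow> real) \<in> borel_measurable (ivl a b)"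
  by (intro measurable_restrict_space1) simp

lemma integrable_ivl_bounded:
  fixes f :: "real \<Rightarrow> 'a::{banach,second_countable_topology}"
  assumes "f \<in> borel_measurable (ivl a b)" "\<And>x. x \<in> {a..b} \<Longrightarrow> norm (f x) \<le> B"
  shows "integrable (ivl a b) f"
  by (rule finite_measure.integrable_const_bound[OF finite_measure_ivl, where B=B])
     (use assms in \<open>auto simp: space_restrict_space intro!: AE_I2\<close>)

lemma integrable_ivl_continuous:
  fixes f :: "real \<Rightarrow> 'a::{banach,second_countable_topology}"
  assumes "continuous_on {a..b} f" shows "integrable (ivl a b) f"
proof -
  have "bounded (f ` {a..b})" using assms by (intro compact_imp_bounded compact_continuous_image) auto
  then obtain B where "\<And>x. x \<in> {a..b} \<Longrightarrow> norm (f x) \<le> B" by (metis bounded_iff imageI)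
  then show ?thesis using integrable_ivl_bounded measurable_ivl_continuous[OF assms] by blast
qed

lemma integral_ivl_continuous:
  fixes f :: "real \<Rightarrow> 'a::euclidean_space"
  assumes "continuous_on {a..b} f"
  shows "integral\<^sup>L (ivl a b) f = integral {a..b} f" "(f has_integral integral\<^sup>L (ivl a b) f) {a..b}"
proof -
  show "integral\<^sup>L (ivl a b) f = integral {a..b} f"
    using set_borel_integral_eq_integral(2)[of "{a..b}" f] integrable_ivl_continuous[OF assms]
    by (simp add: integral_ivl integrable_ivl)
  then show "(f has_integral integral\<^sup>L (ivl a b) f) {a..b}"
    using integrable_integral[OF integrable_continuous_interval[OF assms]] by simp
qed

text \<open>The half lines are stable under intersection and generate the Borel sets, so Dynkin
  induction extends the vanishing integral to all Borel sets; \<open>total\<close> serves the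
  complement case. Uniqueness of densities then compares g with 0.\<close>

lemma AE_zero_if_halfline_integrals_zero:
  fixes g :: "real \<Rightarrow> real"
  assumes g: "integrable lborel g" and total: "integral\<^sup>L lborel g = 0"
    and half: "\<And>d. (LINT x:{..<d}|lborel. g x) = 0"
  shows "AE x in lborel. g x = 0"
proof -
  have gA: "set_integrable lborel A g" if "A \<in> sets borel" for A
    using integrable_mult_indicator[OF _ g, of A] that by (simp add: set_integrable_def)
  have "(LINT x:A|lborel. g x) = 0" if A: "A \<in> sets lborel" for A
  proof -
    have sb: "sets (borel :: real measure) = sigma_sets UNIV (range lessThan)"
      unfolding borel_Iio by (rule sets_measure_of) simp
    have "Int_stable (range (lessThan :: real \<Rightarrow> _))"
    proof (rule Int_stableI_image)
      show "\<exists>k\<in>UNIV. {..<i} \<inter> {..<j} = {..<k}" for i j :: real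
        by (rule bexI[of _ "min i j"]) auto
    qed
    moreover have "range lessThan \<subseteq> Pow (UNIV :: real set)" by simp
    moreover have "A \<in> sigma_sets UNIV (range lessThan)" using A sb by simp
    ultimately show ?thesis
    proof (induction rule: sigma_sets_induct_disjoint)
      case (compl A)
      then have A: "A \<in> sets borel" using sb by simp
      have "(LINT x:UNIV - A|lborel. g x) = (LINT x|lborel. g x - indicator A x *\<^sub>R g x)"
        unfolding set_lebesgue_integral_def
        by (intro Bochner_Integration.integral_cong) (auto simp: indicator_def)
      also have "\<dots> = 0"
        using compl total gA[OF A] g by (simp add: set_lebesgue_integral_def set_integrable_def)
      finally show ?case .
    next
      case (union A)
      then have A: "A i \<in> sets borel" for i using sb by auto
      have "(LINT x:(\<Union>i. A i)|lborel. g x) = (\<Sum>i. LINT x:A i|lborel. g x)"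
        using A union(1) by (intro lebesgue_integral_countable_add gA)
          (auto simp: disjoint_family_on_def)
      then show ?case using union by simp
    qed (use half in \<open>auto simp: set_lebesgue_integral_def\<close>)
  qed
  then show ?thesis using density_unique_real[of lborel g "\<lambda>_. 0"] g
    by (simp add: set_lebesgue_integral_def)
qed

text \<open>Extension by zero turns a half line into an interval anchored at a, up to the null set
  of the two end points, and real and imaginary parts are treated separately. Anchored intervals are
  what cutoffs and arcs of the circle deliver below.\<close>

lemma AE_zero_if_interval_integrals_zero:
  fixes g :: "real \<Rightarrow> complex"
  assumes g: "integrable (ivl a b) g"
    and int: "\<And>d. d \<in> {a..b} \<Longrightarrow> (LINT x|ivl a b. indicator {a<..<d} x *\<^sub>R g x) = 0"
  shows "AE x in ivl a b. g x = 0"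
proof (cases "a \<le> b")
  case True
  define G where "G x = indicator {a..b} x *\<^sub>R g x" for x
  have G: "integrable lborel G" using g by (simp add: integrable_ivl set_integrable_def G_def[abs_def])
  have AEab: "AE x in lborel. x \<noteq> a \<and> x \<noteq> b"
    using AE_lborel_singleton[of a] AE_lborel_singleton[of b] by eventually_elim auto
  have half: "(LINT x|lborel. indicator {..<d} x *\<^sub>R G x) = 0" for d
  proof -
    define e where "e = max a (min d b)"
    have "(LINT x|lborel. indicator {..<d} x *\<^sub>R G x) =
        (LINT x|lborel. indicator {a..b} x *\<^sub>R (indicator {a<..<e} x *\<^sub>R g x))"
    proof (rule integral_cong_AE)
      show "AE x in lborel. indicator {..<d} x *\<^sub>R G x = indicator {a..b} x *\<^sub>R (indicator {a<..<e} x *\<^sub>R g x)"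
        using AEab by eventually_elim (auto simp: G_def e_def indicator_def)
      have "G \<in> borel_measurable lborel" using G by simp
      then show "(\<lambda>x. indicator {..<d} x *\<^sub>R G x) \<in> borel_measurable lborel" by measurable
      have "(\<lambda>x. indicator {a<..<e} x *\<^sub>R G x) \<in> borel_measurable lborel"
        using \<open>G \<in> borel_measurable lborel\<close> by measurable
      moreover have "(\<lambda>x. indicator {a<..<e} x *\<^sub>R G x) = (\<lambda>x. indicator {a..b} x *\<^sub>R (indicator {a<..<e} x *\<^sub>R g x))"
        by (auto simp: G_def)
      ultimately show "(\<lambda>x. indicator {a..b} x *\<^sub>R (indicator {a<..<e} x *\<^sub>R g x)) \<in> borel_measurable lborel"
        by simp
    qed
    also have "\<dots> = 0"
      using int[of e] True by (simp add: integral_ivl set_lebesgue_integral_def e_def)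
    finally show ?thesis .
  qed
  have tot: "integral\<^sup>L lborel G = 0"
  proof -
    have "integral\<^sup>L lborel G = (LINT x|lborel. indicator {..<b+1} x *\<^sub>R G x)"
      by (intro Bochner_Integration.integral_cong) (auto simp: G_def indicator_def)
    then show ?thesis using half by simp
  qed
  have int': "integrable lborel (\<lambda>x. indicator {..<d} x *\<^sub>R G x)" for d
    using integrable_mult_indicator[OF _ G] by simp
  have "AE x in lborel. Re (G x) = 0"
    using G half tot int' integral_Re[OF int'] integral_Re[OF G]
    by (intro AE_zero_if_halfline_integrals_zero) (auto simp: set_lebesgue_integral_def)
  moreover have "AE x in lborel. Im (G x) = 0"
    using G half tot int' integral_Im[OF int'] integral_Im[OF G]
    by (intro AE_zero_if_halfline_integrals_zero) (auto simp: set_lebesgue_integral_def)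
  ultimately have "AE x in lborel. x \<in> {a..b} \<longrightarrow> g x = 0"
    by eventually_elim (auto simp: G_def complex_eq_iff)
  then show ?thesis by (simp add: AE_restrict_space_iff)
qed (auto intro!: AE_I2 simp: space_restrict_space)

lemma bump_bounded:
  assumes "bump a b f" shows "\<exists>B. \<forall>x. \<bar>f x\<bar> \<le> B"
proof -
  have "bounded (f ` {a..b})"
    using assms bump_continuous by (intro compact_imp_bounded compact_continuous_image) auto
  then obtain B where B: "\<forall>x\<in>{a..b}. \<bar>f x\<bar> \<le> B" by (auto simp: bounded_iff)
  have "\<bar>f x\<bar> \<le> max B 0" for x
    using B bump_eq_0[OF assms, of x] by (cases "x \<in> {a..b}") (auto intro: max.coboundedI1)
  then show ?thesis by blast
qed

lemma integrable_bump_mult: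
  fixes g :: "real \<Rightarrow> complex"
  assumes "bump a b f" "integrable (ivl a b) g"
  shows "integrable (ivl a b) (\<lambda>x. f x *\<^sub>R g x)"
proof -
  obtain B where B: "\<And>x. \<bar>f x\<bar> \<le> B" using bump_bounded[OF assms(1)] by blast
  have [measurable]: "f \<in> borel_measurable (ivl a b)"
    using bump_continuous[OF assms(1)] by (rule measurable_ivl_continuous)
  have [measurable]: "g \<in> borel_measurable (ivl a b)" using assms(2) by simp
  show ?thesis
    by (rule Bochner_Integration.integrable_bound[of _ "\<lambda>x. B *\<^sub>R g x"])
       (use assms(2) B order_trans[OF _ abs_ge_self] in \<open>auto intro!: AE_I2 mult_right_mono\<close>)
qed

text \<open>Plateaus on (a, d) converge boundedly to the indicator of \<open>{a<..<d}\<close>, so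
  dominated convergence reduces the claim to integrals over intervals.\<close>

lemma fundamental_lemma_bump:
  fixes g :: "real \<Rightarrow> complex"
  assumes g: "integrable (ivl a b) g"
    and zero: "\<And>f. bump a b f \<Longrightarrow> (LINT x|ivl a b. f x *\<^sub>R g x) = 0"
  shows "AE x in ivl a b. g x = 0"
proof (rule AE_zero_if_interval_integrals_zero[OF g])
  fix d assume d: "d \<in> {a..b}"
  have [measurable]: "g \<in> borel_measurable (ivl a b)" using g by simp
  have "(\<lambda>n. LINT x|ivl a b. plateau a d n x *\<^sub>R g x) \<longlonglongrightarrow> (LINT x|ivl a b. indicator {a<..<d} x *\<^sub>R g x)"
  proof (rule integral_dominated_convergence[where w = "\<lambda>x. norm (g x)"])
    show "AE x in ivl a b. (\<lambda>n. plateau a d n x *\<^sub>R g x) \<longlonglongrightarrow> indicator {a<..<d} x *\<^sub>R g x"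
    proof (rule AE_I2)
      fix x
      have "(\<lambda>n. plateau a d n x) \<longlonglongrightarrow> indicator {a<..<d} x"
        using plateau_tendsto[of x a d] bump_eq_0[OF bump_plateau[OF order_refl order_refl], of x a d]
        by (cases "x \<in> {a<..<d}") auto
      then show "(\<lambda>n. plateau a d n x *\<^sub>R g x) \<longlonglongrightarrow> indicator {a<..<d} x *\<^sub>R g x"
        by (intro tendsto_intros)
    qed
    show "AE x in ivl a b. norm (plateau a d n x *\<^sub>R g x) \<le> norm (g x)" for n
      using plateau_bounds[of a d n] by (auto intro!: AE_I2 mult_left_le_one_le)
    show "(\<lambda>x. plateau a d n x *\<^sub>R g x) \<in> borel_measurable (ivl a b)" for n
      using integrable_bump_mult[OF bump_plateau[of a a d b n] g] d by auto
    show "(\<lambda>x. indicator {a<..<d} x *\<^sub>R g x) \<in> borel_measurable (ivl a b)"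
      by (intro borel_measurable_scaleR measurable_ivl_indicator) auto
  qed (use g in auto)
  moreover have "(LINT x|ivl a b. plateau a d n x *\<^sub>R g x) = 0" for n
    using d by (intro zero bump_plateau) auto
  ultimately show "(LINT x|ivl a b. indicator {a<..<d} x *\<^sub>R g x) = 0"
    using LIMSEQ_unique[OF _ tendsto_const] by force
qed

text \<open>If every plateau had integral 0, dominated convergence would give b - a = 0. Thus some
  plateau can be divided by its integral.\<close>

lemma bump_normalized_ex:
  assumes "a < b"
  obtains \<rho> where "bump a b \<rho>" "(LINT x|ivl a b. \<rho> x) = 1"
proof -
  have "\<exists>n. (LINT x|ivl a b. plateau a b n x) \<noteq> 0"
  proof (rule ccontr)
    assume *: "\<not> ?thesis"
    have "(\<lambda>n. LINT x|ivl a b. plateau a b n x) \<longlonglongrightarrow> (LINT x|ivl a b. indicator {a<..<b} x)"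
    proof (rule integral_dominated_convergence[where w = "\<lambda>x. 1"])
      show "AE x in ivl a b. (\<lambda>n. plateau a b n x) \<longlonglongrightarrow> indicator {a<..<b} x"
      proof (rule AE_I2)
        fix x show "(\<lambda>n. plateau a b n x) \<longlonglongrightarrow> indicator {a<..<b} x"
          using plateau_tendsto[of x a b] bump_eq_0[OF bump_plateau[OF order_refl order_refl], of x a b]
          by (cases "x \<in> {a<..<b}") auto
      qed
      show "plateau a b n \<in> borel_measurable (ivl a b)" for n
        by (rule measurable_ivl_continuous[OF bump_continuous[OF bump_plateau]]) auto
    qed (use plateau_bounds finite_measure.integrable_const[OF finite_measure_ivl, of a b "1::real"] in
        \<open>auto intro!: measurable_ivl_indicator\<close>)
    with * have "(LINT x|ivl a b. indicator {a<..<b} x :: real) = 0"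
      using LIMSEQ_unique[OF _ tendsto_const] by force
    moreover have "(LINT x|ivl a b. indicator {a<..<b} x :: real) = (LINT x|lborel. indicator {a<..<b} x)"
      unfolding integral_ivl set_lebesgue_integral_def
      by (intro Bochner_Integration.integral_cong) (auto simp: indicator_def)
    ultimately show False using assms by simp
  qed
  then obtain n where n: "(LINT x|ivl a b. plateau a b n x) \<noteq> 0" ..
  define c where "c = 1 / (LINT x|ivl a b. plateau a b n x)"
  show thesis
  proof (rule that)
    show "bump a b (\<lambda>x. c * plateau a b n x)"
      by (intro bump_smult smooth_const bump_plateau) auto
    show "(LINT x|ivl a b. c * plateau a b n x) = 1" using n by (simp add: c_def)
  qed
qed

text \<open>Stated for functionals, since the momentum equation integrated in time is a functional of
  the test function that need not be represented by a function of \<open>z\<close>.\<close>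

lemma functional_vanishing_on_derivatives:
  fixes L :: "(real \<Rightarrow> real) \<Rightarrow> complex"
  assumes "a < b"
    and add: "\<And>f g. bump a b f \<Longrightarrow> bump a b g \<Longrightarrow> L (\<lambda>x. f x + g x) = L f + L g"
    and scale: "\<And>c f. bump a b f \<Longrightarrow> L (\<lambda>x. c * f x) = c * L f"
    and zero: "\<And>f f'. bump a b f \<Longrightarrow> (\<And>x. (f has_real_derivative f' x) (at x)) \<Longrightarrow> bump a b f' \<Longrightarrow> L f' = 0"
  shows "\<exists>c::complex. \<forall>f. bump a b f \<longrightarrow> L f = of_real (LINT x|ivl a b. f x) * c"
proof -
  obtain \<rho> where \<rho>: "bump a b \<rho>" "(LINT x|ivl a b. \<rho> x) = 1" using bump_normalized_ex[OF \<open>a < b\<close>] .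
  have "L f = of_real (LINT x|ivl a b. f x) * L \<rho>" if f: "bump a b f" for f
  proof -
    \<comment> \<open>Subtracting m times the normalized bump \<rho> leaves a bump of integral 0,
      that is, the derivative of a bump, on which L vanishes. The constant sought is therefore
      \<open>L \<rho>\<close>.\<close>
    define m where "m = (LINT x|ivl a b. f x)"
    have m\<rho>: "bump a b (\<lambda>x. - m * \<rho> x)" by (intro bump_smult smooth_const \<rho>)
    have g: "bump a b (\<lambda>x. f x + - m * \<rho> x)" by (intro bump_add f m\<rho>)
    have "integrable (ivl a b) f" "integrable (ivl a b) \<rho>"
      using f \<rho> bump_continuous by (auto intro!: integrable_ivl_continuous)
    then have "(LINT x|ivl a b. f x + - m * \<rho> x) = 0" using \<rho> by (simp add: m_def)
    then have "((\<lambda>x. f x + - m * \<rho> x) has_integral 0) {a..b}"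
      using integral_ivl_continuous(2)[OF bump_continuous[OF g], of a b] by metis
    from bump_antiderivE[OF g \<open>a < b\<close> this] obtain F
      where "bump a b F" "\<And>x. (F has_real_derivative f x + - m * \<rho> x) (at x)" by blast
    from zero[OF this g] have "L (\<lambda>x. f x + - m * \<rho> x) = 0" .
    then show ?thesis using add[OF f m\<rho>] scale[OF \<rho>(1), of "- m"] by (simp add: m_def)
  qed
  then show ?thesis by blast
qed

text \<open>Applied to the pairing with g, \<open>functional_vanishing_on_derivatives\<close> yields
  the constant c; the fundamental lemma then kills g - c.\<close>

lemma du_Bois_Reymond_bump:
  fixes g :: "real \<Rightarrow> complex"
  assumes "a < b" and g: "integrable (ivl a b) g"
    and zero: "\<And>f f'. bump a b f \<Longrightarrow> (\<And>x. (f has_real_derivative f' x) (at x)) \<Longrightarrow> bump a b f' \<Longrightarrow>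
      (LINT x|ivl a b. f' x *\<^sub>R g x) = 0"
  shows "\<exists>c. AE x in ivl a b. g x = c"
proof -
  have "\<exists>c::complex. \<forall>f. bump a b f \<longrightarrow> (LINT x|ivl a b. f x *\<^sub>R g x) = of_real (LINT x|ivl a b. f x) * c"
  proof (rule functional_vanishing_on_derivatives[OF \<open>a < b\<close>])
    fix f h assume "bump a b f" "bump a b h"
    then show "(LINT x|ivl a b. (f x + h x) *\<^sub>R g x) = (LINT x|ivl a b. f x *\<^sub>R g x) + (LINT x|ivl a b. h x *\<^sub>R g x)"
      using integrable_bump_mult[OF _ g] by (simp add: scaleR_left_distrib)
  next
    fix c f assume "bump a b f"
    show "(LINT x|ivl a b. (c * f x) *\<^sub>R g x) = c * (LINT x|ivl a b. f x *\<^sub>R g x)"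
      using integral_scaleR_right[of "ivl a b" c "\<lambda>x. f x *\<^sub>R g x"]
      by (simp only: scaleR_scaleR scaleR_conv_of_real[of c])
  qed (use zero in blast)
  then obtain c :: complex
    where "\<forall>f. bump a b f \<longrightarrow> (LINT x|ivl a b. f x *\<^sub>R g x) = of_real (LINT x|ivl a b. f x) * c" ..
  then have c: "(LINT x|ivl a b. f x *\<^sub>R g x) = of_real (LINT x|ivl a b. f x) * c" if "bump a b f" for f
    using that by simp
  have const: "integrable (ivl a b) (\<lambda>x. c)" by (rule finite_measure.integrable_const[OF finite_measure_ivl])
  have "AE x in ivl a b. g x - c = 0"
  proof (rule fundamental_lemma_bump)
    fix f assume f: "bump a b f"
    have "integrable (ivl a b) f" using f bump_continuous by (auto intro!: integrable_ivl_continuous)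
    then have "(LINT x|ivl a b. f x *\<^sub>R c) = (LINT x|ivl a b. f x) *\<^sub>R c" by simp
    then show "(LINT x|ivl a b. f x *\<^sub>R (g x - c)) = 0"
      using c[OF f] integrable_bump_mult[OF f g] integrable_bump_mult[OF f const]
      by (simp add: right_diff_distrib scaleR_conv_of_real)
  qed (use g const in auto)
  then show ?thesis by (auto intro!: exI[of _ c])
qed

text \<open>Weierstrass polynomials multiplied by plateaus. Convergence can only be claimed in the
  open interval, since h may be nonzero at the end points; with the uniform bound this suffices for
  dominated convergence.\<close>

lemma continuous_bump_approx:
  fixes h :: "real \<Rightarrow> real"
  assumes "continuous_on {a..b} h"
  obtains H B where "\<And>n::nat. bump a b (H n)" "\<And>n x. x \<in> {a..b} \<Longrightarrow> \<bar>H n x\<bar> \<le> B"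
    "\<And>x. x \<in> {a<..<b} \<Longrightarrow> (\<lambda>n. H n x) \<longlonglongrightarrow> h x"
proof -
  have "\<exists>p. real_polynomial_function p \<and> (\<forall>x\<in>{a..b}. \<bar>h x - p x\<bar> < 1 / real (n + 1))" for n
    by (rule Stone_Weierstrass_real_polynomial_function[of "{a..b}" h "1 / real (n + 1)"]) (use assms in auto)
  then obtain p where p: "\<And>n. real_polynomial_function (p n)"
    "\<And>n x. x \<in> {a..b} \<Longrightarrow> \<bar>h x - p n x\<bar> < 1 / real (n + 1)" by metis
  have "bounded (h ` {a..b})" using assms by (intro compact_imp_bounded compact_continuous_image) auto
  then obtain B where B: "\<And>x. x \<in> {a..b} \<Longrightarrow> \<bar>h x\<bar> \<le> B" by (metis bounded_iff imageI real_norm_def)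
  show thesis
  proof (rule that)
    show "bump a b (\<lambda>x. p n x * plateau a b n x)" for n
      by (intro bump_smult smooth_real_polynomial_function p bump_plateau) auto
    show "\<bar>p n x * plateau a b n x\<bar> \<le> B + 1" if "x \<in> {a..b}" for n x
    proof -
      have "1 / real (n + 1) \<le> 1" by simp
      then have "\<bar>p n x\<bar> \<le> B + 1" using p(2)[OF that, of n] B[OF that] by linarith
      moreover have "\<bar>p n x * plateau a b n x\<bar> \<le> \<bar>p n x\<bar>"
        using plateau_bounds[of a b n x] by (simp add: abs_mult mult_left_le)
      ultimately show ?thesis by linarith
    qed
    show "(\<lambda>n. p n x * plateau a b n x) \<longlonglongrightarrow> h x" if x: "x \<in> {a<..<b}" for x
    proof -
      have "(\<lambda>n. \<bar>p n x - h x\<bar>) \<longlonglongrightarrow> 0"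
        by (rule tendsto_sandwich[OF _ _ tendsto_const LIMSEQ_inverse_real_of_nat])
           (use p(2)[of x] x in \<open>auto intro!: always_eventually simp: abs_minus_commute inverse_eq_divide less_imp_le\<close>)
      then have "(\<lambda>n. p n x) \<longlonglongrightarrow> h x" using LIM_zero_cancel tendsto_rabs_zero_iff by blast
      from tendsto_mult[OF this plateau_tendsto[OF x]] show ?thesis by simp
    qed
  qed
qed

section \<open>The unit interval and the square as finite measure spaces, and the Cauchy-Schwarz
  inequality\<close>

lemma unit_ivl_eq: "unit_ivl = ivl 0 1"
  by (simp add: unit_ivl_def)

lemma space_unit_ivl [simp]: "space unit_ivl = {0..1}"
  by (simp add: unit_ivl_def space_restrict_space)

lemma measure_unit_ivl [simp]: "measure unit_ivl {0..1} = 1"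
  by (simp add: unit_ivl_def measure_restrict_space)

interpretation U: finite_measure unit_ivl
  unfolding unit_ivl_eq by (rule finite_measure_ivl)

interpretation UU: pair_sigma_finite unit_ivl unit_ivl ..

lemma finite_measure_Omega: "finite_measure Omega"
  unfolding Omega_def by (rule finite_measure_pair_measure) unfold_locales

interpretation Om: finite_measure Omega by (rule finite_measure_Omega)

lemma space_Omega [simp]: "space Omega = {0..1} \<times> {0..1}"
  by (simp add: Omega_def space_pair_measure)

lemma measurable_unit_ivl_borel:
  "f \<in> borel_measurable borel \<Longrightarrow> f \<in> borel_measurable unit_ivl"
  unfolding unit_ivl_def by (intro measurable_restrict_space1) simp

lemma measurable_Omega_swap:
  "f \<in> borel_measurable Omega \<Longrightarrow> z \<in> {0..1} \<Longrightarrow> (\<lambda>x. f (x, z)) \<in> borel_measurable unit_ivl"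
  unfolding Omega_def by (rule measurable_compose[OF measurable_Pair2']) auto

lemma measurable_Omega_fst: "g \<in> borel_measurable unit_ivl \<Longrightarrow> (\<lambda>q. g (fst q)) \<in> borel_measurable Omega"
  and measurable_Omega_snd: "g \<in> borel_measurable unit_ivl \<Longrightarrow> (\<lambda>q. g (snd q)) \<in> borel_measurable Omega"
  unfolding Omega_def by (auto intro: measurable_compose[OF measurable_fst] measurable_compose[OF measurable_snd])

text \<open>The integral of (s |f| - |g|)^2 is a nonnegative quadratic polynomial in s, evaluated at
  its minimizer. Integrability of the product comes first, from |x y| \<le> x^2 + y^2.\<close>

lemma Cauchy_Schwarz_integral:
  fixes f g :: "'a \<Rightarrow> real"
  assumes [measurable]: "f \<in> borel_measurable M" "g \<in> borel_measurable M"
    and f: "integrable M (\<lambda>x. (f x)\<^sup>2)" and g: "integrable M (\<lambda>x. (g x)\<^sup>2)"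
  shows "integrable M (\<lambda>x. f x * g x)"
    and "(LINT x|M. \<bar>f x * g x\<bar>) \<le> sqrt (LINT x|M. (f x)\<^sup>2) * sqrt (LINT x|M. (g x)\<^sup>2)"
proof -
  have young: "\<bar>x * y\<bar> \<le> x\<^sup>2 + y\<^sup>2" for x y :: real
  proof -
    have "2 * \<bar>x * y\<bar> \<le> x\<^sup>2 + y\<^sup>2"
      using sum_squares_bound[of "\<bar>x\<bar>" "\<bar>y\<bar>"] by (simp add: abs_mult)
    then show ?thesis by (smt (verit) zero_le_power2)
  qed
  show int: "integrable M (\<lambda>x. f x * g x)"
    by (rule Bochner_Integration.integrable_bound[of _ "\<lambda>x. (f x)\<^sup>2 + (g x)\<^sup>2"])
       (use f g young in \<open>auto intro!: AE_I2\<close>)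
  then have int': "integrable M (\<lambda>x. \<bar>f x * g x\<bar>)" by (rule integrable_abs)
  define a b c where "a = (LINT x|M. (f x)\<^sup>2)" "b = (LINT x|M. (g x)\<^sup>2)" "c = (LINT x|M. \<bar>f x * g x\<bar>)"
  have abc: "0 \<le> a" "0 \<le> b" "0 \<le> c" by (auto simp: a_b_c_def)
  have quad: "0 \<le> s\<^sup>2 * a - 2 * s * c + b" for s
  proof -
    have "0 \<le> (LINT x|M. (s * \<bar>f x\<bar> - \<bar>g x\<bar>)\<^sup>2)" by simp
    also have "\<dots> = (LINT x|M. s\<^sup>2 * (f x)\<^sup>2 - 2 * s * \<bar>f x * g x\<bar> + (g x)\<^sup>2)"
      by (intro Bochner_Integration.integral_cong) (auto simp: power2_diff abs_mult power_mult_distrib)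
    also have "\<dots> = s\<^sup>2 * a - 2 * s * c + b"
      using f g int' by (simp add: a_b_c_def)
    finally show ?thesis .
  qed
  have "c\<^sup>2 \<le> a * b"
  proof (cases "a = 0")
    case True
    have "c = 0"
    proof (rule ccontr)
      assume "c \<noteq> 0"
      \<comment> \<open>For a = 0 the polynomial is affine in s; at this s it has the value
        -1.\<close>
      then show False using quad[of "(b + 1) / (2 * c)"] True abc by simp
    qed
    then show ?thesis using True by simp
  next
    case False
    then have "a > 0" using abc by simp
    have "0 \<le> a * ((c / a)\<^sup>2 * a - 2 * (c / a) * c + b)"
      using quad[of "c / a"] abc by simp
    also have "\<dots> = a * b - c\<^sup>2" using \<open>a > 0\<close> by (simp add: field_simps power2_eq_square)
    finally show ?thesis by simp
  qed
  then have "sqrt (c\<^sup>2) \<le> sqrt (a * b)" by (rule real_sqrt_le_mono)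
  then show "(LINT x|M. \<bar>f x * g x\<bar>) \<le> sqrt (LINT x|M. (f x)\<^sup>2) * sqrt (LINT x|M. (g x)\<^sup>2)"
    using abc by (simp add: real_sqrt_mult a_b_c_def)
qed

subsection \<open>Square integrable functions on the unit interval\<close>

definition sq_int :: "(real \<Rightarrow> complex) \<Rightarrow> bool" where
  "sq_int f \<longleftrightarrow> f \<in> borel_measurable unit_ivl \<and> integrable unit_ivl (\<lambda>z. (norm (f z))\<^sup>2)"

definition nrm :: "(real \<Rightarrow> complex) \<Rightarrow> real" where
  "nrm f = sqrt (LINT z|unit_ivl. (norm (f z))\<^sup>2)"

lemma nrm_nonneg [simp]: "0 \<le> nrm f"
  by (simp add: nrm_def)

lemma nrm_power2: "(nrm f)\<^sup>2 = (LINT z|unit_ivl. (norm (f z))\<^sup>2)"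
  by (simp add: nrm_def)

lemma sq_int_measurable [measurable_dest]: "sq_int f \<Longrightarrow> f \<in> borel_measurable unit_ivl"
  by (simp add: sq_int_def)

lemma sq_int_mult_bounded:
  assumes [measurable]: "g \<in> borel_measurable unit_ivl" and f: "sq_int f"
    and "\<And>x. x \<in> {0..1} \<Longrightarrow> norm (g x) \<le> B"
  shows "sq_int (\<lambda>x. g x * f x)" "nrm (\<lambda>x. g x * f x) \<le> B * nrm f"
proof -
  have [measurable]: "f \<in> borel_measurable unit_ivl" using f by measurable
  have "0 \<le> B" using order_trans[OF norm_ge_zero assms(3)[of 0]] by simp
  have le: "(norm (g x * f x))\<^sup>2 \<le> B\<^sup>2 * (norm (f x))\<^sup>2" if "x \<in> {0..1}" for x
    using assms(3)[OF that] by (simp add: norm_mult power_mult_distrib mult_right_mono power_mono)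
  have f2: "integrable unit_ivl (\<lambda>x. B\<^sup>2 * (norm (f x))\<^sup>2)" using f by (simp add: sq_int_def)
  show s: "sq_int (\<lambda>x. g x * f x)"
    unfolding sq_int_def
    by (intro conjI Bochner_Integration.integrable_bound[OF f2]) (use le in \<open>auto intro!: AE_I2\<close>)
  have "(LINT x|unit_ivl. (norm (g x * f x))\<^sup>2) \<le> (LINT x|unit_ivl. B\<^sup>2 * (norm (f x))\<^sup>2)"
    using s f2 le by (intro integral_mono) (auto simp: sq_int_def)
  then have "sqrt (LINT x|unit_ivl. (norm (g x * f x))\<^sup>2) \<le> sqrt (B\<^sup>2 * (LINT x|unit_ivl. (norm (f x))\<^sup>2))"
    by simp
  then show "nrm (\<lambda>x. g x * f x) \<le> B * nrm f"
    using \<open>0 \<le> B\<close> by (simp add: nrm_def real_sqrt_mult)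
qed

lemma sq_int_bounded:
  assumes [measurable]: "g \<in> borel_measurable unit_ivl" and "\<And>x. x \<in> {0..1} \<Longrightarrow> norm (g x) \<le> B"
  shows "sq_int g" "nrm g \<le> B"
proof -
  have "sq_int (\<lambda>_. 1)" "nrm (\<lambda>_. 1) = 1" by (auto simp: sq_int_def nrm_def)
  with sq_int_mult_bounded[OF assms(1) this(1) assms(2)] show "sq_int g" "nrm g \<le> B" by auto
qed

lemma sq_int_mult_integrable:
  assumes "sq_int f" "sq_int g"
  shows "integrable unit_ivl (\<lambda>z. f z * g z)"
    and "(LINT z|unit_ivl. norm (f z * g z)) \<le> nrm f * nrm g"
    and "norm (LINT z|unit_ivl. f z * g z) \<le> nrm f * nrm g"
proof -
  have [measurable]: "f \<in> borel_measurable unit_ivl" "g \<in> borel_measurable unit_ivl" using assms by measurable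
  note CS = Cauchy_Schwarz_integral[of "\<lambda>z. norm (f z)" unit_ivl "\<lambda>z. norm (g z)"]
  have "integrable unit_ivl (\<lambda>z. norm (f z) * norm (g z))"
    by (rule CS) (use assms in \<open>auto simp: sq_int_def\<close>)
  then show int: "integrable unit_ivl (\<lambda>z. f z * g z)"
    by (rule Bochner_Integration.integrable_bound) (auto simp: norm_mult)
  show le: "(LINT z|unit_ivl. norm (f z * g z)) \<le> nrm f * nrm g"
    using CS(2) assms by (simp add: sq_int_def nrm_def norm_mult)
  show "norm (LINT z|unit_ivl. f z * g z) \<le> nrm f * nrm g"
    by (rule order_trans[OF integral_norm_bound le])
qed

lemma sq_int_integrable:
  assumes "sq_int f"
  shows "integrable unit_ivl f" "(LINT z|unit_ivl. norm (f z)) \<le> nrm f"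
proof -
  have "sq_int (\<lambda>_. 1)" "nrm (\<lambda>_. 1) = 1" by (auto simp: sq_int_def nrm_def)
  with sq_int_mult_integrable[OF assms this(1)] show "integrable unit_ivl f" "(LINT z|unit_ivl. norm (f z)) \<le> nrm f"
    by auto
qed

lemma sq_int_add:
  assumes "sq_int f" "sq_int g" shows "sq_int (\<lambda>z. f z + g z)"
proof -
  have [measurable]: "f \<in> borel_measurable unit_ivl" "g \<in> borel_measurable unit_ivl" using assms by measurable
  have "(norm (f z + g z))\<^sup>2 \<le> 2 * (norm (f z))\<^sup>2 + 2 * (norm (g z))\<^sup>2" for z
  proof -
    have "(norm (f z + g z))\<^sup>2 \<le> (norm (f z) + norm (g z))\<^sup>2" by (intro power_mono norm_triangle_ineq) auto
    also have "\<dots> \<le> 2 * (norm (f z))\<^sup>2 + 2 * (norm (g z))\<^sup>2"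
      using sum_squares_bound[of "norm (f z)" "norm (g z)"] by (simp add: power2_sum)
    finally show ?thesis .
  qed
  note le = this
  have "integrable unit_ivl (\<lambda>z. (norm (f z + g z))\<^sup>2)"
  proof (rule Bochner_Integration.integrable_bound)
    show "integrable unit_ivl (\<lambda>z. 2 * (norm (f z))\<^sup>2 + 2 * (norm (g z))\<^sup>2)"
      using assms by (simp add: sq_int_def)
    show "AE z in unit_ivl. norm ((norm (f z + g z))\<^sup>2) \<le> norm (2 * (norm (f z))\<^sup>2 + 2 * (norm (g z))\<^sup>2)"
      using le by simp
    show "(\<lambda>z. (norm (f z + g z))\<^sup>2) \<in> borel_measurable unit_ivl" by measurable
  qed
  then show ?thesis by (simp add: sq_int_def)
qed

lemma sq_int_scale: "sq_int f \<Longrightarrow> sq_int (\<lambda>z. c * f z)" "nrm (\<lambda>z. c * f z) = norm c * nrm f"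
  by (auto simp: sq_int_def nrm_def norm_mult power_mult_distrib real_sqrt_mult)

lemma sq_int_diff: "sq_int f \<Longrightarrow> sq_int g \<Longrightarrow> sq_int (\<lambda>z. f z - g z)"
  using sq_int_add[of f "\<lambda>z. (-1) * g z"] sq_int_scale(1)[of g "-1"] by simp

lemma sq_int_cnj: "sq_int f \<Longrightarrow> sq_int (\<lambda>z. cnj (f z))" "nrm (\<lambda>z. cnj (f z)) = nrm f"
  by (auto simp: sq_int_def nrm_def intro: measurable_compose[OF _ borel_measurable_continuous_onI[OF continuous_on_cnj[OF continuous_on_id]]])

lemma nrm_cong_AE:
  assumes "AE z in unit_ivl. f z = g z" "f \<in> borel_measurable unit_ivl" "g \<in> borel_measurable unit_ivl"
  shows "nrm f = nrm g"
  unfolding nrm_def using assms by (intro arg_cong[of _ _ sqrt] integral_cong_AE) auto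

lemma AE_zero_if_nrm_zero:
  assumes "sq_int f" "nrm f = 0" shows "AE z in unit_ivl. f z = 0"
proof -
  have "AE z in unit_ivl. (norm (f z))\<^sup>2 = 0"
    using assms by (subst integral_nonneg_eq_0_iff_AE[symmetric]) (auto simp: sq_int_def nrm_def)
  then show ?thesis by auto
qed

subsection \<open>Fourier coefficients on the circle\<close>

definition fexp :: "int \<Rightarrow> real \<Rightarrow> complex" where
  "fexp k x = cis (2 * pi * of_int k * x)"

definition fcoef :: "(real \<Rightarrow> complex) \<Rightarrow> int \<Rightarrow> complex" where
  "fcoef g k = (LINT x|unit_ivl. g x * fexp (- k) x)"

lemma norm_fexp [simp]: "norm (fexp k x) = 1"
  by (simp add: fexp_def)

lemma fexp_mult: "fexp k x * fexp l x = fexp (k + l) x"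
  by (simp add: fexp_def cis_mult algebra_simps)

lemma cnj_fexp: "cnj (fexp k x) = fexp (- k) x"
  by (simp add: fexp_def cis_cnj)

lemma fexp_0 [simp]: "fexp 0 x = 1"
  by (simp add: fexp_def)

lemma continuous_fexp: "continuous_on A (fexp k)"
  unfolding fexp_def[abs_def] by (intro continuous_intros)

lemma measurable_fexp [measurable]: "fexp k \<in> borel_measurable unit_ivl"
  by (intro measurable_unit_ivl_borel borel_measurable_continuous_onI continuous_fexp)

lemma integral_fexp: "(LINT x|unit_ivl. fexp k x) = (if k = 0 then 1 else 0)"
proof (cases "k = 0")
  case False
  define c where "c = 2 * pi * \<i> * of_int k"
  have "c \<noteq> 0" using False by (simp add: c_def)
  have fexp: "fexp k x = exp (c * of_real x)" for x
    by (simp add: fexp_def cis_conv_exp c_def mult_ac)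
  have "((\<lambda>x. fexp k x / c) has_vector_derivative fexp k x) (at x within {0..1})" for x
  proof -
    have "((\<lambda>w. exp (c * w) / c) has_field_derivative exp (c * of_real x)) (at (of_real x))"
      using \<open>c \<noteq> 0\<close> by (auto intro!: derivative_eq_intros)
    then show ?thesis unfolding fexp
      by (rule has_vector_derivative_real_field[THEN has_vector_derivative_at_within])
  qed
  then have "(fexp k has_integral (fexp k 1 / c - fexp k 0 / c)) {0..1}"
    by (intro fundamental_theorem_of_calculus) auto
  moreover have "fexp k 1 = 1" "fexp k 0 = 1"
    using cis_multiple_2pi[of "of_int k"] by (simp_all add: fexp_def mult_ac)
  ultimately have "(fexp k has_integral 0) {0..1}" by simp
  then show ?thesis
    using False integral_ivl_continuous(1)[OF continuous_fexp, of 0 1 k]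
    by (simp add: unit_ivl_eq integral_unique)
qed simp

lemma integrable_fexp_mult: "integrable unit_ivl g \<Longrightarrow> integrable unit_ivl (\<lambda>x. g x * fexp k x)"
  by (rule Bochner_Integration.integrable_bound[of _ g]) (auto simp: norm_mult)

text \<open>Expanding the square of g - P, with P the partial Fourier sum over F, both the cross
  term and the square of P produce the sum of the squared coefficients.\<close>

lemma Bessel_inequality:
  assumes g: "sq_int g" and "finite F"
  shows "(\<Sum>k\<in>F. (norm (fcoef g k))\<^sup>2) \<le> (LINT x|unit_ivl. (norm (g x))\<^sup>2)"
proof -
  define P where "P x = (\<Sum>k\<in>F. fcoef g k * fexp k x)" for x
  have [measurable]: "g \<in> borel_measurable unit_ivl" using g by measurable
  have [measurable]: "P \<in> borel_measurable unit_ivl" unfolding P_def[abs_def] by measurable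
  have gi: "integrable unit_ivl g" using sq_int_integrable[OF g] by simp
  have Pb: "norm (P x) \<le> (\<Sum>k\<in>F. norm (fcoef g k))" for x
    unfolding P_def by (rule order_trans[OF norm_sum]) (simp add: norm_mult)
  have P: "sq_int P" by (rule sq_int_bounded(1)[where B = "\<Sum>k\<in>F. norm (fcoef g k)"]) (use Pb in auto)
  have cnjP: "cnj (P x) = (\<Sum>k\<in>F. cnj (fcoef g k) * fexp (- k) x)" for x
    by (simp add: P_def cnj_fexp)
  have gP: "(LINT x|unit_ivl. g x * cnj (P x)) = (\<Sum>k\<in>F. of_real ((norm (fcoef g k))\<^sup>2))"
  proof -
    have "(LINT x|unit_ivl. g x * cnj (P x)) = (LINT x|unit_ivl. (\<Sum>k\<in>F. cnj (fcoef g k) * (g x * fexp (- k) x)))"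
      unfolding cnjP by (simp add: sum_distrib_left mult_ac)
    also have "\<dots> = (\<Sum>k\<in>F. cnj (fcoef g k) * fcoef g k)"
      by (subst Bochner_Integration.integral_sum) (auto simp: fcoef_def intro!: integrable_fexp_mult gi)
    also have "\<dots> = (\<Sum>k\<in>F. of_real ((norm (fcoef g k))\<^sup>2))"
      by (intro sum.cong refl) (simp add: complex_norm_square[symmetric] mult.commute)
    finally show ?thesis .
  qed
  have PP: "(LINT x|unit_ivl. P x * cnj (P x)) = (\<Sum>k\<in>F. of_real ((norm (fcoef g k))\<^sup>2))"
  proof -
    have "(LINT x|unit_ivl. P x * cnj (P x)) =
        (LINT x|unit_ivl. (\<Sum>k\<in>F. \<Sum>l\<in>F. fcoef g k * cnj (fcoef g l) * fexp (k - l) x))"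
      unfolding cnjP unfolding P_def sum_product diff_conv_add_uminus fexp_mult[symmetric]
      by (simp only: mult_ac)
    also have "\<dots> = (\<Sum>k\<in>F. \<Sum>l\<in>F. fcoef g k * cnj (fcoef g l) * (if k - l = 0 then 1 else 0))"
      by (subst Bochner_Integration.integral_sum; (subst Bochner_Integration.integral_sum)?)
         (auto simp: integral_fexp intro!: Bochner_Integration.integrable_sum integrable_mult_right
           U.integrable_const_bound[where B=1])
    also have "\<dots> = (\<Sum>k\<in>F. of_real ((norm (fcoef g k))\<^sup>2))"
      using \<open>finite F\<close>
      by (intro sum.cong refl) (simp add: if_distrib complex_norm_square[symmetric] cong: if_cong)
    finally show ?thesis .
  qed
  have int1: "integrable unit_ivl (\<lambda>x. g x * cnj (P x))" "integrable unit_ivl (\<lambda>x. P x * cnj (P x))"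
    using sq_int_mult_integrable(1) sq_int_cnj(1) g P by auto
  have "0 \<le> (LINT x|unit_ivl. (norm (g x - P x))\<^sup>2)" by simp
  also have "\<dots> = (LINT x|unit_ivl. (norm (g x))\<^sup>2 - 2 * Re (g x * cnj (P x)) + Re (P x * cnj (P x)))"
    by (intro Bochner_Integration.integral_cong refl)
       (simp add: cmod_power2 power2_diff, simp add: algebra_simps power2_eq_square)
  also have "\<dots> = (LINT x|unit_ivl. (norm (g x))\<^sup>2) - 2 * Re (LINT x|unit_ivl. g x * cnj (P x))
      + Re (LINT x|unit_ivl. P x * cnj (P x))"
  proof -
    have "(LINT x|unit_ivl. A x - 2 * Re (B x) + Re (C x)) =
        integral\<^sup>L unit_ivl A - 2 * Re (integral\<^sup>L unit_ivl B) + Re (integral\<^sup>L unit_ivl C)"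
      if "integrable unit_ivl A" "integrable unit_ivl B" "integrable unit_ivl C" for A :: "real \<Rightarrow> real" and B C
      using that by simp
    then show ?thesis using int1 g by (simp only: sq_int_def)
  qed
  also have "\<dots> = (LINT x|unit_ivl. (norm (g x))\<^sup>2) - (\<Sum>k\<in>F. (norm (fcoef g k))\<^sup>2)"
    unfolding gP PP by simp
  finally show ?thesis by simp
qed

section \<open>Completeness of the trigonometric system\<close>

inductive trig_poly :: "(real \<Rightarrow> complex) \<Rightarrow> bool" where
  base: "trig_poly (\<lambda>x. c * fexp k x)"
| add: "trig_poly f \<Longrightarrow> trig_poly g \<Longrightarrow> trig_poly (\<lambda>x. f x + g x)"

lemma trig_poly_mult: "trig_poly f \<Longrightarrow> trig_poly g \<Longrightarrow> trig_poly (\<lambda>x. f x * g x)"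
proof (induction f rule: trig_poly.induct)
  case (base c k)
  then show ?case
  proof (induction g rule: trig_poly.induct)
    case (base d l)
    have "(\<lambda>x. c * fexp k x * (d * fexp l x)) = (\<lambda>x. (c * d) * fexp (k + l) x)"
      by (auto simp: fexp_mult[symmetric])
    then show ?case using trig_poly.base by metis
  next
    case (add f g)
    then show ?case using trig_poly.add by (simp add: distrib_left)
  qed
next
  case (add f g)
  then show ?case using trig_poly.add by (simp add: distrib_right)
qed

text \<open>On the unit circle, Re and Im are combinations of \<open>fexp 1\<close> and
  \<open>fexp (- 1)\<close>, and trigonometric polynomials form an algebra. Stone-Weierstrass on the
  circle inside the complex plane therefore provides trigonometric polynomials, with periodicity
  built in.\<close>

lemma trig_poly_real_polynomial_function:
  "real_polynomial_function p \<Longrightarrow> trig_poly (\<lambda>x. of_real (p (cis (2 * pi * x))))"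
proof (induction rule: real_polynomial_function.induct)
  case (linear f)
  define a b where "a = f 1" "b = f \<i>"
  have f: "f w = a * Re w + b * Im w" for w
  proof -
    have "f w = f (Re w *\<^sub>R 1 + Im w *\<^sub>R \<i>)" by (rule arg_cong[of _ _ f]) (simp add: complex_eq_iff)
    also have "\<dots> = Re w *\<^sub>R f 1 + Im w *\<^sub>R f \<i>"
      using linear by (simp only: linear_add linear_scale bounded_linear.linear)
    finally show ?thesis by (simp add: a_b_def)
  qed
  have "(\<lambda>x. of_real (f (cis (2 * pi * x)))) =
      (\<lambda>x. (a - \<i> * b) / 2 * fexp 1 x + (a + \<i> * b) / 2 * fexp (- 1) x)"
    by (auto simp: f fexp_def complex_eq_iff field_simps)
  then show ?case by (simp only:) (intro trig_poly.intros)
next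
  case (const c)
  then show ?case using trig_poly.base[of "of_real c" 0] by simp
qed (auto intro: trig_poly.add trig_poly_mult)

lemma trig_poly_orthogonal:
  assumes "trig_poly h" "integrable unit_ivl g" "\<And>k. fcoef g k = 0"
  shows "integrable unit_ivl (\<lambda>x. g x * h x) \<and> (LINT x|unit_ivl. g x * h x) = 0"
  using assms(1)
proof induction
  case (base c k)
  have "(LINT x|unit_ivl. g x * fexp k x) = 0" using assms(3)[of "- k"] by (simp add: fcoef_def)
  then show ?case
    using integrable_fexp_mult[OF assms(2), of k] by (simp add: mult.left_commute)
qed (simp add: distrib_left)

text \<open>A polynomial within e of h on the unit circle is orthogonal to g, so the pairing with h
  is at most e times the \<open>L1\<close> norm of g. Composing with \<open>cis\<close> encodes
  periodicity of the continuous function.\<close>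

lemma Fourier_orthogonal_continuous:
  fixes h :: "complex \<Rightarrow> real"
  assumes g: "integrable unit_ivl g" "\<And>k. fcoef g k = 0" and h: "continuous_on UNIV h"
  shows "(LINT x|unit_ivl. g x * of_real (h (cis (2 * pi * x)))) = 0"
proof -
  let ?I = "LINT x|unit_ivl. g x * of_real (h (cis (2 * pi * x)))"
  have [measurable]: "(\<lambda>x. h (cis (2 * pi * x))) \<in> borel_measurable unit_ivl"
    by (intro measurable_unit_ivl_borel borel_measurable_continuous_onI continuous_on_compose2[OF h])
       (auto intro!: continuous_intros)
  have [measurable]: "g \<in> borel_measurable unit_ivl" using g by simp
  have "norm ?I \<le> e * ((LINT x|unit_ivl. norm (g x)) + 1)" if "0 < e" for e
  proof -
    obtain p where p: "real_polynomial_function p" "\<And>w. w \<in> sphere 0 1 \<Longrightarrow> \<bar>h w - p w\<bar> < e"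
      using Stone_Weierstrass_real_polynomial_function[of "sphere 0 1" h e] \<open>0 < e\<close>
        continuous_on_subset[OF h] by auto
    note tp = trig_poly_orthogonal[OF trig_poly_real_polynomial_function[OF p(1)] g]
    have gh: "integrable unit_ivl (\<lambda>x. g x * of_real (h (cis (2 * pi * x))))"
    proof -
      obtain B where B: "\<And>w. w \<in> sphere 0 1 \<Longrightarrow> \<bar>h w\<bar> \<le> B"
        using compact_imp_bounded[OF compact_continuous_image[OF continuous_on_subset[OF h], of "sphere 0 1"]]
        by (metis bounded_iff compact_sphere imageI real_norm_def subset_UNIV)
      show ?thesis
      proof (rule Bochner_Integration.integrable_bound[of _ "\<lambda>x. B *\<^sub>R g x"])
        have "norm (g x * of_real (h (cis (2 * pi * x)))) \<le> norm (B *\<^sub>R g x)" for x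
          using order_trans[OF B[of "cis (2 * pi * x)"] abs_ge_self]
          by (simp add: norm_mult mult.commute[of "cmod (g x)"] mult_right_mono)
        then show "AE x in unit_ivl. norm (g x * of_real (h (cis (2 * pi * x)))) \<le> norm (B *\<^sub>R g x)" by simp
      qed (use g in \<open>simp, measurable\<close>)
    qed
    have "?I = (LINT x|unit_ivl. g x * of_real (h (cis (2 * pi * x)))) -
        (LINT x|unit_ivl. g x * of_real (p (cis (2 * pi * x))))" using tp by simp
    also have "\<dots> = (LINT x|unit_ivl. g x * of_real (h (cis (2 * pi * x)) - p (cis (2 * pi * x))))"
      using tp gh by (simp add: right_diff_distrib)
    also have "norm \<dots> \<le> (LINT x|unit_ivl. norm (g x * of_real (h (cis (2 * pi * x)) - p (cis (2 * pi * x)))))"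
      by (rule integral_norm_bound)
    also have "\<dots> \<le> (LINT x|unit_ivl. e * norm (g x))"
    proof (rule integral_mono)
      show "integrable unit_ivl (\<lambda>x. norm (g x * of_real (h (cis (2 * pi * x)) - p (cis (2 * pi * x)))))"
        using tp gh by (simp add: right_diff_distrib)
      show "norm (g x * of_real (h (cis (2 * pi * x)) - p (cis (2 * pi * x)))) \<le> e * norm (g x)" for x
        unfolding norm_mult norm_of_real
        using p(2)[of "cis (2 * pi * x)"] by (subst mult.commute, intro mult_right_mono) auto
    qed (use g in simp)
    also have "\<dots> \<le> e * ((LINT x|unit_ivl. norm (g x)) + 1)" using \<open>0 < e\<close> by simp
    finally show ?thesis .
  qed
  then have *: "norm ?I \<le> e * K" if "0 < e" "K = (LINT x|unit_ivl. norm (g x)) + 1" for e K using that by simp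
  define K where "K = (LINT x|unit_ivl. norm (g x)) + 1"
  have "K > 0" unfolding K_def by (smt (verit) integral_nonneg_AE AE_I2 norm_ge_zero)
  have "norm ?I \<le> 0 + e" if "0 < e" for e
    using *[of "e / K" K] that \<open>K > 0\<close> by (simp add: K_def)
  then have "norm ?I \<le> 0" by (rule field_le_epsilon)
  then show ?thesis by simp
qed

text \<open>The arc 0 < x < d consists of the points whose angle 2 pi x is closer than pi d to the
  angle pi d of its midpoint. This describes the arc by a continuous function on the plane.\<close>

lemma cos_gt_cos_iff_arc:
  assumes "d \<in> {0..1}" "x \<in> {0..1}"
  shows "cos (pi * d) < cos (2 * pi * x - pi * d) \<longleftrightarrow> x \<in> {0<..<d}"
proof -
  define y where "y = \<bar>2 * pi * x - pi * d\<bar>"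
  have cosy: "cos (2 * pi * x - pi * d) = cos y" by (simp add: y_def)
  have pid: "0 \<le> pi * d" "pi * d \<le> pi" using assms by auto
  have pix: "0 \<le> pi * x" "pi * x \<le> pi" using assms by auto
  have x_iff: "x \<in> {0<..<d} \<longleftrightarrow> y < pi * d"
  proof -
    have "x \<in> {0<..<d} \<longleftrightarrow> 0 < pi * x \<and> pi * x < pi * d" by (simp add: zero_less_mult_iff)
    also have "\<dots> \<longleftrightarrow> y < pi * d" unfolding y_def by linarith
    finally show ?thesis .
  qed
  show ?thesis
  proof (cases "y \<le> pi")
    case True
    then show ?thesis unfolding cosy x_iff
      using pid cos_mono_less_eq[of "pi * d" y] by (auto simp: y_def)
  next
    case False
    have "cos y = cos (2 * pi - y)" by (metis cos_2pi_minus)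
    also have "\<dots> \<le> cos (pi * d)"
    proof (rule cos_monotone_0_pi_le)
      show "pi * d \<le> 2 * pi - y" "2 * pi - y \<le> pi" using False pid pix unfolding y_def by linarith+
    qed (use pid in simp)
    finally have "\<not> cos (pi * d) < cos y" by simp
    moreover have "\<not> y < pi * d" using False pid by linarith
    ultimately show ?thesis unfolding cosy x_iff by blast
  qed
qed

text \<open>The indicator of an arc is a bounded pointwise limit of continuous functions on the
  circle, all orthogonal to g. Hence the integrals of g over the intervals anchored at 0
  vanish.\<close>

lemma Fourier_uniqueness:
  assumes g: "integrable unit_ivl g" "\<And>k. fcoef g k = 0"
  shows "AE x in unit_ivl. g x = 0"
  unfolding unit_ivl_eq
proof (rule AE_zero_if_interval_integrals_zero)
  fix d :: real assume d: "d \<in> {0..1}"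
  \<comment> \<open>A ramp: n times the positive part of cos (2 pi x - pi d) - cos (pi d), capped at
    1. As n grows it tends to 1 on the arc and is constantly 0 off it.\<close>
  define h where "h n w = min 1 (real n * max 0 (Re (w * cis (- (pi * d))) - cos (pi * d)))" for n and w :: complex
  have h01: "0 \<le> h n w" "h n w \<le> 1" for n w by (auto simp: h_def)
  have [measurable]: "g \<in> borel_measurable unit_ivl" using g by simp
  have meas: "(\<lambda>x. h n (cis (2 * pi * x))) \<in> borel_measurable unit_ivl" for n
    by (intro measurable_unit_ivl_borel borel_measurable_continuous_onI)
       (auto simp: h_def intro!: continuous_intros)
  have "(\<lambda>n. LINT x|unit_ivl. g x * of_real (h n (cis (2 * pi * x)))) \<longlonglongrightarrow>
      (LINT x|unit_ivl. indicator {0<..<d} x *\<^sub>R g x)"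
  proof (rule integral_dominated_convergence[where w = "\<lambda>x. norm (g x)"])
    show "AE x in unit_ivl. (\<lambda>n. g x * of_real (h n (cis (2 * pi * x)))) \<longlonglongrightarrow> indicator {0<..<d} x *\<^sub>R g x"
    proof (rule AE_I2)
      fix x assume "x \<in> space unit_ivl"
      then have x: "x \<in> {0..1}" by simp
      define r where "r = cos (2 * pi * x - pi * d) - cos (pi * d)"
      have hr: "h n (cis (2 * pi * x)) = min 1 (real n * max 0 r)" for n
        by (simp add: h_def cis_mult r_def)
      have "(\<lambda>n. h n (cis (2 * pi * x))) \<longlonglongrightarrow> indicator {0<..<d} x"
      proof (cases "x \<in> {0<..<d}")
        case True
        then have "0 < r" using cos_gt_cos_iff_arc[OF d x] by (simp add: r_def)
        obtain N :: nat where N: "1 / r < real N" using reals_Archimedean2 by blast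
        have "h n (cis (2 * pi * x)) = 1" if "n \<ge> N" for n
        proof -
          have "1 / r < real n" using N that by linarith
          then have "1 \<le> real n * r" using \<open>0 < r\<close> by (simp add: field_simps)
          then show ?thesis using \<open>0 < r\<close> by (simp add: hr)
        qed
        then have "eventually (\<lambda>n. 1 = h n (cis (2 * pi * x))) sequentially"
          by (auto intro!: eventually_sequentiallyI[of N])
        from Lim_transform_eventually[OF tendsto_const this] show ?thesis using True by simp
      next
        case False
        then have "\<not> cos (pi * d) < cos (2 * pi * x - pi * d)" using cos_gt_cos_iff_arc[OF d x] by blast
        then have "r \<le> 0" by (simp add: r_def)
        then have "h n (cis (2 * pi * x)) = 0" for n unfolding hr by simp
        then show ?thesis using False by simp
      qed
      then have "(\<lambda>n. g x * of_real (h n (cis (2 * pi * x)))) \<longlonglongrightarrow> g x * of_real (indicator {0<..<d} x)"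
        by (intro tendsto_intros)
      then show "(\<lambda>n. g x * of_real (h n (cis (2 * pi * x)))) \<longlonglongrightarrow> indicator {0<..<d} x *\<^sub>R g x"
        by (simp add: scaleR_conv_of_real mult.commute)
    qed
    show "AE x in unit_ivl. norm (g x * of_real (h n (cis (2 * pi * x)))) \<le> norm (g x)" for n
      using h01 by (auto simp: norm_mult mult_left_le)
    show "(\<lambda>x. g x * of_real (h n (cis (2 * pi * x)))) \<in> borel_measurable unit_ivl" for n
      using meas by measurable
    show "(\<lambda>x. indicator {0<..<d} x *\<^sub>R g x) \<in> borel_measurable unit_ivl"
    proof -
      have [measurable]: "indicat_real {0<..<d} \<in> borel_measurable unit_ivl"
        by (rule measurable_unit_ivl_borel) simp
      show ?thesis by measurable
    qed
  qed (use g in auto)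
  moreover have "(LINT x|unit_ivl. g x * of_real (h n (cis (2 * pi * x)))) = 0" for n
    by (rule Fourier_orthogonal_continuous[OF g]) (auto simp: h_def intro!: continuous_intros)
  ultimately have "(LINT x|unit_ivl. indicator {0<..<d} x *\<^sub>R g x) = 0"
    using LIMSEQ_unique[OF _ tendsto_const] by force
  then show "(LINT x|ivl 0 1. indicator {0<..<d} x *\<^sub>R g x) = 0" by (simp add: unit_ivl_eq)
qed (use g in \<open>simp add: unit_ivl_eq\<close>)

subsection \<open>Horizontal Fourier modes\<close>

definition mnorm :: "(real \<times> real \<Rightarrow> real) \<Rightarrow> int \<Rightarrow> real" where
  "mnorm f k = nrm (fourier_h f k)"

lemma mnorm_nonneg [simp]: "0 \<le> mnorm f k"
  by (simp add: mnorm_def)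

lemma fourier_h_eq_fcoef: "fourier_h f k z = fcoef (\<lambda>x. of_real (f (x, z))) k"
  by (simp add: fourier_h_def fcoef_def fexp_def)

lemma L2_measurable [measurable_dest]: "f \<in> L2 \<Longrightarrow> f \<in> borel_measurable Omega"
  by (simp add: L2_def)

lemma L2_mult_integrable:
  assumes "f \<in> L2" "g \<in> L2"
  shows "integrable Omega (\<lambda>q. f q * g q)" "(LINT q|Omega. \<bar>f q * g q\<bar>) \<le> L2_norm f * L2_norm g"
  using Cauchy_Schwarz_integral[of f Omega g] assms by (auto simp: L2_def L2_norm_def)

lemma L2_integrable: "f \<in> L2 \<Longrightarrow> integrable Omega f"
  using L2_mult_integrable(1)[of f "\<lambda>_. 1"] by (simp add: L2_def)

lemma L2_scale: "f \<in> L2 \<Longrightarrow> (\<lambda>q. c * f q) \<in> L2"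
  by (auto simp: L2_def power_mult_distrib)

lemma L2_add: 
  assumes "f \<in> L2" "g \<in> L2" shows "(\<lambda>q. f q + g q) \<in> L2"
proof -
  have "integrable Omega (\<lambda>q. (f q)\<^sup>2 + (g q)\<^sup>2 + 2 * (f q * g q))"
    using L2_mult_integrable[OF assms] assms by (auto simp: L2_def)
  then have "integrable Omega (\<lambda>q. (f q + g q)\<^sup>2)" by (simp add: power2_sum mult.assoc)
  moreover have "(\<lambda>q. f q + g q) \<in> borel_measurable Omega"
    using assms by (auto simp: L2_def)
  ultimately show ?thesis by (simp add: L2_def)
qed

lemma L2_diff: "f \<in> L2 \<Longrightarrow> g \<in> L2 \<Longrightarrow> (\<lambda>q. f q - g q) \<in> L2"
  using L2_add[of f "\<lambda>q. (-1) * g q"] L2_scale[of g "-1"] by simp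

lemma integrable_Omega_snd:
  fixes F :: "real \<times> real \<Rightarrow> 'a::{banach, second_countable_topology}"
  assumes "integrable Omega F"
  shows "AE z in unit_ivl. integrable unit_ivl (\<lambda>x. F (x, z))"
    and "integrable unit_ivl (\<lambda>z. LINT x|unit_ivl. F (x, z))"
    and "(LINT z|unit_ivl. LINT x|unit_ivl. F (x, z)) = integral\<^sup>L Omega F"
proof -
  have *: "integrable (unit_ivl \<Otimes>\<^sub>M unit_ivl) (case_prod (\<lambda>x z. F (x, z)))"
    using assms by (simp add: Omega_def)
  show "AE z in unit_ivl. integrable unit_ivl (\<lambda>x. F (x, z))"
    "integrable unit_ivl (\<lambda>z. LINT x|unit_ivl. F (x, z))"
    "(LINT z|unit_ivl. LINT x|unit_ivl. F (x, z)) = integral\<^sup>L Omega F"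
    using UU.AE_integrable_snd[OF *] UU.integrable_snd[OF *] UU.integral_snd[OF *] by (simp_all add: Omega_def)
qed

lemma integrable_Omega_fst:
  fixes F :: "real \<times> real \<Rightarrow> 'a::{banach, second_countable_topology}"
  assumes "integrable Omega F"
  shows "AE x in unit_ivl. integrable unit_ivl (\<lambda>z. F (x, z))"
    and "integrable unit_ivl (\<lambda>x. LINT z|unit_ivl. F (x, z))"
    and "(LINT x|unit_ivl. LINT z|unit_ivl. F (x, z)) = integral\<^sup>L Omega F"
  using UU.AE_integrable_fst'[of F] UU.integrable_fst'[of F] UU.integral_fst'[of F] assms
  by (simp_all add: Omega_def)

lemma L2_slice:
  assumes "f \<in> L2"
  shows "AE z in unit_ivl. sq_int (\<lambda>x. of_real (f (x, z)))"
proof -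
  have "AE z in unit_ivl. integrable unit_ivl (\<lambda>x. (f (x, z))\<^sup>2)"
    using integrable_Omega_snd(1)[of "\<lambda>q. (f q)\<^sup>2"] assms by (simp add: L2_def)
  moreover have "AE z in unit_ivl. (\<lambda>x. f (x, z)) \<in> borel_measurable unit_ivl"
    using measurable_Omega_swap[of f] assms by (auto simp: L2_def)
  ultimately show ?thesis by eventually_elim (auto simp: sq_int_def)
qed

lemma fourier_h_measurable:
  assumes "f \<in> borel_measurable Omega"
  shows "fourier_h f k \<in> borel_measurable unit_ivl"
proof -
  have "(\<lambda>(z, x). f (x, z)) \<in> borel_measurable (unit_ivl \<Otimes>\<^sub>M unit_ivl)"
    using measurable_compose[OF measurable_pair_swap' assms[unfolded Omega_def]] by (simp add: case_prod_unfold)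
  then have *: "(\<lambda>q. f (snd q, fst q)) \<in> borel_measurable (unit_ivl \<Otimes>\<^sub>M unit_ivl)"
    by (simp add: case_prod_unfold)
  have [measurable]: "(\<lambda>q. fexp (- k) (snd q)) \<in> borel_measurable (unit_ivl \<Otimes>\<^sub>M unit_ivl)"
    by (rule measurable_compose[OF measurable_snd measurable_fexp])
  have "(\<lambda>z. LINT x|unit_ivl. of_real (f (x, z)) * fexp (- k) x) \<in> borel_measurable unit_ivl"
    by (rule U.borel_measurable_lebesgue_integral) (use * in \<open>simp add: case_prod_unfold\<close>)
  then show ?thesis unfolding fourier_h_eq_fcoef[abs_def] fcoef_def .
qed

lemma fourier_h_integrable:
  assumes f: "integrable Omega f"
  shows "integrable unit_ivl (fourier_h f k)" "(LINT z|unit_ivl. norm (fourier_h f k z)) \<le> (LINT q|Omega. \<bar>f q\<bar>)"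
proof -
  have [measurable]: "f \<in> borel_measurable Omega" using f by simp
  have m: "fourier_h f k \<in> borel_measurable unit_ivl" by (rule fourier_h_measurable) simp
  have le: "norm (fourier_h f k z) \<le> (LINT x|unit_ivl. \<bar>f (x, z)\<bar>)" for z
  proof -
    have "norm (fourier_h f k z) \<le> (LINT x|unit_ivl. norm (of_real (f (x, z)) * fexp (- k) x))"
      unfolding fourier_h_eq_fcoef fcoef_def by (rule integral_norm_bound)
    then show ?thesis by (simp add: norm_mult)
  qed
  note abs = integrable_Omega_snd[of "\<lambda>q. \<bar>f q\<bar>"]
  have i: "integrable unit_ivl (\<lambda>z. LINT x|unit_ivl. \<bar>f (x, z)\<bar>)" using abs(2) f by simp
  show int: "integrable unit_ivl (fourier_h f k)"
    by (rule Bochner_Integration.integrable_bound[OF i m])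
       (use le in \<open>auto intro: order_trans[OF _ abs_ge_self]\<close>)
  have "(LINT z|unit_ivl. norm (fourier_h f k z)) \<le> (LINT z|unit_ivl. LINT x|unit_ivl. \<bar>f (x, z)\<bar>)"
    by (rule integral_mono) (use int i le in auto)
  then show "(LINT z|unit_ivl. norm (fourier_h f k z)) \<le> (LINT q|Omega. \<bar>f q\<bar>)" using abs(3) f by simp
qed

lemma fourier_h_cong_AE:
  assumes "integrable Omega f" "integrable Omega g" "AE q in Omega. f q = g q"
  shows "AE z in unit_ivl. fourier_h f k z = fourier_h g k z"
proof -
  have fg: "integrable Omega (\<lambda>q. f q - g q)" using assms by simp
  have "(LINT q|Omega. \<bar>f q - g q\<bar>) = (LINT q|Omega. 0)"
    using assms by (intro integral_cong_AE) auto
  then have "(LINT z|unit_ivl. norm (fourier_h (\<lambda>q. f q - g q) k z)) = 0"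
    using fourier_h_integrable(2)[OF fg, of k] by (simp add: order_antisym)
  then have "AE z in unit_ivl. fourier_h (\<lambda>q. f q - g q) k z = 0"
    using fourier_h_integrable(1)[OF fg, of k] by (subst (asm) integral_nonneg_eq_0_iff_AE) auto
  then show ?thesis
    using integrable_Omega_snd(1)[OF assms(1)] integrable_Omega_snd(1)[OF assms(2)]
  proof eventually_elim
    case (elim z)
    have "integrable unit_ivl (\<lambda>x. complex_of_real (f (x, z)) * fexp (- k) x)"
      "integrable unit_ivl (\<lambda>x. complex_of_real (g (x, z)) * fexp (- k) x)"
      using elim by (auto intro!: integrable_fexp_mult)
    then show ?case using elim(1) by (simp add: fourier_h_eq_fcoef fcoef_def left_diff_distrib)
  qed
qed

lemma fourier_h_add:
  assumes "integrable Omega f" "integrable Omega g"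
  shows "AE z in unit_ivl. fourier_h (\<lambda>q. f q + g q) k z = fourier_h f k z + fourier_h g k z"
  using integrable_Omega_snd(1)[OF assms(1)] integrable_Omega_snd(1)[OF assms(2)]
proof eventually_elim
  case (elim z)
  have "integrable unit_ivl (\<lambda>x. complex_of_real (f (x, z)) * fexp (- k) x)"
    "integrable unit_ivl (\<lambda>x. complex_of_real (g (x, z)) * fexp (- k) x)"
    using elim by (auto intro!: integrable_fexp_mult)
  then show ?case by (simp add: fourier_h_eq_fcoef fcoef_def distrib_right)
qed

lemma fourier_h_scale: "fourier_h (\<lambda>q. c * f q) k z = of_real c * fourier_h f k z"
  by (simp add: fourier_h_eq_fcoef fcoef_def mult.assoc)

lemma fourier_h_diff:
  assumes "integrable Omega f" "integrable Omega g"
  shows "AE z in unit_ivl. fourier_h (\<lambda>q. f q - g q) k z = fourier_h f k z - fourier_h g k z"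
  using fourier_h_add[of f "\<lambda>q. (-1) * g q" k] assms fourier_h_scale[of "-1" g k] by simp

lemma fourier_h_uminus: "fourier_h f (- k) z = cnj (fourier_h f k z)"
  unfolding fourier_h_eq_fcoef fcoef_def by (subst Bochner_Integration.integral_cnj[symmetric]) (simp add: cnj_fexp)

lemma mnorm_uminus: "mnorm f (- k) = mnorm f k"
  unfolding mnorm_def fourier_h_uminus[abs_def] by (rule sq_int_cnj)

text \<open>Bessel's inequality on almost every horizontal slice, integrated in z.\<close>

lemma Bessel_fourier_h:
  assumes f: "f \<in> L2"
  shows fourier_h_sq_int: "sq_int (fourier_h f k)"
    and "finite F \<Longrightarrow> (\<Sum>k\<in>F. (mnorm f k)\<^sup>2) \<le> (L2_norm f)\<^sup>2"
proof -
  have f2: "integrable Omega (\<lambda>q. (f q)\<^sup>2)" using f by (simp add: L2_def)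
  note i = integrable_Omega_snd(2)[OF f2]
  have m: "fourier_h f k \<in> borel_measurable unit_ivl" for k
    using f by (intro fourier_h_measurable) (rule L2_measurable)
  have le: "AE z in unit_ivl. (\<Sum>k\<in>F. (norm (fourier_h f k z))\<^sup>2) \<le> (LINT x|unit_ivl. (f (x, z))\<^sup>2)"
    if "finite F" for F
    using L2_slice[OF f]
  proof eventually_elim
    case (elim z)
    then show ?case using Bessel_inequality[OF elim that] by (simp add: fourier_h_eq_fcoef)
  qed
  show sq: "sq_int (fourier_h f k)" for k
    unfolding sq_int_def
  proof (intro conjI m Bochner_Integration.integrable_bound[OF i])
    show "AE z in unit_ivl. norm ((norm (fourier_h f k z))\<^sup>2) \<le> norm (LINT x|unit_ivl. (f (x, z))\<^sup>2)"
      using le[of "{k}"] by simp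
    show "(\<lambda>z. (norm (fourier_h f k z))\<^sup>2) \<in> borel_measurable unit_ivl" using m by measurable
  qed
  show "(\<Sum>k\<in>F. (mnorm f k)\<^sup>2) \<le> (L2_norm f)\<^sup>2" if "finite F"
  proof -
    have int: "integrable unit_ivl (\<lambda>z. (norm (fourier_h f k z))\<^sup>2)" for k using sq by (simp add: sq_int_def)
    have "(\<Sum>k\<in>F. (mnorm f k)\<^sup>2) = (LINT z|unit_ivl. (\<Sum>k\<in>F. (norm (fourier_h f k z))\<^sup>2))"
      using int by (simp add: mnorm_def nrm_power2)
    also have "\<dots> \<le> (LINT z|unit_ivl. LINT x|unit_ivl. (f (x, z))\<^sup>2)"
      using le[OF that] int i by (intro integral_mono_AE) auto
    also have "\<dots> = (L2_norm f)\<^sup>2"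
      using integrable_Omega_snd(3)[OF f2] by (simp add: L2_norm_def)
    finally show ?thesis .
  qed
qed

text \<open>There are only countably many k, so one null set of heights z serves all modes; on the
  other slices Fourier uniqueness applies, and Fubini collects the slices.\<close>

lemma AE_zero_if_fourier_h_zero:
  assumes f: "f \<in> L2" and zero: "\<And>k. AE z in unit_ivl. fourier_h f k z = 0"
  shows "AE q in Omega. f q = 0"
proof -
  have f2: "integrable Omega (\<lambda>q. (f q)\<^sup>2)" using f by (simp add: L2_def)
  have "AE z in unit_ivl. \<forall>k. fourier_h f k z = 0" using zero by (simp add: AE_all_countable)
  then have "AE z in unit_ivl. (LINT x|unit_ivl. (f (x, z))\<^sup>2) = 0"
    using L2_slice[OF f]
  proof eventually_elim
    case (elim z)
    then have "AE x in unit_ivl. complex_of_real (f (x, z)) = 0"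
      by (intro Fourier_uniqueness sq_int_integrable) (auto simp: fourier_h_eq_fcoef)
    then have "AE x in unit_ivl. (f (x, z))\<^sup>2 = 0" by auto
    then show ?case by (rule integral_eq_zero_AE)
  qed
  then have "(LINT z|unit_ivl. LINT x|unit_ivl. (f (x, z))\<^sup>2) = 0" by (rule integral_eq_zero_AE)
  then have "(LINT q|Omega. (f q)\<^sup>2) = 0" using integrable_Omega_snd(3)[OF f2] by simp
  then show ?thesis using f2 by (subst (asm) integral_nonneg_eq_0_iff_AE) auto
qed

text \<open>The bridge between integrals in z of a mode and the integrals over \<open>Omega\<close>
  in which the weak formulations are stated.\<close>

lemma fourier_h_pairing:
  fixes g :: "real \<Rightarrow> complex"
  assumes f: "integrable Omega f" and [measurable]: "g \<in> borel_measurable unit_ivl"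
    and B: "\<And>z. z \<in> {0..1} \<Longrightarrow> norm (g z) \<le> B"
  shows "integrable Omega (\<lambda>(x, z). of_real (f (x, z)) * fexp (- k) x * g z)"
    and "(LINT z|unit_ivl. g z * fourier_h f k z) = (LINT (x, z)|Omega. of_real (f (x, z)) * fexp (- k) x * g z)"
proof -
  have [measurable]: "f \<in> borel_measurable Omega" using f by simp
  have [measurable]: "(\<lambda>q. fexp (- k) (fst q)) \<in> borel_measurable Omega" "(\<lambda>q. g (snd q)) \<in> borel_measurable Omega"
    by (auto intro!: measurable_Omega_fst measurable_Omega_snd)
  have int: "integrable Omega (\<lambda>q. of_real (f q) * fexp (- k) (fst q) * g (snd q))"
  proof (rule Bochner_Integration.integrable_bound[of _ "\<lambda>q. B * f q"])
    show "AE q in Omega. norm (complex_of_real (f q) * fexp (- k) (fst q) * g (snd q)) \<le> norm (B * f q)"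
      using B by (intro AE_I2) (auto simp: norm_mult abs_mult mult.commute[of "\<bar>B\<bar>"] intro!: mult_left_mono intro: order_trans[OF B abs_ge_self])
  qed (use f in auto)
  then show "integrable Omega (\<lambda>(x, z). of_real (f (x, z)) * fexp (- k) x * g z)"
    by (simp add: case_prod_unfold)
  have "(LINT z|unit_ivl. g z * fourier_h f k z) = (LINT z|unit_ivl. LINT x|unit_ivl. of_real (f (x, z)) * fexp (- k) x * g z)"
    by (simp add: fourier_h_eq_fcoef fcoef_def mult.commute)
  also have "\<dots> = (LINT q|Omega. of_real (f q) * fexp (- k) (fst q) * g (snd q))"
    using integrable_Omega_snd(3)[OF int] by simp
  finally show "(LINT z|unit_ivl. g z * fourier_h f k z) = (LINT (x, z)|Omega. of_real (f (x, z)) * fexp (- k) x * g z)"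
    by (simp add: case_prod_unfold)
qed

subsection \<open>Fourier modes of a product\<close>

text \<open>The interval has length 1, so the \<open>L1\<close> norm in z of a mode is at most its
  \<open>mnorm\<close>; the sum of the absolute values is thus integrable in z and finite almost
  everywhere. The bijection \<open>int_decode\<close> turns sums over the integers into
  series.\<close>

lemma AE_summable_fourier_h:
  assumes f: "f \<in> L2" and C: "\<And>F. finite F \<Longrightarrow> (\<Sum>l\<in>F. mnorm f l) \<le> C"
  shows "AE z in unit_ivl. summable (\<lambda>j. norm (fourier_h f (int_decode j) z))"
proof -
  let ?f = "\<lambda>j z. fourier_h f (int_decode j) z"
  have [measurable]: "?f j \<in> borel_measurable unit_ivl" for j
    using f by (intro fourier_h_measurable) (rule L2_measurable)
  have nn: "(\<integral>\<^sup>+z. ennreal (norm (?f j z)) \<partial>unit_ivl) \<le> ennreal (mnorm f (int_decode j))" for j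
  proof -
    note s = sq_int_integrable[OF fourier_h_sq_int[OF f, of "int_decode j"]]
    have "(\<integral>\<^sup>+z. ennreal (norm (?f j z)) \<partial>unit_ivl) = ennreal (LINT z|unit_ivl. norm (?f j z))"
      using s(1) by (intro nn_integral_eq_integral) auto
    then show ?thesis using s(2) by (simp add: mnorm_def ennreal_leI)
  qed
  have "(\<integral>\<^sup>+z. (\<Sum>j. ennreal (norm (?f j z))) \<partial>unit_ivl) = (\<Sum>j. \<integral>\<^sup>+z. ennreal (norm (?f j z)) \<partial>unit_ivl)"
    by (rule nn_integral_suminf) measurable
  also have "\<dots> \<le> ennreal C"
  proof (rule suminf_le_const)
    fix N
    have "(\<Sum>j<N. \<integral>\<^sup>+z. ennreal (norm (?f j z)) \<partial>unit_ivl) \<le> (\<Sum>j<N. ennreal (mnorm f (int_decode j)))"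
      by (intro sum_mono nn)
    also have "\<dots> = ennreal (\<Sum>l\<in>int_decode ` {..<N}. mnorm f l)"
      by (simp add: sum_ennreal sum.reindex[OF inj_int_decode])
    also have "\<dots> \<le> ennreal C" by (intro ennreal_leI C) auto
    finally show "(\<Sum>j<N. \<integral>\<^sup>+z. ennreal (norm (?f j z)) \<partial>unit_ivl) \<le> ennreal C" .
  qed auto
  finally have "(\<integral>\<^sup>+z. (\<Sum>j. ennreal (norm (?f j z))) \<partial>unit_ivl) \<noteq> \<infinity>"
    by (auto simp: top_unique)
  then have "AE z in unit_ivl. (\<Sum>j. ennreal (norm (?f j z))) \<noteq> \<infinity>"
    by (intro nn_integral_noteq_infinite) auto
  then show ?thesis
    by eventually_elim (auto intro: summable_suminf_not_top)
qed

text \<open>Only f is required to have summable modes. On almost every slice its Fourier series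
  converges absolutely to a function S, which equals f almost everywhere by uniqueness, and the
  series can be integrated termwise against h.\<close>

lemma fourier_h_mult_AE:
  assumes f: "f \<in> L2" and h: "h \<in> L2" and C: "\<And>F. finite F \<Longrightarrow> (\<Sum>l\<in>F. mnorm f l) \<le> C"
  shows "AE z in unit_ivl. (\<lambda>j. fourier_h f (int_decode j) z * fourier_h h (k - int_decode j) z) sums
    fourier_h (\<lambda>q. f q * h q) k z"
proof -
  have sm: "AE z in unit_ivl. summable (\<lambda>j. norm (fourier_h f (int_decode j) z))"
    by (rule AE_summable_fourier_h[OF f]) (rule C)
  show ?thesis using sm L2_slice[OF f] L2_slice[OF h]
  proof eventually_elim
    case (elim z)
    define c where "c j = fourier_h f (int_decode j) z" for j
    define S where "S x = (\<Sum>j. c j * fexp (int_decode j) x)" for x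
    have sumc: "summable (\<lambda>j. norm (c j))" using elim by (simp add: c_def)
    have hz: "integrable unit_ivl (\<lambda>x. complex_of_real (h (x, z)))"
      and fz: "integrable unit_ivl (\<lambda>x. complex_of_real (f (x, z)))"
      using elim sq_int_integrable by auto
    \<comment> \<open>Termwise integration against an arbitrary integrable G. Taking G = 1
      identifies the Fourier coefficients of S, taking G = h gives the convolution formula.\<close>
    have swap: "integrable unit_ivl (\<lambda>x. S x * (G x * fexp (- m) x))"
      "(\<lambda>j. c j * fcoef G (m - int_decode j)) sums (LINT x|unit_ivl. S x * (G x * fexp (- m) x))"
      if G: "integrable unit_ivl G" for G m
    proof -
      have i: "integrable unit_ivl (\<lambda>x. c j * fexp (int_decode j) x * (G x * fexp (- m) x))" for j
        using integrable_mult_right[OF integrable_fexp_mult[OF integrable_fexp_mult[OF G]], of "c j" "- m" "int_decode j"]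
        by (simp add: mult_ac)
      have s: "AE x in unit_ivl. summable (\<lambda>j. norm (c j * fexp (int_decode j) x * (G x * fexp (- m) x)))"
        using sumc by (simp add: norm_mult summable_mult2)
      have s2: "summable (\<lambda>j. LINT x|unit_ivl. norm (c j * fexp (int_decode j) x * (G x * fexp (- m) x)))"
        using sumc by (simp add: norm_mult summable_mult2)
      have Seq: "(\<Sum>j. c j * fexp (int_decode j) x * (G x * fexp (- m) x)) = S x * (G x * fexp (- m) x)" for x
        unfolding S_def by (rule suminf_mult2[symmetric]) (rule summable_norm_cancel, simp add: norm_mult sumc)
      show "integrable unit_ivl (\<lambda>x. S x * (G x * fexp (- m) x))"
        using integrable_suminf[OF i s s2] by (simp add: Seq)
      have eq: "(LINT x|unit_ivl. c j * fexp (int_decode j) x * (G x * fexp (- m) x)) = c j * fcoef G (m - int_decode j)" for j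
      proof -
        have "c j * fexp (int_decode j) x * (G x * fexp (- m) x) = c j * (G x * fexp (- (m - int_decode j)) x)" for x
          using fexp_mult[of "int_decode j" x "- m"] by (simp add: mult_ac add.commute)
        then show ?thesis by (simp only: fcoef_def integral_mult_right_zero)
      qed
      show "(\<lambda>j. c j * fcoef G (m - int_decode j)) sums (LINT x|unit_ivl. S x * (G x * fexp (- m) x))"
        using sums_integral[OF i s s2] by (simp add: Seq eq)
    qed
    have one: "integrable unit_ivl (\<lambda>x. 1 :: complex)" by simp
    have fcoef1: "fcoef (\<lambda>x. 1) m = (if m = 0 then 1 else 0)" for m by (simp add: fcoef_def integral_fexp)
    have Sint: "integrable unit_ivl S" using swap(1)[OF one, of 0] by simp
    have "fcoef S m = fourier_h f m z" for m
    proof -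
      have "(\<lambda>j. c j * (if m - int_decode j = 0 then 1 else 0)) sums (LINT x|unit_ivl. S x * (1 * fexp (- m) x))"
        using swap(2)[OF one, of m] unfolding fcoef1 .
      moreover have "(\<lambda>j. c j * (if m - int_decode j = 0 then 1 else 0)) = (\<lambda>j. if j = int_encode m then c j else 0)"
        by (intro ext) (metis diff_eq_diff_eq diff_self eq_iff_diff_eq_0 int_decode_inverse int_encode_inverse mult.right_neutral mult_zero_right)
      moreover have "(\<lambda>j. if j = int_encode m then c j else 0) sums c (int_encode m)" by (rule sums_single)
      ultimately show ?thesis using sums_unique2 by (fastforce simp: fcoef_def c_def)
    qed
    then have "fcoef (\<lambda>x. complex_of_real (f (x, z)) - S x) m = 0" for m
      using integrable_fexp_mult[OF Sint] integrable_fexp_mult[OF fz]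
      by (simp add: fcoef_def fourier_h_eq_fcoef left_diff_distrib)
    then have "AE x in unit_ivl. complex_of_real (f (x, z)) - S x = 0"
      using fz Sint by (intro Fourier_uniqueness) auto
    then have fS: "AE x in unit_ivl. complex_of_real (f (x, z)) = S x" by simp
    have "fourier_h (\<lambda>q. f q * h q) k z = (LINT x|unit_ivl. S x * (of_real (h (x, z)) * fexp (- k) x))"
      unfolding fourier_h_eq_fcoef fcoef_def
    proof (rule integral_cong_AE)
      show "AE x in unit_ivl. complex_of_real (f (x, z) * h (x, z)) * fexp (- k) x = S x * (of_real (h (x, z)) * fexp (- k) x)"
        using fS by eventually_elim simp
      show "(\<lambda>x. complex_of_real (f (x, z) * h (x, z)) * fexp (- k) x) \<in> borel_measurable unit_ivl"
      proof -
        have [measurable]: "(\<lambda>x. complex_of_real (f (x, z))) \<in> borel_measurable unit_ivl"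
          "(\<lambda>x. complex_of_real (h (x, z))) \<in> borel_measurable unit_ivl" using fz hz by auto
        show ?thesis by simp
      qed
    qed (use swap(1)[OF hz, of k] in simp)
    then show ?case using swap(2)[OF hz, of k] by (simp add: c_def fourier_h_eq_fcoef)
  qed
qed

text \<open>A long partial sum of the convolution differs from the sum over F only by terms outside
  F, each of \<open>L1\<close> norm at most \<open>mnorm f l * H\<close>. Fatou's lemma carries the
  bound over to the full product.\<close>

lemma fourier_h_mult_error:
  assumes f: "f \<in> L2" and h: "h \<in> L2" and C: "\<And>F. finite F \<Longrightarrow> (\<Sum>l\<in>F. mnorm f l) \<le> C"
    and "finite F" and tail: "\<And>F'. finite F' \<Longrightarrow> F' \<inter> F = {} \<Longrightarrow> (\<Sum>l\<in>F'. mnorm f l) \<le> \<tau>"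
    and H: "\<And>j. mnorm h j \<le> H"
  shows "(LINT z|unit_ivl. norm (fourier_h (\<lambda>q. f q * h q) k z - (\<Sum>l\<in>F. fourier_h f l z * fourier_h h (k - l) z))) \<le> \<tau> * H"
proof -
  define t where "t l z = fourier_h f l z * fourier_h h (k - l) z" for l z
  define X where "X z = fourier_h (\<lambda>q. f q * h q) k z - (\<Sum>l\<in>F. t l z)" for z
  define D where "D N z = (\<Sum>j<N. t (int_decode j) z) - (\<Sum>l\<in>F. t l z)" for N z
  have ti: "integrable unit_ivl (t l)" "(LINT z|unit_ivl. norm (t l z)) \<le> mnorm f l * H" for l
  proof -
    note s = sq_int_mult_integrable[OF fourier_h_sq_int[OF f] fourier_h_sq_int[OF h], of l "k - l"]
    show "integrable unit_ivl (t l)" using s(1) by (simp add: t_def[abs_def])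
    have "(LINT z|unit_ivl. norm (t l z)) \<le> mnorm f l * mnorm h (k - l)" using s(2) by (simp add: t_def mnorm_def)
    also have "\<dots> \<le> mnorm f l * H" by (intro mult_left_mono H) simp
    finally show "(LINT z|unit_ivl. norm (t l z)) \<le> mnorm f l * H" .
  qed
  have Xi: "integrable unit_ivl X"
    unfolding X_def[abs_def]
    using fourier_h_integrable(1)[OF L2_mult_integrable(1)[OF f h]] ti(1) by auto
  have Di: "integrable unit_ivl (D N)" for N unfolding D_def[abs_def] using ti(1) by auto
  have H0: "0 \<le> H" using order_trans[OF mnorm_nonneg H] .
  have \<tau>0: "0 \<le> \<tau>" using tail[of "{}"] by simp
  \<comment> \<open>From N0 on, the enumeration of the integers has exhausted F, so that D is a sum
    over modes disjoint from F.\<close>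
  obtain N0 where N0: "F \<subseteq> int_decode ` {..<N0}"
  proof -
    have "finite (int_encode ` F)" using \<open>finite F\<close> by simp
    then obtain N0 where "int_encode ` F \<subseteq> {..<N0}" by (meson finite_nat_iff_bounded)
    then have "F \<subseteq> int_decode ` {..<N0}" by (force simp: image_iff)
    then show thesis using that by blast
  qed
  have Dle: "(LINT z|unit_ivl. norm (D N z)) \<le> \<tau> * H" if "N \<ge> N0" for N
  proof -
    define F' where "F' = int_decode ` {..<N} - F"
    have sub: "F \<subseteq> int_decode ` {..<N}" using N0 that by fastforce
    have "D N z = (\<Sum>l\<in>F'. t l z)" for z
    proof -
      have "(\<Sum>j<N. t (int_decode j) z) = (\<Sum>l\<in>int_decode ` {..<N}. t l z)"
        by (simp add: sum.reindex[OF inj_int_decode])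
      also have "\<dots> = (\<Sum>l\<in>F'. t l z) + (\<Sum>l\<in>F. t l z)"
        unfolding F'_def by (rule sum.subset_diff[OF sub]) simp
      finally show ?thesis by (simp add: D_def)
    qed
    then have "(LINT z|unit_ivl. norm (D N z)) \<le> (LINT z|unit_ivl. (\<Sum>l\<in>F'. norm (t l z)))"
      using ti(1) by (intro integral_mono) (auto intro: norm_sum)
    also have "\<dots> = (\<Sum>l\<in>F'. LINT z|unit_ivl. norm (t l z))"
      using ti(1) by (intro Bochner_Integration.integral_sum) auto
    also have "\<dots> \<le> (\<Sum>l\<in>F'. mnorm f l * H)" by (intro sum_mono ti(2))
    also have "\<dots> = (\<Sum>l\<in>F'. mnorm f l) * H" by (simp add: sum_distrib_right)
    also have "\<dots> \<le> \<tau> * H" by (intro mult_right_mono tail H0) (auto simp: F'_def)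
    finally show ?thesis .
  qed
  have "AE z in unit_ivl. (\<lambda>j. fourier_h f (int_decode j) z * fourier_h h (k - int_decode j) z) sums
      fourier_h (\<lambda>q. f q * h q) k z"
    by (rule fourier_h_mult_AE[OF f h]) (rule C)
  then have lim: "AE z in unit_ivl. (\<lambda>N. D N z) \<longlonglongrightarrow> X z"
    by eventually_elim (auto simp: D_def X_def t_def sums_def intro!: tendsto_intros)
  have "ennreal (LINT z|unit_ivl. norm (X z)) = (\<integral>\<^sup>+z. ennreal (norm (X z)) \<partial>unit_ivl)"
    using Xi by (intro nn_integral_eq_integral[symmetric]) auto
  also have "\<dots> = (\<integral>\<^sup>+z. liminf (\<lambda>N. ennreal (norm (D N z))) \<partial>unit_ivl)"
  proof (rule nn_integral_cong_AE)
    show "AE z in unit_ivl. ennreal (norm (X z)) = liminf (\<lambda>N. ennreal (norm (D N z)))"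
      using lim
    proof eventually_elim
      case (elim z)
      then have "(\<lambda>N. ennreal (norm (D N z))) \<longlonglongrightarrow> ennreal (norm (X z))" by (intro tendsto_intros tendsto_ennrealI)
      then show ?case using lim_imp_Liminf by force
    qed
  qed
  also have "\<dots> \<le> liminf (\<lambda>N. \<integral>\<^sup>+z. ennreal (norm (D N z)) \<partial>unit_ivl)"
    using Di by (intro nn_integral_liminf) (auto dest: borel_measurable_integrable)
  also have "\<dots> \<le> liminf (\<lambda>N::nat. ennreal (\<tau> * H))"
  proof (rule Liminf_mono, rule eventually_sequentiallyI[of N0])
    fix N assume "N0 \<le> N"
    have "(\<integral>\<^sup>+z. ennreal (norm (D N z)) \<partial>unit_ivl) = ennreal (LINT z|unit_ivl. norm (D N z))"
      using Di by (intro nn_integral_eq_integral) auto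
    also have "\<dots> \<le> ennreal (\<tau> * H)" using Dle[OF \<open>N0 \<le> N\<close>] by (rule ennreal_leI)
    finally show "(\<integral>\<^sup>+z. ennreal (norm (D N z)) \<partial>unit_ivl) \<le> ennreal (\<tau> * H)" .
  qed
  also have "\<dots> = ennreal (\<tau> * H)" by (simp add: Liminf_const)
  finally show ?thesis using H0 \<tau>0 by (simp add: X_def t_def)
qed

subsection \<open>Weighted sequences\<close>

definition jb :: "int \<Rightarrow> real" where
  "jb k = 1 + \<bar>real_of_int k\<bar>"

lemma jb_ge_1: "1 \<le> jb k" and jb_pos [simp]: "0 < jb k" and jb_nonzero [simp]: "jb k \<noteq> 0"
  by (auto simp: jb_def)

text \<open>An upper bound for the sum of \<open>jb k powr - \<gamma>\<close> over |k| \<ge> n. The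
  factor 2 accounts for k and -k, at the price of counting k = 0 twice.\<close>

definition jb_tail :: "real \<Rightarrow> nat \<Rightarrow> real" where
  "jb_tail \<gamma> n = 2 * (\<Sum>i. real (i + n + 1) powr - \<gamma>)"

lemma summable_jb: "1 < \<gamma> \<Longrightarrow> summable (\<lambda>i. real (i + n + 1) powr - \<gamma>)"
  using summable_ignore_initial_segment[of "\<lambda>i. real i powr - \<gamma>" "n + 1"]
  by (simp add: summable_real_powr_iff add.assoc)

lemma jb_tail_tendsto: "1 < \<gamma> \<Longrightarrow> jb_tail \<gamma> \<longlonglongrightarrow> 0"
proof -
  assume "1 < \<gamma>"
  from suminf_exist_split2[OF summable_jb[OF this, of 0]]
  have "(\<lambda>n. 2 * (\<Sum>i. real (i + n + 1) powr - \<gamma>)) \<longlonglongrightarrow> 2 * 0"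
    by (intro tendsto_mult tendsto_const) (simp add: add.assoc)
  then show ?thesis by (simp add: jb_tail_def[abs_def])
qed

lemma sum_nat_abs_le:
  fixes g :: "nat \<Rightarrow> real"
  assumes "finite F" "\<And>j. 0 \<le> g j"
  shows "(\<Sum>k\<in>F. g (nat \<bar>k\<bar>)) \<le> 2 * (\<Sum>j\<in>(\<lambda>k. nat \<bar>k\<bar>) ` F. g j)"
proof -
  let ?J = "(\<lambda>k. nat \<bar>k\<bar>) ` F"
  have part: "(\<Sum>k\<in>F'. g (nat \<bar>k\<bar>)) \<le> (\<Sum>j\<in>?J. g j)" if "F' \<subseteq> F" "inj_on (\<lambda>k. nat \<bar>k\<bar>) F'" for F'
  proof -
    have "(\<Sum>k\<in>F'. g (nat \<bar>k\<bar>)) = (\<Sum>j\<in>(\<lambda>k. nat \<bar>k\<bar>) ` F'. g j)" by (simp add: sum.reindex[OF that(2)])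
    also have "\<dots> \<le> (\<Sum>j\<in>?J. g j)" using that assms by (intro sum_mono2) auto
    finally show ?thesis .
  qed
  have "(\<Sum>k\<in>F. g (nat \<bar>k\<bar>)) = (\<Sum>k\<in>{k\<in>F. 0 \<le> k}. g (nat \<bar>k\<bar>)) + (\<Sum>k\<in>{k\<in>F. k < 0}. g (nat \<bar>k\<bar>))"
    using assms(1) by (subst sum.union_disjoint[symmetric]) (auto intro!: sum.cong)
  also have "\<dots> \<le> (\<Sum>j\<in>?J. g j) + (\<Sum>j\<in>?J. g j)"
    by (intro add_mono part) (auto simp: inj_on_def)
  finally show ?thesis by simp
qed

lemma sum_jb_le:
  assumes "1 < \<gamma>" "finite F" "\<And>k. k \<in> F \<Longrightarrow> int n \<le> \<bar>k\<bar>"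
  shows "(\<Sum>k\<in>F. jb k powr - \<gamma>) \<le> jb_tail \<gamma> n"
proof -
  let ?J = "(\<lambda>k. nat \<bar>k\<bar>) ` F" and ?g = "\<lambda>j. real (j + 1) powr - \<gamma>"
  have "(\<Sum>k\<in>F. jb k powr - \<gamma>) = (\<Sum>k\<in>F. ?g (nat \<bar>k\<bar>))"
    by (intro sum.cong refl) (auto simp: jb_def add.commute)
  also have "\<dots> \<le> 2 * (\<Sum>j\<in>?J. ?g j)" by (rule sum_nat_abs_le) (use assms in auto)
  also have "(\<Sum>j\<in>?J. ?g j) = (\<Sum>i\<in>(\<lambda>j. j - n) ` ?J. ?g (i + n))"
  proof -
    have nj: "n \<le> j" if "j \<in> ?J" for j using assms(3) that by force
    then have inj: "inj_on (\<lambda>j. j - n) ?J" by (rule inj_on_diff_nat)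
    have "?g (j - n + n) = ?g j" if "j \<in> ?J" for j using nj[OF that] by simp
    then show ?thesis unfolding sum.reindex[OF inj] by (intro sum.cong) auto
  qed
  also have "2 * \<dots> \<le> jb_tail \<gamma> n"
  proof -
    have "(\<Sum>i\<in>(\<lambda>j. j - n) ` ?J. ?g (i + n)) \<le> (\<Sum>i. real (i + n + 1) powr - \<gamma>)"
      using assms by (intro sum_le_suminf summable_jb) auto
    then show ?thesis by (simp add: jb_tail_def)
  qed
  finally show ?thesis by simp
qed

text \<open>Cauchy-Schwarz with the weights \<open>jb k powr (- \<gamma> / 2)\<close> and
  \<open>jb k powr (\<gamma> / 2)\<close>. For \<gamma> > 1 this is the embedding of a Sobolev space
  of order \<gamma> / 2 into the absolutely convergent Fourier series.\<close>

lemma sum_le_weighted: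
  assumes "finite F" "\<And>k. 0 \<le> x k"
    and "(\<Sum>k\<in>F. jb k powr - \<gamma>) \<le> A" "(\<Sum>k\<in>F. jb k powr \<gamma> * (x k)\<^sup>2) \<le> B"
  shows "(\<Sum>k\<in>F. x k) \<le> sqrt (A * B)"
proof -
  have sq: "(jb k powr (c / 2))\<^sup>2 = jb k powr c" for k c
    by (simp add: power2_eq_square flip: powr_add)
  have one: "jb k powr (- \<gamma> / 2) * (jb k powr (\<gamma> / 2) * x k) = x k" for k
    by (simp flip: powr_add mult.assoc)
  have "(\<Sum>k\<in>F. x k)\<^sup>2 = (\<Sum>k\<in>F. jb k powr (- \<gamma> / 2) * (jb k powr (\<gamma> / 2) * x k))\<^sup>2"
    unfolding one ..
  also have "\<dots> \<le> (\<Sum>k\<in>F. (jb k powr (- \<gamma> / 2))\<^sup>2) * (\<Sum>k\<in>F. (jb k powr (\<gamma> / 2) * x k)\<^sup>2)"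
    by (rule Cauchy_Schwarz_ineq_sum)
  also have "\<dots> \<le> A * B"
    unfolding sq power_mult_distrib using assms(3,4)
    by (intro mult_mono) (auto intro!: sum_nonneg intro: order_trans[OF sum_nonneg assms(3)])
  finally show ?thesis by (rule real_le_rsqrt)
qed

lemma jb_powr_interpolate:
  assumes "\<gamma> < \<alpha>" "0 < \<gamma>" "0 < \<eta>"
  obtains R where "0 \<le> R" "\<And>k. jb k powr \<gamma> \<le> \<eta> * jb k powr \<alpha> + R"
proof -
  \<comment> \<open>The threshold beyond which
    \<open>\<eta> * jb k powr (\<alpha> - \<gamma>)\<close> is at least 1; below it the left-hand
    side is bounded by \<open>r powr \<gamma>\<close>.\<close>
  define r where "r = (1 / \<eta>) powr (1 / (\<alpha> - \<gamma>))"
  have "jb k powr \<gamma> \<le> \<eta> * jb k powr \<alpha> + r powr \<gamma>" for k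
  proof (cases "r \<le> jb k")
    case True
    have "1 / \<eta> = r powr (\<alpha> - \<gamma>)" using assms by (simp add: r_def powr_powr)
    also have "\<dots> \<le> jb k powr (\<alpha> - \<gamma>)" using True assms by (intro powr_mono2) (auto simp: r_def)
    finally have "1 \<le> \<eta> * jb k powr (\<alpha> - \<gamma>)" using assms by (simp add: field_simps)
    then have "jb k powr \<gamma> * 1 \<le> jb k powr \<gamma> * (\<eta> * jb k powr (\<alpha> - \<gamma>))" by (intro mult_left_mono) auto
    also have "\<dots> = \<eta> * (jb k powr \<gamma> * jb k powr (\<alpha> - \<gamma>))" by simp
    also have "\<dots> = \<eta> * jb k powr \<alpha>" by (simp flip: powr_add)
    also have "\<dots> \<le> \<eta> * jb k powr \<alpha> + r powr \<gamma>" by simp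
    finally show ?thesis by simp
  next
    case False
    then have "jb k powr \<gamma> \<le> r powr \<gamma>" using assms less_imp_le[OF jb_pos] by (intro powr_mono2) auto
    moreover have "0 \<le> \<eta> * jb k powr \<alpha>" using assms by simp
    ultimately show ?thesis by linarith
  qed
  then show thesis by (intro that[of "r powr \<gamma>"]) auto
qed

text \<open>All terms are nonnegative, so P can be enlarged to a rectangle. Any two of i, j and i +
  j are independent variables, because a translation of a finite set of integers is again a finite
  set.\<close>

lemma sum_pairs_le:
  fixes u w :: "int \<Rightarrow> real"
  assumes "finite P" "\<And>i. 0 \<le> u i" "\<And>i. 0 \<le> w i"
    and U: "\<And>F. finite F \<Longrightarrow> (\<Sum>i\<in>F. u i) \<le> U" and W: "\<And>F. finite F \<Longrightarrow> (\<Sum>i\<in>F. w i) \<le> W"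
  shows "(\<Sum>(i, j)\<in>P. u i * w (i + j)) \<le> U * W"
    and "(\<Sum>(i, j)\<in>P. u j * w (i + j)) \<le> U * W"
    and "(\<Sum>(i, j)\<in>P. u i * w j) \<le> U * W"
proof -
  define A B where "A = fst ` P" "B = snd ` P"
  have AB: "finite A" "finite B" "P \<subseteq> A \<times> B" using assms(1) by (force simp: A_B_def)+
  have U0: "0 \<le> U" using U[of "{}"] by simp
  have main: "(\<Sum>(i, j)\<in>P. u i * v i j) \<le> U * W"
    if "\<And>i j. 0 \<le> v i j" "\<And>i. (\<Sum>j\<in>B. v i j) \<le> W" for v
  proof -
    have "(\<Sum>(i, j)\<in>P. u i * v i j) \<le> (\<Sum>(i, j)\<in>A \<times> B. u i * v i j)"
      using AB assms that by (intro sum_mono2) auto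
    also have "\<dots> = (\<Sum>i\<in>A. u i * (\<Sum>j\<in>B. v i j))"
      by (simp add: sum.cartesian_product[symmetric] sum_distrib_left)
    also have "\<dots> \<le> (\<Sum>i\<in>A. u i * W)" using assms that by (intro sum_mono mult_left_mono) auto
    also have "\<dots> = (\<Sum>i\<in>A. u i) * W" by (simp add: sum_distrib_right)
    also have "\<dots> \<le> U * W" using U[OF AB(1)] W[of "{}"] by (intro mult_right_mono) auto
    finally show ?thesis .
  qed
  have shift: "(\<Sum>j\<in>F. w (i + j)) \<le> W" if "finite F" for i F
    using W[of "(\<lambda>j. i + j) ` F"] that by (simp add: sum.reindex)
  show "(\<Sum>(i, j)\<in>P. u i * w (i + j)) \<le> U * W" using main shift AB assms by simp
  show "(\<Sum>(i, j)\<in>P. u i * w j) \<le> U * W" using main[of "\<lambda>i j. w j"] W AB assms by simp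
  have "(\<Sum>(i, j)\<in>P. u j * w (i + j)) \<le> (\<Sum>(i, j)\<in>A \<times> B. u j * w (i + j))"
    using AB assms by (intro sum_mono2) auto
  also have "\<dots> = (\<Sum>i\<in>A. \<Sum>j\<in>B. u j * w (j + i))" by (simp add: sum.cartesian_product add.commute)
  also have "\<dots> = (\<Sum>j\<in>B. u j * (\<Sum>i\<in>A. w (j + i)))" by (subst sum.swap) (simp add: sum_distrib_left)
  also have "\<dots> \<le> (\<Sum>j\<in>B. u j * W)" using assms shift AB by (intro sum_mono mult_left_mono) auto
  also have "\<dots> = (\<Sum>j\<in>B. u j) * W" by (simp add: sum_distrib_right)
  also have "\<dots> \<le> U * W" using U[OF AB(2)] W[of "{}"] by (intro mult_right_mono) auto
  finally show "(\<Sum>(i, j)\<in>P. u j * w (i + j)) \<le> U * W" .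
qed

text \<open>Two of the three sequences are square summable and the third is summable. Giving a
  square root of the summable one to each of the others and applying Cauchy-Schwarz reduces the
  claim to \<open>sum_pairs_le\<close>.\<close>

lemma Young_convolution:
  fixes x y z :: "int \<Rightarrow> real"
  assumes "finite P" "\<And>i. 0 \<le> x i" "\<And>i. 0 \<le> y i" "\<And>i. 0 \<le> z i"
    and X: "\<And>F. finite F \<Longrightarrow> (\<Sum>i\<in>F. (x i)\<^sup>2) \<le> X"
  shows "\<lbrakk>\<And>F. finite F \<Longrightarrow> (\<Sum>i\<in>F. (y i)\<^sup>2) \<le> Y; \<And>F. finite F \<Longrightarrow> (\<Sum>i\<in>F. z i) \<le> Z\<rbrakk> \<Longrightarrow>
      (\<Sum>(i, j)\<in>P. x i * y j * z (i + j)) \<le> sqrt X * sqrt Y * Z"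
    and "\<lbrakk>\<And>F. finite F \<Longrightarrow> (\<Sum>i\<in>F. y i) \<le> Y; \<And>F. finite F \<Longrightarrow> (\<Sum>i\<in>F. (z i)\<^sup>2) \<le> Z\<rbrakk> \<Longrightarrow>
      (\<Sum>(i, j)\<in>P. x i * y j * z (i + j)) \<le> sqrt X * Y * sqrt Z"
proof -
  have X0: "0 \<le> X" using X[of "{}"] by simp
  show "(\<Sum>(i, j)\<in>P. x i * y j * z (i + j)) \<le> sqrt X * sqrt Y * Z"
    if Y: "\<And>F. finite F \<Longrightarrow> (\<Sum>i\<in>F. (y i)\<^sup>2) \<le> Y" and Z: "\<And>F. finite F \<Longrightarrow> (\<Sum>i\<in>F. z i) \<le> Z"
  proof -
    have Y0: "0 \<le> Y" "0 \<le> Z" using Y[of "{}"] Z[of "{}"] by auto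
    have "(\<Sum>(i, j)\<in>P. x i * y j * z (i + j))\<^sup>2 =
        (\<Sum>p\<in>P. (x (fst p) * sqrt (z (fst p + snd p))) * (y (snd p) * sqrt (z (fst p + snd p))))\<^sup>2"
      using assms(4) by (intro arg_cong[of _ _ "\<lambda>s. s\<^sup>2"] sum.cong) (auto simp: mult_ac)
    also have "\<dots> \<le> (\<Sum>p\<in>P. (x (fst p) * sqrt (z (fst p + snd p)))\<^sup>2) * (\<Sum>p\<in>P. (y (snd p) * sqrt (z (fst p + snd p)))\<^sup>2)"
      by (rule Cauchy_Schwarz_ineq_sum)
    also have "\<dots> = (\<Sum>(i, j)\<in>P. (x i)\<^sup>2 * z (i + j)) * (\<Sum>(i, j)\<in>P. (y j)\<^sup>2 * z (i + j))"
      using assms(4) by (simp add: power_mult_distrib case_prod_unfold)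
    also have "\<dots> \<le> (X * Z) * (Y * Z)"
      using assms X Y Z X0 Y0
      by (intro mult_mono sum_pairs_le(1,2)) (auto intro!: sum_nonneg)
    finally have "(\<Sum>(i, j)\<in>P. x i * y j * z (i + j)) \<le> sqrt ((X * Z) * (Y * Z))" by (rule real_le_rsqrt)
    also have "\<dots> = sqrt X * sqrt Y * Z" using Y0 by (simp add: real_sqrt_mult)
    finally show ?thesis .
  qed
  show "(\<Sum>(i, j)\<in>P. x i * y j * z (i + j)) \<le> sqrt X * Y * sqrt Z"
    if Y: "\<And>F. finite F \<Longrightarrow> (\<Sum>i\<in>F. y i) \<le> Y" and Z: "\<And>F. finite F \<Longrightarrow> (\<Sum>i\<in>F. (z i)\<^sup>2) \<le> Z"
  proof -
    have Y0: "0 \<le> Y" "0 \<le> Z" using Y[of "{}"] Z[of "{}"] by auto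
    have "(\<Sum>(i, j)\<in>P. x i * y j * z (i + j))\<^sup>2 =
        (\<Sum>p\<in>P. (x (fst p) * sqrt (y (snd p))) * (z (fst p + snd p) * sqrt (y (snd p))))\<^sup>2"
      using assms(3) by (intro arg_cong[of _ _ "\<lambda>s. s\<^sup>2"] sum.cong) (auto simp: mult_ac)
    also have "\<dots> \<le> (\<Sum>p\<in>P. (x (fst p) * sqrt (y (snd p)))\<^sup>2) * (\<Sum>p\<in>P. (z (fst p + snd p) * sqrt (y (snd p)))\<^sup>2)"
      by (rule Cauchy_Schwarz_ineq_sum)
    also have "\<dots> = (\<Sum>(i, j)\<in>P. (x i)\<^sup>2 * y j) * (\<Sum>(i, j)\<in>P. y j * (z (i + j))\<^sup>2)"
      using assms(3) by (simp add: power_mult_distrib case_prod_unfold mult.commute)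
    also have "\<dots> \<le> (X * Y) * (Y * Z)"
      using assms X Y Z X0 Y0
      by (intro mult_mono sum_pairs_le(2,3)) (auto intro!: sum_nonneg)
    finally have "(\<Sum>(i, j)\<in>P. x i * y j * z (i + j)) \<le> sqrt ((X * Y) * (Y * Z))" by (rule real_le_rsqrt)
    also have "\<dots> = sqrt X * Y * sqrt Z" using Y0 by (simp add: real_sqrt_mult)
    finally show ?thesis .
  qed
qed

text \<open>One horizontal derivative is split as \<open>\<alpha> / 2\<close>, which the dissipation absorbs, plus
  \<open>1 - \<alpha> / 2 < 1 / 2\<close>, which is moved to one of the other two factors.\<close>

lemma trilinear_estimate:
  assumes "1 < \<alpha>" "\<alpha> < 2" "0 \<le> K" "0 < \<epsilon>"
  shows "\<exists>C\<ge>0. \<forall>b e E Y P. finite P \<longrightarrow> (\<forall>k. 0 \<le> b k) \<longrightarrow> (\<forall>k. 0 \<le> e k) \<longrightarrow>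
    (\<forall>F. finite F \<longrightarrow> (\<Sum>k\<in>F. jb k powr \<alpha> * (b k)\<^sup>2) \<le> K) \<longrightarrow>
    (\<forall>F. finite F \<longrightarrow> (\<Sum>k\<in>F. jb k powr \<alpha> * (e k)\<^sup>2) \<le> E) \<longrightarrow>
    (\<forall>F. finite F \<longrightarrow> (\<Sum>k\<in>F. (e k)\<^sup>2) \<le> Y) \<longrightarrow>
    (\<Sum>(i, j)\<in>P. \<bar>real_of_int i\<bar> * e i * e j * b (i + j)) \<le> \<epsilon> * E + C * Y"
proof -
  \<comment> \<open>\<gamma> lies strictly between 1, which makes e summable in the second Young
    bound, and \<alpha>, which permits interpolation with a small factor. The inequality 2 s \<le>
    \<gamma> is equivalent to \<alpha> \<ge> 1.\<close>
  define \<gamma> s where "\<gamma> = (1 + \<alpha>) / 2" "s = 1 - \<alpha> / 2"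
  have \<gamma>: "1 < \<gamma>" "\<gamma> < \<alpha>" and s: "0 < s" "s < 1" "2 * s \<le> \<gamma>" "2 * s \<le> \<alpha>" "\<alpha> / 2 + s = 1"
    using assms by (auto simp: \<gamma>_s_def)
  \<comment> \<open>The combined constant of the two Young bounds, in front of
    \<open>sqrt E * sqrt I\<close>.\<close>
  define M where "M = 2 * (sqrt (jb_tail \<alpha> 0 * K) + sqrt (jb_tail \<gamma> 0) * sqrt K)"
  \<comment> \<open>Chosen so that M^2 / (2 \<epsilon>) times \<eta> is at most \<epsilon> / 2; the
    summand 1 keeps the denominator positive when M = 0.\<close>
  define \<eta> where "\<eta> = \<epsilon>\<^sup>2 / (M\<^sup>2 + 1)"
  have "0 < \<eta>" using assms by (simp add: \<eta>_def sum_power2_gt_zero_iff add_nonneg_pos)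
  obtain R where R: "0 \<le> R" "\<And>k. jb k powr \<gamma> \<le> \<eta> * jb k powr \<alpha> + R"
    using jb_powr_interpolate[of \<gamma> \<alpha> \<eta>] \<gamma> \<open>0 < \<eta>\<close> by auto
  define C where "C = M\<^sup>2 / (2 * \<epsilon>) * R"
  show ?thesis
  proof (intro exI[of _ C] conjI allI impI)
    show "0 \<le> C" using R assms by (simp add: C_def)
    fix b e :: "int \<Rightarrow> real" and E Y :: real and P :: "(int \<times> int) set"
    assume P: "finite P" and b0: "\<forall>k. 0 \<le> b k" and e0: "\<forall>k. 0 \<le> e k"
      and b: "\<forall>F. finite F \<longrightarrow> (\<Sum>k\<in>F. jb k powr \<alpha> * (b k)\<^sup>2) \<le> K"
      and e: "\<forall>F. finite F \<longrightarrow> (\<Sum>k\<in>F. jb k powr \<alpha> * (e k)\<^sup>2) \<le> E"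
      and y: "\<forall>F. finite F \<longrightarrow> (\<Sum>k\<in>F. (e k)\<^sup>2) \<le> Y"
    have E0: "0 \<le> E" "0 \<le> Y" using e[rule_format, of "{}"] y[rule_format, of "{}"] by auto
    define I where "I = \<eta> * E + R * Y"
    have I0: "0 \<le> I" using E0 R \<open>0 < \<eta>\<close> by (simp add: I_def)
    have I: "(\<Sum>k\<in>F. jb k powr \<gamma> * (e k)\<^sup>2) \<le> I" if "finite F" for F
    proof -
      have "(\<Sum>k\<in>F. jb k powr \<gamma> * (e k)\<^sup>2) \<le> (\<Sum>k\<in>F. (\<eta> * jb k powr \<alpha> + R) * (e k)\<^sup>2)"
        by (intro sum_mono mult_right_mono R) auto
      also have "\<dots> = \<eta> * (\<Sum>k\<in>F. jb k powr \<alpha> * (e k)\<^sup>2) + R * (\<Sum>k\<in>F. (e k)\<^sup>2)"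
        by (simp add: distrib_right sum.distrib sum_distrib_left mult.assoc)
      also have "\<dots> \<le> I" unfolding I_def using e y that \<open>0 < \<eta>\<close> R
        by (intro add_mono mult_left_mono) auto
      finally show ?thesis .
    qed
    have sq: "(jb k powr c)\<^sup>2 = jb k powr (2 * c)" for k c
      by (simp add: power2_eq_square flip: powr_add)
    have X: "(\<Sum>i\<in>F. (jb i powr (\<alpha> / 2) * e i)\<^sup>2) \<le> E" if "finite F" for F
      using e that by (simp add: power_mult_distrib sq)
    have es: "(\<Sum>i\<in>F. (jb i powr s * e i)\<^sup>2) \<le> I" if "finite F" for F
    proof -
      have "(\<Sum>i\<in>F. (jb i powr s * e i)\<^sup>2) \<le> (\<Sum>k\<in>F. jb k powr \<gamma> * (e k)\<^sup>2)"
        unfolding power_mult_distrib sq using s jb_ge_1 by (intro sum_mono mult_right_mono powr_mono) auto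
      with I[OF that] show ?thesis by simp
    qed
    have bs: "(\<Sum>i\<in>F. (jb i powr s * b i)\<^sup>2) \<le> K" if "finite F" for F
    proof -
      have "(\<Sum>i\<in>F. (jb i powr s * b i)\<^sup>2) \<le> (\<Sum>k\<in>F. jb k powr \<alpha> * (b k)\<^sup>2)"
        unfolding power_mult_distrib sq using s jb_ge_1 by (intro sum_mono mult_right_mono powr_mono) auto
      with b that show ?thesis by (meson order_trans)
    qed
    have b1: "(\<Sum>i\<in>F. b i) \<le> sqrt (jb_tail \<alpha> 0 * K)" if "finite F" for F
      using that b b0 assms by (intro sum_le_weighted[where \<gamma> = \<alpha>] sum_jb_le) auto
    have e1: "(\<Sum>i\<in>F. e i) \<le> sqrt (jb_tail \<gamma> 0 * I)" if "finite F" for F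
      using that I e0 \<gamma> by (intro sum_le_weighted[where \<gamma> = \<gamma>] sum_jb_le) auto
    have trm: "\<bar>real_of_int i\<bar> * e i * e j * b (i + j) \<le>
        2 * (jb i powr (\<alpha> / 2) * e i * (jb j powr s * e j) * b (i + j)) +
        2 * (jb i powr (\<alpha> / 2) * e i * e j * (jb (i + j) powr s * b (i + j)))" for i j
    proof -
      \<comment> \<open>The frequencies i, j and i + j obey the triangle inequality, so one of the
        other two is comparable to i and can take over the power s.\<close>
      have "\<bar>real_of_int i\<bar> \<le> \<bar>real_of_int j\<bar> + \<bar>real_of_int (i + j)\<bar>" by simp
      then have "jb i \<le> 2 * max (jb j) (jb (i + j))" unfolding jb_def max_def by (simp; linarith)
      then have "jb i powr s \<le> (2 * max (jb j) (jb (i + j))) powr s"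
        using s less_imp_le[OF jb_pos] by (intro powr_mono2) auto
      also have "\<dots> = 2 powr s * max (jb j) (jb (i + j)) powr s"
        by (rule powr_mult)
      also have "\<dots> \<le> 2 powr 1 * (jb j powr s + jb (i + j) powr s)"
        using s by (intro mult_mono powr_mono) (auto simp: max_def)
      finally have js: "jb i powr s \<le> 2 * (jb j powr s + jb (i + j) powr s)" by simp
      have "\<bar>real_of_int i\<bar> \<le> jb i" by (simp add: jb_def)
      also have "jb i = jb i powr (\<alpha> / 2) * jb i powr s"
        using s(5) less_imp_le[OF jb_pos[of i]] by (simp flip: powr_add)
      also have "\<dots> \<le> jb i powr (\<alpha> / 2) * (2 * (jb j powr s + jb (i + j) powr s))"
        by (intro mult_left_mono js) auto
      finally have "\<bar>real_of_int i\<bar> * (e i * e j * b (i + j)) \<le>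
          jb i powr (\<alpha> / 2) * (2 * (jb j powr s + jb (i + j) powr s)) * (e i * e j * b (i + j))"
        using b0 e0 by (intro mult_right_mono) auto
      then show ?thesis by (simp add: algebra_simps)
    qed
    have "(\<Sum>(i, j)\<in>P. \<bar>real_of_int i\<bar> * e i * e j * b (i + j)) \<le>
        (\<Sum>(i, j)\<in>P. 2 * (jb i powr (\<alpha> / 2) * e i * (jb j powr s * e j) * b (i + j)) +
          2 * (jb i powr (\<alpha> / 2) * e i * e j * (jb (i + j) powr s * b (i + j))))"
      by (rule sum_mono) (use trm in auto)
    also have "\<dots> = 2 * (\<Sum>(i, j)\<in>P. jb i powr (\<alpha> / 2) * e i * (jb j powr s * e j) * b (i + j)) +
        2 * (\<Sum>(i, j)\<in>P. jb i powr (\<alpha> / 2) * e i * e j * (jb (i + j) powr s * b (i + j)))"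
      by (simp add: case_prod_unfold sum.distrib sum_distrib_left)
    also have "\<dots> \<le> 2 * (sqrt E * sqrt I * sqrt (jb_tail \<alpha> 0 * K)) + 2 * (sqrt E * sqrt (jb_tail \<gamma> 0 * I) * sqrt K)"
      using P b0 e0 X es bs b1 e1
      by (intro add_mono mult_left_mono Young_convolution[where x = "\<lambda>i. jb i powr (\<alpha> / 2) * e i"]) auto
    also have "\<dots> = M * (sqrt E * sqrt I)" by (simp add: M_def real_sqrt_mult algebra_simps)
    also have "\<dots> \<le> \<epsilon> / 2 * E + M\<^sup>2 / (2 * \<epsilon>) * I"
    proof -
      have "2 * (\<epsilon> * sqrt E) * (M * sqrt I) \<le> (\<epsilon> * sqrt E)\<^sup>2 + (M * sqrt I)\<^sup>2" by (rule sum_squares_bound)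
      then have "2 * \<epsilon> * (M * (sqrt E * sqrt I)) \<le> \<epsilon>\<^sup>2 * E + M\<^sup>2 * I"
        using E0 I0 by (simp add: power_mult_distrib mult_ac)
      also have "\<dots> = 2 * \<epsilon> * (\<epsilon> / 2 * E + M\<^sup>2 / (2 * \<epsilon>) * I)" using assms by (simp add: field_simps power2_eq_square)
      finally show ?thesis using assms by simp
    qed
    also have "\<dots> \<le> \<epsilon> * E + C * Y"
    proof -
      have "M\<^sup>2 / (2 * \<epsilon>) * \<eta> \<le> \<epsilon> / 2"
      proof -
        have "M\<^sup>2 / (2 * \<epsilon>) * \<eta> = M\<^sup>2 / (M\<^sup>2 + 1) * (\<epsilon> / 2)"
          using assms by (simp add: \<eta>_def power2_eq_square mult_ac)
        also have "\<dots> \<le> 1 * (\<epsilon> / 2)"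
          using assms by (intro mult_right_mono) (auto simp: divide_le_eq add_nonneg_pos)
        finally show ?thesis by simp
      qed
      then have "M\<^sup>2 / (2 * \<epsilon>) * \<eta> * E \<le> \<epsilon> / 2 * E" using E0 by (intro mult_right_mono) auto
      moreover have "\<epsilon> / 2 * E + r * (\<eta> * E + R * Y) \<le> \<epsilon> * E + r * R * Y" if "r * \<eta> * E \<le> \<epsilon> / 2 * E" for r
        using that by (simp add: algebra_simps)
      ultimately show ?thesis unfolding I_def C_def by blast
    qed
    finally show "(\<Sum>(i, j)\<in>P. \<bar>real_of_int i\<bar> * e i * e j * b (i + j)) \<le> \<epsilon> * E + C * Y" .
  qed
qed

subsection \<open>Absolutely continuous functions on the unit interval\<close>

text \<open>The indefinite Lebesgue integral from 0. Writing it over the whole interval with an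
  indicator makes linearity and Fubini available without changing the domain.\<close>

definition prim0 :: "(real \<Rightarrow> complex) \<Rightarrow> real \<Rightarrow> complex" where
  "prim0 f z = (LINT y|unit_ivl. indicator {0..z} y *\<^sub>R f y)"

lemma measurable_unit_indicator [measurable]:
  "A \<in> sets borel \<Longrightarrow> indicat_real A \<in> borel_measurable unit_ivl"
  by (rule measurable_unit_ivl_borel) simp

lemma AE_unit_ivl_neq: "AE y in unit_ivl. y \<noteq> c"
  using AE_lborel_singleton[of c] unfolding unit_ivl_def
  by (simp add: AE_restrict_space_iff) (auto elim: eventually_mono)

lemma prim0_integrable:
  fixes f :: "real \<Rightarrow> complex"
  assumes "integrable unit_ivl f" "A \<in> sets borel"
  shows "integrable unit_ivl (\<lambda>y. indicator A y *\<^sub>R f y)"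
proof (rule Bochner_Integration.integrable_bound[OF assms(1)])
  have [measurable]: "f \<in> borel_measurable unit_ivl" using assms by simp
  show "(\<lambda>y. indicator A y *\<^sub>R f y) \<in> borel_measurable unit_ivl" using assms(2) by measurable
qed (auto simp: indicator_def)

lemma prim0_0: "prim0 f 0 = 0"
proof -
  have "AE y in unit_ivl. indicator {0..0} y *\<^sub>R f y = 0"
    using AE_unit_ivl_neq[of 0] by eventually_elim simp
  then show ?thesis unfolding prim0_def by (rule integral_eq_zero_AE)
qed

lemma prim0_1: "prim0 f 1 = integral\<^sup>L unit_ivl f"
  unfolding prim0_def by (intro Bochner_Integration.integral_cong) (auto simp: indicator_def)

lemma prim0_add:
  assumes "integrable unit_ivl f" "integrable unit_ivl g"
  shows "prim0 (\<lambda>y. f y + g y) z = prim0 f z + prim0 g z"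
  unfolding prim0_def using prim0_integrable[OF assms(1), of "{0..z}"] prim0_integrable[OF assms(2), of "{0..z}"]
  by (simp add: scaleR_add_right)

lemma prim0_scale: "prim0 (\<lambda>y. c * f y) z = c * prim0 f z"
  unfolding prim0_def by (simp flip: mult_scaleR_right)

lemma prim0_continuous:
  assumes "integrable unit_ivl f"
  shows "continuous_on {0..1} (prim0 f)"
proof -
  have f: "set_integrable lborel {0..1} f" using assms by (simp add: unit_ivl_eq integrable_ivl)
  have "prim0 f z = integral {0..z} f" if "z \<in> {0..1}" for z
  proof -
    have "set_integrable lborel {0..z} f" by (rule set_integrable_subset[OF f]) (use that in auto)
    then have "(LINT y:{0..z}|lborel. f y) = integral {0..z} f" by (rule set_borel_integral_eq_integral)
    moreover have "prim0 f z = (LINT y:{0..z}|lborel. f y)"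
      unfolding prim0_def unit_ivl_eq integral_ivl set_lebesgue_integral_def
      using that by (intro Bochner_Integration.integral_cong) (auto simp: indicator_def)
    ultimately show ?thesis by simp
  qed
  moreover have "continuous_on {0..1} (\<lambda>z. integral {0..z} f)"
    by (intro indefinite_integral_continuous_1 set_borel_integral_eq_integral(1) f)
  ultimately show ?thesis by (metis (no_types, lifting) continuous_on_eq)
qed

lemma norm_prim0_le:
  assumes "integrable unit_ivl f"
  shows "norm (prim0 f z - prim0 f y) \<le> (LINT z|unit_ivl. norm (f z))"
    and "norm (prim0 f z) \<le> (LINT z|unit_ivl. norm (f z))"
proof -
  have le: "norm (LINT x|unit_ivl. (indicator A x - indicator B x) *\<^sub>R f x) \<le> (LINT z|unit_ivl. norm (f z))"
    if "A \<in> sets borel" "B \<in> sets borel" for A B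
  proof -
    have int: "integrable unit_ivl (\<lambda>x. (indicator A x - indicator B x) *\<^sub>R f x)"
      using prim0_integrable[OF assms that(1)] prim0_integrable[OF assms that(2)]
      by (simp add: scaleR_diff_left)
    have "norm (LINT x|unit_ivl. (indicator A x - indicator B x) *\<^sub>R f x)
        \<le> (LINT x|unit_ivl. norm ((indicator A x - indicator B x) *\<^sub>R f x))"
      by (rule integral_norm_bound)
    also have "\<dots> \<le> (LINT z|unit_ivl. norm (f z))"
      using assms integrable_norm[OF int] by (intro integral_mono) (auto simp: indicator_def)
    finally show ?thesis .
  qed
  have "prim0 f z - prim0 f y = (LINT x|unit_ivl. (indicator {0..z} x - indicator {0..y} x) *\<^sub>R f x)"
    unfolding prim0_def using prim0_integrable[OF assms] by (simp add: scaleR_diff_left)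
  then show "norm (prim0 f z - prim0 f y) \<le> (LINT z|unit_ivl. norm (f z))" using le by simp
  show "norm (prim0 f z) \<le> (LINT z|unit_ivl. norm (f z))"
    using le[of "{0..z}" "{}"] by (simp add: prim0_def)
qed

lemma measurable_unit_continuous:
  fixes f :: "real \<Rightarrow> 'a::topological_space"
  shows "continuous_on {0..1} f \<Longrightarrow> f \<in> borel_measurable unit_ivl"
  unfolding unit_ivl_eq by (rule measurable_ivl_continuous)

lemma integrable_mult_continuous:
  fixes f g :: "real \<Rightarrow> complex"
  assumes "integrable unit_ivl f" "continuous_on {0..1} g"
  shows "integrable unit_ivl (\<lambda>x. f x * g x)"
proof -
  obtain B where B: "\<And>x. x \<in> {0..1} \<Longrightarrow> norm (g x) \<le> B"
    using compact_imp_bounded[OF compact_continuous_image[OF assms(2)]] by (metis bounded_iff compact_Icc imageI)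
  have [measurable]: "f \<in> borel_measurable unit_ivl" "g \<in> borel_measurable unit_ivl"
    using assms measurable_unit_continuous by auto
  show ?thesis
  proof (rule Bochner_Integration.integrable_bound[of _ "\<lambda>x. B *\<^sub>R f x"])
    show "AE x in unit_ivl. norm (f x * g x) \<le> norm (B *\<^sub>R f x)"
      using order_trans[OF B abs_ge_self]
      by (intro AE_I2) (auto simp: norm_mult mult.commute[of "cmod (f _)"] intro!: mult_right_mono)
  qed (use assms in auto)
qed

text \<open>Fubini on the square [0, z] x [0, z], cut along the diagonal. No differentiability is
  involved, so that f and g may be merely integrable.\<close>

lemma prim0_mult:
  assumes f: "integrable unit_ivl f" and g: "integrable unit_ivl g"
  shows "prim0 f z * prim0 g z = prim0 (\<lambda>y. f y * prim0 g y + prim0 f y * g y) z"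
proof -
  define F where "F x = indicator {0..z} x *\<^sub>R f x" for x
  define G where "G x = indicator {0..z} x *\<^sub>R g x" for x
  have FG: "integrable unit_ivl F" "integrable unit_ivl G"
    unfolding F_def[abs_def] G_def[abs_def] by (auto intro!: prim0_integrable f g)
  then have [measurable]: "F \<in> borel_measurable unit_ivl" "G \<in> borel_measurable unit_ivl" by auto
  have [measurable]: "(\<lambda>q. F (fst q)) \<in> borel_measurable Omega" "(\<lambda>q. G (snd q)) \<in> borel_measurable Omega"
    by (auto intro!: measurable_Omega_fst measurable_Omega_snd)
  \<comment> \<open>The triangle y \<le> x integrates to the term with
    \<open>f x * prim0 g x\<close>, its complement to the one with \<open>prim0 f y * g y\<close>.
    The diagonal belongs to A and is negligible on either side.\<close>
  define A where "A = {q \<in> space Omega. snd q \<le> fst q}"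
  have fst_m: "fst \<in> borel_measurable Omega" and snd_m: "snd \<in> borel_measurable Omega"
    using measurable_Omega_fst[OF measurable_unit_ivl_borel[OF measurable_ident]]
      measurable_Omega_snd[OF measurable_unit_ivl_borel[OF measurable_ident]] by simp_all
  have A[measurable]: "A \<in> sets Omega" unfolding A_def
    by (rule borel_measurable_le[OF snd_m fst_m])
  have int: "integrable Omega (\<lambda>q. F (fst q) * G (snd q))"
  proof -
    have "(\<lambda>q. F (fst q) * G (snd q)) \<in> borel_measurable Omega" by measurable
    then show ?thesis unfolding Omega_def
      using FG by (intro UU.Fubini_integrable) (auto simp: norm_mult)
  qed
  have intA: "integrable Omega (\<lambda>q. indicator A q *\<^sub>R (F (fst q) * G (snd q)))"
    "integrable Omega (\<lambda>q. indicator (space Omega - A) q *\<^sub>R (F (fst q) * G (snd q)))"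
    by (rule integrable_mult_indicator[OF A int], rule integrable_mult_indicator[OF sets.compl_sets[OF A] int])
  have split: "(LINT q|Omega. F (fst q) * G (snd q)) =
      (LINT q|Omega. indicator A q *\<^sub>R (F (fst q) * G (snd q))) +
      (LINT q|Omega. indicator (space Omega - A) q *\<^sub>R (F (fst q) * G (snd q)))"
    by (subst Bochner_Integration.integral_add[OF intA, symmetric])
       (auto intro!: Bochner_Integration.integral_cong simp: indicator_def)
  have total: "(LINT q|Omega. F (fst q) * G (snd q)) = prim0 f z * prim0 g z"
  proof -
    have "prim0 f z = integral\<^sup>L unit_ivl F" "prim0 g z = integral\<^sup>L unit_ivl G"
      by (simp_all add: prim0_def F_def[abs_def] G_def[abs_def])
    then show ?thesis using integrable_Omega_fst(3)[OF int] by simp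
  qed
  have lower: "(LINT q|Omega. indicator A q *\<^sub>R (F (fst q) * G (snd q))) =
      (LINT x|unit_ivl. indicator {0..z} x *\<^sub>R (f x * prim0 g x))"
    unfolding integrable_Omega_fst(3)[OF intA(1), symmetric]
  proof (rule Bochner_Integration.integral_cong[OF refl])
    fix x assume x: "x \<in> space unit_ivl"
    have "(LINT y|unit_ivl. indicator A (x, y) *\<^sub>R (F (fst (x, y)) * G (snd (x, y)))) =
        (LINT y|unit_ivl. F x * (indicator {0..x} y *\<^sub>R g y))"
      using x by (intro Bochner_Integration.integral_cong) (auto simp: A_def F_def G_def indicator_def)
    also have "\<dots> = F x * (LINT y|unit_ivl. indicator {0..x} y *\<^sub>R g y)" by (rule integral_mult_right_zero)
    finally show "(LINT y|unit_ivl. indicator A (x, y) *\<^sub>R (F (fst (x, y)) * G (snd (x, y)))) =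
        indicator {0..z} x *\<^sub>R (f x * prim0 g x)"
      by (simp add: F_def prim0_def)
  qed
  have upper: "(LINT q|Omega. indicator (space Omega - A) q *\<^sub>R (F (fst q) * G (snd q))) =
      (LINT y|unit_ivl. indicator {0..z} y *\<^sub>R (prim0 f y * g y))"
    unfolding integrable_Omega_snd(3)[OF intA(2), symmetric]
  proof (rule Bochner_Integration.integral_cong[OF refl])
    fix y assume y: "y \<in> space unit_ivl"
    have "(LINT x|unit_ivl. indicator (space Omega - A) (x, y) *\<^sub>R (F (fst (x, y)) * G (snd (x, y)))) =
        (LINT x|unit_ivl. G y * (indicator {0..<y} x *\<^sub>R f x))"
      using y by (intro Bochner_Integration.integral_cong) (auto simp: A_def F_def G_def indicator_def)
    also have "\<dots> = G y * (LINT x|unit_ivl. indicator {0..<y} x *\<^sub>R f x)" by (rule integral_mult_right_zero)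
    also have "(LINT x|unit_ivl. indicator {0..<y} x *\<^sub>R f x) = prim0 f y"
      unfolding prim0_def
    proof (rule integral_cong_AE)
      show "AE x in unit_ivl. indicator {0..<y} x *\<^sub>R f x = indicator {0..y} x *\<^sub>R f x"
        using AE_unit_ivl_neq[of y] by eventually_elim (auto simp: indicator_def)
    qed (use prim0_integrable[OF f] in auto)
    finally show "(LINT x|unit_ivl. indicator (space Omega - A) (x, y) *\<^sub>R (F (fst (x, y)) * G (snd (x, y)))) =
        indicator {0..z} y *\<^sub>R (prim0 f y * g y)"
      by (simp add: G_def mult.commute)
  qed
  have i1: "integrable unit_ivl (\<lambda>y. f y * prim0 g y)"
    by (rule integrable_mult_continuous[OF f prim0_continuous[OF g]])
  have i2: "integrable unit_ivl (\<lambda>y. prim0 f y * g y)"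
    using integrable_mult_continuous[OF g prim0_continuous[OF f]] by (simp add: mult.commute)
  show ?thesis
    unfolding total[symmetric] split lower upper using prim0_add[OF i1 i2, of z] by (simp add: prim0_def)
qed

text \<open>Absolute continuity on [0, 1] in integrated form with an explicit density, which
  replaces almost everywhere differentiation.\<close>

definition AC :: "(real \<Rightarrow> complex) \<Rightarrow> (real \<Rightarrow> complex) \<Rightarrow> bool" where
  "AC F f \<longleftrightarrow> integrable unit_ivl f \<and> (\<forall>z\<in>{0..1}. F z = F 0 + prim0 f z)"

lemma AC_prim0: "integrable unit_ivl f \<Longrightarrow> AC (prim0 f) f"
  unfolding AC_def by (simp add: prim0_0)

lemma ACD: "AC F f \<Longrightarrow> integrable unit_ivl f" "AC F f \<Longrightarrow> z \<in> {0..1} \<Longrightarrow> F z = F 0 + prim0 f z"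
  unfolding AC_def by blast+

lemma ACI: "integrable unit_ivl f \<Longrightarrow> (\<And>z. z \<in> {0..1} \<Longrightarrow> F z = F 0 + prim0 f z) \<Longrightarrow> AC F f"
  unfolding AC_def by blast

lemma AC_continuous: "AC F f \<Longrightarrow> continuous_on {0..1} F"
proof -
  assume F: "AC F f"
  have "continuous_on {0..1} (\<lambda>z. F 0 + prim0 f z)"
    by (intro continuous_intros prim0_continuous ACD(1)[OF F])
  then show ?thesis by (rule continuous_on_eq) (rule ACD(2)[OF F, symmetric])
qed

lemma AC_integral: "AC F f \<Longrightarrow> integral\<^sup>L unit_ivl f = F 1 - F 0"
  using ACD(2)[of F f 1] by (simp add: prim0_1)

lemma AC_scale:
  assumes "AC F f" shows "AC (\<lambda>z. c * F z) (\<lambda>z. c * f z)"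
proof (rule ACI)
  fix z :: real assume "z \<in> {0..1}"
  from ACD(2)[OF assms this] show "c * F z = c * F 0 + prim0 (\<lambda>z. c * f z) z"
    unfolding prim0_scale by (metis distrib_left)
qed (use ACD(1)[OF assms] in simp)

lemma AC_mult:
  assumes "AC F f" "AC G g"
  shows "AC (\<lambda>z. F z * G z) (\<lambda>z. f z * G z + F z * g z)"
  unfolding AC_def
proof (intro conjI ballI)
  have f: "integrable unit_ivl f" and g: "integrable unit_ivl g" using assms ACD(1) by auto
  have F: "F z = F 0 + prim0 f z" and G: "G z = G 0 + prim0 g z" if "z \<in> {0..1}" for z
    using assms that ACD(2) by blast+
  note i1 = integrable_mult_continuous[OF f AC_continuous[OF assms(2)]]
  have i2: "integrable unit_ivl (\<lambda>y. F y * g y)"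
    using integrable_mult_continuous[OF g AC_continuous[OF assms(1)]] by (simp add: mult.commute)
  show "integrable unit_ivl (\<lambda>z. f z * G z + F z * g z)" using i1 i2 by simp
  fix z :: real assume z: "z \<in> {0..1}"
  have j1: "integrable unit_ivl (\<lambda>y. f y * prim0 g y)"
    by (rule integrable_mult_continuous[OF f prim0_continuous[OF g]])
  have j2: "integrable unit_ivl (\<lambda>y. prim0 f y * g y)"
    using integrable_mult_continuous[OF g prim0_continuous[OF f]] by (simp add: mult.commute)
  have "prim0 (\<lambda>z. f z * G z + F z * g z) z =
      prim0 (\<lambda>y. (G 0 * f y + F 0 * g y) + (f y * prim0 g y + prim0 f y * g y)) z"
  proof -
    have "f y * G y + F y * g y = (G 0 * f y + F 0 * g y) + (f y * prim0 g y + prim0 f y * g y)" if "y \<in> {0..1}" for y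
    proof -
      have "f y * G y + F y * g y = f y * (G 0 + prim0 g y) + (F 0 + prim0 f y) * g y"
        using F[OF that] G[OF that] by metis
      then show ?thesis by (simp add: algebra_simps)
    qed
    then show ?thesis unfolding prim0_def by (intro Bochner_Integration.integral_cong) auto
  qed
  also have "\<dots> = prim0 (\<lambda>y. G 0 * f y + F 0 * g y) z + prim0 (\<lambda>y. f y * prim0 g y + prim0 f y * g y) z"
    using f g j1 j2 by (intro prim0_add) auto
  also have "\<dots> = G 0 * prim0 f z + F 0 * prim0 g z + prim0 f z * prim0 g z"
    using f g by (simp add: prim0_add prim0_scale prim0_mult[OF f g])
  finally have *: "prim0 (\<lambda>z. f z * G z + F z * g z) z = G 0 * prim0 f z + F 0 * prim0 g z + prim0 f z * prim0 g z" .
  show "F z * G z = F 0 * G 0 + prim0 (\<lambda>z. f z * G z + F z * g z) z"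
  proof -
    have "F z * G z = (F 0 + prim0 f z) * (G 0 + prim0 g z)" using F[OF z] G[OF z] by metis
    then show ?thesis unfolding * by (simp add: algebra_simps)
  qed
qed

lemma AC_of_real:
  assumes "\<And>x. (f has_real_derivative f' x) (at x)" "continuous_on UNIV f'"
  shows "AC (\<lambda>z. complex_of_real (f z)) (\<lambda>z. of_real (f' z))"
proof -
  have c: "continuous_on {0..1} (\<lambda>z. complex_of_real (f' z))"
    using continuous_on_subset[OF assms(2)] by (intro continuous_intros) auto
  have int: "integrable unit_ivl (\<lambda>z. complex_of_real (f' z))"
    unfolding unit_ivl_eq by (rule integrable_ivl_continuous[OF c])
  have "complex_of_real (f z) = of_real (f 0) + prim0 (\<lambda>z. of_real (f' z)) z" if "z \<in> {0..1}" for z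
  proof -
    have fz: "(f' has_integral (f z - f 0)) {0..z}"
      using that assms(1) by (intro fundamental_theorem_of_calculus)
        (auto simp: has_real_derivative_iff_has_vector_derivative[symmetric] intro: has_field_derivative_at_within)
    have "prim0 (\<lambda>z. of_real (f' z)) z = (LINT y:{0..z}|lborel. complex_of_real (f' y))"
      unfolding prim0_def unit_ivl_eq integral_ivl set_lebesgue_integral_def
      using that by (intro Bochner_Integration.integral_cong) (auto simp: indicator_def)
    also have "\<dots> = of_real (LINT y:{0..z}|lborel. f' y)" by (rule set_integral_complex_of_real)
    also have "(LINT y:{0..z}|lborel. f' y) = integral\<^sup>L (ivl 0 z) f'" by (simp add: integral_ivl)
    also have "integral\<^sup>L (ivl 0 z) f' = integral {0..z} f'"
      by (rule integral_ivl_continuous(1)[OF continuous_on_subset[OF assms(2)]]) simp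
    also have "\<dots> = f z - f 0" using fz by (rule integral_unique)
    finally show ?thesis by simp
  qed
  then show ?thesis using int by (intro ACI)
qed

text \<open>The primitive of mean zero. It recovers a velocity mode from the corresponding vorticity
  mode, because the velocity has vanishing vertical mean.\<close>

definition mprim :: "(real \<Rightarrow> complex) \<Rightarrow> real \<Rightarrow> complex" where
  "mprim f z = prim0 f z - (LINT y|unit_ivl. prim0 f y)"

lemma integrable_unit_continuous:
  fixes f :: "real \<Rightarrow> 'a::{banach,second_countable_topology}"
  shows "continuous_on {0..1} f \<Longrightarrow> integrable unit_ivl f"
  unfolding unit_ivl_eq by (rule integrable_ivl_continuous)

lemma AC_mprim: "integrable unit_ivl f \<Longrightarrow> AC (mprim f) f"
  by (rule ACI) (simp_all add: mprim_def prim0_0)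

lemma mprim_mean: "integrable unit_ivl f \<Longrightarrow> (LINT z|unit_ivl. mprim f z) = 0"
  using integrable_unit_continuous[OF prim0_continuous] by (simp add: mprim_def)

lemma mprim_continuous: "integrable unit_ivl f \<Longrightarrow> continuous_on {0..1} (mprim f)"
  by (rule AC_continuous[OF AC_mprim])

lemma mprim_diff:
  assumes "integrable unit_ivl f" "integrable unit_ivl g"
  shows "mprim (\<lambda>y. f y - g y) z = mprim f z - mprim g z"
proof -
  have "prim0 (\<lambda>y. f y - g y) z = prim0 f z - prim0 g z" for z
    using prim0_add[of f "\<lambda>y. (-1) * g y" z] prim0_scale[of "-1" g z] assms by simp
  then show ?thesis
    using integrable_unit_continuous[OF prim0_continuous[OF assms(1)]]
      integrable_unit_continuous[OF prim0_continuous[OF assms(2)]] by (simp add: mprim_def)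
qed

text \<open>The value at z is the average over y of the increments
  \<open>prim0 f z - prim0 f y\<close>, each of which is bounded by the \<open>L1\<close> norm of
  f.\<close>

lemma norm_mprim_le:
  assumes "sq_int f"
  shows "norm (mprim f z) \<le> nrm f"
proof -
  have f: "integrable unit_ivl f" using sq_int_integrable[OF assms] by simp
  have c: "integrable unit_ivl (prim0 f)" by (rule integrable_unit_continuous[OF prim0_continuous[OF f]])
  have "mprim f z = (LINT y|unit_ivl. prim0 f z - prim0 f y)" using c by (simp add: mprim_def)
  also have "norm \<dots> \<le> (LINT y|unit_ivl. norm (prim0 f z - prim0 f y))" by (rule integral_norm_bound)
  also have "\<dots> \<le> (LINT y|unit_ivl. (LINT z|unit_ivl. norm (f z)))"
    using c by (intro integral_mono norm_prim0_le f) auto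
  also have "\<dots> \<le> nrm f" using sq_int_integrable(2)[OF assms] by simp
  finally show ?thesis .
qed

subsection \<open>Modes of weak derivatives\<close>

lemma sq_int_continuous:
  assumes "continuous_on {0..1} g" shows "sq_int g"
proof -
  obtain B where B: "\<And>x. x \<in> {0..1} \<Longrightarrow> norm (g x) \<le> B"
    using compact_imp_bounded[OF compact_continuous_image[OF assms]] by (metis bounded_iff compact_Icc imageI)
  show ?thesis by (rule sq_int_bounded(1)[OF measurable_unit_continuous[OF assms] B])
qed

lemma cos_2pi_int_periodic: "cos (2 * pi * of_int k * (x + 1)) = cos (2 * pi * of_int k * x)"
  and sin_2pi_int_periodic: "sin (2 * pi * of_int k * (x + 1)) = sin (2 * pi * of_int k * x)"
proof -
  have "2 * pi * of_int k * (x + 1) = 2 * pi * of_int k * x + 2 * pi * of_int k"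
    by (simp add: algebra_simps)
  then have "cis (2 * pi * of_int k * (x + 1)) = cis (2 * pi * of_int k * x) * cis (2 * pi * of_int k)"
    by (simp only: cis_mult)
  also have "cis (2 * pi * of_int k) = 1" by (rule cis_multiple_2pi) simp
  finally have "cis (2 * pi * of_int k * (x + 1)) = cis (2 * pi * of_int k * x)" by simp
  then show "cos (2 * pi * of_int k * (x + 1)) = cos (2 * pi * of_int k * x)"
    "sin (2 * pi * of_int k * (x + 1)) = sin (2 * pi * of_int k * x)" by (auto simp: complex_eq_iff)
qed

lemma smooth_cos: "smooth (\<lambda>x::real. cos (c * x))" and smooth_sin: "smooth (\<lambda>x::real. sin (c * x))"
  using smooth_sin_cos[of 0 c 1] smooth_sin_cos[of 1 c 0] by auto

text \<open>The weak formulations admit only real test functions, so a complex mode has to be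
  assembled from a cosine test and a sine test.\<close>

lemma fourier_h_pairing_real:
  fixes g :: "real \<Rightarrow> real"
  assumes f: "integrable Omega f" and [measurable]: "g \<in> borel_measurable unit_ivl"
    and B: "\<And>z. z \<in> {0..1} \<Longrightarrow> \<bar>g z\<bar> \<le> B"
  shows "(LINT z|unit_ivl. g z *\<^sub>R fourier_h f k z) =
      of_real (LINT q|Omega. f q * (\<lambda>(x, z). cos (2 * pi * of_int k * x) * g z) q)
      - \<i> * of_real (LINT q|Omega. f q * (\<lambda>(x, z). sin (2 * pi * of_int k * x) * g z) q)"
proof -
  let ?F = "\<lambda>(x, z). of_real (f (x, z)) * fexp (- k) x * complex_of_real (g z)"
  have B': "norm (complex_of_real (g z)) \<le> B" if "z \<in> {0..1}" for z using B[OF that] by simp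
  have m: "(\<lambda>z. complex_of_real (g z)) \<in> borel_measurable unit_ivl" by measurable
  note P = fourier_h_pairing[OF f m B', of k]
  have Re: "Re (?F q) = f q * (\<lambda>(x, z). cos (2 * pi * of_int k * x) * g z) q"
    and Im: "Im (?F q) = - (f q * (\<lambda>(x, z). sin (2 * pi * of_int k * x) * g z) q)" for q
    by (cases q; simp add: fexp_def)+
  have "(LINT z|unit_ivl. g z *\<^sub>R fourier_h f k z) = (LINT q|Omega. ?F q)"
    using P(2) by (simp add: scaleR_conv_of_real)
  also have "\<dots> = Complex (LINT q|Omega. Re (?F q)) (LINT q|Omega. Im (?F q))"
    using integral_Re[OF P(1)] integral_Im[OF P(1)] by (simp add: complex_eq_iff)
  also have "\<dots> = of_real (LINT q|Omega. f q * (\<lambda>(x, z). cos (2 * pi * of_int k * x) * g z) q)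
      - \<i> * of_real (LINT q|Omega. f q * (\<lambda>(x, z). sin (2 * pi * of_int k * x) * g z) q)"
    unfolding Re Im by (simp add: complex_eq_iff)
  finally show ?thesis .
qed

lemma bump_pairing_real:
  assumes "integrable Omega f" "bump 0 1 g"
  shows "(LINT z|unit_ivl. g z *\<^sub>R fourier_h f k z) =
      of_real (LINT q|Omega. f q * (\<lambda>(x, z). cos (2 * pi * of_int k * x) * g z) q)
      - \<i> * of_real (LINT q|Omega. f q * (\<lambda>(x, z). sin (2 * pi * of_int k * x) * g z) q)"
proof -
  obtain B where "\<And>x. \<bar>g x\<bar> \<le> B" using bump_bounded[OF assms(2)] by blast
  then show ?thesis
    by (intro fourier_h_pairing_real[where B = B] assms measurable_unit_continuous bump_continuous[OF assms(2)])
qed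

text \<open>For a test function cos or sin in x times a bump in z, the x-derivative exchanges the
  two trigonometric functions; this is multiplication by 2 pi i k for the mode, and the fundamental
  lemma removes the bump.\<close>

lemma weak_dx_fourier_h:
  assumes "weak_dx u v"
  shows "AE z in unit_ivl. fourier_h v k z = 2 * pi * \<i> * of_int k * fourier_h u k z"
proof -
  have u: "u \<in> L2" and v: "v \<in> L2" using assms by (auto simp: weak_dx_def)
  define c where "c = 2 * pi * of_int k"
  define g where "g z = fourier_h v k z - 2 * pi * \<i> * of_int k * fourier_h u k z" for z
  note iu = fourier_h_integrable(1)[OF L2_integrable[OF u]] and iv = fourier_h_integrable(1)[OF L2_integrable[OF v]]
  have "AE z in ivl 0 1. g z = 0"
  proof (rule fundamental_lemma_bump)
    show "integrable (ivl 0 1) g" unfolding unit_ivl_eq[symmetric] g_def[abs_def] using iu iv by simp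
    fix f assume f: "bump 0 1 f"
    obtain f' where f': "\<And>x. (f has_real_derivative f' x) (at x)" using f bump_derivE by blast
    have dcos: "((\<lambda>x. cos (c * x)) has_real_derivative - c * sin (c * x)) (at x)"
      and dsin: "((\<lambda>x. sin (c * x)) has_real_derivative c * cos (c * x)) (at x)" for x
      by (auto intro!: derivative_eq_intros)
    have "test_fun (\<lambda>(x, z). cos (c * x) * f z)" "test_fun (\<lambda>(x, z). sin (c * x) * f z)"
      unfolding c_def using f
      by (auto intro!: test_fun_tensor smooth_cos smooth_sin cos_2pi_int_periodic sin_2pi_int_periodic)
    then have "(LINT q|Omega. v q * (\<lambda>(x, z). cos (c * x) * f z) q) =
        - (LINT q|Omega. u q * (\<lambda>(x, z). - c * sin (c * x) * f z) q)"
      "(LINT q|Omega. v q * (\<lambda>(x, z). sin (c * x) * f z) q) =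
        - (LINT q|Omega. u q * (\<lambda>(x, z). c * cos (c * x) * f z) q)"
      using assms by (auto simp: weak_dx_def pderiv_dir_tensor2(1)[OF dcos f'] pderiv_dir_tensor2(1)[OF dsin f'])
    moreover have "(LINT q|Omega. u q * (\<lambda>(x, z). - c * sin (c * x) * f z) q) =
        - c * (LINT q|Omega. u q * (\<lambda>(x, z). sin (c * x) * f z) q)"
      unfolding integral_mult_right_zero[symmetric]
      by (intro Bochner_Integration.integral_cong) (auto simp: mult_ac)
    moreover have "(LINT q|Omega. u q * (\<lambda>(x, z). c * cos (c * x) * f z) q) =
        c * (LINT q|Omega. u q * (\<lambda>(x, z). cos (c * x) * f z) q)"
      unfolding integral_mult_right_zero[symmetric]
      by (intro Bochner_Integration.integral_cong) (auto simp: mult_ac)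
    ultimately have "(LINT z|unit_ivl. f z *\<^sub>R fourier_h v k z) = \<i> * c * (LINT z|unit_ivl. f z *\<^sub>R fourier_h u k z)"
      unfolding bump_pairing_real[OF L2_integrable[OF v] f] bump_pairing_real[OF L2_integrable[OF u] f] c_def[symmetric]
      by (simp add: complex_eq_iff)
    moreover have "(LINT z|unit_ivl. f z *\<^sub>R g z) =
        (LINT z|unit_ivl. f z *\<^sub>R fourier_h v k z) - \<i> * c * (LINT z|unit_ivl. f z *\<^sub>R fourier_h u k z)"
    proof -
      have "f z *\<^sub>R g z = f z *\<^sub>R fourier_h v k z - \<i> * c * (f z *\<^sub>R fourier_h u k z)" for z
        by (simp add: g_def c_def scaleR_conv_of_real algebra_simps)
      then have "(LINT z|unit_ivl. f z *\<^sub>R g z) =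
          (LINT z|unit_ivl. f z *\<^sub>R fourier_h v k z - \<i> * c * (f z *\<^sub>R fourier_h u k z))" by (simp only:)
      also have "\<dots> = (LINT z|unit_ivl. f z *\<^sub>R fourier_h v k z) - (LINT z|unit_ivl. \<i> * c * (f z *\<^sub>R fourier_h u k z))"
        using integrable_bump_mult[OF f iu[unfolded unit_ivl_eq]] integrable_bump_mult[OF f iv[unfolded unit_ivl_eq]]
        unfolding unit_ivl_eq by (intro Bochner_Integration.integral_diff integrable_mult_right)
      finally show ?thesis by (simp only: integral_mult_right_zero)
    qed
    ultimately show "(LINT x|ivl 0 1. f x *\<^sub>R g x) = 0" by (simp add: unit_ivl_eq)
  qed
  then show ?thesis unfolding unit_ivl_eq by (simp add: g_def)
qed

lemma weak_dz_pairing: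
  assumes "weak_dz u \<omega>" and f: "bump 0 1 f" "\<And>x. (f has_real_derivative f' x) (at x)" "bump 0 1 f'"
  shows "(LINT z|unit_ivl. f z *\<^sub>R fourier_h \<omega> k z) = - (LINT z|unit_ivl. f' z *\<^sub>R fourier_h u k z)"
proof -
  have u: "u \<in> L2" and w: "\<omega> \<in> L2" using assms by (auto simp: weak_dz_def)
  define c where "c = 2 * pi * of_int k"
  have dcos: "((\<lambda>x. cos (c * x)) has_real_derivative - c * sin (c * x)) (at x)"
    and dsin: "((\<lambda>x. sin (c * x)) has_real_derivative c * cos (c * x)) (at x)" for x
    by (auto intro!: derivative_eq_intros)
  have "test_fun (\<lambda>(x, z). cos (c * x) * f z)" "test_fun (\<lambda>(x, z). sin (c * x) * f z)"
    unfolding c_def using f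
    by (auto intro!: test_fun_tensor smooth_cos smooth_sin cos_2pi_int_periodic sin_2pi_int_periodic)
  then have "(LINT q|Omega. \<omega> q * (\<lambda>(x, z). cos (c * x) * f z) q) = - (LINT q|Omega. u q * (\<lambda>(x, z). cos (c * x) * f' z) q)"
    "(LINT q|Omega. \<omega> q * (\<lambda>(x, z). sin (c * x) * f z) q) = - (LINT q|Omega. u q * (\<lambda>(x, z). sin (c * x) * f' z) q)"
    using assms(1) by (auto simp: weak_dz_def pderiv_dir_tensor2(2)[OF dcos f(2)] pderiv_dir_tensor2(2)[OF dsin f(2)])
  then show ?thesis
    unfolding bump_pairing_real[OF L2_integrable[OF w] f(1)] bump_pairing_real[OF L2_integrable[OF u] f(3)] c_def[symmetric]
    by simp
qed

lemma mean_zero_fourier_h: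
  assumes "u \<in> mean_zero"
  shows "(LINT z|unit_ivl. fourier_h u k z) = 0"
proof -
  have u: "u \<in> L2" and mean: "AE x in unit_ivl. (LINT z|unit_ivl. u (x, z)) = 0"
    using assms by (auto simp: mean_zero_def)
  have one: "norm (1::complex) \<le> 1" by simp
  note P = fourier_h_pairing[OF L2_integrable[OF u] borel_measurable_const one, of k]
  have "(LINT z|unit_ivl. fourier_h u k z) = (LINT x|unit_ivl. LINT z|unit_ivl. of_real (u (x, z)) * fexp (- k) x)"
    using P(2) integrable_Omega_fst(3)[OF P(1)] by simp
  also have "\<dots> = (LINT x|unit_ivl. of_real (LINT z|unit_ivl. u (x, z)) * fexp (- k) x)" by simp
  also have "\<dots> = 0" by (rule integral_eq_zero_AE) (use mean in \<open>eventually_elim, simp\<close>)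
  finally show ?thesis .
qed

text \<open>By du Bois-Reymond the mode of u differs from a primitive of the mode of \<omega> by a
  constant, and the mean-zero condition determines that constant.\<close>

lemma weak_dz_fourier_h:
  assumes uw: "weak_dz u \<omega>" and "u \<in> mean_zero"
  shows "AE z in unit_ivl. fourier_h u k z = mprim (fourier_h \<omega> k) z"
proof -
  have u: "u \<in> L2" and w: "\<omega> \<in> L2" using uw by (auto simp: weak_dz_def)
  note iu = fourier_h_integrable(1)[OF L2_integrable[OF u], of k]
    and iw = fourier_h_integrable(1)[OF L2_integrable[OF w], of k]
  define \<Phi> where "\<Phi> = prim0 (fourier_h \<omega> k)"
  have \<Phi>: "AC \<Phi> (fourier_h \<omega> k)" unfolding \<Phi>_def by (rule AC_prim0[OF iw])
  note i\<Phi> = integrable_unit_continuous[OF AC_continuous[OF \<Phi>]]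
  have "\<exists>c. AE z in ivl 0 1. fourier_h u k z - \<Phi> z = c"
  proof (rule du_Bois_Reymond_bump)
    show "integrable (ivl 0 1) (\<lambda>z. fourier_h u k z - \<Phi> z)"
      using iu i\<Phi> by (simp add: unit_ivl_eq)
    fix f f' assume f: "bump 0 1 f" "\<And>x. (f has_real_derivative f' x) (at x)" "bump 0 1 f'"
    have "AC (\<lambda>z. complex_of_real (f z)) (\<lambda>z. of_real (f' z))"
      by (rule AC_of_real[OF f(2) bump_continuous[OF f(3)]])
    from AC_integral[OF AC_mult[OF \<Phi> this]]
    have "(LINT z|unit_ivl. fourier_h \<omega> k z * of_real (f z) + \<Phi> z * of_real (f' z)) = 0"
      using bump_eq_0[OF f(1), of 0] bump_eq_0[OF f(1), of 1] by simp
    moreover have i1: "integrable unit_ivl (\<lambda>z. f z *\<^sub>R fourier_h \<omega> k z)"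
      "integrable unit_ivl (\<lambda>z. f' z *\<^sub>R \<Phi> z)" "integrable unit_ivl (\<lambda>z. f' z *\<^sub>R fourier_h u k z)"
      using integrable_bump_mult[OF f(1)] integrable_bump_mult[OF f(3)] iw i\<Phi> iu by (auto simp: unit_ivl_eq)
    ultimately have "(LINT z|unit_ivl. f z *\<^sub>R fourier_h \<omega> k z) + (LINT z|unit_ivl. f' z *\<^sub>R \<Phi> z) = 0"
      by (subst Bochner_Integration.integral_add[symmetric]) (auto simp: scaleR_conv_of_real mult.commute)
    then have "(LINT z|unit_ivl. f' z *\<^sub>R fourier_h u k z) - (LINT z|unit_ivl. f' z *\<^sub>R \<Phi> z) = 0"
      using weak_dz_pairing[OF uw f, of k] by (simp add: add_eq_0_iff)
    then show "(LINT z|ivl 0 1. f' z *\<^sub>R (fourier_h u k z - \<Phi> z)) = 0"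
      using i1 by (simp add: unit_ivl_eq[symmetric] scaleR_diff_right)
  qed simp
  then obtain c where c: "AE z in unit_ivl. fourier_h u k z - \<Phi> z = c" unfolding unit_ivl_eq by blast
  have "(LINT z|unit_ivl. fourier_h u k z - \<Phi> z) = (LINT z|unit_ivl. c)"
    using c iu i\<Phi> by (intro integral_cong_AE) auto
  then have "c = - (LINT z|unit_ivl. \<Phi> z)"
    using mean_zero_fourier_h[OF assms(2), of k] iu i\<Phi> by simp
  with c show ?thesis by (auto simp: mprim_def \<Phi>_def algebra_simps elim!: eventually_mono)
qed

text \<open>The equation and the regularity class each supply a vorticity under their own
  existential quantifier; their modes have to be identified.\<close>

lemma weak_dz_unique:
  assumes "weak_dz u \<omega>" "weak_dz u \<omega>'"
  shows "AE z in unit_ivl. fourier_h \<omega> k z = fourier_h \<omega>' k z"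
proof -
  have w: "\<omega> \<in> L2" "\<omega>' \<in> L2" using assms by (auto simp: weak_dz_def)
  note i = fourier_h_integrable(1)[OF L2_integrable[OF w(1)], of k] fourier_h_integrable(1)[OF L2_integrable[OF w(2)], of k]
  have "AE z in ivl 0 1. fourier_h \<omega> k z - fourier_h \<omega>' k z = 0"
  proof (rule fundamental_lemma_bump)
    show "integrable (ivl 0 1) (\<lambda>z. fourier_h \<omega> k z - fourier_h \<omega>' k z)" using i by (simp add: unit_ivl_eq)
    fix f assume f: "bump 0 1 f"
    obtain f' where f': "bump 0 1 f'" "\<And>x. (f has_real_derivative f' x) (at x)" using f bump_derivE by blast
    have "(LINT z|unit_ivl. f z *\<^sub>R fourier_h \<omega> k z) = (LINT z|unit_ivl. f z *\<^sub>R fourier_h \<omega>' k z)"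
      using weak_dz_pairing[OF assms(1) f f'(2,1)] weak_dz_pairing[OF assms(2) f f'(2,1)] by simp
    then show "(LINT z|ivl 0 1. f z *\<^sub>R (fourier_h \<omega> k z - fourier_h \<omega>' k z)) = 0"
      using integrable_bump_mult[OF f i(1)[unfolded unit_ivl_eq]] integrable_bump_mult[OF f i(2)[unfolded unit_ivl_eq]]
      by (simp add: unit_ivl_eq scaleR_diff_right)
  qed
  then show ?thesis unfolding unit_ivl_eq by simp
qed

text \<open>Valid at every height z, not just almost every one, since for almost every x the
  defining relation holds at all z simultaneously. Fubini exchanges the x-integral of the mode with
  the primitive in z.\<close>

lemma incompressible_fourier_h:
  assumes inc: "incompressible v w" and v: "v \<in> L2" and z: "z \<in> {0..1}"
  shows "fourier_h w k z = - prim0 (fourier_h v k) z"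
proof -
  have w: "w \<in> L2" using inc by (simp add: incompressible_def)
  define g :: "real \<Rightarrow> complex" where "g y = of_real (indicator {0..z} y)" for y
  have g: "g \<in> borel_measurable unit_ivl" unfolding g_def by measurable
  have gb: "norm (g y) \<le> 1" for y by (simp add: g_def indicator_def)
  note P = fourier_h_pairing[OF L2_integrable[OF v] g gb, of k]
  have AEw: "AE x in unit_ivl. w (x, z) = - (LINT y:{0..z}|lborel. v (x, y))"
  proof -
    have "AE x in unit_ivl. w (x, 0) = 0 \<and> w (x, 1) = 0 \<and>
        (\<forall>z\<in>{0..1}. w (x, z) = w (x, 0) - (LINT y:{0..z}|lborel. v (x, y)))"
      using inc by (simp add: incompressible_def)
    then show ?thesis by eventually_elim (use z in auto)
  qed
  have eq: "(LINT y|unit_ivl. of_real (v (x, y)) * fexp (- k) x * g y) =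
      of_real (LINT y:{0..z}|lborel. v (x, y)) * fexp (- k) x" for x
  proof -
    have "(LINT y:{0..z}|lborel. v (x, y)) = (LINT y|unit_ivl. indicator {0..z} y * v (x, y))"
      unfolding unit_ivl_eq integral_ivl set_lebesgue_integral_def
      using z by (intro Bochner_Integration.integral_cong) (auto simp: indicator_def)
    then have "of_real (LINT y:{0..z}|lborel. v (x, y)) * fexp (- k) x =
        (LINT y|unit_ivl. complex_of_real (indicator {0..z} y * v (x, y))) * fexp (- k) x"
      by (simp only: integral_complex_of_real)
    also have "\<dots> = (LINT y|unit_ivl. complex_of_real (indicator {0..z} y * v (x, y)) * fexp (- k) x)" by simp
    finally show ?thesis by (auto simp: g_def mult_ac)
  qed
  have "prim0 (fourier_h v k) z = (LINT y|unit_ivl. g y * fourier_h v k y)"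
    by (simp add: prim0_def g_def scaleR_conv_of_real)
  also have "\<dots> = (LINT x|unit_ivl. LINT y|unit_ivl. of_real (v (x, y)) * fexp (- k) x * g y)"
    unfolding P(2) using integrable_Omega_fst(3)[OF P(1)] by simp
  also have "\<dots> = (LINT x|unit_ivl. of_real (LINT y:{0..z}|lborel. v (x, y)) * fexp (- k) x)" unfolding eq ..
  also have "\<dots> = (LINT x|unit_ivl. - (of_real (w (x, z)) * fexp (- k) x))"
  proof (rule integral_cong_AE)
    show "(\<lambda>x. complex_of_real (LINT y:{0..z}|lborel. v (x, y)) * fexp (- k) x) \<in> borel_measurable unit_ivl"
      using integrable_Omega_fst(2)[OF P(1)] unfolding prod.case eq by auto
    have [measurable]: "(\<lambda>x. w (x, z)) \<in> borel_measurable unit_ivl"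
      by (rule measurable_Omega_swap[OF L2_measurable[OF w] z])
    show "(\<lambda>x. - (complex_of_real (w (x, z)) * fexp (- k) x)) \<in> borel_measurable unit_ivl" by measurable
    show "AE x in unit_ivl. complex_of_real (LINT y:{0..z}|lborel. v (x, y)) * fexp (- k) x =
        - (complex_of_real (w (x, z)) * fexp (- k) x)"
      using AEw by eventually_elim simp
  qed
  also have "\<dots> = - fourier_h w k z" by (simp add: fourier_h_eq_fcoef fcoef_def)
  finally show ?thesis by simp
qed

lemma nrm_triangle:
  assumes "sq_int f" "sq_int g"
  shows "nrm (\<lambda>z. f z + g z) \<le> nrm f + nrm g"
proof (rule power2_le_imp_le)
  note fg = sq_int_mult_integrable[OF assms]
  have i: "integrable unit_ivl (\<lambda>z. (norm (f z))\<^sup>2)" "integrable unit_ivl (\<lambda>z. (norm (g z))\<^sup>2)"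
    "integrable unit_ivl (\<lambda>z. (norm (f z + g z))\<^sup>2)" using assms sq_int_add[OF assms] by (auto simp: sq_int_def)
  have "(nrm (\<lambda>z. f z + g z))\<^sup>2 \<le> (LINT z|unit_ivl. (norm (f z))\<^sup>2 + (norm (g z))\<^sup>2 + 2 * norm (f z * g z))"
    unfolding nrm_power2
  proof (rule integral_mono)
    show "(norm (f z + g z))\<^sup>2 \<le> (norm (f z))\<^sup>2 + (norm (g z))\<^sup>2 + 2 * norm (f z * g z)" for z
      using power_mono[OF norm_triangle_ineq[of "f z" "g z"], of 2] by (simp add: power2_sum norm_mult)
    show "integrable unit_ivl (\<lambda>z. (norm (f z))\<^sup>2 + (norm (g z))\<^sup>2 + 2 * norm (f z * g z))"
      using i(1,2) integrable_norm[OF fg(1)] by simp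
  qed (rule i(3))
  also have "\<dots> = (nrm f)\<^sup>2 + (nrm g)\<^sup>2 + 2 * (LINT z|unit_ivl. norm (f z * g z))"
    using i fg(1) by (simp add: nrm_power2)
  also have "\<dots> \<le> (nrm f + nrm g)\<^sup>2" using fg(2) by (simp add: power2_sum)
  finally show "(nrm (\<lambda>z. f z + g z))\<^sup>2 \<le> (nrm f + nrm g)\<^sup>2" .
qed simp

lemma mnorm_diff:
  assumes "f \<in> L2" "g \<in> L2"
  shows "mnorm (\<lambda>q. f q - g q) k = nrm (\<lambda>z. fourier_h f k z - fourier_h g k z)"
  unfolding mnorm_def
proof (rule nrm_cong_AE)
  show "AE z in unit_ivl. fourier_h (\<lambda>q. f q - g q) k z = fourier_h f k z - fourier_h g k z"
    by (rule fourier_h_diff[OF L2_integrable[OF assms(1)] L2_integrable[OF assms(2)]])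
qed (use assms L2_diff[OF assms] in \<open>auto intro!: borel_measurable_diff fourier_h_measurable L2_measurable\<close>)

lemma mnorm_le_diff:
  assumes "f \<in> L2" "g \<in> L2"
  shows "mnorm f k \<le> mnorm (\<lambda>q. f q - g q) k + mnorm g k"
  using nrm_triangle[OF sq_int_diff[OF fourier_h_sq_int[OF assms(1), of k] fourier_h_sq_int[OF assms(2), of k]]
      fourier_h_sq_int[OF assms(2), of k]]
  by (simp add: mnorm_diff[OF assms]) (simp add: mnorm_def)

lemma L2_norm_nonneg [simp]: "0 \<le> L2_norm f"
  by (simp add: L2_norm_def)

lemma mnorm_le_L2_norm:
  assumes "f \<in> L2" shows "mnorm f k \<le> L2_norm f"
proof (rule power2_le_imp_le)
  show "(mnorm f k)\<^sup>2 \<le> (L2_norm f)\<^sup>2" using Bessel_fourier_h(2)[OF assms, of "{k}"] by simp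
qed simp

subsection \<open>Continuity in time of the modes of a product\<close>

lemma integral_triple_le:
  assumes "sq_int f" "sq_int h" and [measurable]: "g \<in> borel_measurable unit_ivl"
    and B: "\<And>z. z \<in> {0..1} \<Longrightarrow> norm (g z) \<le> B"
  shows "integrable unit_ivl (\<lambda>z. g z * (f z * h z))" "norm (LINT z|unit_ivl. g z * (f z * h z)) \<le> B * (nrm f * nrm h)"
proof -
  note gf = sq_int_mult_bounded[OF assms(3,1) B]
  note m = sq_int_mult_integrable[OF gf(1) assms(2)]
  show "integrable unit_ivl (\<lambda>z. g z * (f z * h z))" using m(1) by (simp add: mult.assoc)
  have "norm (LINT z|unit_ivl. g z * (f z * h z)) \<le> nrm (\<lambda>z. g z * f z) * nrm h" using m(3) by (simp add: mult.assoc)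
  also have "\<dots> \<le> B * nrm f * nrm h" by (intro mult_right_mono gf(2)) auto
  finally show "norm (LINT z|unit_ivl. g z * (f z * h z)) \<le> B * (nrm f * nrm h)" by (simp add: mult.assoc)
qed

lemma norm_integral_mult_le:
  fixes f g :: "real \<Rightarrow> complex"
  assumes f: "integrable unit_ivl f" and [measurable]: "g \<in> borel_measurable unit_ivl"
    and B: "\<And>z. z \<in> {0..1} \<Longrightarrow> norm (g z) \<le> B"
  shows "integrable unit_ivl (\<lambda>z. g z * f z)" "norm (LINT z|unit_ivl. g z * f z) \<le> B * (LINT z|unit_ivl. norm (f z))"
proof -
  have [measurable]: "f \<in> borel_measurable unit_ivl" using f by simp
  have le: "norm (g z * f z) \<le> B * norm (f z)" if "z \<in> {0..1}" for z
    using B[OF that] by (simp add: norm_mult mult_right_mono)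
  have i: "integrable unit_ivl (\<lambda>z. B * norm (f z))" using f by simp
  show int: "integrable unit_ivl (\<lambda>z. g z * f z)"
    by (rule Bochner_Integration.integrable_bound[OF i])
       (use le in \<open>auto intro!: AE_I2 intro: order_trans[OF _ abs_ge_self]\<close>)
  have "norm (LINT z|unit_ivl. g z * f z) \<le> (LINT z|unit_ivl. norm (g z * f z))" by (rule integral_norm_bound)
  also have "\<dots> \<le> (LINT z|unit_ivl. B * norm (f z))"
    by (rule integral_mono[OF integrable_norm[OF int] i]) (use le in auto)
  finally show "norm (LINT z|unit_ivl. g z * f z) \<le> B * (LINT z|unit_ivl. norm (f z))" by simp
qed

text \<open>The bound depends on f and h only through \<tau> and H, so it is uniform over families
  sharing them. The index is \<open>Suc n\<close> because a frequency outside
  \<open>{- int n..int n}\<close> has modulus at least n + 1.\<close>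

lemma mode_product_error:
  fixes g :: "real \<Rightarrow> complex"
  assumes f: "f \<in> L2" and h: "h \<in> L2"
    and tail: "\<And>n F. finite F \<Longrightarrow> (\<And>k. k \<in> F \<Longrightarrow> int n \<le> \<bar>k\<bar>) \<Longrightarrow> (\<Sum>l\<in>F. mnorm f l) \<le> \<tau> n"
    and H: "\<And>j. mnorm h j \<le> H"
    and g: "g \<in> borel_measurable unit_ivl" and B: "\<And>z. z \<in> {0..1} \<Longrightarrow> norm (g z) \<le> B"
  shows "norm ((LINT z|unit_ivl. g z * fourier_h (\<lambda>q. f q * h q) k z) -
    (\<Sum>l\<in>{- int n..int n}. LINT z|unit_ivl. g z * (fourier_h f l z * fourier_h h (k - l) z))) \<le> B * (\<tau> (Suc n) * H)"
proof -
  let ?I = "LINT z|unit_ivl. g z * fourier_h (\<lambda>q. f q * h q) k z"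
  let ?t = "\<lambda>l. LINT z|unit_ivl. g z * (fourier_h f l z * fourier_h h (k - l) z)"
  let ?F = "{- int n..int n}"
  let ?r = "\<lambda>z. fourier_h (\<lambda>q. f q * h q) k z - (\<Sum>l\<in>?F. fourier_h f l z * fourier_h h (k - l) z)"
  have B0: "0 \<le> B" using order_trans[OF norm_ge_zero B[of 0]] by simp
  have e: "(LINT z|unit_ivl. norm (?r z)) \<le> \<tau> (Suc n) * H"
  proof (rule fourier_h_mult_error[OF f h])
    show "(\<Sum>l\<in>F. mnorm f l) \<le> \<tau> 0" if "finite F" for F using tail[OF that, of 0] by simp
    show "(\<Sum>l\<in>F'. mnorm f l) \<le> \<tau> (Suc n)" if "finite F'" "F' \<inter> ?F = {}" for F'
    proof (rule tail[OF that(1)])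
      fix k assume "k \<in> F'"
      with that(2) have "k \<notin> ?F" by blast
      then show "int (Suc n) \<le> \<bar>k\<bar>" by auto
    qed
  qed (use H in auto)
  have i1: "integrable unit_ivl (fourier_h (\<lambda>q. f q * h q) k)"
    by (rule fourier_h_integrable(1)[OF L2_mult_integrable(1)[OF f h]])
  have i2: "integrable unit_ivl (\<lambda>z. fourier_h f l z * fourier_h h (k - l) z)" for l
    by (rule sq_int_mult_integrable(1)[OF fourier_h_sq_int[OF f] fourier_h_sq_int[OF h]])
  have i3: "integrable unit_ivl (\<lambda>z. \<Sum>l\<in>?F. fourier_h f l z * fourier_h h (k - l) z)"
    using i2 by simp
  have P: "(\<Sum>l\<in>?F. ?t l) = (LINT z|unit_ivl. g z * (\<Sum>l\<in>?F. fourier_h f l z * fourier_h h (k - l) z))"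
    unfolding sum_distrib_left
    by (rule Bochner_Integration.integral_sum[symmetric]) (rule norm_integral_mult_le(1)[OF i2 g B])
  have eq: "?I - (\<Sum>l\<in>?F. ?t l) = (LINT z|unit_ivl. g z * ?r z)"
    unfolding P right_diff_distrib
    by (rule Bochner_Integration.integral_diff[symmetric, OF norm_integral_mult_le(1)[OF i1 g B] norm_integral_mult_le(1)[OF i3 g B]])
  have "norm (?I - (\<Sum>l\<in>?F. ?t l)) \<le> B * (LINT z|unit_ivl. norm (?r z))"
    unfolding eq by (rule norm_integral_mult_le(2)[OF Bochner_Integration.integrable_diff[OF i1 i3] g B])
  also have "\<dots> \<le> B * (\<tau> (Suc n) * H)" by (intro mult_left_mono e B0)
  finally show ?thesis .
qed

text \<open>Each truncated convolution is a finite sum of bilinear expressions in modes that are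
  continuous in time. The truncation error is uniform in t, so the full product is a uniform limit
  of continuous functions.\<close>

lemma continuous_on_mode_product:
  fixes f h :: "real \<Rightarrow> real \<times> real \<Rightarrow> real" and g :: "real \<Rightarrow> complex"
  assumes f: "\<And>t. t \<in> S \<Longrightarrow> f t \<in> L2" and h: "\<And>t. t \<in> S \<Longrightarrow> h t \<in> L2"
    and tail: "\<And>t n F. t \<in> S \<Longrightarrow> finite F \<Longrightarrow> (\<And>k. k \<in> F \<Longrightarrow> int n \<le> \<bar>k\<bar>) \<Longrightarrow> (\<Sum>l\<in>F. mnorm (f t) l) \<le> \<tau> n"
    and \<tau>: "\<tau> \<longlonglongrightarrow> 0"
    and H: "\<And>t j. t \<in> S \<Longrightarrow> mnorm (h t) j \<le> H"
    and fc: "\<And>t k. t \<in> S \<Longrightarrow> ((\<lambda>s. nrm (\<lambda>z. fourier_h (f s) k z - fourier_h (f t) k z)) \<longlongrightarrow> 0) (at t within S)"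
    and hc: "\<And>t k. t \<in> S \<Longrightarrow> ((\<lambda>s. nrm (\<lambda>z. fourier_h (h s) k z - fourier_h (h t) k z)) \<longlongrightarrow> 0) (at t within S)"
    and g: "g \<in> borel_measurable unit_ivl" and B: "\<And>z. z \<in> {0..1} \<Longrightarrow> norm (g z) \<le> B"
  shows "continuous_on S (\<lambda>t. LINT z|unit_ivl. g z * fourier_h (\<lambda>q. f t q * h t q) k z)"
proof -
  define P where "P n t = (\<Sum>l\<in>{- int n..int n}. LINT z|unit_ivl. g z * (fourier_h (f t) l z * fourier_h (h t) (k - l) z))" for n t
  have B0: "0 \<le> B" using order_trans[OF norm_ge_zero B[of 0]] by simp
  have sqf: "sq_int (fourier_h (f t) l)" and sqh: "sq_int (fourier_h (h t) l)" if "t \<in> S" for t l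
    using fourier_h_sq_int f h that by auto
  have contP: "continuous_on S (P n)" for n
    unfolding P_def[abs_def]
  proof (rule continuous_on_sum)
    fix l
    show "continuous_on S (\<lambda>t. LINT z|unit_ivl. g z * (fourier_h (f t) l z * fourier_h (h t) (k - l) z))"
      unfolding continuous_on_def
    proof
      fix t assume t: "t \<in> S"
      let ?I = "\<lambda>s. LINT z|unit_ivl. g z * (fourier_h (f s) l z * fourier_h (h s) (k - l) z)"
      let ?df = "\<lambda>s z. fourier_h (f s) l z - fourier_h (f t) l z"
      let ?dh = "\<lambda>s z. fourier_h (h s) (k - l) z - fourier_h (h t) (k - l) z"
      have "((\<lambda>s. ?I s - ?I t) \<longlongrightarrow> 0) (at t within S)"
      proof (rule Lim_null_comparison)
        show "\<forall>\<^sub>F s in at t within S. norm (?I s - ?I t) \<le> B * (nrm (?df s) * H) + B * (mnorm (f t) l * nrm (?dh s))"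
          unfolding eventually_at_filter
        proof (rule always_eventually, intro allI impI)
          fix s assume "s \<noteq> t" "s \<in> S"
          have i1: "integrable unit_ivl (\<lambda>z. g z * (?df s z * fourier_h (h s) (k - l) z))"
            "norm (LINT z|unit_ivl. g z * (?df s z * fourier_h (h s) (k - l) z)) \<le> B * (nrm (?df s) * mnorm (h s) (k - l))"
            using integral_triple_le[OF sq_int_diff[OF sqf sqf] sqh g B] \<open>s \<in> S\<close> t by (auto simp: mnorm_def)
          have i2: "integrable unit_ivl (\<lambda>z. g z * (fourier_h (f t) l z * ?dh s z))"
            "norm (LINT z|unit_ivl. g z * (fourier_h (f t) l z * ?dh s z)) \<le> B * (mnorm (f t) l * nrm (?dh s))"
            using integral_triple_le[OF sqf sq_int_diff[OF sqh sqh] g B] \<open>s \<in> S\<close> t by (auto simp: mnorm_def)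
          have i3: "integrable unit_ivl (\<lambda>z. g z * (fourier_h (f s) l z * fourier_h (h s) (k - l) z))"
            "integrable unit_ivl (\<lambda>z. g z * (fourier_h (f t) l z * fourier_h (h t) (k - l) z))"
            using integral_triple_le(1)[OF sqf sqh g B] \<open>s \<in> S\<close> t by auto
          have "?I s - ?I t = (LINT z|unit_ivl. g z * (fourier_h (f s) l z * fourier_h (h s) (k - l) z) -
              g z * (fourier_h (f t) l z * fourier_h (h t) (k - l) z))"
            by (rule Bochner_Integration.integral_diff[symmetric, OF i3])
          also have "\<dots> = (LINT z|unit_ivl. g z * (?df s z * fourier_h (h s) (k - l) z) +
              g z * (fourier_h (f t) l z * ?dh s z))"
            by (intro Bochner_Integration.integral_cong) (auto simp: algebra_simps)
          also have "\<dots> = (LINT z|unit_ivl. g z * (?df s z * fourier_h (h s) (k - l) z)) +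
              (LINT z|unit_ivl. g z * (fourier_h (f t) l z * ?dh s z))"
            by (rule Bochner_Integration.integral_add[OF i1(1) i2(1)])
          finally have eq: "?I s - ?I t = (LINT z|unit_ivl. g z * (?df s z * fourier_h (h s) (k - l) z)) +
              (LINT z|unit_ivl. g z * (fourier_h (f t) l z * ?dh s z))" .
          have "norm (?I s - ?I t) \<le> B * (nrm (?df s) * mnorm (h s) (k - l)) + B * (mnorm (f t) l * nrm (?dh s))"
            unfolding eq by (rule norm_triangle_le[OF add_mono[OF i1(2) i2(2)]])
          also have "\<dots> \<le> B * (nrm (?df s) * H) + B * (mnorm (f t) l * nrm (?dh s))"
            using B0 H[OF \<open>s \<in> S\<close>] by (intro add_right_mono mult_left_mono) auto
          finally show "norm (?I s - ?I t) \<le> B * (nrm (?df s) * H) + B * (mnorm (f t) l * nrm (?dh s))" .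
        qed
        have "((\<lambda>s. B * (nrm (?df s) * H) + B * (mnorm (f t) l * nrm (?dh s))) \<longlongrightarrow>
            B * (0 * H) + B * (mnorm (f t) l * 0)) (at t within S)"
          by (intro tendsto_intros fc hc t)
        then show "((\<lambda>s. B * (nrm (?df s) * H) + B * (mnorm (f t) l * nrm (?dh s))) \<longlongrightarrow> 0) (at t within S)" by simp
      qed
      then show "(?I \<longlongrightarrow> ?I t) (at t within S)" by (simp add: LIM_zero_iff)
    qed
  qed
  show ?thesis
  proof (rule uniform_limit_theorem[OF always_eventually uniform_limitI])
    show "\<forall>n. continuous_on S (P n)" using contP by blast
    fix e :: real assume "0 < e"
    have "(\<lambda>n. B * (\<tau> (Suc n) * H)) \<longlonglongrightarrow> B * (0 * H)"
      by (intro tendsto_intros LIMSEQ_Suc \<tau>)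
    then have "\<forall>\<^sub>F n in sequentially. B * (\<tau> (Suc n) * H) < e"
      using \<open>0 < e\<close> by (intro order_tendstoD(2)) auto
    then show "\<forall>\<^sub>F n in sequentially. \<forall>t\<in>S. dist (P n t) (LINT z|unit_ivl. g z * fourier_h (\<lambda>q. f t q * h t q) k z) < e"
    proof (eventually_elim, intro ballI)
      fix n t assume n: "B * (\<tau> (Suc n) * H) < e" and t: "t \<in> S"
      have "norm ((LINT z|unit_ivl. g z * fourier_h (\<lambda>q. f t q * h t q) k z) - P n t) \<le> B * (\<tau> (Suc n) * H)"
        unfolding P_def by (rule mode_product_error[OF f[OF t] h[OF t] tail[OF t] H[OF t] g B])
      then show "dist (P n t) (LINT z|unit_ivl. g z * fourier_h (\<lambda>q. f t q * h t q) k z) < e"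
        using n by (simp add: dist_norm norm_minus_commute)
    qed
  qed simp
qed

text \<open>What the argument uses of a solution: regularity enters only through weighted sums of the
  mode norms that are bounded uniformly in time.\<close>

locale modal_flow =
  fixes \<alpha> \<nu> T K :: real and u v w \<omega> :: "real \<Rightarrow> real \<times> real \<Rightarrow> real"
  assumes \<alpha>: "1 < \<alpha>" "\<alpha> < 2"
    and uL2: "\<And>t. t \<in> {0..T} \<Longrightarrow> u t \<in> L2" and vL2: "\<And>t. t \<in> {0..T} \<Longrightarrow> v t \<in> L2"
    and wL2: "\<And>t. t \<in> {0..T} \<Longrightarrow> w t \<in> L2" and \<omega>L2: "\<And>t. t \<in> {0..T} \<Longrightarrow> \<omega> t \<in> L2"
    and v_mode: "\<And>t k. t \<in> {0..T} \<Longrightarrow> AE z in unit_ivl. fourier_h (v t) k z = 2 * pi * \<i> * of_int k * fourier_h (u t) k z"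
    and u_mode: "\<And>t k. t \<in> {0..T} \<Longrightarrow> AE z in unit_ivl. fourier_h (u t) k z = mprim (fourier_h (\<omega> t) k) z"
    and w_mode: "\<And>t k z. t \<in> {0..T} \<Longrightarrow> z \<in> {0..1} \<Longrightarrow> fourier_h (w t) k z = - prim0 (fourier_h (v t) k) z"
    and \<omega>_bound: "\<And>t F. t \<in> {0..T} \<Longrightarrow> finite F \<Longrightarrow> (\<Sum>k\<in>F. jb k powr \<alpha> * (mnorm (\<omega> t) k)\<^sup>2) \<le> K"
    and u_bound: "\<And>t F. t \<in> {0..T} \<Longrightarrow> finite F \<Longrightarrow> (\<Sum>k\<in>F. jb k powr (2 * \<alpha>) * (mnorm (u t) k)\<^sup>2) \<le> K"
    and \<omega>_cont: "\<And>t k. t \<in> {0..T} \<Longrightarrow>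
      ((\<lambda>s. nrm (\<lambda>z. fourier_h (\<omega> s) k z - fourier_h (\<omega> t) k z)) \<longlongrightarrow> 0) (at t within {0..T})"
    and u_cont: "\<And>t k. t \<in> {0..T} \<Longrightarrow>
      ((\<lambda>s. nrm (\<lambda>z. fourier_h (u s) k z - fourier_h (u t) k z)) \<longlongrightarrow> 0) (at t within {0..T})"
begin

definition H :: real where "H = 2 * pi * sqrt K"

definition tail :: "nat \<Rightarrow> real" where "tail n = sqrt (jb_tail \<alpha> n * K)"

text \<open>The k-th mode of the momentum equation without time derivative and pressure. Leaving out
  the pressure is legitimate because N is paired only with functions of mean zero once the equation
  is used.\<close>

definition N :: "real \<Rightarrow> int \<Rightarrow> real \<Rightarrow> complex" where
  "N t k z = fourier_h (\<lambda>q. u t q * v t q + w t q * \<omega> t q) k z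
    + of_real (\<nu> * \<bar>2 * pi * of_int k\<bar> powr \<alpha>) * fourier_h (u t) k z"

lemma tail_tendsto: "tail \<longlonglongrightarrow> 0"
proof -
  have "(\<lambda>n. sqrt (jb_tail \<alpha> n * K)) \<longlonglongrightarrow> sqrt (0 * K)"
    by (intro tendsto_intros jb_tail_tendsto \<alpha>)
  then show ?thesis by (simp add: tail_def[abs_def])
qed

lemmas sq_modes = fourier_h_sq_int[OF uL2] fourier_h_sq_int[OF vL2] fourier_h_sq_int[OF wL2] fourier_h_sq_int[OF \<omega>L2]

lemmas int_modes = sq_int_integrable(1)[OF sq_modes(1)] sq_int_integrable(1)[OF sq_modes(2)]
  sq_int_integrable(1)[OF sq_modes(3)] sq_int_integrable(1)[OF sq_modes(4)]

lemma mnorm_u_le: "t \<in> {0..T} \<Longrightarrow> mnorm (u t) k \<le> mnorm (\<omega> t) k"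
proof -
  assume t: "t \<in> {0..T}"
  have c: "continuous_on {0..1} (mprim (fourier_h (\<omega> t) k))" by (rule mprim_continuous[OF int_modes(4)[OF t]])
  have "mnorm (u t) k = nrm (mprim (fourier_h (\<omega> t) k))"
    unfolding mnorm_def using u_mode[OF t] sq_int_measurable[OF sq_modes(1)[OF t]] measurable_unit_continuous[OF c]
    by (intro nrm_cong_AE) auto
  also have "\<dots> \<le> mnorm (\<omega> t) k"
    unfolding mnorm_def using norm_mprim_le[OF sq_modes(4)[OF t]] measurable_unit_continuous[OF c]
    by (intro sq_int_bounded(2)) auto
  finally show ?thesis .
qed

lemma mnorm_v: "t \<in> {0..T} \<Longrightarrow> mnorm (v t) k = 2 * pi * \<bar>of_int k\<bar> * mnorm (u t) k"
proof -
  assume t: "t \<in> {0..T}"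
  have "mnorm (v t) k = nrm (\<lambda>z. 2 * pi * \<i> * of_int k * fourier_h (u t) k z)"
    unfolding mnorm_def using v_mode[OF t] sq_int_measurable[OF sq_modes(2)[OF t]]
      sq_int_measurable[OF sq_int_scale(1)[OF sq_modes(1)[OF t]]]
    by (intro nrm_cong_AE) auto
  then show ?thesis by (simp only: sq_int_scale(2)) (simp add: norm_mult mnorm_def)
qed

text \<open>A single term of \<open>u_bound\<close> suffices: since \<alpha> > 1, the factor |k|
  from the x-derivative is dominated by \<open>jb k powr \<alpha>\<close>.\<close>

lemma mnorm_v_le: "t \<in> {0..T} \<Longrightarrow> mnorm (v t) k \<le> H"
proof -
  assume t: "t \<in> {0..T}"
  have "\<bar>real_of_int k\<bar> \<le> jb k powr \<alpha>"
  proof -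
    have "\<bar>real_of_int k\<bar> \<le> jb k powr 1" by (simp add: jb_def)
    also have "\<dots> \<le> jb k powr \<alpha>" using \<alpha> jb_ge_1 by (intro powr_mono) auto
    finally show ?thesis .
  qed
  then have "(\<bar>real_of_int k\<bar> * mnorm (u t) k)\<^sup>2 \<le> (jb k powr \<alpha> * mnorm (u t) k)\<^sup>2"
    by (intro power_mono mult_right_mono) auto
  also have "\<dots> = jb k powr (2 * \<alpha>) * (mnorm (u t) k)\<^sup>2"
    by (simp add: power_mult_distrib power2_eq_square flip: powr_add)
  also have "\<dots> \<le> K" using u_bound[OF t, of "{k}"] by simp
  finally have "\<bar>real_of_int k\<bar> * mnorm (u t) k \<le> sqrt K" by (rule real_le_rsqrt)
  then show ?thesis using mnorm_v[OF t] by (simp add: H_def mult.assoc)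
qed

lemma norm_w_le: "t \<in> {0..T} \<Longrightarrow> z \<in> {0..1} \<Longrightarrow> norm (fourier_h (w t) k z) \<le> mnorm (v t) k"
  using order_trans[OF norm_prim0_le(2)[OF int_modes(2)[of t k], of z] sq_int_integrable(2)[OF sq_modes(2)[of t k]]]
  by (simp add: w_mode mnorm_def)

lemma mnorm_w_le: "t \<in> {0..T} \<Longrightarrow> mnorm (w t) k \<le> H"
proof -
  assume t: "t \<in> {0..T}"
  have "mnorm (w t) k \<le> mnorm (v t) k" unfolding mnorm_def[of "w t"]
    using norm_w_le[OF t] sq_int_measurable[OF sq_modes(3)[OF t]] by (intro sq_int_bounded(2)) auto
  with mnorm_v_le[OF t] show ?thesis by (rule order_trans[rotated])
qed

lemma H_nonneg: "t \<in> {0..T} \<Longrightarrow> 0 \<le> H"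
  using mnorm_v_le order_trans[OF mnorm_nonneg] by blast

lemma sum_mnorm_\<omega>_le:
  assumes "t \<in> {0..T}" "finite F" "\<And>k. k \<in> F \<Longrightarrow> int n \<le> \<bar>k\<bar>"
  shows "(\<Sum>k\<in>F. mnorm (\<omega> t) k) \<le> tail n"
  unfolding tail_def using assms \<omega>_bound \<alpha> by (intro sum_le_weighted[where \<gamma> = \<alpha>] sum_jb_le) auto

lemma sum_mnorm_u_le:
  assumes "t \<in> {0..T}" "finite F" "\<And>k. k \<in> F \<Longrightarrow> int n \<le> \<bar>k\<bar>"
  shows "(\<Sum>k\<in>F. mnorm (u t) k) \<le> tail n"
  by (rule order_trans[OF sum_mono sum_mnorm_\<omega>_le]) (use assms mnorm_u_le in auto)

lemma v_cont:
  assumes t: "t \<in> {0..T}"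
  shows "((\<lambda>s. nrm (\<lambda>z. fourier_h (v s) k z - fourier_h (v t) k z)) \<longlongrightarrow> 0) (at t within {0..T})"
proof -
  define c where "c = 2 * pi * \<i> * of_int k"
  have "nrm (\<lambda>z. fourier_h (v s) k z - fourier_h (v t) k z) =
      norm c * nrm (\<lambda>z. fourier_h (u s) k z - fourier_h (u t) k z)" if s: "s \<in> {0..T}" for s
  proof -
    have "nrm (\<lambda>z. fourier_h (v s) k z - fourier_h (v t) k z) = nrm (\<lambda>z. c * (fourier_h (u s) k z - fourier_h (u t) k z))"
    proof (rule nrm_cong_AE)
      show "AE z in unit_ivl. fourier_h (v s) k z - fourier_h (v t) k z = c * (fourier_h (u s) k z - fourier_h (u t) k z)"
        using v_mode[OF s, of k] v_mode[OF t, of k] by eventually_elim (simp add: c_def right_diff_distrib)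
    qed (use sq_int_measurable[OF sq_modes(1)] sq_int_measurable[OF sq_modes(2)] s t in auto)
    then show ?thesis by (simp only: sq_int_scale(2))
  qed
  moreover have "((\<lambda>s. norm c * nrm (\<lambda>z. fourier_h (u s) k z - fourier_h (u t) k z)) \<longlongrightarrow> norm c * 0) (at t within {0..T})"
    by (intro tendsto_intros u_cont t)
  ultimately show ?thesis
    using Lim_cong_within[of t t 0 0 "{0..T}" "{0..T}" "\<lambda>s. nrm (\<lambda>z. fourier_h (v s) k z - fourier_h (v t) k z)"
        "\<lambda>s. norm c * nrm (\<lambda>z. fourier_h (u s) k z - fourier_h (u t) k z)"] by simp
qed

lemma w_cont:
  assumes t: "t \<in> {0..T}"
  shows "((\<lambda>s. nrm (\<lambda>z. fourier_h (w s) k z - fourier_h (w t) k z)) \<longlongrightarrow> 0) (at t within {0..T})"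
proof (rule tendsto_sandwich[OF _ _ tendsto_const v_cont[OF t, of k]])
  show "\<forall>\<^sub>F s in at t within {0..T}. nrm (\<lambda>z. fourier_h (w s) k z - fourier_h (w t) k z)
      \<le> nrm (\<lambda>z. fourier_h (v s) k z - fourier_h (v t) k z)"
    unfolding eventually_at_filter
  proof (rule always_eventually, intro allI impI)
    fix s assume s: "s \<in> {0..T}"
    let ?d = "\<lambda>z. fourier_h (v s) k z - fourier_h (v t) k z"
    have d: "sq_int ?d" using sq_modes(2) s t by (intro sq_int_diff) auto
    have p: "prim0 ?d z = prim0 (fourier_h (v s) k) z - prim0 (fourier_h (v t) k) z" for z
      using prim0_add[OF int_modes(2)[OF s], of "\<lambda>z. (-1) * fourier_h (v t) k z" k z]
        prim0_scale[of "-1" "fourier_h (v t) k" z] int_modes(2)[OF t, of k] by simp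
    have "norm (fourier_h (w s) k z - fourier_h (w t) k z) \<le> nrm ?d" if "z \<in> {0..1}" for z
    proof -
      have "norm (fourier_h (w s) k z - fourier_h (w t) k z) = norm (prim0 ?d z)"
        unfolding w_mode[OF s that] w_mode[OF t that] p by (simp add: norm_minus_commute)
      also have "\<dots> \<le> nrm ?d"
        by (rule order_trans[OF norm_prim0_le(2)[OF sq_int_integrable(1)[OF d], of z] sq_int_integrable(2)[OF d]])
      finally show ?thesis .
    qed
    then show "nrm (\<lambda>z. fourier_h (w s) k z - fourier_h (w t) k z) \<le> nrm ?d"
      using sq_int_measurable[OF sq_modes(3)] s t by (intro sq_int_bounded(2)) auto
  qed
qed auto

lemma uv_integrable: "t \<in> {0..T} \<Longrightarrow> integrable Omega (\<lambda>q. u t q * v t q)"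
  and w\<omega>_integrable: "t \<in> {0..T} \<Longrightarrow> integrable Omega (\<lambda>q. \<omega> t q * w t q)"
  using L2_mult_integrable(1) uL2 vL2 wL2 \<omega>L2 by auto

text \<open>The order \<open>\<omega> t q * w t q\<close> matters: the product estimates ask for
  summable modes of the first factor, which the vorticity has, while w is only controlled mode by
  mode through H.\<close>

lemma N_AE:
  assumes t: "t \<in> {0..T}"
  shows "AE z in unit_ivl. N t k z = fourier_h (\<lambda>q. u t q * v t q) k z + fourier_h (\<lambda>q. \<omega> t q * w t q) k z
    + of_real (\<nu> * \<bar>2 * pi * of_int k\<bar> powr \<alpha>) * fourier_h (u t) k z"
  using fourier_h_add[OF uv_integrable[OF t] w\<omega>_integrable[OF t], of k]
  by eventually_elim (simp add: N_def mult.commute)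

lemma N_integrable: "t \<in> {0..T} \<Longrightarrow> integrable unit_ivl (N t k)"
proof -
  assume t: "t \<in> {0..T}"
  have "integrable Omega (\<lambda>q. u t q * v t q + w t q * \<omega> t q)"
    using uv_integrable[OF t] w\<omega>_integrable[OF t] by (simp add: mult.commute)
  from fourier_h_integrable(1)[OF this] int_modes(1)[OF t]
  show ?thesis unfolding N_def[abs_def] by auto
qed

lemma N_bound:
  assumes t: "t \<in> {0..T}"
  shows "(LINT z|unit_ivl. norm (N t k z)) \<le> 2 * (tail 0 * H) + \<bar>\<nu> * \<bar>2 * pi * of_int k\<bar> powr \<alpha>\<bar> * tail 0"
proof -
  let ?c = "\<nu> * \<bar>2 * pi * of_int k\<bar> powr \<alpha>"
  \<comment> \<open>With the empty truncation set, the truncation error is the whole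
    product.\<close>
  have uv: "(LINT z|unit_ivl. norm (fourier_h (\<lambda>q. u t q * v t q) k z)) \<le> tail 0 * H"
    using fourier_h_mult_error[OF uL2[OF t] vL2[OF t], of "tail 0" "{}" "tail 0" H k]
      sum_mnorm_u_le[OF t, of _ 0] mnorm_v_le[OF t] by simp
  have ww: "(LINT z|unit_ivl. norm (fourier_h (\<lambda>q. \<omega> t q * w t q) k z)) \<le> tail 0 * H"
    using fourier_h_mult_error[OF \<omega>L2[OF t] wL2[OF t], of "tail 0" "{}" "tail 0" H k]
      sum_mnorm_\<omega>_le[OF t, of _ 0] mnorm_w_le[OF t] by simp
  have uu: "(LINT z|unit_ivl. norm (fourier_h (u t) k z)) \<le> tail 0"
    using order_trans[OF sq_int_integrable(2)[OF sq_modes(1)[OF t]], of k "tail 0"] sum_mnorm_u_le[OF t, of "{k}" 0]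
    by (simp add: mnorm_def)
  note i = fourier_h_integrable(1)[OF uv_integrable[OF t], of k] fourier_h_integrable(1)[OF w\<omega>_integrable[OF t], of k]
    int_modes(1)[OF t, of k]
  have "(LINT z|unit_ivl. norm (N t k z)) \<le> (LINT z|unit_ivl. norm (fourier_h (\<lambda>q. u t q * v t q) k z)
      + norm (fourier_h (\<lambda>q. \<omega> t q * w t q) k z) + \<bar>?c\<bar> * norm (fourier_h (u t) k z))"
  proof (rule integral_mono_AE)
    show "AE z in unit_ivl. norm (N t k z) \<le> norm (fourier_h (\<lambda>q. u t q * v t q) k z)
      + norm (fourier_h (\<lambda>q. \<omega> t q * w t q) k z) + \<bar>?c\<bar> * norm (fourier_h (u t) k z)"
      using N_AE[OF t, of k]
    proof eventually_elim
      case (elim z)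
      have "norm (a + b + of_real r * d) \<le> norm a + norm b + \<bar>r\<bar> * norm d" for a b d :: complex and r
        using norm_triangle_ineq[of "a + b" "of_real r * d"] norm_triangle_ineq[of a b] by (simp add: norm_mult)
      then show ?case unfolding elim .
    qed
  qed (use i N_integrable[OF t] in auto)
  also have "\<dots> = (LINT z|unit_ivl. norm (fourier_h (\<lambda>q. u t q * v t q) k z))
      + (LINT z|unit_ivl. norm (fourier_h (\<lambda>q. \<omega> t q * w t q) k z)) + \<bar>?c\<bar> * (LINT z|unit_ivl. norm (fourier_h (u t) k z))"
    using i by simp
  also have "\<dots> \<le> tail 0 * H + tail 0 * H + \<bar>?c\<bar> * tail 0"
    using uv ww uu by (intro add_mono mult_left_mono) auto
  finally show ?thesis by linarith
qed

lemma N_pairing_continuous: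
  assumes g: "g \<in> borel_measurable unit_ivl" and B: "\<And>z. z \<in> {0..1} \<Longrightarrow> norm (g z) \<le> B"
  shows "continuous_on {0..T} (\<lambda>t. LINT z|unit_ivl. g z * N t k z)"
    and "continuous_on {0..T} (\<lambda>t. LINT z|unit_ivl. g z * fourier_h (u t) k z)"
proof -
  have c1: "continuous_on {0..T} (\<lambda>t. LINT z|unit_ivl. g z * fourier_h (\<lambda>q. u t q * v t q) k z)"
    by (rule continuous_on_mode_product[where \<tau> = tail and H = H and B = B])
       (use uL2 vL2 sum_mnorm_u_le tail_tendsto mnorm_v_le u_cont v_cont g B in auto)
  have c2: "continuous_on {0..T} (\<lambda>t. LINT z|unit_ivl. g z * fourier_h (\<lambda>q. \<omega> t q * w t q) k z)"
    by (rule continuous_on_mode_product[where \<tau> = tail and H = H and B = B])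
       (use \<omega>L2 wL2 sum_mnorm_\<omega>_le tail_tendsto mnorm_w_le \<omega>_cont w_cont g B in auto)
  show c3: "continuous_on {0..T} (\<lambda>t. LINT z|unit_ivl. g z * fourier_h (u t) k z)"
    unfolding continuous_on_def
  proof
    fix t assume t: "t \<in> {0..T}"
    let ?I = "\<lambda>s. LINT z|unit_ivl. g z * fourier_h (u s) k z"
    let ?d = "\<lambda>s z. fourier_h (u s) k z - fourier_h (u t) k z"
    have B0: "0 \<le> B" using order_trans[OF norm_ge_zero B[of 0]] by simp
    have "((\<lambda>s. ?I s - ?I t) \<longlongrightarrow> 0) (at t within {0..T})"
    proof (rule Lim_null_comparison)
      show "\<forall>\<^sub>F s in at t within {0..T}. norm (?I s - ?I t) \<le> B * nrm (?d s)"
        unfolding eventually_at_filter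
      proof (rule always_eventually, intro allI impI)
        fix s assume s: "s \<in> {0..T}"
        have d: "sq_int (?d s)" using sq_modes(1) s t by (intro sq_int_diff) auto
        have "?I s - ?I t = (LINT z|unit_ivl. g z * ?d s z)"
          unfolding right_diff_distrib
          by (rule Bochner_Integration.integral_diff[symmetric];
              rule norm_integral_mult_le(1)[OF int_modes(1) g B]) (use s t in auto)
        then have "norm (?I s - ?I t) = norm (LINT z|unit_ivl. g z * ?d s z)" by (rule arg_cong)
        also have "\<dots> \<le> B * (LINT z|unit_ivl. norm (?d s z))"
          by (rule norm_integral_mult_le(2)[OF sq_int_integrable(1)[OF d] g B])
        also have "\<dots> \<le> B * nrm (?d s)" by (intro mult_left_mono sq_int_integrable(2) d B0)
        finally show "norm (?I s - ?I t) \<le> B * nrm (?d s)" .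
      qed
      have "((\<lambda>s. B * nrm (?d s)) \<longlongrightarrow> B * 0) (at t within {0..T})" by (intro tendsto_intros u_cont t)
      then show "((\<lambda>s. B * nrm (?d s)) \<longlongrightarrow> 0) (at t within {0..T})" by simp
    qed
    then show "(?I \<longlongrightarrow> ?I t) (at t within {0..T})" by (simp add: LIM_zero_iff)
  qed
  let ?c = "complex_of_real (\<nu> * \<bar>2 * pi * of_int k\<bar> powr \<alpha>)"
  have eq: "(LINT z|unit_ivl. g z * N t k z) = (LINT z|unit_ivl. g z * fourier_h (\<lambda>q. u t q * v t q) k z)
      + (LINT z|unit_ivl. g z * fourier_h (\<lambda>q. \<omega> t q * w t q) k z) + ?c * (LINT z|unit_ivl. g z * fourier_h (u t) k z)"
    if t: "t \<in> {0..T}" for t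
  proof -
    note i = norm_integral_mult_le(1)[OF fourier_h_integrable(1)[OF uv_integrable[OF t], of k] g B]
      norm_integral_mult_le(1)[OF fourier_h_integrable(1)[OF w\<omega>_integrable[OF t], of k] g B]
      norm_integral_mult_le(1)[OF int_modes(1)[OF t, of k] g B]
    have "(LINT z|unit_ivl. g z * N t k z) = (LINT z|unit_ivl. g z * fourier_h (\<lambda>q. u t q * v t q) k z
      + g z * fourier_h (\<lambda>q. \<omega> t q * w t q) k z + ?c * (g z * fourier_h (u t) k z))"
    proof (rule integral_cong_AE)
      show "AE z in unit_ivl. g z * N t k z = g z * fourier_h (\<lambda>q. u t q * v t q) k z
        + g z * fourier_h (\<lambda>q. \<omega> t q * w t q) k z + ?c * (g z * fourier_h (u t) k z)"
        using N_AE[OF t, of k] by eventually_elim (simp add: distrib_left mult_ac)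
      show "(\<lambda>z. g z * N t k z) \<in> borel_measurable unit_ivl"
        using norm_integral_mult_le(1)[OF N_integrable[OF t] g B] by auto
    qed (use i in \<open>auto dest: borel_measurable_integrable\<close>)
    also have "\<dots> = (LINT z|unit_ivl. g z * fourier_h (\<lambda>q. u t q * v t q) k z)
      + (LINT z|unit_ivl. g z * fourier_h (\<lambda>q. \<omega> t q * w t q) k z) + (LINT z|unit_ivl. ?c * (g z * fourier_h (u t) k z))"
      using i by (subst Bochner_Integration.integral_add; (subst Bochner_Integration.integral_add)?) auto
    finally show ?thesis by (simp only: integral_mult_right_zero)
  qed
  have cont: "continuous_on {0..T} (\<lambda>t. (LINT z|unit_ivl. g z * fourier_h (\<lambda>q. u t q * v t q) k z)
      + (LINT z|unit_ivl. g z * fourier_h (\<lambda>q. \<omega> t q * w t q) k z) + ?c * (LINT z|unit_ivl. g z * fourier_h (u t) k z))"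
    by (intro continuous_intros c1 c2 c3)
  show "continuous_on {0..T} (\<lambda>t. LINT z|unit_ivl. g z * N t k z)"
    by (rule continuous_on_eq[OF cont]) (rule eq[symmetric])
qed

end

subsection \<open>From classical solutions to modal flows\<close>

lemma is_Lambda_h_Lambda_h: "f \<in> dom_Lambda_h s \<Longrightarrow> is_Lambda_h s f (Lambda_h s f)"
  unfolding dom_Lambda_h_def Lambda_h_def using someI[of "is_Lambda_h s f"] by auto

lemma dom_Lambda_h_diff:
  assumes "f \<in> dom_Lambda_h s" "f' \<in> dom_Lambda_h s"
  shows "(\<lambda>q. f q - f' q) \<in> dom_Lambda_h s"
proof -
  obtain g g' where g: "is_Lambda_h s f g" "is_Lambda_h s f' g'" using assms by (auto simp: dom_Lambda_h_def)
  have "is_Lambda_h s (\<lambda>q. f q - f' q) (\<lambda>q. g q - g' q)"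
    unfolding is_Lambda_h_def
  proof (intro conjI allI)
    have L: "f \<in> L2" "f' \<in> L2" "g \<in> L2" "g' \<in> L2" using g by (auto simp: is_Lambda_h_def)
    show "(\<lambda>q. f q - f' q) \<in> L2" "(\<lambda>q. g q - g' q) \<in> L2" using L by (auto intro: L2_diff)
    fix k
    have "AE z in unit_ivl. fourier_h g k z = complex_of_real (\<bar>2 * pi * of_int k\<bar> powr s) * fourier_h f k z"
      "AE z in unit_ivl. fourier_h g' k z = complex_of_real (\<bar>2 * pi * of_int k\<bar> powr s) * fourier_h f' k z"
      using g unfolding is_Lambda_h_def by blast+
    then show "AE z in unit_ivl. fourier_h (\<lambda>q. g q - g' q) k z =
        complex_of_real (\<bar>2 * pi * of_int k\<bar> powr s) * fourier_h (\<lambda>q. f q - f' q) k z"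
      using fourier_h_diff[OF L2_integrable[OF L(1)] L2_integrable[OF L(2)], of k]
        fourier_h_diff[OF L2_integrable[OF L(3)] L2_integrable[OF L(4)], of k]
      by eventually_elim (simp add: right_diff_distrib)
  qed
  then show ?thesis by (auto simp: dom_Lambda_h_def is_Lambda_h_def)
qed

text \<open>The homogeneous symbol |2 pi k|^s vanishes at k = 0, so the inhomogeneous weight is
  controlled only after adding 1. This is why the \<open>L2\<close> norm accompanies that of the
  fractional derivative.\<close>

lemma jb_powr_le:
  assumes "0 < s"
  shows "jb k powr s \<le> 2 powr s * (1 + \<bar>2 * pi * of_int k\<bar> powr s)"
proof -
  define a where "a = \<bar>2 * pi * real_of_int k\<bar>"
  have "1 * \<bar>real_of_int k\<bar> \<le> 2 * pi * \<bar>real_of_int k\<bar>" using pi_ge_two by (intro mult_right_mono) auto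
  then have "\<bar>real_of_int k\<bar> \<le> a" by (simp add: a_def abs_mult)
  moreover have "1 \<le> max 1 a" "a \<le> max 1 a" by auto
  ultimately have "jb k \<le> 2 * max 1 a" unfolding jb_def by linarith
  then have "jb k powr s \<le> (2 * max 1 a) powr s"
    using assms less_imp_le[OF jb_pos] by (intro powr_mono2) auto
  also have "\<dots> = 2 powr s * max 1 a powr s" by (rule powr_mult)
  also have "\<dots> \<le> 2 powr s * (1 + a powr s)" by (intro mult_left_mono) (auto simp: max_def)
  finally show ?thesis by (simp add: a_def)
qed

text \<open>Bessel's inequality for f and for its fractional derivative, whose mode norms carry the
  factor |2 pi k|^s.\<close>

lemma dom_Lambda_h_weighted:
  assumes f: "f \<in> dom_Lambda_h s" and "0 < s" "finite F"
  shows "(\<Sum>k\<in>F. jb k powr (2 * s) * (mnorm f k)\<^sup>2) \<le> 2 powr (2 * s) * (dom_Lambda_h_norm s f)\<^sup>2"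
proof -
  define g where "g = Lambda_h s f"
  have fg: "is_Lambda_h s f g" unfolding g_def by (rule is_Lambda_h_Lambda_h[OF f])
  have L: "f \<in> L2" "g \<in> L2" using fg by (auto simp: is_Lambda_h_def)
  have mg: "mnorm g k = \<bar>2 * pi * of_int k\<bar> powr s * mnorm f k" for k
  proof -
    have "AE z in unit_ivl. fourier_h g k z = complex_of_real (\<bar>2 * pi * of_int k\<bar> powr s) * fourier_h f k z"
      using fg unfolding is_Lambda_h_def by blast
    then have "mnorm g k = nrm (\<lambda>z. complex_of_real (\<bar>2 * pi * of_int k\<bar> powr s) * fourier_h f k z)"
      unfolding mnorm_def
      using sq_int_measurable[OF fourier_h_sq_int[OF L(2)]] sq_int_measurable[OF sq_int_scale(1)[OF fourier_h_sq_int[OF L(1)]]]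
      by (intro nrm_cong_AE) auto
    then show ?thesis by (simp only: sq_int_scale(2)) (simp add: mnorm_def)
  qed
  have jb: "jb k powr (2 * s) \<le> 2 powr (2 * s) * (1 + (\<bar>2 * pi * of_int k\<bar> powr s)\<^sup>2)" for k
    using jb_powr_le[of "2 * s" k] \<open>0 < s\<close> by (simp add: power2_eq_square flip: powr_add)
  have "(\<Sum>k\<in>F. jb k powr (2 * s) * (mnorm f k)\<^sup>2) \<le>
      (\<Sum>k\<in>F. 2 powr (2 * s) * (1 + (\<bar>2 * pi * of_int k\<bar> powr s)\<^sup>2) * (mnorm f k)\<^sup>2)"
    by (intro sum_mono mult_right_mono jb) auto
  also have "\<dots> = 2 powr (2 * s) * ((\<Sum>k\<in>F. (mnorm f k)\<^sup>2) + (\<Sum>k\<in>F. (mnorm g k)\<^sup>2))"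
    by (simp add: mg power_mult_distrib distrib_right distrib_left sum.distrib sum_distrib_left mult.assoc)
  also have "\<dots> \<le> 2 powr (2 * s) * ((L2_norm f)\<^sup>2 + (L2_norm g)\<^sup>2)"
    using Bessel_fourier_h(2)[OF L(1) \<open>finite F\<close>] Bessel_fourier_h(2)[OF L(2) \<open>finite F\<close>]
    by (intro mult_left_mono add_mono) auto
  finally show ?thesis by (simp add: dom_Lambda_h_norm_def g_def)
qed

text \<open>A continuous function on a compact interval is bounded, but \<open>C_time\<close> speaks
  of a norm functional and not of a topology, so Bolzano bisection stands in for compactness.
  Bounding the mode sums avoids comparing the chosen \<open>Lambda_h\<close> of a difference with
  the difference of the chosen ones.\<close>

lemma C_time_dom_bound:
  assumes C: "C_time T X (dom_Lambda_h_norm s) u" and X: "X \<subseteq> dom_Lambda_h s" and "0 < s" "0 \<le> T"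
  shows "\<exists>K. \<forall>t\<in>{0..T}. \<forall>F. finite F \<longrightarrow> (\<Sum>k\<in>F. jb k powr (2 * s) * (mnorm (u t) k)\<^sup>2) \<le> K"
proof -
  have dom: "u t \<in> dom_Lambda_h s" if "t \<in> {0..T}" for t using C X that by (auto simp: C_time_def)
  then have L: "u t \<in> L2" if "t \<in> {0..T}" for t using that by (auto simp: dom_Lambda_h_def)
  define P where "P a b \<longleftrightarrow> (\<exists>K. \<forall>t\<in>{a..b} \<inter> {0..T}. \<forall>F. finite F \<longrightarrow>
      (\<Sum>k\<in>F. jb k powr (2 * s) * (mnorm (u t) k)\<^sup>2) \<le> K)" for a b
  have "P 0 T"
    using \<open>0 \<le> T\<close>
  proof (induction rule: Bolzano)
    case (trans a b c)
    then obtain K1 K2 where "\<forall>t\<in>{a..b} \<inter> {0..T}. \<forall>F. finite F \<longrightarrow> (\<Sum>k\<in>F. jb k powr (2 * s) * (mnorm (u t) k)\<^sup>2) \<le> K1"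
      "\<forall>t\<in>{b..c} \<inter> {0..T}. \<forall>F. finite F \<longrightarrow> (\<Sum>k\<in>F. jb k powr (2 * s) * (mnorm (u t) k)\<^sup>2) \<le> K2"
      unfolding P_def by blast
    then have "\<forall>t\<in>{a..c} \<inter> {0..T}. \<forall>F. finite F \<longrightarrow> (\<Sum>k\<in>F. jb k powr (2 * s) * (mnorm (u t) k)\<^sup>2) \<le> max K1 K2"
      by (force simp: le_max_iff_disj)
    then show ?case unfolding P_def by blast
  next
    case (local t)
    then have t: "t \<in> {0..T}" by simp
    have "((\<lambda>r. dom_Lambda_h_norm s (\<lambda>q. u r q - u t q)) \<longlongrightarrow> 0) (at t within {0..T})"
      using C t by (simp add: C_time_def)
    then have "\<forall>\<^sub>F r in at t within {0..T}. dom_Lambda_h_norm s (\<lambda>q. u r q - u t q) < 1"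
      by (rule order_tendstoD) simp
    then obtain d where d: "0 < d" "\<And>r. r \<in> {0..T} \<Longrightarrow> r \<noteq> t \<Longrightarrow> dist r t < d \<Longrightarrow> dom_Lambda_h_norm s (\<lambda>q. u r q - u t q) < 1"
      unfolding eventually_at by blast
    define c where "c = 2 powr (2 * s)"
    define M where "M = c * (dom_Lambda_h_norm s (u t))\<^sup>2"
    have M: "(\<Sum>k\<in>F. jb k powr (2 * s) * (mnorm (u t) k)\<^sup>2) \<le> M" if "finite F" for F
      unfolding M_def c_def by (rule dom_Lambda_h_weighted[OF dom[OF t] \<open>0 < s\<close> that])
    have M0: "0 \<le> M" "0 \<le> c" by (auto simp: M_def c_def)
    have "(\<Sum>k\<in>F. jb k powr (2 * s) * (mnorm (u r) k)\<^sup>2) \<le> 2 * c + 2 * M"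
      if r: "r \<in> {0..T}" "dist r t < d" and F: "finite F" for r F
    proof (cases "r = t")
      case True
      with M[OF F] M0 show ?thesis by simp
    next
      case False
      define y where "y = (\<lambda>q. u r q - u t q)"
      have y: "y \<in> dom_Lambda_h s" unfolding y_def by (rule dom_Lambda_h_diff[OF dom dom]) (use r t in auto)
      have "dom_Lambda_h_norm s y < 1" unfolding y_def by (rule d) (use r False in auto)
      moreover have "0 \<le> dom_Lambda_h_norm s y" by (simp add: dom_Lambda_h_norm_def)
      ultimately have n1: "(dom_Lambda_h_norm s y)\<^sup>2 \<le> 1" by (simp add: power_le_one)
      have "(\<Sum>k\<in>F. jb k powr (2 * s) * (mnorm y k)\<^sup>2) \<le> c * (dom_Lambda_h_norm s y)\<^sup>2"
        unfolding c_def by (rule dom_Lambda_h_weighted[OF y \<open>0 < s\<close> F])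
      also have "\<dots> \<le> c * 1" by (intro mult_left_mono n1 M0)
      finally have yc: "(\<Sum>k\<in>F. jb k powr (2 * s) * (mnorm y k)\<^sup>2) \<le> c" by simp
      have "(mnorm (u r) k)\<^sup>2 \<le> 2 * (mnorm y k)\<^sup>2 + 2 * (mnorm (u t) k)\<^sup>2" for k
      proof -
        have "(mnorm (u r) k)\<^sup>2 \<le> (mnorm y k + mnorm (u t) k)\<^sup>2"
          unfolding y_def by (intro power_mono mnorm_le_diff L) (use r t in auto)
        also have "\<dots> \<le> 2 * (mnorm y k)\<^sup>2 + 2 * (mnorm (u t) k)\<^sup>2"
          using sum_squares_bound[of "mnorm y k" "mnorm (u t) k"] by (simp add: power2_sum)
        finally show ?thesis .
      qed
      then have "(\<Sum>k\<in>F. jb k powr (2 * s) * (mnorm (u r) k)\<^sup>2) \<le>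
          (\<Sum>k\<in>F. jb k powr (2 * s) * (2 * (mnorm y k)\<^sup>2 + 2 * (mnorm (u t) k)\<^sup>2))"
        by (intro sum_mono mult_left_mono) auto
      also have "\<dots> = 2 * (\<Sum>k\<in>F. jb k powr (2 * s) * (mnorm y k)\<^sup>2) + 2 * (\<Sum>k\<in>F. jb k powr (2 * s) * (mnorm (u t) k)\<^sup>2)"
        by (simp add: distrib_left sum.distrib sum_distrib_left mult_ac)
      also have "\<dots> \<le> 2 * c + 2 * M" using yc M[OF F] by simp
      finally show ?thesis .
    qed
    then have "P a b" if "a \<le> t \<and> t \<le> b \<and> b - a < d" for a b
      unfolding P_def using that by (intro exI[of _ "2 * c + 2 * M"]) (auto simp: dist_real_def)
    then show ?case using d(1) by blast
  qed
  then show ?thesis by (auto simp: P_def)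
qed

lemma C_time_dom_modes:
  assumes C: "C_time T X (dom_Lambda_h_norm s) u" and X: "X \<subseteq> dom_Lambda_h s" and t: "t \<in> {0..T}"
  shows "((\<lambda>r. nrm (\<lambda>z. fourier_h (u r) k z - fourier_h (u t) k z)) \<longlongrightarrow> 0) (at t within {0..T})"
proof (rule tendsto_sandwich[OF _ _ tendsto_const])
  have L: "u t \<in> L2" if "t \<in> {0..T}" for t using C X that by (auto simp: C_time_def dom_Lambda_h_def)
  show "((\<lambda>r. dom_Lambda_h_norm s (\<lambda>q. u r q - u t q)) \<longlongrightarrow> 0) (at t within {0..T})"
    using C t by (simp add: C_time_def)
  show "\<forall>\<^sub>F r in at t within {0..T}. nrm (\<lambda>z. fourier_h (u r) k z - fourier_h (u t) k z) \<le> dom_Lambda_h_norm s (\<lambda>q. u r q - u t q)"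
    unfolding eventually_at_filter
  proof (rule always_eventually, intro allI impI)
    fix r assume r: "r \<in> {0..T}"
    have "nrm (\<lambda>z. fourier_h (u r) k z - fourier_h (u t) k z) = mnorm (\<lambda>q. u r q - u t q) k"
      by (rule mnorm_diff[symmetric, OF L[OF r] L[OF t]])
    also have "\<dots> \<le> L2_norm (\<lambda>q. u r q - u t q)" by (rule mnorm_le_L2_norm[OF L2_diff[OF L[OF r] L[OF t]]])
    also have "\<dots> \<le> dom_Lambda_h_norm s (\<lambda>q. u r q - u t q)"
      unfolding dom_Lambda_h_norm_def by (rule real_le_rsqrt) simp
    finally show "nrm (\<lambda>z. fourier_h (u r) k z - fourier_h (u t) k z) \<le> dom_Lambda_h_norm s (\<lambda>q. u r q - u t q)" .
  qed
qed auto

text \<open>The hypothesis says A' = -B in the sense of distributions. Adding the primitive of B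
  yields a function with zero weak derivative, which du Bois-Reymond makes constant.\<close>

lemma weak_ode_integrated:
  fixes A B :: "real \<Rightarrow> complex"
  assumes "0 < T" and A: "continuous_on {0..T} A" and B: "continuous_on {0..T} B"
    and weak: "\<And>\<eta> \<eta>'. bump 0 T \<eta> \<Longrightarrow> (\<And>x. (\<eta> has_real_derivative \<eta>' x) (at x)) \<Longrightarrow> bump 0 T \<eta>' \<Longrightarrow>
      (LINT t|ivl 0 T. \<eta>' t *\<^sub>R A t) = (LINT t|ivl 0 T. \<eta> t *\<^sub>R B t)"
    and t: "t \<in> {0..T}"
  shows "A t + integral {0..t} B = A 0"
proof -
  define \<Gamma> where "\<Gamma> t = integral {0..t} B" for t
  have \<Gamma>': "(\<Gamma> has_vector_derivative B t) (at t within {0..T})" if "t \<in> {0..T}" for t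
    unfolding \<Gamma>_def[abs_def] by (rule integral_has_vector_derivative[OF B that])
  then have \<Gamma>: "continuous_on {0..T} \<Gamma>"
    by (intro continuous_on_vector_derivative) auto
  have "\<exists>c. AE t in ivl 0 T. A t + \<Gamma> t = c"
  proof (rule du_Bois_Reymond_bump[OF \<open>0 < T\<close>])
    show "integrable (ivl 0 T) (\<lambda>t. A t + \<Gamma> t)" by (intro integrable_ivl_continuous continuous_intros A \<Gamma>)
    fix \<eta> \<eta>' assume \<eta>: "bump 0 T \<eta>" "\<And>x. (\<eta> has_real_derivative \<eta>' x) (at x)" "bump 0 T \<eta>'"
    note c = bump_continuous[OF \<eta>(1), of "{0..T}"] bump_continuous[OF \<eta>(3), of "{0..T}"]
    have i: "integrable (ivl 0 T) (\<lambda>t. \<eta>' t *\<^sub>R A t)" "integrable (ivl 0 T) (\<lambda>t. \<eta>' t *\<^sub>R \<Gamma> t)"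
      "integrable (ivl 0 T) (\<lambda>t. \<eta> t *\<^sub>R B t)"
      by (intro integrable_ivl_continuous continuous_intros c A \<Gamma> B)+
    have "((\<lambda>t. \<eta> t *\<^sub>R \<Gamma> t) has_vector_derivative \<eta> t *\<^sub>R B t + \<eta>' t *\<^sub>R \<Gamma> t) (at t within {0..T})" if "t \<in> {0..T}" for t
      using has_vector_derivative_scaleR[OF has_field_derivative_at_within[OF \<eta>(2)] \<Gamma>'[OF that]] .
    then have "((\<lambda>t. \<eta> t *\<^sub>R B t + \<eta>' t *\<^sub>R \<Gamma> t) has_integral (\<eta> T *\<^sub>R \<Gamma> T - \<eta> 0 *\<^sub>R \<Gamma> 0)) {0..T}"
      using \<open>0 < T\<close> by (intro fundamental_theorem_of_calculus) auto
    then have "((\<lambda>t. \<eta> t *\<^sub>R B t + \<eta>' t *\<^sub>R \<Gamma> t) has_integral 0) {0..T}"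
      using bump_eq_0[OF \<eta>(1), of 0] bump_eq_0[OF \<eta>(1), of T] by simp
    moreover have "((\<lambda>t. \<eta> t *\<^sub>R B t + \<eta>' t *\<^sub>R \<Gamma> t) has_integral (LINT t|ivl 0 T. \<eta> t *\<^sub>R B t + \<eta>' t *\<^sub>R \<Gamma> t)) {0..T}"
      by (intro integral_ivl_continuous(2) continuous_intros c \<Gamma> B)
    ultimately have "(LINT t|ivl 0 T. \<eta> t *\<^sub>R B t + \<eta>' t *\<^sub>R \<Gamma> t) = 0" using has_integral_unique by blast
    then show "(LINT t|ivl 0 T. \<eta>' t *\<^sub>R (A t + \<Gamma> t)) = 0"
      using weak[OF \<eta>] i by (simp add: scaleR_add_right)
  qed
  then obtain c where c: "AE t in ivl 0 T. A t + \<Gamma> t = c" by blast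
  \<comment> \<open>From almost every time to every time: a nonnegative continuous function with
    integral zero vanishes identically.\<close>
  have "integral {0..T} (\<lambda>t. norm (A t + \<Gamma> t - c)) = (LINT t|ivl 0 T. norm (A t + \<Gamma> t - c))"
    by (intro integral_ivl_continuous(1)[symmetric] continuous_intros A \<Gamma>)
  also have "\<dots> = 0" by (rule integral_eq_zero_AE) (use c in auto)
  finally have "\<forall>t\<in>{0..T}. norm (A t + \<Gamma> t - c) = 0"
    using \<open>0 < T\<close> by (subst (asm) integral_eq_0_iff) (auto intro!: continuous_intros A \<Gamma>)
  then have "A t + \<Gamma> t = c" "A 0 + \<Gamma> 0 = c" using t \<open>0 < T\<close> by auto
  then show ?thesis by (simp add: \<Gamma>_def)
qed

section \<open>The weak momentum equation tested with products, and its modes integrated in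
  time\<close>

lemma set_integral_bump_ivl:
  fixes X :: "real \<Rightarrow> real"
  assumes "bump 0 T \<eta>"
  shows "(LINT t:{0<..<T}|lborel. \<eta> t * X t) = (LINT t|ivl 0 T. \<eta> t * X t)"
  unfolding integral_ivl set_lebesgue_integral_def
  using bump_eq_0[OF assms] by (intro Bochner_Integration.integral_cong) (auto simp: indicator_def)

text \<open>Testing with \<open>\<partial>\<^sub>z \<psi>\<close> removes the pressure, since \<open>\<partial>\<^sub>x \<partial>\<^sub>z \<psi> = \<partial>\<^sub>z \<partial>\<^sub>x \<psi>\<close> and \<open>\<partial>\<^sub>z p = 0\<close>.\<close>

lemma pressure_free_equation:
  assumes mom: "\<And>\<phi>. test_fun_time T \<phi> \<Longrightarrow>
      - (LINT t:{0<..<T}|lborel. LINT q|Omega. u t q * pderiv_dir (1, 0, 0) \<phi> (t, q))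
      + (LINT t:{0<..<T}|lborel. LINT q|Omega. F t q * \<phi> (t, q))
      - (LINT r|Omega_time T. p r * pderiv_dir (0, 1, 0) \<phi> r) = 0"
    and pz: "\<And>\<phi>. test_fun_time T \<phi> \<Longrightarrow> (LINT r|Omega_time T. p r * pderiv_dir (0, 0, 1) \<phi> r) = 0"
    and \<eta>: "bump 0 T \<eta>" "\<And>x. (\<eta> has_real_derivative \<eta>' x) (at x)" "bump 0 T \<eta>'"
    and e: "\<And>x. e (x + 1) = e x" "\<And>x. e' (x + 1) = e' x" "smooth e" "smooth e'"
      "\<And>x. (e has_real_derivative e' x) (at x)"
    and f: "bump 0 1 f" "\<And>x. (f has_real_derivative f' x) (at x)" "bump 0 1 f'"
  shows "(LINT t|ivl 0 T. \<eta>' t * (LINT q|Omega. u t q * (\<lambda>(x, z). e x * f' z) q)) =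
    (LINT t|ivl 0 T. \<eta> t * (LINT q|Omega. F t q * (\<lambda>(x, z). e x * f' z) q))"
proof -
  obtain f'' where f'': "\<And>x. (f' has_real_derivative f'' x) (at x)" using f(3) bump_derivE by blast
  obtain e'' where e'': "\<And>x. (e' has_real_derivative e'' x) (at x)" using e(4) smooth_derivE by blast
  have t1: "test_fun_time T (\<lambda>(t, x, z). \<eta> t * (e x * f' z))"
    by (rule test_fun_time_tensor[OF \<eta>(1) e(3) e(1) f(3)])
  \<comment> \<open>The z-derivative of this test function is the x-derivative of the one in
    \<open>t1\<close>, so the two equations for p cancel its contribution.\<close>
  have t2: "test_fun_time T (\<lambda>(t, x, z). \<eta> t * (e' x * f z))"
    by (rule test_fun_time_tensor[OF \<eta>(1) e(4) e(2) f(1)])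
  have "(LINT r|Omega_time T. p r * (\<lambda>(t, x, z). \<eta> t * (e' x * f' z)) r) = 0"
    using pz[OF t2] unfolding pderiv_dir_tensor3(3)[OF \<eta>(2) e'' f(2)] .
  with mom[OF t1]
  have E1: "(LINT t:{0<..<T}|lborel. LINT q|Omega. u t q * (\<lambda>(t, x, z). \<eta>' t * (e x * f' z)) (t, q)) =
    (LINT t:{0<..<T}|lborel. LINT q|Omega. F t q * (\<lambda>(t, x, z). \<eta> t * (e x * f' z)) (t, q))"
    unfolding pderiv_dir_tensor3(1,2)[OF \<eta>(2) e(5) f''] by simp
  have E2: "(LINT q|Omega. X q * (\<lambda>(t, x, z). y t * (e x * f' z)) (t, q)) =
      y t * (LINT q|Omega. X q * (\<lambda>(x, z). e x * f' z) q)" for X y t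
    unfolding integral_mult_right_zero[symmetric]
    by (intro Bochner_Integration.integral_cong) (auto simp: mult_ac)
  show ?thesis using E1 unfolding E2 set_integral_bump_ivl[OF \<eta>(1)] set_integral_bump_ivl[OF \<eta>(3)] .
qed

text \<open>The tests in z are derivatives f' of bumps, as left over by the elimination of the
  pressure. Bounds and continuity are proved for the vorticity of the regularity class and
  transferred, mode by mode, to the one that occurs in the equation.\<close>

lemma classical_solution_modal:
  assumes sol: "classical_solution \<alpha> \<nu> T u0 u" and \<alpha>: "1 < \<alpha>" "\<alpha> < 2" and T: "0 < T"
  shows "\<exists>v w \<omega> K. modal_flow \<alpha> T K u v w \<omega> \<and>
    (\<forall>k f f' t. bump 0 1 f \<longrightarrow> (\<forall>x. (f has_real_derivative f' x) (at x)) \<longrightarrow> bump 0 1 f' \<longrightarrow> t \<in> {0..T} \<longrightarrow>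
      (LINT z|unit_ivl. of_real (f' z) * fourier_h (u t) k z)
      + integral {0..t} (\<lambda>r. LINT z|unit_ivl. of_real (f' z) * modal_flow.N \<alpha> \<nu> u v w \<omega> r k z)
      = (LINT z|unit_ivl. of_real (f' z) * fourier_h (u 0) k z))"
proof -
  have Cu: "C_time T (dom_Lambda_h \<alpha> \<inter> mean_zero) (dom_Lambda_h_norm \<alpha>) u"
    using sol by (simp add: classical_solution_def)
  obtain \<omega>0 where w0: "\<And>t. t \<in> {0..T} \<Longrightarrow> weak_dz (u t) (\<omega>0 t)"
    and Cw: "C_time T (dom_Lambda_h (\<alpha> / 2)) (dom_Lambda_h_norm (\<alpha> / 2)) \<omega>0"
    using sol unfolding classical_solution_def by blast
  obtain v \<omega> w p where
    slice: "\<And>t. t \<in> {0..T} \<Longrightarrow> u t \<in> dom_Lambda_h \<alpha> \<and> weak_dx (u t) (v t) \<and> weak_dz (u t) (\<omega> t) \<and> incompressible (v t) (w t)"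
    and mom: "\<And>\<phi>. test_fun_time T \<phi> \<Longrightarrow>
      - (LINT t:{0<..<T}|lborel. LINT q|Omega. u t q * pderiv_dir (1, 0, 0) \<phi> (t, q))
      + (LINT t:{0<..<T}|lborel. LINT q|Omega. (u t q * v t q + w t q * \<omega> t q + \<nu> * Lambda_h \<alpha> (u t) q) * \<phi> (t, q))
      - (LINT r|Omega_time T. p r * pderiv_dir (0, 1, 0) \<phi> r) = 0"
    and pz: "\<And>\<phi>. test_fun_time T \<phi> \<Longrightarrow> (LINT r|Omega_time T. p r * pderiv_dir (0, 0, 1) \<phi> r) = 0"
    using sol unfolding classical_solution_def fpe_solution_def by blast
  have L2s: "u t \<in> L2" "v t \<in> L2" "w t \<in> L2" "\<omega> t \<in> L2" "\<omega>0 t \<in> L2" if "t \<in> {0..T}" for t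
    using slice[OF that] w0[OF that] by (auto simp: weak_dx_def weak_dz_def incompressible_def)
  have mode_eq: "AE z in unit_ivl. fourier_h (\<omega> t) k z = fourier_h (\<omega>0 t) k z" if "t \<in> {0..T}" for t k
    using weak_dz_unique[of "u t" "\<omega> t" "\<omega>0 t" k] slice[OF that] w0[OF that] by blast
  have m\<omega>: "mnorm (\<omega> t) k = mnorm (\<omega>0 t) k" if t: "t \<in> {0..T}" for t k
    unfolding mnorm_def
    by (rule nrm_cong_AE[OF mode_eq[OF t]]) (use L2s[OF t] in \<open>auto intro!: fourier_h_measurable L2_measurable\<close>)
  obtain K1 where K1: "\<And>t F. t \<in> {0..T} \<Longrightarrow> finite F \<Longrightarrow> (\<Sum>k\<in>F. jb k powr (2 * \<alpha>) * (mnorm (u t) k)\<^sup>2) \<le> K1"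
  proof -
    have "\<exists>K. \<forall>t\<in>{0..T}. \<forall>F. finite F \<longrightarrow> (\<Sum>k\<in>F. jb k powr (2 * \<alpha>) * (mnorm (u t) k)\<^sup>2) \<le> K"
      by (rule C_time_dom_bound[OF Cu]) (use \<alpha> T in auto)
    then show thesis using that by blast
  qed
  obtain K2 where K2: "\<And>t F. t \<in> {0..T} \<Longrightarrow> finite F \<Longrightarrow> (\<Sum>k\<in>F. jb k powr (2 * (\<alpha> / 2)) * (mnorm (\<omega>0 t) k)\<^sup>2) \<le> K2"
  proof -
    have "\<exists>K. \<forall>t\<in>{0..T}. \<forall>F. finite F \<longrightarrow> (\<Sum>k\<in>F. jb k powr (2 * (\<alpha> / 2)) * (mnorm (\<omega>0 t) k)\<^sup>2) \<le> K"
      by (rule C_time_dom_bound[OF Cw]) (use \<alpha> T in auto)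
    then show thesis using that by blast
  qed
  have mf: "modal_flow \<alpha> T (max K1 K2) u v w \<omega>"
  proof
    show "1 < \<alpha>" "\<alpha> < 2" by fact+
    fix t assume t: "t \<in> {0..T}"
    show "u t \<in> L2" "v t \<in> L2" "w t \<in> L2" "\<omega> t \<in> L2" using L2s[OF t] by auto
    have mz: "u t \<in> mean_zero" using Cu t by (auto simp: C_time_def)
    show "AE z in unit_ivl. fourier_h (v t) k z = 2 * pi * \<i> * of_int k * fourier_h (u t) k z" for k
      using weak_dx_fourier_h slice[OF t] by blast
    show "AE z in unit_ivl. fourier_h (u t) k z = mprim (fourier_h (\<omega> t) k) z" for k
      using weak_dz_fourier_h[OF _ mz] slice[OF t] by blast
    show "fourier_h (w t) k z = - prim0 (fourier_h (v t) k) z" if "z \<in> {0..1}" for k z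
      using incompressible_fourier_h[OF _ L2s(2)[OF t] that] slice[OF t] by blast
    show "(\<Sum>k\<in>F. jb k powr \<alpha> * (mnorm (\<omega> t) k)\<^sup>2) \<le> max K1 K2" if "finite F" for F
      using K2[OF t that] by (simp add: m\<omega>[OF t])
    show "(\<Sum>k\<in>F. jb k powr (2 * \<alpha>) * (mnorm (u t) k)\<^sup>2) \<le> max K1 K2" if "finite F" for F
      using K1[OF t that] by simp
    show "((\<lambda>s. nrm (\<lambda>z. fourier_h (u s) k z - fourier_h (u t) k z)) \<longlongrightarrow> 0) (at t within {0..T})" for k
      by (rule C_time_dom_modes[OF Cu _ t]) auto
    have eq: "nrm (\<lambda>z. fourier_h (\<omega> s) k z - fourier_h (\<omega> t) k z) = nrm (\<lambda>z. fourier_h (\<omega>0 s) k z - fourier_h (\<omega>0 t) k z)"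
      if s: "s \<in> {0..T}" for s k
    proof (rule nrm_cong_AE)
      show "AE z in unit_ivl. fourier_h (\<omega> s) k z - fourier_h (\<omega> t) k z = fourier_h (\<omega>0 s) k z - fourier_h (\<omega>0 t) k z"
        using mode_eq[OF s, of k] mode_eq[OF t, of k] by eventually_elim simp
    qed (use L2s[OF s] L2s[OF t] in \<open>auto intro!: borel_measurable_diff fourier_h_measurable L2_measurable\<close>)
    have "((\<lambda>s. nrm (\<lambda>z. fourier_h (\<omega>0 s) k z - fourier_h (\<omega>0 t) k z)) \<longlongrightarrow> 0) (at t within {0..T})" for k
      by (rule C_time_dom_modes[OF Cw _ t]) auto
    then show "((\<lambda>s. nrm (\<lambda>z. fourier_h (\<omega> s) k z - fourier_h (\<omega> t) k z)) \<longlongrightarrow> 0) (at t within {0..T})" for k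
      using Lim_cong_within[of t t 0 0 "{0..T}" "{0..T}" "\<lambda>s. nrm (\<lambda>z. fourier_h (\<omega> s) k z - fourier_h (\<omega> t) k z)"
          "\<lambda>s. nrm (\<lambda>z. fourier_h (\<omega>0 s) k z - fourier_h (\<omega>0 t) k z)"] eq by simp
  qed
  interpret M: modal_flow \<alpha> \<nu> T "max K1 K2" u v w \<omega> by (rule mf)
  have "(LINT z|unit_ivl. of_real (f' z) * fourier_h (u t) k z)
      + integral {0..t} (\<lambda>r. LINT z|unit_ivl. of_real (f' z) * M.N r k z)
      = (LINT z|unit_ivl. of_real (f' z) * fourier_h (u 0) k z)"
    if f: "bump 0 1 f" "\<And>x. (f has_real_derivative f' x) (at x)" "bump 0 1 f'" and t: "t \<in> {0..T}" for k f f' t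
  proof -
    define A where "A t = (LINT z|unit_ivl. complex_of_real (f' z) * fourier_h (u t) k z)" for t
    define B where "B t = (LINT z|unit_ivl. complex_of_real (f' z) * M.N t k z)" for t
    obtain C where C: "\<And>x. \<bar>f' x\<bar> \<le> C" using bump_bounded[OF f(3)] by blast
    have fm: "(\<lambda>z. complex_of_real (f' z)) \<in> borel_measurable unit_ivl"
      using measurable_unit_continuous[OF bump_continuous[OF f(3)]] by measurable
    have fC: "norm (complex_of_real (f' z)) \<le> C" for z using C by simp
    have Ac: "continuous_on {0..T} A" and Bc: "continuous_on {0..T} B"
      unfolding A_def[abs_def] B_def[abs_def]
      by (rule M.N_pairing_continuous[OF fm fC])+
    define F where "F t q = u t q * v t q + w t q * \<omega> t q + \<nu> * Lambda_h \<alpha> (u t) q" for t q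
    have Fint: "integrable Omega (F t)" and FB: "(LINT z|unit_ivl. f' z *\<^sub>R fourier_h (F t) k z) = B t" if t: "t \<in> {0..T}" for t
    proof -
      have Lam: "is_Lambda_h \<alpha> (u t) (Lambda_h \<alpha> (u t))" using slice[OF t] by (intro is_Lambda_h_Lambda_h) blast
      have i1: "integrable Omega (\<lambda>q. u t q * v t q + w t q * \<omega> t q)"
        using M.uv_integrable[OF t] M.w\<omega>_integrable[OF t] by (simp add: mult.commute)
      have i2: "integrable Omega (\<lambda>q. \<nu> * Lambda_h \<alpha> (u t) q)"
        using Lam by (intro L2_integrable L2_scale) (simp add: is_Lambda_h_def)
      show Fi: "integrable Omega (F t)" unfolding F_def[abs_def] using i1 i2 by simp
      have "AE z in unit_ivl. fourier_h (Lambda_h \<alpha> (u t)) k z = complex_of_real (\<bar>2 * pi * of_int k\<bar> powr \<alpha>) * fourier_h (u t) k z"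
        using Lam unfolding is_Lambda_h_def by blast
      then have FN: "AE z in unit_ivl. fourier_h (F t) k z = M.N t k z"
        using fourier_h_add[OF i1 i2, of k]
        by eventually_elim (simp add: F_def[abs_def] M.N_def fourier_h_scale)
      show "(LINT z|unit_ivl. f' z *\<^sub>R fourier_h (F t) k z) = B t"
        unfolding B_def
      proof (rule integral_cong_AE)
        show "AE z in unit_ivl. f' z *\<^sub>R fourier_h (F t) k z = complex_of_real (f' z) * M.N t k z"
          using FN by eventually_elim (simp add: scaleR_conv_of_real)
        show "(\<lambda>z. f' z *\<^sub>R fourier_h (F t) k z) \<in> borel_measurable unit_ivl"
          using norm_integral_mult_le(1)[OF fourier_h_integrable(1)[OF Fi] fm fC]
          by (auto simp: scaleR_conv_of_real dest: borel_measurable_integrable)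
        show "(\<lambda>z. complex_of_real (f' z) * M.N t k z) \<in> borel_measurable unit_ivl"
          using norm_integral_mult_le(1)[OF M.N_integrable[OF t] fm fC] by (auto dest: borel_measurable_integrable)
      qed
    qed
    have uA: "(LINT z|unit_ivl. f' z *\<^sub>R fourier_h (u t) k z) = A t" for t
      by (simp add: A_def scaleR_conv_of_real)
    \<comment> \<open>Real and imaginary part of the complex mode equation are the cosine test and
      minus the sine test.\<close>
    let ?cos = "\<lambda>(x, z). cos (2 * pi * of_int k * x) * f' z" and ?sin = "\<lambda>(x, z). sin (2 * pi * of_int k * x) * f' z"
    have Ap: "A t = of_real (LINT q|Omega. u t q * ?cos q) - \<i> * of_real (LINT q|Omega. u t q * ?sin q)" if "t \<in> {0..T}" for t
      using bump_pairing_real[OF L2_integrable[OF L2s(1)[OF that]] f(3), of k] uA by simp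
    have Bp: "B t = of_real (LINT q|Omega. F t q * ?cos q) - \<i> * of_real (LINT q|Omega. F t q * ?sin q)" if "t \<in> {0..T}" for t
      using bump_pairing_real[OF Fint[OF that] f(3), of k] FB[OF that] by simp
    have "A t + integral {0..t} B = A 0"
    proof (rule weak_ode_integrated[OF T Ac Bc _ t])
      fix \<eta> \<eta>' assume \<eta>: "bump 0 T \<eta>" "\<And>x. (\<eta> has_real_derivative \<eta>' x) (at x)" "bump 0 T \<eta>'"
      define c where "c = 2 * pi * of_int k"
      have per: "cos (c * (x + 1)) = cos (c * x)" "sin (c * (x + 1)) = sin (c * x)" for x
        unfolding c_def using cos_2pi_int_periodic[of k x] sin_2pi_int_periodic[of k x] by auto
      have dcos: "((\<lambda>x. cos (c * x)) has_real_derivative - c * sin (c * x)) (at x)"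
        and dsin: "((\<lambda>x. sin (c * x)) has_real_derivative c * cos (c * x)) (at x)" for x
        by (auto intro!: derivative_eq_intros)
      have sm: "smooth (\<lambda>x. - c * sin (c * x))" "smooth (\<lambda>x. c * cos (c * x))"
        by (intro smooth_mult smooth_const smooth_sin smooth_cos)+
      have eqc: "(LINT t|ivl 0 T. \<eta>' t * (LINT q|Omega. u t q * (\<lambda>(x, z). cos (c * x) * f' z) q)) =
          (LINT t|ivl 0 T. \<eta> t * (LINT q|Omega. F t q * (\<lambda>(x, z). cos (c * x) * f' z) q))"
        by (rule pressure_free_equation[OF mom[folded F_def] pz \<eta>, where e' = "\<lambda>x. - c * sin (c * x)"])
           (use per dcos sm smooth_cos f in auto)
      have eqs: "(LINT t|ivl 0 T. \<eta>' t * (LINT q|Omega. u t q * (\<lambda>(x, z). sin (c * x) * f' z) q)) =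
          (LINT t|ivl 0 T. \<eta> t * (LINT q|Omega. F t q * (\<lambda>(x, z). sin (c * x) * f' z) q))"
        by (rule pressure_free_equation[OF mom[folded F_def] pz \<eta>, where e' = "\<lambda>x. c * cos (c * x)"])
           (use per dsin sm smooth_sin f in auto)
      have iA: "integrable (ivl 0 T) (\<lambda>t. \<eta>' t *\<^sub>R A t)" and iB: "integrable (ivl 0 T) (\<lambda>t. \<eta> t *\<^sub>R B t)"
        using bump_continuous[OF \<eta>(1)] bump_continuous[OF \<eta>(3)] Ac Bc
        by (auto intro!: integrable_ivl_continuous continuous_intros)
      have ReA: "(LINT t|ivl 0 T. Re (\<eta>' t *\<^sub>R A t)) = (LINT t|ivl 0 T. \<eta>' t * (LINT q|Omega. u t q * (\<lambda>(x, z). cos (c * x) * f' z) q))"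
        by (rule Bochner_Integration.integral_cong) (auto simp: Ap c_def space_restrict_space)
      have ReB: "(LINT t|ivl 0 T. Re (\<eta> t *\<^sub>R B t)) = (LINT t|ivl 0 T. \<eta> t * (LINT q|Omega. F t q * (\<lambda>(x, z). cos (c * x) * f' z) q))"
        by (rule Bochner_Integration.integral_cong) (auto simp: Bp c_def space_restrict_space)
      have ImA: "(LINT t|ivl 0 T. Im (\<eta>' t *\<^sub>R A t)) = - (LINT t|ivl 0 T. \<eta>' t * (LINT q|Omega. u t q * (\<lambda>(x, z). sin (c * x) * f' z) q))"
        unfolding Bochner_Integration.integral_minus[symmetric]
        by (rule Bochner_Integration.integral_cong) (auto simp: Ap c_def space_restrict_space)
      have ImB: "(LINT t|ivl 0 T. Im (\<eta> t *\<^sub>R B t)) = - (LINT t|ivl 0 T. \<eta> t * (LINT q|Omega. F t q * (\<lambda>(x, z). sin (c * x) * f' z) q))"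
        unfolding Bochner_Integration.integral_minus[symmetric]
        by (rule Bochner_Integration.integral_cong) (auto simp: Bp c_def space_restrict_space)
      show "(LINT t|ivl 0 T. \<eta>' t *\<^sub>R A t) = (LINT t|ivl 0 T. \<eta> t *\<^sub>R B t)"
      proof (rule complex_eqI)
        show "Re (LINT t|ivl 0 T. \<eta>' t *\<^sub>R A t) = Re (LINT t|ivl 0 T. \<eta> t *\<^sub>R B t)"
          unfolding integral_Re[OF iA, symmetric] integral_Re[OF iB, symmetric] ReA ReB by (rule eqc)
        show "Im (LINT t|ivl 0 T. \<eta>' t *\<^sub>R A t) = Im (LINT t|ivl 0 T. \<eta> t *\<^sub>R B t)"
          unfolding integral_Im[OF iA, symmetric] integral_Im[OF iB, symmetric] ImA ImB eqs ..
      qed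
    qed
    then show ?thesis unfolding A_def B_def[abs_def] .
  qed
  then show ?thesis using mf by blast
qed

subsection \<open>The energy identity for one mode of the difference\<close>

text \<open>Raising K lets two flows share the constants \<open>H\<close> and \<open>tail\<close>,
  which depend on K but not on the solution.\<close>

lemma modal_flow_mono:
  assumes "modal_flow \<alpha> T K u v w \<omega>" "K \<le> K'"
  shows "modal_flow \<alpha> T K' u v w \<omega>"
  using assms unfolding modal_flow_def by (meson order_trans)

lemma pairing_bounded_convergence:
  fixes X :: "real \<Rightarrow> complex"
  assumes X: "integrable unit_ivl X"
    and m: "\<And>n. h n \<in> borel_measurable unit_ivl" "h0 \<in> borel_measurable unit_ivl"
    and B: "\<And>n z. z \<in> {0..1} \<Longrightarrow> \<bar>h n z\<bar> \<le> B" and lim: "\<And>z. z \<in> {0<..<1} \<Longrightarrow> (\<lambda>n. h n z) \<longlonglongrightarrow> h0 z"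
  shows "(\<lambda>n. LINT z|unit_ivl. complex_of_real (h n z) * X z) \<longlonglongrightarrow> (LINT z|unit_ivl. complex_of_real (h0 z) * X z)"
proof (rule integral_dominated_convergence[where w = "\<lambda>z. B * norm (X z)"])
  have [measurable]: "X \<in> borel_measurable unit_ivl" using X by simp
  show "(\<lambda>z. complex_of_real (h n z) * X z) \<in> borel_measurable unit_ivl" for n using m by measurable
  show "(\<lambda>z. complex_of_real (h0 z) * X z) \<in> borel_measurable unit_ivl" using m by measurable
  show "integrable unit_ivl (\<lambda>z. B * norm (X z))" using X by simp
  show "AE z in unit_ivl. norm (complex_of_real (h n z) * X z) \<le> B * norm (X z)" for n
    using B by (intro AE_I2) (auto simp: norm_mult intro!: mult_right_mono)
  show "AE z in unit_ivl. (\<lambda>n. complex_of_real (h n z) * X z) \<longlonglongrightarrow> complex_of_real (h0 z) * X z"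
    using AE_unit_ivl_neq[of 0] AE_unit_ivl_neq[of 1] AE_space
  proof eventually_elim
    case (elim z)
    then have "(\<lambda>n. h n z) \<longlonglongrightarrow> h0 z" by (intro lim) auto
    then show ?case by (intro tendsto_intros)
  qed
qed

lemma prim0_cnj: "prim0 (\<lambda>y. cnj (f y)) z = cnj (prim0 f z)"
  unfolding prim0_def by (subst Bochner_Integration.integral_cnj[symmetric]) simp

lemma mprim_cnj: "mprim (\<lambda>y. cnj (f y)) z = cnj (mprim f z)"
  unfolding mprim_def prim0_cnj by simp

locale modal_pair =
  A: modal_flow \<alpha> \<nu> T K u1 v1 w1 \<omega>1 + B: modal_flow \<alpha> \<nu> T K u2 v2 w2 \<omega>2
  for \<alpha> \<nu> T K :: real and u1 v1 w1 \<omega>1 u2 v2 w2 \<omega>2 :: "real \<Rightarrow> real \<times> real \<Rightarrow> real" +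
  assumes T: "0 < T" and \<nu>: "0 < \<nu>"
    and eq1: "\<And>k f f' t. bump 0 1 f \<Longrightarrow> (\<And>x. (f has_real_derivative f' x) (at x)) \<Longrightarrow> bump 0 1 f' \<Longrightarrow> t \<in> {0..T} \<Longrightarrow>
      (LINT z|unit_ivl. of_real (f' z) * fourier_h (u1 t) k z)
      + integral {0..t} (\<lambda>r. LINT z|unit_ivl. of_real (f' z) * A.N r k z)
      = (LINT z|unit_ivl. of_real (f' z) * fourier_h (u1 0) k z)"
    and eq2: "\<And>k f f' t. bump 0 1 f \<Longrightarrow> (\<And>x. (f has_real_derivative f' x) (at x)) \<Longrightarrow> bump 0 1 f' \<Longrightarrow> t \<in> {0..T} \<Longrightarrow>
      (LINT z|unit_ivl. of_real (f' z) * fourier_h (u2 t) k z)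
      + integral {0..t} (\<lambda>r. LINT z|unit_ivl. of_real (f' z) * B.N r k z)
      = (LINT z|unit_ivl. of_real (f' z) * fourier_h (u2 0) k z)"
    and init: "\<And>k. AE z in unit_ivl. fourier_h (u1 0) k z = fourier_h (u2 0) k z"
begin

definition d :: "real \<Rightarrow> real \<times> real \<Rightarrow> real" where "d t q = u1 t q - u2 t q"
definition dv :: "real \<Rightarrow> real \<times> real \<Rightarrow> real" where "dv t q = v1 t q - v2 t q"
definition dw :: "real \<Rightarrow> real \<times> real \<Rightarrow> real" where "dw t q = w1 t q - w2 t q"
definition \<theta> :: "real \<Rightarrow> real \<times> real \<Rightarrow> real" where "\<theta> t q = \<omega>1 t q - \<omega>2 t q"

text \<open>The continuous representative in z of the k-th mode of the difference. It has pointwise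
  values and sup bounds, is absolutely continuous with density \<open>Th\<close>, and obeys the
  conjugation symmetry at every z.\<close>

definition Dm :: "real \<Rightarrow> int \<Rightarrow> real \<Rightarrow> complex" where
  "Dm t k z = mprim (fourier_h (\<omega>1 t) k) z - mprim (fourier_h (\<omega>2 t) k) z"

definition Th :: "real \<Rightarrow> int \<Rightarrow> real \<Rightarrow> complex" where
  "Th t k z = fourier_h (\<omega>1 t) k z - fourier_h (\<omega>2 t) k z"

definition M :: "real \<Rightarrow> int \<Rightarrow> real \<Rightarrow> complex" where
  "M t k z = A.N t k z - B.N t k z"

definition MB :: "int \<Rightarrow> real" where
  "MB k = 2 * (2 * (A.tail 0 * A.H) + \<bar>\<nu> * \<bar>2 * pi * of_int k\<bar> powr \<alpha>\<bar> * A.tail 0)"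

lemma diff_L2:
  assumes "t \<in> {0..T}"
  shows "d t \<in> L2" "dv t \<in> L2" "dw t \<in> L2" "\<theta> t \<in> L2"
  unfolding d_def[abs_def] dv_def[abs_def] dw_def[abs_def] \<theta>_def[abs_def]
  using assms by (auto intro!: L2_diff A.uL2 B.uL2 A.vL2 B.vL2 A.wL2 B.wL2 A.\<omega>L2 B.\<omega>L2)

lemma Th_sq_int: "t \<in> {0..T} \<Longrightarrow> sq_int (Th t k)"
  unfolding Th_def[abs_def] by (intro sq_int_diff A.sq_modes(4) B.sq_modes(4))

lemma nrm_Th: "t \<in> {0..T} \<Longrightarrow> nrm (Th t k) = mnorm (\<theta> t) k"
  unfolding Th_def[abs_def] \<theta>_def[abs_def] by (rule mnorm_diff[symmetric, OF A.\<omega>L2 B.\<omega>L2])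

lemma \<theta>_mode: "t \<in> {0..T} \<Longrightarrow> AE z in unit_ivl. fourier_h (\<theta> t) k z = Th t k z"
  unfolding Th_def \<theta>_def[abs_def] by (rule fourier_h_diff[OF L2_integrable[OF A.\<omega>L2] L2_integrable[OF B.\<omega>L2]])

lemma Dm_eq: "t \<in> {0..T} \<Longrightarrow> Dm t k = mprim (Th t k)"
  unfolding Dm_def[abs_def] Th_def[abs_def]
  by (rule ext) (rule mprim_diff[symmetric, OF A.int_modes(4) B.int_modes(4)])

lemma AC_Dm: "t \<in> {0..T} \<Longrightarrow> AC (Dm t k) (Th t k)"
  using AC_mprim[OF sq_int_integrable(1)[OF Th_sq_int]] by (simp add: Dm_eq)

lemma Dm_continuous: "t \<in> {0..T} \<Longrightarrow> continuous_on {0..1} (Dm t k)"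
  by (rule AC_continuous[OF AC_Dm])

lemma Dm_sq_int: "t \<in> {0..T} \<Longrightarrow> sq_int (Dm t k)"
  by (rule sq_int_continuous[OF Dm_continuous])

lemma Dm_mean: "t \<in> {0..T} \<Longrightarrow> (LINT z|unit_ivl. Dm t k z) = 0"
  using mprim_mean[OF sq_int_integrable(1)[OF Th_sq_int]] by (simp add: Dm_eq)

lemma norm_Dm_le: "t \<in> {0..T} \<Longrightarrow> norm (Dm t k z) \<le> mnorm (\<theta> t) k"
  using norm_mprim_le[OF Th_sq_int] by (simp add: Dm_eq nrm_Th)

lemma u_modes_Dm:
  assumes t: "t \<in> {0..T}"
  shows "AE z in unit_ivl. fourier_h (u1 t) k z - fourier_h (u2 t) k z = Dm t k z"
  using A.u_mode[OF t, of k] B.u_mode[OF t, of k] by eventually_elim (simp add: Dm_def)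

lemma d_mode:
  assumes t: "t \<in> {0..T}"
  shows "AE z in unit_ivl. fourier_h (d t) k z = Dm t k z"
  using fourier_h_diff[OF L2_integrable[OF A.uL2[OF t]] L2_integrable[OF B.uL2[OF t]], of k] u_modes_Dm[OF t, of k]
  unfolding d_def[abs_def] by eventually_elim simp

lemma nrm_Dm: "t \<in> {0..T} \<Longrightarrow> nrm (Dm t k) = mnorm (d t) k"
  unfolding mnorm_def
  by (rule nrm_cong_AE[symmetric, OF d_mode fourier_h_measurable[OF L2_measurable[OF diff_L2(1)]]
        measurable_unit_continuous[OF Dm_continuous]])

lemma Dm_uminus: "Dm t (- k) z = cnj (Dm t k z)"
  unfolding Dm_def fourier_h_uminus[abs_def] mprim_cnj by simp

lemma M_integrable: "t \<in> {0..T} \<Longrightarrow> integrable unit_ivl (M t k)"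
  unfolding M_def[abs_def] by (intro Bochner_Integration.integrable_diff A.N_integrable B.N_integrable)

lemma M_bound:
  assumes t: "t \<in> {0..T}"
  shows "(LINT z|unit_ivl. norm (M t k z)) \<le> MB k"
proof -
  have "(LINT z|unit_ivl. norm (M t k z)) \<le> (LINT z|unit_ivl. norm (A.N t k z) + norm (B.N t k z))"
    using M_integrable[OF t] A.N_integrable[OF t] B.N_integrable[OF t]
    by (intro integral_mono) (auto simp: M_def intro: norm_triangle_ineq4)
  also have "\<dots> = (LINT z|unit_ivl. norm (A.N t k z)) + (LINT z|unit_ivl. norm (B.N t k z))"
    using A.N_integrable[OF t] B.N_integrable[OF t] by simp
  also have "\<dots> \<le> MB k"
    using add_mono[OF A.N_bound[OF t, of k] B.N_bound[OF t, of k]] unfolding MB_def mult_2[of "_ + _"] .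
  finally show ?thesis .
qed

lemma M_pairing_bound:
  assumes t: "t \<in> {0..T}" and g: "g \<in> borel_measurable unit_ivl" and B: "\<And>z. z \<in> {0..1} \<Longrightarrow> norm (g z) \<le> B"
  shows "norm (LINT z|unit_ivl. g z * M t k z) \<le> B * MB k"
proof -
  have B0: "0 \<le> B" using order_trans[OF norm_ge_zero B[of 0]] by simp
  have "norm (LINT z|unit_ivl. g z * M t k z) \<le> B * (LINT z|unit_ivl. norm (M t k z))"
    by (rule norm_integral_mult_le(2)[OF M_integrable[OF t] g B])
  also have "\<dots> \<le> B * MB k" by (intro mult_left_mono M_bound t B0)
  finally show ?thesis .
qed

lemma M_pairing_continuous:
  assumes g: "g \<in> borel_measurable unit_ivl" and B: "\<And>z. z \<in> {0..1} \<Longrightarrow> norm (g z) \<le> B"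
  shows "continuous_on {0..T} (\<lambda>t. LINT z|unit_ivl. g z * M t k z)"
proof -
  have c: "continuous_on {0..T} (\<lambda>t. (LINT z|unit_ivl. g z * A.N t k z) - (LINT z|unit_ivl. g z * B.N t k z))"
    by (intro continuous_intros A.N_pairing_continuous[OF g B] B.N_pairing_continuous[OF g B])
  show ?thesis
  proof (rule continuous_on_eq[OF c])
    fix t assume t: "t \<in> {0..T}"
    show "(LINT z|unit_ivl. g z * A.N t k z) - (LINT z|unit_ivl. g z * B.N t k z) = (LINT z|unit_ivl. g z * M t k z)"
      unfolding M_def right_diff_distrib
      by (rule Bochner_Integration.integral_diff[symmetric, OF norm_integral_mult_le(1)[OF A.N_integrable[OF t] g B]
          norm_integral_mult_le(1)[OF B.N_integrable[OF t] g B]])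
  qed
qed

section \<open>The equation for the difference, tested with arbitrary continuous functions of mean
  zero\<close>

definition I :: "int \<Rightarrow> (real \<Rightarrow> complex) \<Rightarrow> real \<Rightarrow> complex" where
  "I k g t = integral {0..t} (\<lambda>r. LINT z|unit_ivl. g z * M r k z)"

definition X :: "real \<Rightarrow> int \<Rightarrow> real \<Rightarrow> complex" where
  "X t k z = Dm t k z - Dm 0 k z"

lemma X_integrable: "t \<in> {0..T} \<Longrightarrow> integrable unit_ivl (X t k)"
  unfolding X_def[abs_def] using T
  by (intro integrable_unit_continuous continuous_intros Dm_continuous) auto

lemma bump_equation:
  assumes f: "bump 0 1 f" "\<And>x. (f has_real_derivative f' x) (at x)" "bump 0 1 f'" and t: "t \<in> {0..T}"
  shows "(LINT z|unit_ivl. of_real (f' z) * X t k z) + I k (\<lambda>z. of_real (f' z)) t = 0"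
proof -
  obtain C where C: "\<And>x. \<bar>f' x\<bar> \<le> C" using bump_bounded[OF f(3)] by blast
  have fm: "(\<lambda>z. complex_of_real (f' z)) \<in> borel_measurable unit_ivl"
    using measurable_unit_continuous[OF bump_continuous[OF f(3)]] by measurable
  have fC: "norm (complex_of_real (f' z)) \<le> C" for z using C by simp
  have t0: "0 \<in> {0..T}" using T by simp
  have sub: "{0..t} \<subseteq> {0..T}" using t by auto
  note iA = integrable_continuous_interval[OF continuous_on_subset[OF A.N_pairing_continuous(1)[OF fm fC, of k] sub]]
  note iB = integrable_continuous_interval[OF continuous_on_subset[OF B.N_pairing_continuous(1)[OF fm fC, of k] sub]]
  have "I k (\<lambda>z. of_real (f' z)) t = integral {0..t} (\<lambda>r. (LINT z|unit_ivl. of_real (f' z) * A.N r k z) - (LINT z|unit_ivl. of_real (f' z) * B.N r k z))"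
    unfolding I_def
  proof (rule Henstock_Kurzweil_Integration.integral_cong)
    fix r assume "r \<in> {0..t}"
    then have r: "r \<in> {0..T}" using t by auto
    show "(LINT z|unit_ivl. complex_of_real (f' z) * M r k z) = (LINT z|unit_ivl. of_real (f' z) * A.N r k z) - (LINT z|unit_ivl. of_real (f' z) * B.N r k z)"
      unfolding M_def right_diff_distrib
      by (rule Bochner_Integration.integral_diff[OF norm_integral_mult_le(1)[OF A.N_integrable[OF r] fm fC]
          norm_integral_mult_le(1)[OF B.N_integrable[OF r] fm fC]])
  qed
  also have "\<dots> = integral {0..t} (\<lambda>r. LINT z|unit_ivl. of_real (f' z) * A.N r k z) - integral {0..t} (\<lambda>r. LINT z|unit_ivl. of_real (f' z) * B.N r k z)"
    by (rule Henstock_Kurzweil_Integration.integral_diff[OF iA iB])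
  finally have Ieq: "I k (\<lambda>z. of_real (f' z)) t = \<dots>" .
  have D: "(LINT z|unit_ivl. of_real (f' z) * fourier_h (u1 s) k z) - (LINT z|unit_ivl. of_real (f' z) * fourier_h (u2 s) k z)
      = (LINT z|unit_ivl. of_real (f' z) * Dm s k z)" if s: "s \<in> {0..T}" for s
  proof -
    note i = norm_integral_mult_le(1)[OF A.int_modes(1)[OF s, of k] fm fC] norm_integral_mult_le(1)[OF B.int_modes(1)[OF s, of k] fm fC]
    have "(LINT z|unit_ivl. of_real (f' z) * fourier_h (u1 s) k z) - (LINT z|unit_ivl. of_real (f' z) * fourier_h (u2 s) k z)
      = (LINT z|unit_ivl. of_real (f' z) * fourier_h (u1 s) k z - of_real (f' z) * fourier_h (u2 s) k z)"
      by (rule Bochner_Integration.integral_diff[symmetric, OF i])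
    also have "\<dots> = (LINT z|unit_ivl. of_real (f' z) * Dm s k z)"
    proof (rule integral_cong_AE)
      show "AE z in unit_ivl. of_real (f' z) * fourier_h (u1 s) k z - of_real (f' z) * fourier_h (u2 s) k z = of_real (f' z) * Dm s k z"
        using u_modes_Dm[OF s, of k] by eventually_elim (simp flip: right_diff_distrib)
      show "(\<lambda>z. of_real (f' z) * fourier_h (u1 s) k z - of_real (f' z) * fourier_h (u2 s) k z) \<in> borel_measurable unit_ivl"
        using Bochner_Integration.integrable_diff[OF i] by (rule borel_measurable_integrable)
      show "(\<lambda>z. of_real (f' z) * Dm s k z) \<in> borel_measurable unit_ivl"
        using norm_integral_mult_le(1)[OF sq_int_integrable(1)[OF Dm_sq_int[OF s]] fm fC] by (rule borel_measurable_integrable)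
    qed
    finally show ?thesis .
  qed
  have "(LINT z|unit_ivl. of_real (f' z) * X t k z) = (LINT z|unit_ivl. of_real (f' z) * Dm t k z) - (LINT z|unit_ivl. of_real (f' z) * Dm 0 k z)"
    unfolding X_def right_diff_distrib
    by (rule Bochner_Integration.integral_diff[OF norm_integral_mult_le(1)[OF sq_int_integrable(1)[OF Dm_sq_int[OF t]] fm fC]
          norm_integral_mult_le(1)[OF sq_int_integrable(1)[OF Dm_sq_int[OF t0]] fm fC]])
  moreover have "(a - a') - (b - b') + (c - c') = 0" if "a + c = b" "a' + c' = b'" for a a' b b' c c' :: complex
    unfolding that[symmetric] by simp
  from this[OF eq1[OF f t, of k] eq2[OF f t, of k]]
  have "(LINT z|unit_ivl. of_real (f' z) * Dm t k z) - (LINT z|unit_ivl. of_real (f' z) * Dm 0 k z)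
      + I k (\<lambda>z. of_real (f' z)) t = 0" unfolding D[OF t] D[OF t0] Ieq .
  ultimately show ?thesis by simp
qed

text \<open>The residual of the time-integrated equation. It vanishes on derivatives of bumps and is
  hence a multiple of the mean of g; formally the multiple is minus the time integral of the k-th
  mode of the difference of the pressure gradients.\<close>

definition L :: "int \<Rightarrow> real \<Rightarrow> (real \<Rightarrow> complex) \<Rightarrow> complex" where
  "L k t g = (LINT z|unit_ivl. g z * X t k z) + I k g t"

lemma bounded_measurable_continuous:
  assumes "continuous_on {0..1} (g :: real \<Rightarrow> complex)"
  shows "g \<in> borel_measurable unit_ivl" "\<exists>B. \<forall>z\<in>{0..1}. norm (g z) \<le> B"
proof -
  show "g \<in> borel_measurable unit_ivl" by (rule measurable_unit_continuous[OF assms])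
  show "\<exists>B. \<forall>z\<in>{0..1}. norm (g z) \<le> B"
    using compact_imp_bounded[OF compact_continuous_image[OF assms]] by (metis bounded_iff compact_Icc imageI)
qed

lemma M_pairing_integrable_on:
  assumes t: "t \<in> {0..T}" and g: "continuous_on {0..1} g"
  shows "(\<lambda>r. LINT z|unit_ivl. g z * M r k z) integrable_on {0..t}"
proof -
  obtain B where B: "\<forall>z\<in>{0..1}. norm (g z) \<le> B" using bounded_measurable_continuous(2)[OF g] by blast
  have "continuous_on {0..T} (\<lambda>r. LINT z|unit_ivl. g z * M r k z)"
    by (rule M_pairing_continuous[OF bounded_measurable_continuous(1)[OF g]]) (use B in auto)
  then have "continuous_on {0..t} (\<lambda>r. LINT z|unit_ivl. g z * M r k z)"
    by (rule continuous_on_subset) (use t in auto)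
  then show ?thesis by (rule integrable_continuous_interval)
qed

lemma pair_integrable:
  fixes g Y :: "real \<Rightarrow> complex"
  assumes "continuous_on {0..1} g" "integrable unit_ivl Y"
  shows "integrable unit_ivl (\<lambda>z. g z * Y z)"
  using integrable_mult_continuous[OF assms(2,1)] by (simp add: mult.commute)

lemma L_add:
  assumes t: "t \<in> {0..T}" and g: "continuous_on {0..1} g" and h: "continuous_on {0..1} h"
  shows "L k t (\<lambda>z. g z + h z) = L k t g + L k t h"
proof -
  have "I k (\<lambda>z. g z + h z) t = integral {0..t} (\<lambda>r. (LINT z|unit_ivl. g z * M r k z) + (LINT z|unit_ivl. h z * M r k z))"
    unfolding I_def
  proof (rule Henstock_Kurzweil_Integration.integral_cong)
    fix r assume "r \<in> {0..t}"
    then have r: "r \<in> {0..T}" using t by auto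
    show "(LINT z|unit_ivl. (g z + h z) * M r k z) = (LINT z|unit_ivl. g z * M r k z) + (LINT z|unit_ivl. h z * M r k z)"
      unfolding distrib_right
      by (rule Bochner_Integration.integral_add[OF pair_integrable[OF g M_integrable[OF r]] pair_integrable[OF h M_integrable[OF r]]])
  qed
  also have "\<dots> = I k g t + I k h t"
    unfolding I_def by (rule Henstock_Kurzweil_Integration.integral_add[OF M_pairing_integrable_on[OF t g] M_pairing_integrable_on[OF t h]])
  finally have "I k (\<lambda>z. g z + h z) t = I k g t + I k h t" .
  moreover have "(LINT z|unit_ivl. (g z + h z) * X t k z) = (LINT z|unit_ivl. g z * X t k z) + (LINT z|unit_ivl. h z * X t k z)"
    unfolding distrib_right
    by (rule Bochner_Integration.integral_add[OF pair_integrable[OF g X_integrable[OF t]] pair_integrable[OF h X_integrable[OF t]]])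
  ultimately show ?thesis by (simp add: L_def)
qed

lemma L_scale: "L k t (\<lambda>z. c * g z) = c * L k t g"
proof -
  have "I k (\<lambda>z. c * g z) t = c * I k g t"
    unfolding I_def mult.assoc integral_mult_right_zero by (rule Henstock_Kurzweil_Integration.integral_mult_right)
  then show ?thesis unfolding L_def mult.assoc integral_mult_right_zero by (simp add: distrib_left)
qed

lemma continuous_of_real_bump: "bump 0 1 f \<Longrightarrow> continuous_on {0..1} (\<lambda>z. complex_of_real (f z))"
  by (intro continuous_intros bump_continuous)

text \<open>On bumps the claim is \<open>functional_vanishing_on_derivatives\<close>. Bounded
  approximation of h by bumps extends it, with dominated convergence in z and, under the majorant
  \<open>B * MB k\<close>, also in time; the constant c does not change.\<close>

lemma L_continuous_real:
  assumes t: "t \<in> {0..T}"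
  shows "\<exists>c. \<forall>h. continuous_on {0..1} h \<longrightarrow> L k t (\<lambda>z. complex_of_real (h z)) = of_real (LINT z|unit_ivl. h z) * c"
proof -
  have "\<exists>c. \<forall>f. bump 0 1 f \<longrightarrow> L k t (\<lambda>z. complex_of_real (f z)) = of_real (LINT x|ivl 0 1. f x) * c"
  proof (rule functional_vanishing_on_derivatives[of 0 1 "\<lambda>f. L k t (\<lambda>z. complex_of_real (f z))"])
    fix f g assume "bump 0 1 f" "bump 0 1 g"
    then show "L k t (\<lambda>z. complex_of_real (f z + g z)) = L k t (\<lambda>z. complex_of_real (f z)) + L k t (\<lambda>z. complex_of_real (g z))"
      using L_add[OF t continuous_of_real_bump continuous_of_real_bump, of f g k] by simp
  next
    show "L k t (\<lambda>z. complex_of_real (c * f z)) = complex_of_real c * L k t (\<lambda>z. complex_of_real (f z))" for c f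
      using L_scale[of k t "of_real c" "\<lambda>z. complex_of_real (f z)"] by simp
  next
    fix f f' assume "bump 0 1 f" "\<And>x. (f has_real_derivative f' x) (at x)" "bump 0 1 f'"
    then show "L k t (\<lambda>z. complex_of_real (f' z)) = 0" unfolding L_def by (rule bump_equation) (rule t)
  qed simp
  then obtain c :: complex where
    "\<forall>f. bump 0 1 f \<longrightarrow> L k t (\<lambda>z. complex_of_real (f z)) = of_real (LINT x|unit_ivl. f x) * c"
    unfolding unit_ivl_eq by blast
  then have c: "L k t (\<lambda>z. complex_of_real (f z)) = of_real (LINT x|unit_ivl. f x) * c" if "bump 0 1 f" for f
    using that by simp
  have "L k t (\<lambda>z. complex_of_real (h z)) = of_real (LINT z|unit_ivl. h z) * c" if h: "continuous_on {0..1} h" for h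
  proof -
    obtain H B where H: "\<And>n::nat. bump 0 1 (H n)" "\<And>n x. x \<in> {0..1} \<Longrightarrow> \<bar>H n x\<bar> \<le> B"
      "\<And>x. x \<in> {0<..<1} \<Longrightarrow> (\<lambda>n. H n x) \<longlonglongrightarrow> h x"
      using continuous_bump_approx[OF h] by metis
    have Hm: "H n \<in> borel_measurable unit_ivl" for n by (rule measurable_unit_continuous[OF bump_continuous[OF H(1)]])
    have hm: "h \<in> borel_measurable unit_ivl" by (rule measurable_unit_continuous[OF h])
    note conv = pairing_bounded_convergence[OF _ Hm hm H(2,3)]
    have l1: "(\<lambda>n. LINT z|unit_ivl. complex_of_real (H n z) * X t k z) \<longlonglongrightarrow> (LINT z|unit_ivl. complex_of_real (h z) * X t k z)"
      by (rule conv[OF X_integrable[OF t]]) auto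
    have l2: "(\<lambda>n. of_real (LINT z|unit_ivl. H n z) * c) \<longlonglongrightarrow> of_real (LINT z|unit_ivl. h z) * c"
    proof -
      have "(\<lambda>n. LINT z|unit_ivl. complex_of_real (H n z) * 1) \<longlonglongrightarrow> (LINT z|unit_ivl. complex_of_real (h z) * 1)"
        by (rule conv) auto
      then have "(\<lambda>n. complex_of_real (LINT z|unit_ivl. H n z)) \<longlonglongrightarrow> of_real (LINT z|unit_ivl. h z)" by simp
      from tendsto_mult[OF this tendsto_const] show ?thesis .
    qed
    have l3: "(\<lambda>n. I k (\<lambda>z. complex_of_real (H n z)) t) \<longlonglongrightarrow> I k (\<lambda>z. complex_of_real (h z)) t"
    proof -
      have cH: "continuous_on {0..t} (\<lambda>r. LINT z|unit_ivl. complex_of_real (H n z) * M r k z)" for n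
      proof -
        have "(\<lambda>z. complex_of_real (H n z)) \<in> borel_measurable unit_ivl" using Hm by measurable
        moreover have "norm (complex_of_real (H n z)) \<le> B" if "z \<in> {0..1}" for z using H(2)[OF that] by simp
        ultimately have "continuous_on {0..T} (\<lambda>r. LINT z|unit_ivl. complex_of_real (H n z) * M r k z)"
          by (rule M_pairing_continuous)
        then show ?thesis by (rule continuous_on_subset) (use t in auto)
      qed
      have ch: "continuous_on {0..t} (\<lambda>r. LINT z|unit_ivl. complex_of_real (h z) * M r k z)"
      proof -
        have c': "continuous_on {0..1} (\<lambda>z. complex_of_real (h z))" by (intro continuous_intros h)
        obtain B' where B': "\<forall>z\<in>{0..1}. norm (complex_of_real (h z)) \<le> B'" using bounded_measurable_continuous(2)[OF c'] by blast
        have "continuous_on {0..T} (\<lambda>r. LINT z|unit_ivl. complex_of_real (h z) * M r k z)"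
          by (rule M_pairing_continuous[OF bounded_measurable_continuous(1)[OF c']]) (use B' in auto)
        then show ?thesis by (rule continuous_on_subset) (use t in auto)
      qed
      have "(\<lambda>n. LINT r|ivl 0 t. LINT z|unit_ivl. complex_of_real (H n z) * M r k z) \<longlonglongrightarrow>
          (LINT r|ivl 0 t. LINT z|unit_ivl. complex_of_real (h z) * M r k z)"
      proof (rule integral_dominated_convergence[where w = "\<lambda>r. B * MB k"])
        show "(\<lambda>r. LINT z|unit_ivl. complex_of_real (H n z) * M r k z) \<in> borel_measurable (ivl 0 t)" for n
          by (rule measurable_ivl_continuous[OF cH])
        show "(\<lambda>r. LINT z|unit_ivl. complex_of_real (h z) * M r k z) \<in> borel_measurable (ivl 0 t)"
          by (rule measurable_ivl_continuous[OF ch])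
        show "integrable (ivl 0 t) (\<lambda>r. B * MB k)" by (rule finite_measure.integrable_const[OF finite_measure_ivl])
        show "AE r in ivl 0 t. norm (LINT z|unit_ivl. complex_of_real (H n z) * M r k z) \<le> B * MB k" for n
        proof (rule AE_I2)
          fix r assume "r \<in> space (ivl 0 t)"
          then have r: "r \<in> {0..T}" using t by (auto simp: space_restrict_space)
          have "(\<lambda>z. complex_of_real (H n z)) \<in> borel_measurable unit_ivl" using Hm by measurable
          then show "norm (LINT z|unit_ivl. complex_of_real (H n z) * M r k z) \<le> B * MB k"
            by (rule M_pairing_bound[OF r]) (use H(2) in auto)
        qed
        show "AE r in ivl 0 t. (\<lambda>n. LINT z|unit_ivl. complex_of_real (H n z) * M r k z) \<longlonglongrightarrow> (LINT z|unit_ivl. complex_of_real (h z) * M r k z)"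
        proof (rule AE_I2)
          fix r assume "r \<in> space (ivl 0 t)"
          then have r: "r \<in> {0..T}" using t by (auto simp: space_restrict_space)
          show "(\<lambda>n. LINT z|unit_ivl. complex_of_real (H n z) * M r k z) \<longlonglongrightarrow> (LINT z|unit_ivl. complex_of_real (h z) * M r k z)"
            by (rule conv[OF M_integrable[OF r]]) auto
        qed
      qed
      then show ?thesis unfolding I_def by (simp only: integral_ivl_continuous(1)[OF cH] integral_ivl_continuous(1)[OF ch])
    qed
    have "(\<lambda>n. L k t (\<lambda>z. complex_of_real (H n z))) \<longlonglongrightarrow> L k t (\<lambda>z. complex_of_real (h z))"
      unfolding L_def by (intro tendsto_add l1 l3)
    then show ?thesis using LIMSEQ_unique[OF _ l2] c[OF H(1)] by simp
  qed
  then show ?thesis by blast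
qed

text \<open>For mean zero the unknown multiple in \<open>L_continuous_real\<close> is multiplied by
  0. Complex g are split into real and imaginary part, both of mean zero.\<close>

lemma mean_zero_equation:
  assumes t: "t \<in> {0..T}" and g: "continuous_on {0..1} g" and mean: "(LINT z|unit_ivl. g z) = 0"
  shows "(LINT z|unit_ivl. g z * X t k z) + I k g t = 0"
proof -
  obtain c where c: "\<And>h. continuous_on {0..1} h \<Longrightarrow> L k t (\<lambda>z. complex_of_real (h z)) = of_real (LINT z|unit_ivl. h z) * c"
    using L_continuous_real[OF t] by blast
  have cr: "continuous_on {0..1} (\<lambda>z. Re (g z))" "continuous_on {0..1} (\<lambda>z. Im (g z))"
    by (intro continuous_intros g)+
  have "L k t g = L k t (\<lambda>z. complex_of_real (Re (g z)) + \<i> * complex_of_real (Im (g z)))"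
    by (simp flip: complex_eq)
  also have "\<dots> = L k t (\<lambda>z. complex_of_real (Re (g z))) + L k t (\<lambda>z. \<i> * complex_of_real (Im (g z)))"
    by (intro L_add t continuous_intros cr)
  also have "\<dots> = (of_real (LINT z|unit_ivl. Re (g z)) + \<i> * of_real (LINT z|unit_ivl. Im (g z))) * c"
    unfolding L_scale c[OF cr(1)] c[OF cr(2)] by (simp add: algebra_simps)
  also have "(LINT z|unit_ivl. Re (g z)) = 0" using mean integral_Re[OF integrable_unit_continuous[OF g]] by simp
  also have "(LINT z|unit_ivl. Im (g z)) = 0" using mean integral_Im[OF integrable_unit_continuous[OF g]] by simp
  finally show ?thesis by (simp add: L_def)
qed

lemma mean_zero_increment:
  assumes s: "s \<in> {0..T}" and t: "t \<in> {0..T}" and g: "continuous_on {0..1} g" and mean: "(LINT z|unit_ivl. g z) = 0"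
  shows "(LINT z|unit_ivl. g z * (Dm t k z - Dm s k z)) = - (I k g t - I k g s)"
proof -
  have "(LINT z|unit_ivl. g z * (Dm t k z - Dm s k z)) = (LINT z|unit_ivl. g z * X t k z - g z * X s k z)"
    by (intro Bochner_Integration.integral_cong) (auto simp: X_def algebra_simps)
  also have "\<dots> = (LINT z|unit_ivl. g z * X t k z) - (LINT z|unit_ivl. g z * X s k z)"
    by (rule Bochner_Integration.integral_diff[OF pair_integrable[OF g X_integrable[OF t]] pair_integrable[OF g X_integrable[OF s]]])
  finally show ?thesis using mean_zero_equation[OF t g mean, of k] mean_zero_equation[OF s g mean, of k]
    by (simp add: add_eq_0_iff)
qed

lemma I_derivative:
  assumes g: "continuous_on {0..1} g" and s: "s \<in> {0..T}"
  shows "(I k g has_vector_derivative (LINT z|unit_ivl. g z * M s k z)) (at s within {0..T})"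
proof -
  obtain B where B: "\<forall>z\<in>{0..1}. norm (g z) \<le> B" using bounded_measurable_continuous(2)[OF g] by blast
  have "continuous_on {0..T} (\<lambda>r. LINT z|unit_ivl. g z * M r k z)"
    by (rule M_pairing_continuous[OF bounded_measurable_continuous(1)[OF g]]) (use B in auto)
  from integral_has_vector_derivative[OF this s] show ?thesis by (simp add: I_def[abs_def])
qed

text \<open>The Lipschitz constant is proportional to the sup norm of the test function. This is
  what controls a test function that depends on time and shrinks as t approaches s.\<close>

lemma I_Lipschitz:
  assumes g: "continuous_on {0..1} g" and B: "\<And>z. z \<in> {0..1} \<Longrightarrow> norm (g z) \<le> B"
    and s: "s \<in> {0..T}" and t: "t \<in> {0..T}"
  shows "norm (I k g t - I k g s) \<le> B * MB k * \<bar>t - s\<bar>"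
proof -
  have le: "norm (I k g t - I k g s) \<le> B * MB k * (t - s)" if s: "s \<in> {0..T}" and t: "t \<in> {0..T}" and "s \<le> t" for s t
  proof -
    let ?f = "\<lambda>r. LINT z|unit_ivl. g z * M r k z"
    have c: "continuous_on {0..T} ?f"
      by (rule M_pairing_continuous[OF bounded_measurable_continuous(1)[OF g]]) (use B in auto)
    have "integral {0..s} ?f + integral {s..t} ?f = integral {0..t} ?f"
      using s t \<open>s \<le> t\<close> by (intro Henstock_Kurzweil_Integration.integral_combine M_pairing_integrable_on[OF t g]) auto
    then have "I k g t - I k g s = integral {s..t} ?f" by (simp add: I_def algebra_simps)
    also have "norm (integral {s..t} ?f) \<le> B * MB k * (t - s)"
    proof (rule integral_bound[OF \<open>s \<le> t\<close>])
      show "continuous_on {s..t} ?f" by (rule continuous_on_subset[OF c]) (use s t in auto)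
      show "norm (?f r) \<le> B * MB k" if "r \<in> {s..t}" for r
        by (rule M_pairing_bound[OF _ bounded_measurable_continuous(1)[OF g]]) (use B that s t in auto)
    qed
    finally show ?thesis .
  qed
  show ?thesis
    using le[OF s t] le[OF t s] by (cases "s \<le> t") (auto simp: norm_minus_commute)
qed

text \<open>Continuity of the vorticity modes in \<open>L2\<close> gives continuity of the velocity
  modes uniformly in z, via the sup bound for mean-zero primitives.\<close>

lemma Dm_sup_tendsto:
  assumes s: "s \<in> {0..T}"
  shows "((\<lambda>t. nrm (\<lambda>z. Th t k z - Th s k z)) \<longlongrightarrow> 0) (at s within {0..T})"
    and "t \<in> {0..T} \<Longrightarrow> norm (Dm t k z - Dm s k z) \<le> nrm (\<lambda>z. Th t k z - Th s k z)"
proof -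
  let ?a = "\<lambda>t z. fourier_h (\<omega>1 t) k z - fourier_h (\<omega>1 s) k z" and ?b = "\<lambda>t z. fourier_h (\<omega>2 t) k z - fourier_h (\<omega>2 s) k z"
  have le: "nrm (\<lambda>z. Th t k z - Th s k z) \<le> nrm (?a t) + nrm (?b t)" if t: "t \<in> {0..T}" for t
  proof -
    have a: "sq_int (?a t)" by (rule sq_int_diff[OF A.sq_modes(4)[OF t] A.sq_modes(4)[OF s]])
    have b: "sq_int (?b t)" by (rule sq_int_diff[OF B.sq_modes(4)[OF t] B.sq_modes(4)[OF s]])
    have "(\<lambda>z. Th t k z - Th s k z) = (\<lambda>z. ?a t z + (-1) * ?b t z)" by (auto simp: Th_def)
    then have "nrm (\<lambda>z. Th t k z - Th s k z) \<le> nrm (?a t) + nrm (\<lambda>z. (-1) * ?b t z)"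
      using nrm_triangle[OF a sq_int_scale(1)[OF b, of "-1"]] by (simp only:)
    then show ?thesis by (simp only: sq_int_scale(2)) simp
  qed
  show "((\<lambda>t. nrm (\<lambda>z. Th t k z - Th s k z)) \<longlongrightarrow> 0) (at s within {0..T})"
  proof (rule tendsto_sandwich[OF _ _ tendsto_const])
    show "\<forall>\<^sub>F t in at s within {0..T}. nrm (\<lambda>z. Th t k z - Th s k z) \<le> nrm (?a t) + nrm (?b t)"
      unfolding eventually_at_filter using le by (intro always_eventually) auto
    show "((\<lambda>t. nrm (?a t) + nrm (?b t)) \<longlongrightarrow> 0) (at s within {0..T})"
      using tendsto_add[OF A.\<omega>_cont[OF s, of k] B.\<omega>_cont[OF s, of k]] by simp
  qed auto
  assume t: "t \<in> {0..T}"
  have "Dm t k z - Dm s k z = mprim (\<lambda>z. Th t k z - Th s k z) z"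
    unfolding Dm_eq[OF t] Dm_eq[OF s]
    by (rule mprim_diff[symmetric, OF sq_int_integrable(1)[OF Th_sq_int[OF t]] sq_int_integrable(1)[OF Th_sq_int[OF s]]])
  then show "norm (Dm t k z - Dm s k z) \<le> nrm (\<lambda>z. Th t k z - Th s k z)"
    using norm_mprim_le[OF sq_int_diff[OF Th_sq_int[OF t] Th_sq_int[OF s]]] by simp
qed

lemma energy_derivative:
  assumes s: "s \<in> {0..T}"
  shows "((\<lambda>t. (mnorm (d t) k)\<^sup>2) has_real_derivative - 2 * Re (LINT z|unit_ivl. cnj (Dm s k z) * M s k z)) (at s within {0..T})"
proof -
  define y where "y t = (LINT z|unit_ivl. (norm (Dm t k z))\<^sup>2)" for t
  have y: "(mnorm (d t) k)\<^sup>2 = y t" if "t \<in> {0..T}" for t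
    using nrm_Dm[OF that, of k] by (simp add: y_def flip: nrm_power2)
  define L where "L = (LINT z|unit_ivl. cnj (Dm s k z) * M s k z)"
  define gs where "gs z = cnj (Dm s k z)" for z
  have gs: "continuous_on {0..1} gs" unfolding gs_def by (intro continuous_intros Dm_continuous s)
  have gs0: "(LINT z|unit_ivl. gs z) = 0" unfolding gs_def using Dm_mean[OF s, of k] by simp
  define R where "R t = nrm (\<lambda>z. Th t k z - Th s k z) * MB k" for t
  have key: "\<bar>y t - y s + 2 * Re (I k gs t - I k gs s)\<bar> \<le> R t * \<bar>t - s\<bar>" if t: "t \<in> {0..T}" for t
  proof -
    define gt where "gt z = cnj (Dm t k z - Dm s k z)" for z
    have gt: "continuous_on {0..1} gt" unfolding gt_def by (intro continuous_intros Dm_continuous s t)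
    have gt0: "(LINT z|unit_ivl. gt z) = 0"
      unfolding gt_def using Dm_mean[OF s, of k] Dm_mean[OF t, of k]
        sq_int_integrable(1)[OF Dm_sq_int[OF s]] sq_int_integrable(1)[OF Dm_sq_int[OF t]] by simp
    have cD: "continuous_on {0..1} (\<lambda>z. Dm t k z - Dm s k z)" by (intro continuous_intros Dm_continuous s t)
    have iD: "integrable unit_ivl (\<lambda>z. Dm t k z - Dm s k z)" by (rule integrable_unit_continuous[OF cD])
    have i1: "integrable unit_ivl (\<lambda>z. gt z * (Dm t k z - Dm s k z))" "integrable unit_ivl (\<lambda>z. gs z * (Dm t k z - Dm s k z))"
      by (intro pair_integrable gt gs iD)+
    have i2: "integrable unit_ivl (\<lambda>z. (norm (Dm r k z))\<^sup>2)" if "r \<in> {0..T}" for r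
      using Dm_sq_int[OF that] by (simp add: sq_int_def)
    have alg: "(norm a)\<^sup>2 - (norm b)\<^sup>2 = Re (cnj (a - b) * (a - b)) + 2 * Re (cnj b * (a - b))" for a b :: complex
      unfolding cmod_power2 by (simp add: algebra_simps power2_eq_square)
    \<comment> \<open>The identity |a|^2 - |b|^2 = |a - b|^2 + 2 Re (cnj b (a - b)); both summands
      are pairings of the increment with functions of mean zero, namely \<open>gt\<close> and
      \<open>gs\<close>.\<close>
    have "y t - y s = (LINT z|unit_ivl. (norm (Dm t k z))\<^sup>2 - (norm (Dm s k z))\<^sup>2)"
      unfolding y_def by (rule Bochner_Integration.integral_diff[symmetric, OF i2[OF t] i2[OF s]])
    also have "\<dots> = (LINT z|unit_ivl. Re (gt z * (Dm t k z - Dm s k z)) + 2 * Re (gs z * (Dm t k z - Dm s k z)))"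
      unfolding gt_def gs_def alg ..
    also have "\<dots> = (LINT z|unit_ivl. Re (gt z * (Dm t k z - Dm s k z))) + (LINT z|unit_ivl. 2 * Re (gs z * (Dm t k z - Dm s k z)))"
      by (intro Bochner_Integration.integral_add integrable_mult_right integrable_Re i1)
    also have "\<dots> = Re (LINT z|unit_ivl. gt z * (Dm t k z - Dm s k z)) + 2 * Re (LINT z|unit_ivl. gs z * (Dm t k z - Dm s k z))"
      unfolding integral_mult_right_zero integral_Re[OF i1(1)] integral_Re[OF i1(2)] ..
    also have "\<dots> = - Re (I k gt t - I k gt s) - 2 * Re (I k gs t - I k gs s)"
      unfolding mean_zero_increment[OF s t gt gt0] mean_zero_increment[OF s t gs gs0] by simp
    finally have "y t - y s + 2 * Re (I k gs t - I k gs s) = - Re (I k gt t - I k gt s)" by simp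
    moreover have "norm (I k gt t - I k gt s) \<le> R t * \<bar>t - s\<bar>"
      unfolding R_def
      by (rule I_Lipschitz[OF gt _ s t]) (unfold gt_def complex_mod_cnj, rule Dm_sup_tendsto(2)[OF s t])
    ultimately show ?thesis using abs_Re_le_cmod[of "I k gt t - I k gt s"] by simp
  qed
  have R0: "(R \<longlongrightarrow> 0) (at s within {0..T})"
    unfolding R_def[abs_def] using tendsto_mult[OF Dm_sup_tendsto(1)[OF s, of k] tendsto_const, of "MB k"] by simp
  have ID: "((\<lambda>t. Re (I k gs t)) has_real_derivative Re L) (at s within {0..T})"
    using bounded_linear.has_vector_derivative[OF bounded_linear_Re I_derivative[OF gs s, of k]]
    by (simp add: has_real_derivative_iff_has_vector_derivative L_def gs_def)
  \<comment> \<open>Adding back the linear part leaves a function whose difference quotient at s is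
    bounded by \<open>R t\<close>, which tends to 0.\<close>
  have Z: "((\<lambda>t. y t + 2 * Re (I k gs t)) has_real_derivative 0) (at s within {0..T})"
    unfolding has_field_derivative_iff
  proof (rule Lim_null_comparison[OF _ R0])
    show "\<forall>\<^sub>F t in at s within {0..T}. norm ((y t + 2 * Re (I k gs t) - (y s + 2 * Re (I k gs s))) / (t - s)) \<le> R t"
      unfolding eventually_at_filter
    proof (rule always_eventually, intro allI impI)
      fix t assume t: "t \<noteq> s" "t \<in> {0..T}"
      then have "0 < \<bar>t - s\<bar>" by simp
      moreover have "\<bar>y t + 2 * Re (I k gs t) - (y s + 2 * Re (I k gs s))\<bar> \<le> R t * \<bar>t - s\<bar>"
        using key[OF t(2)] by (simp add: algebra_simps)
      ultimately show "norm ((y t + 2 * Re (I k gs t) - (y s + 2 * Re (I k gs s))) / (t - s)) \<le> R t"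
        by (simp add: divide_le_eq)
    qed
  qed
  have "((\<lambda>t. (y t + 2 * Re (I k gs t)) - 2 * Re (I k gs t)) has_real_derivative 0 - 2 * Re L) (at s within {0..T})"
    by (intro DERIV_diff Z DERIV_cmult ID)
  then have "(y has_real_derivative - 2 * Re L) (at s within {0..T})" by simp
  then show ?thesis unfolding L_def
    by (rule has_field_derivative_transform_within[OF _ zero_less_one s]) (simp add: y)
qed

end

subsection \<open>The nonlinear estimate and uniqueness\<close>

text \<open>The function (y + c / a) exp (-a t) is nonincreasing. The constant term c is kept
  because the truncated energy satisfies its inequality only up to an error.\<close>

lemma Gronwall_linear:
  fixes y y' :: "real \<Rightarrow> real"
  assumes d: "\<And>t. t \<in> {0..T} \<Longrightarrow> (y has_real_derivative y' t) (at t within {0..T})"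
    and le: "\<And>t. t \<in> {0..T} \<Longrightarrow> y' t \<le> a * y t + c" and "0 < a" "0 \<le> c" "y 0 = 0" and t: "t \<in> {0..T}"
  shows "y t \<le> c / a * exp (a * T)"
proof -
  define h where "h t = (y t + c / a) * exp (- a * t)" for t
  have hd: "(h has_real_derivative (y' t - a * y t - c) * exp (- a * t)) (at t within {0..T})" if "t \<in> {0..T}" for t
    unfolding h_def[abs_def] using \<open>0 < a\<close>
    by (auto intro!: derivative_eq_intros d that simp: field_simps)
  have "h t \<le> h 0"
  proof (cases "t = 0")
    case False
    then have "0 < t" using t by simp
    show ?thesis
    proof (rule DERIV_nonpos_imp_decreasing_open[of 0 t h])
      show "0 \<le> t" using t by simp
      have "continuous_on {0..T} h" by (rule DERIV_continuous_on[OF hd])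
      then show "continuous_on {0..t} h" by (rule continuous_on_subset) (use t in auto)
      fix x assume x: "0 < x" "x < t"
      then have xT: "x \<in> {0..T}" using t by auto
      have "at x within {0..T} = at x" using x t by (intro at_within_interior) auto
      with hd[OF xT] have "(h has_real_derivative (y' x - a * y x - c) * exp (- a * x)) (at x)" by simp
      moreover have "(y' x - a * y x - c) * exp (- a * x) \<le> 0"
        using le[OF xT] by (intro mult_nonpos_nonneg) auto
      ultimately show "\<exists>y. (h has_real_derivative y) (at x) \<and> y \<le> 0" by blast
    qed
  qed simp
  then have "(y t + c / a) * exp (- a * t) \<le> c / a" using \<open>y 0 = 0\<close> by (simp add: h_def)
  then have "(y t + c / a) * exp (- a * t) * exp (a * t) \<le> c / a * exp (a * t)" by (intro mult_right_mono) auto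
  then have "y t + c / a \<le> c / a * exp (a * t)" by (simp add: mult.assoc flip: exp_add)
  also have "\<dots> \<le> c / a * exp (a * T)" using assms by (intro mult_left_mono) auto
  finally show ?thesis using assms by (smt (verit) divide_nonneg_pos)
qed

text \<open>Reduces the sum of product modes to double sums of triple integrals. The truncation
  errors vanish as n grows, W being fixed, so a bound Q valid for all finite F survives without
  loss.\<close>

lemma sum_mode_product_le:
  fixes G :: "int \<Rightarrow> real \<Rightarrow> complex"
  assumes f: "f \<in> L2" and h: "h \<in> L2"
    and tail: "\<And>n F. finite F \<Longrightarrow> (\<And>k. k \<in> F \<Longrightarrow> int n \<le> \<bar>k\<bar>) \<Longrightarrow> (\<Sum>l\<in>F. mnorm f l) \<le> \<tau> n"
    and \<tau>: "\<tau> \<longlonglongrightarrow> 0" and H: "\<And>j. mnorm h j \<le> H"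
    and G: "\<And>k. G k \<in> borel_measurable unit_ivl" and B: "\<And>k z. z \<in> {0..1} \<Longrightarrow> norm (G k z) \<le> B k"
    and W: "finite W"
    and Q: "\<And>F. finite F \<Longrightarrow>
      (\<Sum>k\<in>W. \<Sum>l\<in>F. norm (LINT z|unit_ivl. G k z * (fourier_h f l z * fourier_h h (k - l) z))) \<le> Q"
  shows "(\<Sum>k\<in>W. norm (LINT z|unit_ivl. G k z * fourier_h (\<lambda>q. f q * h q) k z)) \<le> Q"
proof -
  let ?I = "\<lambda>k. LINT z|unit_ivl. G k z * fourier_h (\<lambda>q. f q * h q) k z"
  let ?t = "\<lambda>k l. LINT z|unit_ivl. G k z * (fourier_h f l z * fourier_h h (k - l) z)"
  have err: "norm (?I k - (\<Sum>l\<in>{- int n..int n}. ?t k l)) \<le> B k * (\<tau> (Suc n) * H)" for k n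
    by (rule mode_product_error[OF f h tail H G B])
  have le: "(\<Sum>k\<in>W. norm (?I k)) \<le> Q + (\<Sum>k\<in>W. B k) * (\<tau> (Suc n) * H)" for n
  proof -
    have "norm (?I k) \<le> (\<Sum>l\<in>{- int n..int n}. norm (?t k l)) + B k * (\<tau> (Suc n) * H)" for k
      using norm_triangle_sub[of "?I k" "\<Sum>l\<in>{- int n..int n}. ?t k l"] err[of k n]
        norm_sum[of "?t k" "{- int n..int n}"] by linarith
    then have "(\<Sum>k\<in>W. norm (?I k)) \<le> (\<Sum>k\<in>W. (\<Sum>l\<in>{- int n..int n}. norm (?t k l)) + B k * (\<tau> (Suc n) * H))"
      by (rule sum_mono)
    also have "\<dots> = (\<Sum>k\<in>W. \<Sum>l\<in>{- int n..int n}. norm (?t k l)) + (\<Sum>k\<in>W. B k) * (\<tau> (Suc n) * H)"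
      by (simp add: sum.distrib sum_distrib_right)
    also have "\<dots> \<le> Q + (\<Sum>k\<in>W. B k) * (\<tau> (Suc n) * H)" by (intro add_right_mono Q) simp
    finally show ?thesis .
  qed
  have "(\<lambda>n. Q + (\<Sum>k\<in>W. B k) * (\<tau> (Suc n) * H)) \<longlonglongrightarrow> Q + (\<Sum>k\<in>W. B k) * (0 * H)"
    by (intro tendsto_intros LIMSEQ_Suc \<tau>)
  then show ?thesis using LIMSEQ_le_const[of _ Q] le by simp
qed

section \<open>Bounds for the nonlinear terms by the trilinear sum\<close>

context modal_pair
begin

definition b :: "real \<Rightarrow> int \<Rightarrow> real" where "b t k = mnorm (\<omega>1 t) k + mnorm (\<omega>2 t) k"

definition e :: "real \<Rightarrow> int \<Rightarrow> real" where "e t k = mnorm (d t) k"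

definition S :: "real \<Rightarrow> (int \<times> int) set \<Rightarrow> real" where
  "S t P = (\<Sum>(i, j)\<in>P. \<bar>real_of_int i\<bar> * e t i * e t j * b t (i + j))"

lemma e_nonneg [simp]: "0 \<le> e t k" and b_nonneg [simp]: "0 \<le> b t k"
  by (simp_all add: e_def b_def)

lemma e_uminus: "e t (- k) = e t k" and b_uminus: "b t (- k) = b t k"
  by (simp_all add: e_def b_def mnorm_uminus)

lemma nrm_cnj_Dm: "t \<in> {0..T} \<Longrightarrow> nrm (\<lambda>z. cnj (Dm t k z)) = e t k"
  by (simp add: sq_int_cnj(2) nrm_Dm e_def)

lemma weighted_square_sum_le:
  fixes x y :: "int \<Rightarrow> real"
  assumes "(\<Sum>k\<in>F. g k * (x k)\<^sup>2) \<le> K'" "(\<Sum>k\<in>F. g k * (y k)\<^sup>2) \<le> K'"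
    and "\<And>k. 0 \<le> z k" "\<And>k. z k \<le> x k + y k" "\<And>k. (0::real) \<le> g k"
  shows "(\<Sum>k\<in>F. g k * (z k)\<^sup>2) \<le> 4 * K'"
proof -
  have "(z k)\<^sup>2 \<le> 2 * (x k)\<^sup>2 + 2 * (y k)\<^sup>2" for k
  proof -
    have "(z k)\<^sup>2 \<le> (x k + y k)\<^sup>2" by (intro power_mono assms)
    also have "\<dots> \<le> 2 * (x k)\<^sup>2 + 2 * (y k)\<^sup>2"
      using sum_squares_bound[of "x k" "y k"] by (simp add: power2_sum)
    finally show ?thesis .
  qed
  then have "(\<Sum>k\<in>F. g k * (z k)\<^sup>2) \<le> (\<Sum>k\<in>F. g k * (2 * (x k)\<^sup>2 + 2 * (y k)\<^sup>2))"
    by (intro sum_mono mult_left_mono assms)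
  also have "\<dots> = 2 * (\<Sum>k\<in>F. g k * (x k)\<^sup>2) + 2 * (\<Sum>k\<in>F. g k * (y k)\<^sup>2)"
    by (simp add: distrib_left sum.distrib sum_distrib_left mult_ac)
  finally show ?thesis using assms(1,2) by linarith
qed

lemma b_bound: "t \<in> {0..T} \<Longrightarrow> finite F \<Longrightarrow> (\<Sum>k\<in>F. jb k powr \<alpha> * (b t k)\<^sup>2) \<le> 4 * K"
  by (rule weighted_square_sum_le[OF A.\<omega>_bound B.\<omega>_bound]) (auto simp: b_def)

lemma mnorm_diff_le: "f \<in> L2 \<Longrightarrow> g \<in> L2 \<Longrightarrow> mnorm (\<lambda>q. f q - g q) k \<le> mnorm f k + mnorm g k"
proof -
  assume fg: "f \<in> L2" "g \<in> L2"
  have "nrm (\<lambda>z. fourier_h f k z + (-1) * fourier_h g k z) \<le> nrm (fourier_h f k) + nrm (\<lambda>z. (-1) * fourier_h g k z)"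
    by (rule nrm_triangle[OF fourier_h_sq_int[OF fg(1)] sq_int_scale(1)[OF fourier_h_sq_int[OF fg(2)]]])
  then show ?thesis unfolding sq_int_scale(2) mnorm_diff[OF fg] by (simp add: mnorm_def)
qed

lemma e_bound: "t \<in> {0..T} \<Longrightarrow> finite F \<Longrightarrow> (\<Sum>k\<in>F. jb k powr (2 * \<alpha>) * (e t k)\<^sup>2) \<le> 4 * K"
  unfolding e_def d_def[abs_def]
  by (rule weighted_square_sum_le[OF A.u_bound B.u_bound]) (auto intro!: mnorm_diff_le A.uL2 B.uL2)

lemma mnorm_\<theta>_le: "t \<in> {0..T} \<Longrightarrow> mnorm (\<theta> t) k \<le> b t k"
  unfolding \<theta>_def[abs_def] b_def by (intro mnorm_diff_le A.\<omega>L2 B.\<omega>L2)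

lemma sum_\<theta>_le:
  assumes "t \<in> {0..T}" "finite F" "\<And>k. k \<in> F \<Longrightarrow> int n \<le> \<bar>k\<bar>"
  shows "(\<Sum>k\<in>F. mnorm (\<theta> t) k) \<le> 2 * A.tail n"
proof -
  have "(\<Sum>k\<in>F. mnorm (\<theta> t) k) \<le> (\<Sum>k\<in>F. mnorm (\<omega>1 t) k + mnorm (\<omega>2 t) k)"
    using mnorm_\<theta>_le[OF assms(1)] by (intro sum_mono) (simp add: b_def)
  also have "\<dots> = (\<Sum>k\<in>F. mnorm (\<omega>1 t) k) + (\<Sum>k\<in>F. mnorm (\<omega>2 t) k)" by (rule sum.distrib)
  finally show ?thesis using A.sum_mnorm_\<omega>_le[OF assms] B.sum_mnorm_\<omega>_le[OF assms] by linarith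
qed

lemma e_le_\<theta>: "t \<in> {0..T} \<Longrightarrow> e t k \<le> mnorm (\<theta> t) k"
  unfolding e_def nrm_Dm[symmetric]
  by (rule sq_int_bounded(2)[OF measurable_unit_continuous[OF Dm_continuous] norm_Dm_le])

lemma sum_e_le:
  assumes "t \<in> {0..T}" "finite F" "\<And>k. k \<in> F \<Longrightarrow> int n \<le> \<bar>k\<bar>"
  shows "(\<Sum>k\<in>F. mnorm (d t) k) \<le> 2 * A.tail n"
  by (rule order_trans[OF sum_mono sum_\<theta>_le[OF assms]]) (use e_le_\<theta> assms(1) in \<open>auto simp: e_def\<close>)

lemma tail2_tendsto: "(\<lambda>n. 2 * A.tail n) \<longlonglongrightarrow> 0"
  using tendsto_mult[OF tendsto_const A.tail_tendsto, of 2] by simp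

text \<open>Hoelder's inequality in z with exponents \<infinity>, 2, 2; the bounded factor g need be
  bounded only almost everywhere, as is known for the modes.\<close>

lemma norm_triple_integral_le:
  assumes g: "g \<in> borel_measurable unit_ivl" and gB: "AE z in unit_ivl. norm (g z) \<le> B" and "0 \<le> B"
    and f: "sq_int f" and h: "sq_int h"
  shows "norm (LINT z|unit_ivl. f z * (g z * h z)) \<le> B * (nrm f * nrm h)"
proof -
  note fh = sq_int_mult_integrable[OF f h]
  have [measurable]: "f \<in> borel_measurable unit_ivl" "h \<in> borel_measurable unit_ivl" using f h by measurable
  have le: "AE z in unit_ivl. norm (f z * (g z * h z)) \<le> B * norm (f z * h z)"
    using gB
  proof eventually_elim
    case (elim z)
    have "norm (f z * (g z * h z)) = norm (g z) * norm (f z * h z)" by (simp add: norm_mult mult_ac)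
    also have "\<dots> \<le> B * norm (f z * h z)" by (intro mult_right_mono elim) simp
    finally show ?case .
  qed
  have i: "integrable unit_ivl (\<lambda>z. B * norm (f z * h z))" using fh(1) by simp
  have int: "integrable unit_ivl (\<lambda>z. f z * (g z * h z))"
  proof (rule Bochner_Integration.integrable_bound[OF i])
    show "(\<lambda>z. f z * (g z * h z)) \<in> borel_measurable unit_ivl" using g by measurable
    show "AE z in unit_ivl. norm (f z * (g z * h z)) \<le> norm (B * norm (f z * h z))"
      using le by eventually_elim (use \<open>0 \<le> B\<close> in simp)
  qed
  have "norm (LINT z|unit_ivl. f z * (g z * h z)) \<le> (LINT z|unit_ivl. norm (f z * (g z * h z)))"
    by (rule integral_norm_bound)
  also have "\<dots> \<le> (LINT z|unit_ivl. B * norm (f z * h z))"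
    by (rule integral_mono_AE[OF integrable_norm[OF int] i le])
  also have "\<dots> \<le> B * (nrm f * nrm h)" using fh(2) \<open>0 \<le> B\<close> by (simp add: mult_left_mono)
  finally show ?thesis .
qed

lemma norm_u_AE:
  assumes t: "t \<in> {0..T}"
  shows "AE z in unit_ivl. norm (fourier_h (u1 t) k z) \<le> b t k"
    and "AE z in unit_ivl. norm (fourier_h (u2 t) k z) \<le> b t k"
proof -
  have n1: "norm (mprim (fourier_h (\<omega>1 t) k) z) \<le> b t k" for z
    using norm_mprim_le[OF A.sq_modes(4)[OF t], of k z] by (simp add: b_def mnorm_def add_increasing2)
  show "AE z in unit_ivl. norm (fourier_h (u1 t) k z) \<le> b t k"
    using A.u_mode[OF t, of k] by eventually_elim (simp add: n1)
  have n2: "norm (mprim (fourier_h (\<omega>2 t) k) z) \<le> b t k" for z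
    using norm_mprim_le[OF B.sq_modes(4)[OF t], of k z] by (simp add: b_def mnorm_def add_increasing)
  show "AE z in unit_ivl. norm (fourier_h (u2 t) k z) \<le> b t k"
    using B.u_mode[OF t, of k] by eventually_elim (simp add: n2)
qed

lemma norm_v_AE:
  assumes t: "t \<in> {0..T}"
  shows "AE z in unit_ivl. norm (fourier_h (v1 t) k z) \<le> 2 * pi * \<bar>of_int k\<bar> * b t k"
    and "AE z in unit_ivl. norm (fourier_h (v2 t) k z) \<le> 2 * pi * \<bar>of_int k\<bar> * b t k"
proof -
  show "AE z in unit_ivl. norm (fourier_h (v1 t) k z) \<le> 2 * pi * \<bar>of_int k\<bar> * b t k"
    using A.v_mode[OF t, of k] norm_u_AE(1)[OF t, of k]
    by eventually_elim (auto simp: norm_mult intro!: mult_left_mono)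
  show "AE z in unit_ivl. norm (fourier_h (v2 t) k z) \<le> 2 * pi * \<bar>of_int k\<bar> * b t k"
    using B.v_mode[OF t, of k] norm_u_AE(2)[OF t, of k]
    by eventually_elim (auto simp: norm_mult intro!: mult_left_mono)
qed

lemma dv_mode:
  assumes t: "t \<in> {0..T}"
  shows "AE z in unit_ivl. fourier_h (dv t) k z = 2 * pi * \<i> * of_int k * Dm t k z"
  using fourier_h_diff[OF L2_integrable[OF A.vL2[OF t]] L2_integrable[OF B.vL2[OF t]], of k]
    A.v_mode[OF t, of k] B.v_mode[OF t, of k] u_modes_Dm[OF t, of k]
  unfolding dv_def[abs_def] by eventually_elim (metis right_diff_distrib)

lemma mnorm_dv: 
  assumes t: "t \<in> {0..T}" shows "mnorm (dv t) k = 2 * pi * \<bar>of_int k\<bar> * e t k"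
proof -
  have "mnorm (dv t) k = nrm (\<lambda>z. 2 * pi * \<i> * of_int k * Dm t k z)"
    unfolding mnorm_def
    by (rule nrm_cong_AE[OF dv_mode[OF t] fourier_h_measurable[OF L2_measurable[OF diff_L2(2)[OF t]]]
          sq_int_measurable[OF sq_int_scale(1)[OF Dm_sq_int[OF t]]]])
  then show ?thesis by (simp only: sq_int_scale(2) nrm_Dm[OF t]) (simp add: norm_mult e_def)
qed

lemma norm_dw_AE:
  assumes t: "t \<in> {0..T}"
  shows "AE z in unit_ivl. norm (fourier_h (dw t) k z) \<le> 2 * pi * \<bar>of_int k\<bar> * e t k"
proof -
  let ?g = "\<lambda>z. fourier_h (v1 t) k z - fourier_h (v2 t) k z"
  have g: "sq_int ?g" by (rule sq_int_diff[OF A.sq_modes(2)[OF t] B.sq_modes(2)[OF t]])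
  have ng: "nrm ?g = mnorm (dv t) k" unfolding dv_def[abs_def] by (rule mnorm_diff[symmetric, OF A.vL2[OF t] B.vL2[OF t]])
  have p: "prim0 ?g z = prim0 (fourier_h (v1 t) k) z - prim0 (fourier_h (v2 t) k) z" for z
    using prim0_add[OF A.int_modes(2)[OF t], of "\<lambda>z. (-1) * fourier_h (v2 t) k z" k z]
      prim0_scale[of "-1" "fourier_h (v2 t) k" z] B.int_modes(2)[OF t, of k] by simp
  have "AE z in unit_ivl. z \<in> {0..1}" by (rule AE_I2) simp
  then show ?thesis
    using fourier_h_diff[OF L2_integrable[OF A.wL2[OF t]] L2_integrable[OF B.wL2[OF t]], of k]
  proof eventually_elim
    case (elim z)
    have "fourier_h (dw t) k z = - prim0 ?g z"
      using elim(2) unfolding dw_def[abs_def] A.w_mode[OF t elim(1)] B.w_mode[OF t elim(1)] p by simp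
    then have "norm (fourier_h (dw t) k z) \<le> nrm ?g"
      using order_trans[OF norm_prim0_le(2)[OF sq_int_integrable(1)[OF g], of z] sq_int_integrable(2)[OF g]] by simp
    then show ?case by (simp add: ng mnorm_dv[OF t])
  qed
qed

lemma mnorm_dv_le: "t \<in> {0..T} \<Longrightarrow> mnorm (dv t) k \<le> 2 * A.H"
  unfolding dv_def[abs_def]
  using order_trans[OF mnorm_diff_le[OF A.vL2 B.vL2] add_mono[OF A.mnorm_v_le B.mnorm_v_le]] by simp

lemma mnorm_dw_le: "t \<in> {0..T} \<Longrightarrow> mnorm (dw t) k \<le> 2 * A.H"
  unfolding dw_def[abs_def]
  using order_trans[OF mnorm_diff_le[OF A.wL2 B.wL2] add_mono[OF A.mnorm_w_le B.mnorm_w_le]] by simp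

lemma S_reindex:
  assumes "inj_on \<phi> P"
  shows "(\<Sum>p\<in>P. \<bar>real_of_int (fst (\<phi> p))\<bar> * e t (fst (\<phi> p)) * e t (snd (\<phi> p)) * b t (fst (\<phi> p) + snd (\<phi> p))) = S t (\<phi> ` P)"
  unfolding S_def by (simp add: sum.reindex[OF assms] case_prod_unfold)

text \<open>In each triple integral one factor is measured in the sup norm in z: the modes of
  \<open>v1\<close>, \<open>u2\<close> and \<open>dw\<close>, respectively. The first term has its
  derivative on the solution and not on the difference; distributing |k - l| \<le> |k| + |l| costs a
  second copy of the trilinear sum, hence 4 pi.\<close>

lemma advection_terms_le:
  assumes t: "t \<in> {0..T}" and W: "finite W" and Q: "\<And>P. finite P \<Longrightarrow> S t P \<le> Q"
  shows "(\<Sum>k\<in>W. norm (LINT z|unit_ivl. cnj (Dm t k z) * fourier_h (\<lambda>q. d t q * v1 t q) k z)) \<le> 4 * pi * Q"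
    and "(\<Sum>k\<in>W. norm (LINT z|unit_ivl. cnj (Dm t k z) * fourier_h (\<lambda>q. u2 t q * dv t q) k z)) \<le> 2 * pi * Q"
    and "(\<Sum>k\<in>W. norm (LINT z|unit_ivl. cnj (Dm t k z) * fourier_h (\<lambda>q. \<omega>1 t q * dw t q) k z)) \<le> 2 * pi * Q"
proof -
  have cm: "(\<lambda>z. cnj (Dm t k z)) \<in> borel_measurable unit_ivl" for k
    using sq_int_cnj(1)[OF Dm_sq_int[OF t]] by (rule sq_int_measurable)
  have cB: "norm (cnj (Dm t k z)) \<le> mnorm (\<theta> t) k" for k z using norm_Dm_le[OF t] by simp
  have csq: "sq_int (\<lambda>z. cnj (Dm t k z))" for k by (rule sq_int_cnj(1)[OF Dm_sq_int[OF t]])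
  have shape: "(\<Sum>k\<in>W. \<Sum>l\<in>F. 2 * pi * (\<bar>real_of_int (k - l)\<bar> * e t (k - l) * e t k * b t l)) \<le> 2 * pi * Q" if F: "finite F" for F
  proof -
    \<comment> \<open>The substitution i = k - l, j = -k gives i + j = -l; e and b are even, the
      functions being real.\<close>
    let ?\<phi> = "\<lambda>(k, l). (k - l, - k :: int)"
    have inj: "inj_on ?\<phi> (W \<times> F)" by (auto simp: inj_on_def)
    have "(\<Sum>k\<in>W. \<Sum>l\<in>F. 2 * pi * (\<bar>real_of_int (k - l)\<bar> * e t (k - l) * e t k * b t l)) =
        2 * pi * (\<Sum>p\<in>W \<times> F. \<bar>real_of_int (fst (?\<phi> p))\<bar> * e t (fst (?\<phi> p)) * e t (snd (?\<phi> p)) * b t (fst (?\<phi> p) + snd (?\<phi> p)))"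
      by (simp add: sum.cartesian_product sum_distrib_left case_prod_unfold e_uminus b_uminus)
    also have "\<dots> = 2 * pi * S t (?\<phi> ` (W \<times> F))" unfolding S_reindex[OF inj] ..
    also have "\<dots> \<le> 2 * pi * Q" using W F by (intro mult_left_mono Q) auto
    finally show ?thesis .
  qed
  show "(\<Sum>k\<in>W. norm (LINT z|unit_ivl. cnj (Dm t k z) * fourier_h (\<lambda>q. d t q * v1 t q) k z)) \<le> 4 * pi * Q"
  proof (rule sum_mode_product_le[OF diff_L2(1)[OF t] A.vL2[OF t] sum_e_le[OF t] tail2_tendsto A.mnorm_v_le[OF t] cm cB W])
    fix F :: "int set" assume F: "finite F"
    have each: "norm (LINT z|unit_ivl. cnj (Dm t k z) * (fourier_h (d t) l z * fourier_h (v1 t) (k - l) z)) \<le>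
        2 * pi * (\<bar>real_of_int k\<bar> * e t k * e t l * b t (k - l)) + 2 * pi * (\<bar>real_of_int l\<bar> * e t l * e t k * b t (k - l))" for k l
    proof -
      have "norm (LINT z|unit_ivl. cnj (Dm t k z) * (fourier_h (v1 t) (k - l) z * fourier_h (d t) l z)) \<le>
          2 * pi * \<bar>of_int (k - l)\<bar> * b t (k - l) * (nrm (\<lambda>z. cnj (Dm t k z)) * nrm (fourier_h (d t) l))"
        by (rule norm_triple_integral_le[OF sq_int_measurable[OF A.sq_modes(2)[OF t]] norm_v_AE(1)[OF t] _ csq fourier_h_sq_int[OF diff_L2(1)[OF t]]]) simp
      also have "\<dots> = 2 * pi * (\<bar>of_int (k - l)\<bar> * (b t (k - l) * (e t k * e t l)))"
        by (simp add: nrm_cnj_Dm[OF t] mnorm_def[symmetric] e_def[symmetric])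
      also have "\<dots> \<le> 2 * pi * ((\<bar>of_int k\<bar> + \<bar>of_int l\<bar>) * (b t (k - l) * (e t k * e t l)))"
        by (intro mult_left_mono mult_right_mono) auto
      finally show ?thesis by (simp add: algebra_simps)
    qed
    \<comment> \<open>Two substitutions, (i, j) = (k, -l) and (i, j) = (-l, k), each with i + j = k
      - l; they put the derivative on k and on l.\<close>
    have i1: "inj_on (\<lambda>(k, l). (k, - l :: int)) (W \<times> F)" by (auto simp: inj_on_def)
    have i2: "inj_on (\<lambda>(k :: int, l). (- l :: int, k)) (W \<times> F)" by (auto simp: inj_on_def)
    have "(\<Sum>k\<in>W. \<Sum>l\<in>F. norm (LINT z|unit_ivl. cnj (Dm t k z) * (fourier_h (d t) l z * fourier_h (v1 t) (k - l) z))) \<le>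
        (\<Sum>k\<in>W. \<Sum>l\<in>F. 2 * pi * (\<bar>real_of_int k\<bar> * e t k * e t l * b t (k - l)) + 2 * pi * (\<bar>real_of_int l\<bar> * e t l * e t k * b t (k - l)))"
      by (intro sum_mono each)
    also have "\<dots> = 2 * pi * (\<Sum>(k, l)\<in>W \<times> F. \<bar>real_of_int k\<bar> * e t k * e t l * b t (k - l))
        + 2 * pi * (\<Sum>(k, l)\<in>W \<times> F. \<bar>real_of_int l\<bar> * e t l * e t k * b t (k - l))"
      by (simp add: sum.distrib sum_distrib_left sum.cartesian_product[symmetric])
    also have "(\<Sum>(k, l)\<in>W \<times> F. \<bar>real_of_int k\<bar> * e t k * e t l * b t (k - l)) = S t ((\<lambda>(k, l). (k, - l)) ` (W \<times> F))"
      unfolding S_reindex[OF i1, symmetric] by (intro sum.cong) (auto simp: e_uminus)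
    also have "(\<Sum>(k, l)\<in>W \<times> F. \<bar>real_of_int l\<bar> * e t l * e t k * b t (k - l)) = S t ((\<lambda>(k, l). (- l, k)) ` (W \<times> F))"
      unfolding S_reindex[OF i2, symmetric] by (intro sum.cong) (auto simp: e_uminus)
    also have "2 * pi * S t ((\<lambda>(k, l). (k, - l)) ` (W \<times> F)) + 2 * pi * S t ((\<lambda>(k, l). (- l, k)) ` (W \<times> F)) \<le> 2 * pi * Q + 2 * pi * Q"
      using W F by (intro add_mono mult_left_mono Q) auto
    finally show "(\<Sum>k\<in>W. \<Sum>l\<in>F. norm (LINT z|unit_ivl. cnj (Dm t k z) * (fourier_h (d t) l z * fourier_h (v1 t) (k - l) z))) \<le> 4 * pi * Q"
      by (simp add: mult_ac)
  qed
  show "(\<Sum>k\<in>W. norm (LINT z|unit_ivl. cnj (Dm t k z) * fourier_h (\<lambda>q. u2 t q * dv t q) k z)) \<le> 2 * pi * Q"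
  proof (rule sum_mode_product_le[OF B.uL2[OF t] diff_L2(2)[OF t] B.sum_mnorm_u_le[OF t] B.tail_tendsto mnorm_dv_le[OF t] cm cB W])
    fix F :: "int set" assume F: "finite F"
    have "norm (LINT z|unit_ivl. cnj (Dm t k z) * (fourier_h (u2 t) l z * fourier_h (dv t) (k - l) z)) \<le>
        2 * pi * (\<bar>real_of_int (k - l)\<bar> * e t (k - l) * e t k * b t l)" for k l
    proof -
      have "norm (LINT z|unit_ivl. cnj (Dm t k z) * (fourier_h (u2 t) l z * fourier_h (dv t) (k - l) z)) \<le>
          b t l * (nrm (\<lambda>z. cnj (Dm t k z)) * nrm (fourier_h (dv t) (k - l)))"
        by (rule norm_triple_integral_le[OF sq_int_measurable[OF B.sq_modes(1)[OF t]] norm_u_AE(2)[OF t] b_nonneg csq fourier_h_sq_int[OF diff_L2(2)[OF t]]])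
      also have "\<dots> = b t l * (e t k * (2 * pi * \<bar>of_int (k - l)\<bar> * e t (k - l)))"
        by (simp add: nrm_cnj_Dm[OF t] mnorm_def[symmetric] mnorm_dv[OF t])
      finally show ?thesis by (simp add: mult_ac)
    qed
    then have "(\<Sum>k\<in>W. \<Sum>l\<in>F. norm (LINT z|unit_ivl. cnj (Dm t k z) * (fourier_h (u2 t) l z * fourier_h (dv t) (k - l) z))) \<le>
        (\<Sum>k\<in>W. \<Sum>l\<in>F. 2 * pi * (\<bar>real_of_int (k - l)\<bar> * e t (k - l) * e t k * b t l))"
      by (intro sum_mono)
    with shape[OF F] show "(\<Sum>k\<in>W. \<Sum>l\<in>F. norm (LINT z|unit_ivl. cnj (Dm t k z) * (fourier_h (u2 t) l z * fourier_h (dv t) (k - l) z))) \<le> 2 * pi * Q"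
      by (rule order_trans[rotated])
  qed
  show "(\<Sum>k\<in>W. norm (LINT z|unit_ivl. cnj (Dm t k z) * fourier_h (\<lambda>q. \<omega>1 t q * dw t q) k z)) \<le> 2 * pi * Q"
  proof (rule sum_mode_product_le[OF A.\<omega>L2[OF t] diff_L2(3)[OF t] A.sum_mnorm_\<omega>_le[OF t] A.tail_tendsto mnorm_dw_le[OF t] cm cB W])
    fix F :: "int set" assume F: "finite F"
    have "norm (LINT z|unit_ivl. cnj (Dm t k z) * (fourier_h (\<omega>1 t) l z * fourier_h (dw t) (k - l) z)) \<le>
        2 * pi * (\<bar>real_of_int (k - l)\<bar> * e t (k - l) * e t k * b t l)" for k l
    proof -
      have "norm (LINT z|unit_ivl. cnj (Dm t k z) * (fourier_h (dw t) (k - l) z * fourier_h (\<omega>1 t) l z)) \<le>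
          2 * pi * \<bar>of_int (k - l)\<bar> * e t (k - l) * (nrm (\<lambda>z. cnj (Dm t k z)) * nrm (fourier_h (\<omega>1 t) l))"
        by (rule norm_triple_integral_le[OF fourier_h_measurable[OF L2_measurable[OF diff_L2(3)[OF t]]] norm_dw_AE[OF t] _ csq A.sq_modes(4)[OF t]]) simp
      also have "\<dots> \<le> 2 * pi * \<bar>of_int (k - l)\<bar> * e t (k - l) * (e t k * b t l)"
        unfolding nrm_cnj_Dm[OF t] by (intro mult_left_mono) (auto simp: b_def mnorm_def)
      finally show ?thesis by (simp add: mult_ac)
    qed
    then have "(\<Sum>k\<in>W. \<Sum>l\<in>F. norm (LINT z|unit_ivl. cnj (Dm t k z) * (fourier_h (\<omega>1 t) l z * fourier_h (dw t) (k - l) z))) \<le>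
        (\<Sum>k\<in>W. \<Sum>l\<in>F. 2 * pi * (\<bar>real_of_int (k - l)\<bar> * e t (k - l) * e t k * b t l))"
      by (intro sum_mono)
    with shape[OF F] show "(\<Sum>k\<in>W. \<Sum>l\<in>F. norm (LINT z|unit_ivl. cnj (Dm t k z) * (fourier_h (\<omega>1 t) l z * fourier_h (dw t) (k - l) z))) \<le> 2 * pi * Q"
      by (rule order_trans[rotated])
  qed
qed

text \<open>Integration by parts in \<open>z\<close>, where the boundary terms vanish since \<open>w = 0\<close> at \<open>z = 0, 1\<close>.\<close>

lemma vertical_symmetrization:
  assumes t: "t \<in> {0..T}"
  shows "(LINT z|unit_ivl. Dm t j z * (Th t m z * fourier_h (w2 t) l z)) + (LINT z|unit_ivl. Dm t m z * (Th t j z * fourier_h (w2 t) l z))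
    = (LINT z|unit_ivl. Dm t j z * (fourier_h (v2 t) l z * Dm t m z))"
proof -
  let ?v = "fourier_h (v2 t) l"
  define G where "G z = (-1) * prim0 ?v z" for z
  have v: "integrable unit_ivl ?v" by (rule B.int_modes(2)[OF t])
  have G: "AC G (\<lambda>z. (-1) * ?v z)" unfolding G_def[abs_def] by (rule AC_scale[OF AC_prim0[OF v]])
  have Gw: "fourier_h (w2 t) l z = G z" if "z \<in> {0..1}" for z using B.w_mode[OF t that] by (simp add: G_def)
  have G0: "G 0 = 0" by (simp add: G_def prim0_0)
  \<comment> \<open>The upper boundary condition for w: the mode of \<open>v2\<close> is a multiple
    of a velocity mode and so has mean zero.\<close>
  have G1: "G 1 = 0"
  proof -
    have "integral\<^sup>L unit_ivl ?v = (LINT z|unit_ivl. 2 * pi * \<i> * of_int l * mprim (fourier_h (\<omega>2 t) l) z)"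
    proof (rule integral_cong_AE)
      show "AE z in unit_ivl. ?v z = 2 * pi * \<i> * of_int l * mprim (fourier_h (\<omega>2 t) l) z"
        using B.v_mode[OF t, of l] B.u_mode[OF t, of l] by eventually_elim simp
      have "mprim (fourier_h (\<omega>2 t) l) \<in> borel_measurable unit_ivl"
        by (rule measurable_unit_continuous[OF mprim_continuous[OF B.int_modes(4)[OF t]]])
      then show "(\<lambda>z. 2 * pi * \<i> * of_int l * mprim (fourier_h (\<omega>2 t) l) z) \<in> borel_measurable unit_ivl" by measurable
    qed (use v in simp)
    also have "\<dots> = 2 * pi * \<i> * of_int l * (LINT z|unit_ivl. mprim (fourier_h (\<omega>2 t) l) z)"
      by (rule integral_mult_right_zero)
    also have "\<dots> = 0" using mprim_mean[OF B.int_modes(4)[OF t]] by simp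
    finally show ?thesis by (simp add: G_def prim0_1)
  qed
  note DD = AC_mult[OF AC_Dm[OF t, of j] AC_Dm[OF t, of m]]
  have zero: "(LINT z|unit_ivl. (-1) * ?v z * (Dm t j z * Dm t m z) + G z * (Th t j z * Dm t m z + Dm t j z * Th t m z)) = 0"
    using AC_integral[OF AC_mult[OF G DD]] by (simp add: G0 G1)
  have cDD: "continuous_on {0..1} (\<lambda>z. Dm t j z * Dm t m z)" by (rule AC_continuous[OF DD])
  have i0: "integrable unit_ivl (\<lambda>z. Dm t j z * (?v z * Dm t m z))"
    using integrable_mult_continuous[OF v cDD] by (simp add: mult_ac)
  have cG: "continuous_on {0..1} (\<lambda>z. G z * Dm t i z)" for i
    by (intro continuous_intros AC_continuous[OF G] Dm_continuous t)
  have i1: "integrable unit_ivl (\<lambda>z. Dm t j z * (Th t m z * G z))" "integrable unit_ivl (\<lambda>z. Dm t m z * (Th t j z * G z))"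
    using integrable_mult_continuous[OF sq_int_integrable(1)[OF Th_sq_int[OF t, of m]] cG[of j]]
      integrable_mult_continuous[OF sq_int_integrable(1)[OF Th_sq_int[OF t, of j]] cG[of m]] by (simp_all add: mult_ac)
  have "(LINT z|unit_ivl. (Dm t j z * (Th t m z * G z) + Dm t m z * (Th t j z * G z)) - Dm t j z * (?v z * Dm t m z)) = 0"
    unfolding zero[symmetric] by (intro Bochner_Integration.integral_cong) (auto simp: algebra_simps)
  then have "(LINT z|unit_ivl. Dm t j z * (Th t m z * G z)) + (LINT z|unit_ivl. Dm t m z * (Th t j z * G z))
      = (LINT z|unit_ivl. Dm t j z * (?v z * Dm t m z))"
    using i0 i1 by simp
  moreover have "(LINT z|unit_ivl. Dm t j z * (Th t m z * fourier_h (w2 t) l z)) = (LINT z|unit_ivl. Dm t j z * (Th t m z * G z))" for j m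
    by (intro Bochner_Integration.integral_cong) (auto simp: Gw)
  ultimately show ?thesis by simp
qed

text \<open>The cancellation takes place between the pairs (j, m) and (m, j), so only the norm of
  the whole sum can be bounded, and the modes of \<theta> must be cut to the same symmetric range as
  those of the test function. This fixed cut is the source of the error with
  \<open>A.tail (Suc n)\<close>.\<close>

lemma vertical_term_le:
  assumes t: "t \<in> {0..T}" and Q: "\<And>P. finite P \<Longrightarrow> S t P \<le> Q"
  shows "norm (\<Sum>k\<in>{- int n..int n}. LINT z|unit_ivl. cnj (Dm t k z) * fourier_h (\<lambda>q. \<theta> t q * w2 t q) k z)
    \<le> 2 * pi * Q + 2 * A.tail 0 * (2 * A.tail (Suc n) * A.H)"
proof -
  let ?W = "{- int n..int n}"
  let ?I = "\<lambda>k. LINT z|unit_ivl. cnj (Dm t k z) * fourier_h (\<lambda>q. \<theta> t q * w2 t q) k z"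
  let ?s = "\<lambda>k m. LINT z|unit_ivl. cnj (Dm t k z) * (fourier_h (\<theta> t) m z * fourier_h (w2 t) (k - m) z)"
  define z where "z j m = (LINT z|unit_ivl. Dm t j z * (Th t m z * fourier_h (w2 t) (- (j + m)) z))" for j m
  have cm: "(\<lambda>z. cnj (Dm t k z)) \<in> borel_measurable unit_ivl" for k
    using sq_int_cnj(1)[OF Dm_sq_int[OF t]] by (rule sq_int_measurable)
  have cB: "norm (cnj (Dm t k z)) \<le> mnorm (\<theta> t) k" for k z using norm_Dm_le[OF t] by simp
  have err: "norm (?I k - (\<Sum>m\<in>?W. ?s k m)) \<le> mnorm (\<theta> t) k * (2 * A.tail (Suc n) * A.H)" for k
    by (rule mode_product_error[OF diff_L2(4)[OF t] B.wL2[OF t] sum_\<theta>_le[OF t] B.mnorm_w_le[OF t] cm cB])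
  have s_eq: "?s k m = z (- k) m" for k m
    unfolding z_def
  proof (rule integral_cong_AE)
    show "AE z in unit_ivl. cnj (Dm t k z) * (fourier_h (\<theta> t) m z * fourier_h (w2 t) (k - m) z) =
        Dm t (- k) z * (Th t m z * fourier_h (w2 t) (- (- k + m)) z)"
      using \<theta>_mode[OF t, of m] by eventually_elim (simp add: Dm_uminus)
    have [measurable]: "fourier_h (\<theta> t) m \<in> borel_measurable unit_ivl" "fourier_h (w2 t) l \<in> borel_measurable unit_ivl"
      "Th t m \<in> borel_measurable unit_ivl" "Dm t i \<in> borel_measurable unit_ivl" for l i
      using sq_int_measurable[OF fourier_h_sq_int[OF diff_L2(4)[OF t]]] sq_int_measurable[OF B.sq_modes(3)[OF t]]
        sq_int_measurable[OF Th_sq_int[OF t]] sq_int_measurable[OF Dm_sq_int[OF t]] by auto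
    show "(\<lambda>z. cnj (Dm t k z) * (fourier_h (\<theta> t) m z * fourier_h (w2 t) (k - m) z)) \<in> borel_measurable unit_ivl"
      using cm[of k] by measurable
    show "(\<lambda>z. Dm t (- k) z * (Th t m z * fourier_h (w2 t) (- (- k + m)) z)) \<in> borel_measurable unit_ivl" by measurable
  qed
  define Z where "Z = (\<Sum>k\<in>?W. \<Sum>m\<in>?W. ?s k m)"
  \<comment> \<open>Conjugating the test mode turns k into -k, and the range is symmetric; in terms
    of j = -k the summand has the form required by \<open>vertical_symmetrization\<close>.\<close>
  have Z: "Z = (\<Sum>j\<in>?W. \<Sum>m\<in>?W. z j m)"
  proof -
    have "(\<Sum>j\<in>?W. \<Sum>m\<in>?W. z j m) = (\<Sum>j\<in>uminus ` ?W. \<Sum>m\<in>?W. z j m)" by simp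
    also have "\<dots> = (\<Sum>k\<in>?W. \<Sum>m\<in>?W. z (- k) m)" by (subst sum.reindex) auto
    finally show ?thesis unfolding Z_def s_eq by simp
  qed
  have pair: "norm (z j m + z m j) \<le> 2 * pi * (\<bar>real_of_int j\<bar> * e t j * e t m * b t (j + m)) + 2 * pi * (\<bar>real_of_int m\<bar> * e t m * e t j * b t (m + j))" for j m
  proof -
    have eq: "z j m + z m j = (LINT z|unit_ivl. Dm t j z * (fourier_h (v2 t) (- (j + m)) z * Dm t m z))"
      unfolding z_def using vertical_symmetrization[OF t, of j m "- (j + m)"] by (simp add: add.commute)
    have "norm (z j m + z m j) \<le> 2 * pi * \<bar>of_int (- (j + m))\<bar> * b t (- (j + m)) * (nrm (Dm t j) * nrm (Dm t m))"
      unfolding eq by (rule norm_triple_integral_le[OF sq_int_measurable[OF B.sq_modes(2)[OF t]] norm_v_AE(2)[OF t] _ Dm_sq_int[OF t] Dm_sq_int[OF t]]) simp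
    also have "\<dots> = 2 * pi * (\<bar>of_int (j + m)\<bar> * (b t (j + m) * (e t j * e t m)))"
      unfolding b_uminus nrm_Dm[OF t] by (simp only: of_int_minus abs_minus_cancel e_def mult.assoc)
    also have "\<dots> \<le> 2 * pi * ((\<bar>of_int j\<bar> + \<bar>of_int m\<bar>) * (b t (j + m) * (e t j * e t m)))"
      by (intro mult_left_mono mult_right_mono) auto
    finally show ?thesis by (simp add: algebra_simps)
  qed
  \<comment> \<open>Exchanging the two summation indices in one copy of Z pairs each summand with
    its mirror image.\<close>
  have "2 * Z = Z + Z" by simp
  also have "\<dots> = (\<Sum>j\<in>?W. \<Sum>m\<in>?W. z j m) + (\<Sum>j\<in>?W. \<Sum>m\<in>?W. z m j)"
    unfolding Z using sum.swap[of z ?W ?W] by simp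
  also have "\<dots> = (\<Sum>j\<in>?W. \<Sum>m\<in>?W. z j m + z m j)" by (simp add: sum.distrib)
  finally have Z2: "2 * Z = (\<Sum>j\<in>?W. \<Sum>m\<in>?W. z j m + z m j)" .
  have "norm (2 * Z) \<le> (\<Sum>j\<in>?W. \<Sum>m\<in>?W. norm (z j m + z m j))"
    unfolding Z2 by (intro order_trans[OF norm_sum] sum_mono norm_sum)
  also have "\<dots> \<le> (\<Sum>j\<in>?W. \<Sum>m\<in>?W. 2 * pi * (\<bar>real_of_int j\<bar> * e t j * e t m * b t (j + m)) + 2 * pi * (\<bar>real_of_int m\<bar> * e t m * e t j * b t (m + j)))"
    by (intro sum_mono pair)
  also have "\<dots> = 2 * pi * (\<Sum>j\<in>?W. \<Sum>m\<in>?W. \<bar>real_of_int j\<bar> * e t j * e t m * b t (j + m))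
      + 2 * pi * (\<Sum>j\<in>?W. \<Sum>m\<in>?W. \<bar>real_of_int m\<bar> * e t m * e t j * b t (m + j))"
    by (simp add: sum.distrib sum_distrib_left)
  also have "(\<Sum>j\<in>?W. \<Sum>m\<in>?W. \<bar>real_of_int m\<bar> * e t m * e t j * b t (m + j)) =
      (\<Sum>j\<in>?W. \<Sum>m\<in>?W. \<bar>real_of_int j\<bar> * e t j * e t m * b t (j + m))"
    by (rule sum.swap)
  also have "(\<Sum>j\<in>?W. \<Sum>m\<in>?W. \<bar>real_of_int j\<bar> * e t j * e t m * b t (j + m)) = S t (?W \<times> ?W)"
    unfolding S_def by (simp add: sum.cartesian_product)
  also have "2 * pi * S t (?W \<times> ?W) + 2 * pi * S t (?W \<times> ?W) \<le> 2 * pi * Q + 2 * pi * Q"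
    by (intro add_mono mult_left_mono Q) auto
  finally have Zle: "norm Z \<le> 2 * pi * Q" by (simp add: norm_mult mult_ac)
  have "norm (\<Sum>k\<in>?W. ?I k) = norm (Z + (\<Sum>k\<in>?W. ?I k - (\<Sum>m\<in>?W. ?s k m)))"
    unfolding Z_def by (simp add: sum_subtractf)
  also have "\<dots> \<le> norm Z + (\<Sum>k\<in>?W. norm (?I k - (\<Sum>m\<in>?W. ?s k m)))"
    by (intro norm_triangle_mono order_refl norm_sum)
  also have "\<dots> \<le> 2 * pi * Q + (\<Sum>k\<in>?W. mnorm (\<theta> t) k * (2 * A.tail (Suc n) * A.H))"
    by (intro add_mono Zle sum_mono err)
  also have "(\<Sum>k\<in>?W. mnorm (\<theta> t) k * (2 * A.tail (Suc n) * A.H)) = (\<Sum>k\<in>?W. mnorm (\<theta> t) k) * (2 * A.tail (Suc n) * A.H)"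
    by (simp add: sum_distrib_right)
  also have "\<dots> \<le> 2 * A.tail 0 * (2 * A.tail (Suc n) * A.H)"
  proof (rule mult_right_mono)
    show "(\<Sum>k\<in>?W. mnorm (\<theta> t) k) \<le> 2 * A.tail 0" by (rule sum_\<theta>_le[OF t]) auto
    have "0 \<le> A.tail (Suc n)" using A.sum_mnorm_\<omega>_le[OF t, of "{}" "Suc n"] by simp
    then show "0 \<le> 2 * A.tail (Suc n) * A.H" using A.H_nonneg[OF t] by simp
  qed
  finally show ?thesis by simp
qed

lemma M_AE:
  assumes t: "t \<in> {0..T}"
  shows "AE z in unit_ivl. M t k z = fourier_h (\<lambda>q. d t q * v1 t q) k z + fourier_h (\<lambda>q. u2 t q * dv t q) k z
    + fourier_h (\<lambda>q. \<omega>1 t q * dw t q) k z + fourier_h (\<lambda>q. \<theta> t q * w2 t q) k z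
    + of_real (\<nu> * \<bar>2 * pi * of_int k\<bar> powr \<alpha>) * Dm t k z"
proof -
  note i = L2_mult_integrable(1)[OF diff_L2(1)[OF t] A.vL2[OF t]] L2_mult_integrable(1)[OF B.uL2[OF t] diff_L2(2)[OF t]]
    L2_mult_integrable(1)[OF A.\<omega>L2[OF t] diff_L2(3)[OF t]] L2_mult_integrable(1)[OF diff_L2(4)[OF t] B.wL2[OF t]]
  have j1: "integrable Omega (\<lambda>q. u1 t q * v1 t q + w1 t q * \<omega>1 t q)"
    using A.uv_integrable[OF t] A.w\<omega>_integrable[OF t] by (simp add: mult.commute)
  have j2: "integrable Omega (\<lambda>q. u2 t q * v2 t q + w2 t q * \<omega>2 t q)"
    using B.uv_integrable[OF t] B.w\<omega>_integrable[OF t] by (simp add: mult.commute)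
  \<comment> \<open>The splitting is chosen so that the first factor of each product, namely
    \<open>d\<close>, \<open>u2\<close>, \<open>\<omega>1\<close> and \<open>\<theta>\<close>, has
    summable modes.\<close>
  have split: "(\<lambda>q. (u1 t q * v1 t q + w1 t q * \<omega>1 t q) - (u2 t q * v2 t q + w2 t q * \<omega>2 t q)) =
      (\<lambda>q. ((d t q * v1 t q + u2 t q * dv t q) + \<omega>1 t q * dw t q) + \<theta> t q * w2 t q)"
    by (auto simp: d_def dv_def dw_def \<theta>_def algebra_simps)
  have i12: "integrable Omega (\<lambda>q. d t q * v1 t q + u2 t q * dv t q)" using i by simp
  have i123: "integrable Omega (\<lambda>q. (d t q * v1 t q + u2 t q * dv t q) + \<omega>1 t q * dw t q)" using i by simp
  have diff: "AE z in unit_ivl. fourier_h (\<lambda>q. ((d t q * v1 t q + u2 t q * dv t q) + \<omega>1 t q * dw t q) + \<theta> t q * w2 t q) k z =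
      fourier_h (\<lambda>q. u1 t q * v1 t q + w1 t q * \<omega>1 t q) k z - fourier_h (\<lambda>q. u2 t q * v2 t q + w2 t q * \<omega>2 t q) k z"
    using fourier_h_diff[OF j1 j2, of k] unfolding split .
  show ?thesis
    using diff fourier_h_add[OF i(1,2), of k] fourier_h_add[OF i12 i(3), of k] fourier_h_add[OF i123 i(4), of k] u_modes_Dm[OF t, of k]
  proof eventually_elim
    case (elim z)
    have "M t k z = (fourier_h (\<lambda>q. u1 t q * v1 t q + w1 t q * \<omega>1 t q) k z - fourier_h (\<lambda>q. u2 t q * v2 t q + w2 t q * \<omega>2 t q) k z)
        + of_real (\<nu> * \<bar>2 * pi * of_int k\<bar> powr \<alpha>) * (fourier_h (u1 t) k z - fourier_h (u2 t) k z)"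
      by (simp add: M_def A.N_def B.N_def algebra_simps)
    then show ?case unfolding elim(1)[symmetric] elim(2-5) by simp
  qed
qed

lemma M_pairing:
  assumes t: "t \<in> {0..T}"
  shows "(LINT z|unit_ivl. cnj (Dm t k z) * M t k z) =
    (LINT z|unit_ivl. cnj (Dm t k z) * fourier_h (\<lambda>q. d t q * v1 t q) k z)
    + (LINT z|unit_ivl. cnj (Dm t k z) * fourier_h (\<lambda>q. u2 t q * dv t q) k z)
    + (LINT z|unit_ivl. cnj (Dm t k z) * fourier_h (\<lambda>q. \<omega>1 t q * dw t q) k z)
    + (LINT z|unit_ivl. cnj (Dm t k z) * fourier_h (\<lambda>q. \<theta> t q * w2 t q) k z)
    + of_real (\<nu> * \<bar>2 * pi * of_int k\<bar> powr \<alpha> * (e t k)\<^sup>2)"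
proof -
  let ?c = "complex_of_real (\<nu> * \<bar>2 * pi * of_int k\<bar> powr \<alpha>)"
  have g: "continuous_on {0..1} (\<lambda>z. cnj (Dm t k z))" by (intro continuous_intros Dm_continuous t)
  note p = pair_integrable[OF g]
  note i = p[OF fourier_h_integrable(1)[OF L2_mult_integrable(1)[OF diff_L2(1)[OF t] A.vL2[OF t]], of k]]
    p[OF fourier_h_integrable(1)[OF L2_mult_integrable(1)[OF B.uL2[OF t] diff_L2(2)[OF t]], of k]]
    p[OF fourier_h_integrable(1)[OF L2_mult_integrable(1)[OF A.\<omega>L2[OF t] diff_L2(3)[OF t]], of k]]
    p[OF fourier_h_integrable(1)[OF L2_mult_integrable(1)[OF diff_L2(4)[OF t] B.wL2[OF t]], of k]]
  have i5: "integrable unit_ivl (\<lambda>z. ?c * (cnj (Dm t k z) * Dm t k z))"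
    by (intro integrable_mult_right p sq_int_integrable(1) Dm_sq_int t)
  have "(LINT z|unit_ivl. cnj (Dm t k z) * M t k z) = (LINT z|unit_ivl. cnj (Dm t k z) * fourier_h (\<lambda>q. d t q * v1 t q) k z
      + cnj (Dm t k z) * fourier_h (\<lambda>q. u2 t q * dv t q) k z + cnj (Dm t k z) * fourier_h (\<lambda>q. \<omega>1 t q * dw t q) k z
      + cnj (Dm t k z) * fourier_h (\<lambda>q. \<theta> t q * w2 t q) k z + ?c * (cnj (Dm t k z) * Dm t k z))" (is "_ = integral\<^sup>L _ ?R")
  proof (rule integral_cong_AE)
    show "AE z in unit_ivl. cnj (Dm t k z) * M t k z = ?R z"
      using M_AE[OF t, of k]
    proof eventually_elim
      case (elim z)
      have "g * (a1 + a2 + a3 + a4 + c * x) = g * a1 + g * a2 + g * a3 + g * a4 + c * (g * x)" for g a1 a2 a3 a4 c x :: complex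
        by (simp add: algebra_simps)
      then show ?case unfolding elim .
    qed
    show "(\<lambda>z. cnj (Dm t k z) * M t k z) \<in> borel_measurable unit_ivl"
      using p[OF M_integrable[OF t]] by (rule borel_measurable_integrable)
    show "?R \<in> borel_measurable unit_ivl"
      by (intro borel_measurable_integrable Bochner_Integration.integrable_add i i5)
  qed
  also have "\<dots> = (LINT z|unit_ivl. cnj (Dm t k z) * fourier_h (\<lambda>q. d t q * v1 t q) k z)
    + (LINT z|unit_ivl. cnj (Dm t k z) * fourier_h (\<lambda>q. u2 t q * dv t q) k z)
    + (LINT z|unit_ivl. cnj (Dm t k z) * fourier_h (\<lambda>q. \<omega>1 t q * dw t q) k z)
    + (LINT z|unit_ivl. cnj (Dm t k z) * fourier_h (\<lambda>q. \<theta> t q * w2 t q) k z)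
    + (LINT z|unit_ivl. ?c * (cnj (Dm t k z) * Dm t k z))"
    by (simp only: Bochner_Integration.integral_add i i5 Bochner_Integration.integrable_add)
  also have "(LINT z|unit_ivl. ?c * (cnj (Dm t k z) * Dm t k z)) = ?c * (LINT z|unit_ivl. cnj (Dm t k z) * Dm t k z)"
    by (rule integral_mult_right_zero)
  also have "(LINT z|unit_ivl. cnj (Dm t k z) * Dm t k z) = of_real ((e t k)\<^sup>2)"
  proof -
    have "cnj w * w = complex_of_real ((norm w)\<^sup>2)" for w :: complex
      by (metis complex_norm_square mult.commute)
    then have "(LINT z|unit_ivl. cnj (Dm t k z) * Dm t k z) = of_real (LINT z|unit_ivl. (norm (Dm t k z))\<^sup>2)"
      by (simp only: integral_complex_of_real)
    then show ?thesis unfolding nrm_power2[symmetric] nrm_Dm[OF t] e_def .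
  qed
  finally show ?thesis by simp
qed

section \<open>The truncated energy inequality and its limit\<close>

definition Y :: "nat \<Rightarrow> real \<Rightarrow> real" where "Y n t = (\<Sum>k\<in>{- int n..int n}. (e t k)\<^sup>2)"

definition Y' :: "nat \<Rightarrow> real \<Rightarrow> real" where
  "Y' n t = (\<Sum>k\<in>{- int n..int n}. - 2 * Re (LINT z|unit_ivl. cnj (Dm t k z) * M t k z))"

text \<open>Outside \<open>{- int n..int n}\<close> one has jb k \<ge> n + 2, so passing from the
  weight with exponent 2 \<alpha> to the one with exponent \<alpha> gains this power; 4 K is the
  constant of \<open>e_bound\<close>.\<close>

definition \<delta> :: "nat \<Rightarrow> real" where "\<delta> n = 4 * K * real (n + 2) powr - \<alpha>"

lemma Y_derivative: "t \<in> {0..T} \<Longrightarrow> (Y n has_real_derivative Y' n t) (at t within {0..T})"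
  unfolding Y_def[abs_def] Y'_def e_def by (intro DERIV_sum energy_derivative)

lemma K_nonneg: "0 \<le> K"
  using A.\<omega>_bound[of 0 "{}"] T by simp

lemma \<delta>_tendsto: "\<delta> \<longlonglongrightarrow> 0"
proof -
  have "filterlim (\<lambda>n. real (n + 2)) at_top sequentially"
    by (intro filterlim_compose[OF filterlim_real_sequentially] filterlim_add_const_nat_at_top)
  then have "(\<lambda>n. real (n + 2) powr - \<alpha>) \<longlonglongrightarrow> 0"
    by (intro tendsto_neg_powr) (use A.\<alpha> in auto)
  from tendsto_mult[OF tendsto_const this, of "4 * K"] show ?thesis by (simp add: \<delta>_def[abs_def])
qed

text \<open>The energy balance sees only finitely many modes, whereas the trilinear estimate demands
  bounds over all finite sets of modes. The missing high frequencies are paid for by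
  \<open>\<delta> n\<close>.\<close>

lemma weighted_tail:
  assumes t: "t \<in> {0..T}" and F: "finite F"
  shows "(\<Sum>k\<in>F. jb k powr \<alpha> * (e t k)\<^sup>2) \<le> (\<Sum>k\<in>{- int n..int n}. jb k powr \<alpha> * (e t k)\<^sup>2) + \<delta> n"
    and "(\<Sum>k\<in>F. (e t k)\<^sup>2) \<le> Y n t + \<delta> n"
proof -
  let ?W = "{- int n..int n}"
  have out: "(\<Sum>k\<in>F - ?W. jb k powr \<alpha> * (e t k)\<^sup>2) \<le> \<delta> n"
  proof -
    have "jb k powr \<alpha> * (e t k)\<^sup>2 \<le> real (n + 2) powr - \<alpha> * (jb k powr (2 * \<alpha>) * (e t k)\<^sup>2)" if "k \<in> F - ?W" for k
    proof -
      have "real (n + 2) \<le> jb k" using that by (auto simp: jb_def)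
      then have "jb k powr - \<alpha> \<le> real (n + 2) powr - \<alpha>" using A.\<alpha> by (intro powr_mono2') auto
      then have "jb k powr - \<alpha> * (jb k powr (2 * \<alpha>) * (e t k)\<^sup>2) \<le> real (n + 2) powr - \<alpha> * (jb k powr (2 * \<alpha>) * (e t k)\<^sup>2)"
        by (intro mult_right_mono) auto
      moreover have "jb k powr - \<alpha> * (jb k powr (2 * \<alpha>) * (e t k)\<^sup>2) = jb k powr \<alpha> * (e t k)\<^sup>2"
        unfolding mult.assoc[symmetric] powr_add[symmetric] by simp
      ultimately show ?thesis by simp
    qed
    then have "(\<Sum>k\<in>F - ?W. jb k powr \<alpha> * (e t k)\<^sup>2) \<le> (\<Sum>k\<in>F - ?W. real (n + 2) powr - \<alpha> * (jb k powr (2 * \<alpha>) * (e t k)\<^sup>2))"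
      by (rule sum_mono)
    also have "\<dots> = real (n + 2) powr - \<alpha> * (\<Sum>k\<in>F - ?W. jb k powr (2 * \<alpha>) * (e t k)\<^sup>2)" by (simp add: sum_distrib_left)
    also have "\<dots> \<le> real (n + 2) powr - \<alpha> * (4 * K)" using F by (intro mult_left_mono e_bound t) auto
    finally show ?thesis by (simp add: \<delta>_def mult.commute)
  qed
  have split: "(\<Sum>k\<in>F. x k) \<le> (\<Sum>k\<in>?W. x k) + (\<Sum>k\<in>F - ?W. x k)" if "\<And>k. 0 \<le> x k" for x :: "int \<Rightarrow> real"
  proof -
    have "(\<Sum>k\<in>F. x k) \<le> (\<Sum>k\<in>?W \<union> (F - ?W). x k)" using F that by (intro sum_mono2) auto
    also have "\<dots> = (\<Sum>k\<in>?W. x k) + (\<Sum>k\<in>F - ?W. x k)" using F by (intro sum.union_disjoint) auto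
    finally show ?thesis .
  qed
  show "(\<Sum>k\<in>F. jb k powr \<alpha> * (e t k)\<^sup>2) \<le> (\<Sum>k\<in>?W. jb k powr \<alpha> * (e t k)\<^sup>2) + \<delta> n"
    using split[of "\<lambda>k. jb k powr \<alpha> * (e t k)\<^sup>2"] out by simp
  have "(\<Sum>k\<in>F - ?W. (e t k)\<^sup>2) \<le> (\<Sum>k\<in>F - ?W. jb k powr \<alpha> * (e t k)\<^sup>2)"
  proof (rule sum_mono)
    fix k
    have "1 \<le> jb k powr \<alpha>" using jb_ge_1 A.\<alpha> by (intro ge_one_powr_ge_zero) auto
    then show "(e t k)\<^sup>2 \<le> jb k powr \<alpha> * (e t k)\<^sup>2" using mult_right_mono[of 1 "jb k powr \<alpha>" "(e t k)\<^sup>2"] by simp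
  qed
  then show "(\<Sum>k\<in>F. (e t k)\<^sup>2) \<le> Y n t + \<delta> n"
    using split[of "\<lambda>k. (e t k)\<^sup>2"] out by (simp add: Y_def)
qed

lemma jb_powr_\<alpha>_le: "jb k powr \<alpha> \<le> 4 * (1 + \<bar>2 * pi * of_int k\<bar> powr \<alpha>)"
proof -
  have "2 powr \<alpha> \<le> 2 powr (2::real)" using A.\<alpha> by (intro powr_mono) auto
  then have "2 powr \<alpha> * (1 + \<bar>2 * pi * of_int k\<bar> powr \<alpha>) \<le> 4 * (1 + \<bar>2 * pi * of_int k\<bar> powr \<alpha>)"
    by (intro mult_right_mono) auto
  moreover have "jb k powr \<alpha> \<le> 2 powr \<alpha> * (1 + \<bar>2 * pi * of_int k\<bar> powr \<alpha>)"
    using A.\<alpha> by (intro jb_powr_le) simp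
  ultimately show ?thesis by linarith
qed

lemma difference_vanishes:
  assumes t: "t \<in> {0..T}"
  shows "AE q in Omega. u1 t q = u2 t q"
proof -
  \<comment> \<open>The four terms contribute 4 pi + 2 pi + 2 pi + 2 pi = 10 pi times Q, the
    derivative of a square doubles this, and \<open>jb_powr_\<alpha>_le\<close> adds a factor 4 in
    front of the dissipation: 80 pi \<epsilon> = \<nu>.\<close>
  define \<epsilon> where "\<epsilon> = \<nu> / (80 * pi)"
  have \<epsilon>: "0 < \<epsilon>" using \<nu> by (simp add: \<epsilon>_def)
  obtain C where C: "0 \<le> C" and tri: "\<And>b e E Y P. finite P \<Longrightarrow> (\<forall>k. 0 \<le> b k) \<Longrightarrow> (\<forall>k. 0 \<le> e k) \<Longrightarrow>
    (\<forall>F. finite F \<longrightarrow> (\<Sum>k\<in>F. jb k powr \<alpha> * (b k)\<^sup>2) \<le> 4 * K) \<Longrightarrow>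
    (\<forall>F. finite F \<longrightarrow> (\<Sum>k\<in>F. jb k powr \<alpha> * (e k)\<^sup>2) \<le> E) \<Longrightarrow>
    (\<forall>F. finite F \<longrightarrow> (\<Sum>k\<in>F. (e k)\<^sup>2) \<le> Y) \<Longrightarrow>
    (\<Sum>(i, j)\<in>P. \<bar>real_of_int i\<bar> * e i * e j * b (i + j)) \<le> \<epsilon> * E + C * Y"
    using trilinear_estimate[OF A.\<alpha> _ \<epsilon>, of "4 * K"] K_nonneg by auto
  \<comment> \<open>Here a collects what multiplies the energy after E is replaced by 4 (Y + Diss) +
    \<delta>, and c collects the truncation errors.\<close>
  define a where "a = 20 * pi * (4 * \<epsilon> + C)"
  define c where "c n = 20 * pi * (\<epsilon> + C) * \<delta> n + 2 * (2 * A.tail 0 * (2 * A.tail (Suc n) * A.H))" for n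
  have a: "0 < a" using \<epsilon> C by (simp add: a_def add_pos_nonneg)
  have \<delta>0: "0 \<le> \<delta> n" for n using K_nonneg by (simp add: \<delta>_def)
  have tail0: "0 \<le> A.tail n" for n using A.sum_mnorm_\<omega>_le[OF t, of "{}" n] by simp
  have c0: "0 \<le> c n" for n
    unfolding c_def using \<epsilon> C \<delta>0 tail0 A.H_nonneg[OF t] by (intro add_nonneg_nonneg mult_nonneg_nonneg) auto
  have diff_ineq: "Y' n s \<le> a * Y n s + c n" if s: "s \<in> {0..T}" for n s
  proof -
    let ?W = "{- int n..int n}"
    let ?p = "\<lambda>f k. LINT z|unit_ivl. cnj (Dm s k z) * fourier_h f k z"
    define Diss where "Diss = (\<Sum>k\<in>?W. \<bar>2 * pi * of_int k\<bar> powr \<alpha> * (e s k)\<^sup>2)"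
    define E where "E = (\<Sum>k\<in>?W. jb k powr \<alpha> * (e s k)\<^sup>2) + \<delta> n"
    define Q where "Q = \<epsilon> * E + C * (Y n s + \<delta> n)"
    have Q: "S s P \<le> Q" if "finite P" for P
      unfolding S_def Q_def E_def
      by (rule tri[OF that]) (use b_bound[OF s] weighted_tail[OF s] in auto)
    have E: "E \<le> 4 * (Y n s + Diss) + \<delta> n"
    proof -
      have "(\<Sum>k\<in>?W. jb k powr \<alpha> * (e s k)\<^sup>2) \<le> (\<Sum>k\<in>?W. 4 * (1 + \<bar>2 * pi * of_int k\<bar> powr \<alpha>) * (e s k)\<^sup>2)"
        by (intro sum_mono mult_right_mono jb_powr_\<alpha>_le) auto
      also have "\<dots> = 4 * (Y n s + Diss)"
        unfolding Y_def Diss_def by (simp add: distrib_right distrib_left sum.distrib sum_distrib_left mult.assoc)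
      finally show ?thesis by (simp add: E_def)
    qed
    define R where "R = (\<Sum>k\<in>?W. ?p (\<lambda>q. d s q * v1 s q) k) + (\<Sum>k\<in>?W. ?p (\<lambda>q. u2 s q * dv s q) k)
      + (\<Sum>k\<in>?W. ?p (\<lambda>q. \<omega>1 s q * dw s q) k) + (\<Sum>k\<in>?W. ?p (\<lambda>q. \<theta> s q * w2 s q) k)"
    have sumM: "(\<Sum>k\<in>?W. LINT z|unit_ivl. cnj (Dm s k z) * M s k z) = R + of_real (\<nu> * Diss)"
      unfolding M_pairing[OF s] R_def Diss_def by (simp add: sum.distrib sum_distrib_left mult.assoc)
    have "norm (\<Sum>k\<in>?W. ?p (\<lambda>q. d s q * v1 s q) k) \<le> 4 * pi * Q"
      by (rule order_trans[OF norm_sum advection_terms_le(1)[OF s _ Q]]) auto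
    moreover have "norm (\<Sum>k\<in>?W. ?p (\<lambda>q. u2 s q * dv s q) k) \<le> 2 * pi * Q"
      by (rule order_trans[OF norm_sum advection_terms_le(2)[OF s _ Q]]) auto
    moreover have "norm (\<Sum>k\<in>?W. ?p (\<lambda>q. \<omega>1 s q * dw s q) k) \<le> 2 * pi * Q"
      by (rule order_trans[OF norm_sum advection_terms_le(3)[OF s _ Q]]) auto
    moreover have "norm (\<Sum>k\<in>?W. ?p (\<lambda>q. \<theta> s q * w2 s q) k) \<le> 2 * pi * Q + 2 * A.tail 0 * (2 * A.tail (Suc n) * A.H)"
      by (rule vertical_term_le[OF s Q])
    moreover have "norm R \<le> norm (\<Sum>k\<in>?W. ?p (\<lambda>q. d s q * v1 s q) k) + norm (\<Sum>k\<in>?W. ?p (\<lambda>q. u2 s q * dv s q) k)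
      + norm (\<Sum>k\<in>?W. ?p (\<lambda>q. \<omega>1 s q * dw s q) k) + norm (\<Sum>k\<in>?W. ?p (\<lambda>q. \<theta> s q * w2 s q) k)"
      unfolding R_def by (intro norm_triangle_mono order_refl)
    ultimately have R: "norm R \<le> 10 * (pi * Q) + 2 * A.tail 0 * (2 * A.tail (Suc n) * A.H)"
      by (simp only: mult.assoc)
    have "Y' n s = - 2 * Re (\<Sum>k\<in>?W. LINT z|unit_ivl. cnj (Dm s k z) * M s k z)"
      unfolding Y'_def by (simp add: sum_distrib_left)
    also have "\<dots> = - 2 * \<nu> * Diss - 2 * Re R" unfolding sumM by simp
    also have "\<dots> \<le> - 2 * \<nu> * Diss + 2 * norm R" using abs_Re_le_cmod[of R] by linarith
    also have "\<dots> \<le> - 2 * \<nu> * Diss + 20 * (pi * Q) + 2 * (2 * A.tail 0 * (2 * A.tail (Suc n) * A.H))" using R by linarith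
    \<comment> \<open>The nonlinearity produces at most \<nu> times the dissipation, against the
      available 2 \<nu>.\<close>
    also have "\<dots> \<le> a * Y n s + c n"
    proof -
      have "Q \<le> \<epsilon> * (4 * (Y n s + Diss) + \<delta> n) + C * (Y n s + \<delta> n)"
        unfolding Q_def using E \<epsilon> by (intro add_right_mono mult_left_mono) auto
      then have "20 * (pi * Q) \<le> 20 * (pi * (\<epsilon> * (4 * (Y n s + Diss) + \<delta> n) + C * (Y n s + \<delta> n)))"
        by (intro mult_left_mono) auto
      also have "\<dots> = (80 * pi * \<epsilon>) * Diss + a * Y n s + 20 * pi * (\<epsilon> + C) * \<delta> n"
        by (simp add: a_def algebra_simps)
      also have "80 * pi * \<epsilon> = \<nu>" by (simp add: \<epsilon>_def)
      finally have "20 * (pi * Q) \<le> \<nu> * Diss + a * Y n s + 20 * pi * (\<epsilon> + C) * \<delta> n" .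
      moreover have "0 \<le> \<nu> * Diss" using \<nu> by (simp add: Diss_def sum_nonneg)
      ultimately show ?thesis unfolding c_def by linarith
    qed
    finally show ?thesis .
  qed
  have e0: "e 0 k = 0" for k
  proof -
    have "0 \<in> {0..T}" using T by simp
    note d0 = d_mode[OF this, of k] u_modes_Dm[OF this, of k] diff_L2(1)[OF this]
    have "e 0 k = nrm (\<lambda>z. 0)"
      unfolding e_def mnorm_def
    proof (rule nrm_cong_AE)
      show "AE z in unit_ivl. fourier_h (d 0) k z = 0" using d0(1,2) init[of k] by eventually_elim simp
    qed (auto intro!: fourier_h_measurable L2_measurable d0(3))
    then show ?thesis by (simp add: nrm_def)
  qed
  \<comment> \<open>Gronwall is applied for each fixed n, with a independent of n. Since c n tends
    to 0 while every mode eventually belongs to the truncated energy, all modes vanish in the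
    limit.\<close>
  have Yle: "Y n t \<le> c n / a * exp (a * T)" for n
    by (rule Gronwall_linear[OF Y_derivative diff_ineq a c0 _ t]) (auto simp: Y_def e0)
  have clim: "(\<lambda>n. c n / a * exp (a * T)) \<longlonglongrightarrow> 0"
  proof -
    have "(\<lambda>n. (20 * pi * (\<epsilon> + C) * \<delta> n + 2 * (2 * A.tail 0 * (2 * A.tail (Suc n) * A.H))) / a * exp (a * T)) \<longlonglongrightarrow>
        (20 * pi * (\<epsilon> + C) * 0 + 2 * (2 * A.tail 0 * (2 * 0 * A.H))) / a * exp (a * T)"
      by (intro tendsto_intros \<delta>_tendsto LIMSEQ_Suc A.tail_tendsto) (use a in auto)
    then show ?thesis by (simp add: c_def)
  qed
  have ek: "e t k = 0" for k
  proof -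
    have "(e t k)\<^sup>2 \<le> c n / a * exp (a * T)" if "nat \<bar>k\<bar> \<le> n" for n
    proof -
      have "k \<in> {- int n..int n}" using that by auto
      then have "(e t k)\<^sup>2 \<le> Y n t" unfolding Y_def by (intro member_le_sum) auto
      with Yle[of n] show ?thesis by linarith
    qed
    then have "(e t k)\<^sup>2 \<le> 0" by (intro LIMSEQ_le_const[OF clim]) blast
    then show ?thesis by simp
  qed
  have "AE q in Omega. d t q = 0"
  proof (rule AE_zero_if_fourier_h_zero[OF diff_L2(1)[OF t]])
    show "AE z in unit_ivl. fourier_h (d t) k z = 0" for k
      using AE_zero_if_nrm_zero[OF fourier_h_sq_int[OF diff_L2(1)[OF t]]] ek[of k] by (simp add: e_def mnorm_def)
  qed
  then show ?thesis by (simp add: d_def)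
qed

end

theorem theorem4p7:
  fixes \<alpha> \<nu> T :: real
    and u0 \<omega>0 \<zeta>0 :: "real \<times> real \<Rightarrow> real"
    and u1 u2 :: "real \<Rightarrow> real \<times> real \<Rightarrow> real"
  assumes "1 < \<alpha>" and "\<alpha> < 2" and "0 < \<nu>" and "0 < T"
    and "u0 \<in> dom_Lambda_h \<alpha> \<inter> mean_zero"
    and "weak_dz u0 \<omega>0" and "\<omega>0 \<in> dom_Lambda_h (\<alpha> / 2) \<inter> Linf"
    and "weak_dz \<omega>0 \<zeta>0" and "\<zeta>0 \<in> L2"
    and "classical_solution \<alpha> \<nu> T u0 u1"
    and "classical_solution \<alpha> \<nu> T u0 u2"
  shows "\<forall>t\<in>{0..T}. AE q in Omega. u1 t q = u2 t q"
proof -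
  obtain v1 w1 \<omega>1 K1 where m1: "modal_flow \<alpha> T K1 u1 v1 w1 \<omega>1"
    and eq1: "\<forall>k f f' t. bump 0 1 f \<longrightarrow> (\<forall>x. (f has_real_derivative f' x) (at x)) \<longrightarrow> bump 0 1 f' \<longrightarrow> t \<in> {0..T} \<longrightarrow>
      (LINT z|unit_ivl. of_real (f' z) * fourier_h (u1 t) k z)
      + integral {0..t} (\<lambda>r. LINT z|unit_ivl. of_real (f' z) * modal_flow.N \<alpha> \<nu> u1 v1 w1 \<omega>1 r k z)
      = (LINT z|unit_ivl. of_real (f' z) * fourier_h (u1 0) k z)"
    using classical_solution_modal[OF assms(10,1,2,4)] by blast
  obtain v2 w2 \<omega>2 K2 where m2: "modal_flow \<alpha> T K2 u2 v2 w2 \<omega>2"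
    and eq2: "\<forall>k f f' t. bump 0 1 f \<longrightarrow> (\<forall>x. (f has_real_derivative f' x) (at x)) \<longrightarrow> bump 0 1 f' \<longrightarrow> t \<in> {0..T} \<longrightarrow>
      (LINT z|unit_ivl. of_real (f' z) * fourier_h (u2 t) k z)
      + integral {0..t} (\<lambda>r. LINT z|unit_ivl. of_real (f' z) * modal_flow.N \<alpha> \<nu> u2 v2 w2 \<omega>2 r k z)
      = (LINT z|unit_ivl. of_real (f' z) * fourier_h (u2 0) k z)"
    using classical_solution_modal[OF assms(11,1,2,4)] by blast
  have "modal_pair \<alpha> \<nu> T (max K1 K2) u1 v1 w1 \<omega>1 u2 v2 w2 \<omega>2"
  proof (rule modal_pair.intro[OF modal_flow_mono[OF m1] modal_flow_mono[OF m2]])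
    have t0: "0 \<in> {0..T}" using \<open>0 < T\<close> by simp
    have "AE q in Omega. u1 0 q = u0 q" "AE q in Omega. u2 0 q = u0 q"
      using assms(10,11) by (auto simp: classical_solution_def)
    then have "AE q in Omega. u1 0 q = u2 0 q" by eventually_elim simp
    then have "AE z in unit_ivl. fourier_h (u1 0) k z = fourier_h (u2 0) k z" for k
      by (rule fourier_h_cong_AE[OF L2_integrable[OF modal_flow.uL2[OF m1 t0]] L2_integrable[OF modal_flow.uL2[OF m2 t0]]])
    then show "modal_pair_axioms \<alpha> \<nu> T u1 v1 w1 \<omega>1 u2 v2 w2 \<omega>2"
      using eq1 eq2 \<open>0 < T\<close> \<open>0 < \<nu>\<close> by (intro modal_pair_axioms.intro) blast+
  qed simp_all
  then show ?thesis using modal_pair.difference_vanishes by blast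
qed

end
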